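(* Let $\sigma>0$ be known, let $\alpha_1,\alpha_2>0$, let $X_0\in\mathbb R$, and let $X$ be the solution of $$dX_t=-\alpha_1X_tI(X_t\le 0)\,dt-\alpha_2X_tI(X_t>0)\,dt+\sigma\,dW_t .$$ Fix a real number $n>0$ and an arbitrary $h>0$. Put $\alpha=(\alpha_1,\alpha_2)^T$ and $\widehat\alpha_{n,N}=(\widehat\alpha_{1,n,N},\widehat\alpha_{2,n,N})^T$, where $\widehat\alpha_{i,n,N}=G_{i,n}(\widehat L_{n,N},\widehat R_{n,N})$, $i=1,2$, with $$\widehat L_{n,N}=\frac1N\sum_{k=1}^N(-X_{kh})^nI(X_{kh}\le0),\qquad \widehat R_{n,N}=\frac1N\sum_{k=1}^N(X_{kh})^nI(X_{kh}>0)$$ and $G_{1,n},G_{2,n}$ as defined in the context. Then, as $N\to\infty$, $$\sqrt N\,(\widehat\alpha_{n,N}-\alpha)\Rightarrow \mathbf N\left(0,\ \nabla G_n(L_n,R_n)\cdot\Sigma_n\cdot\nabla G_n(L_n,R_n)^T\right),$$ where $\Sigma_n=(\sigma^n_{ij})_{1\le i,j\le2}$ and $L_n,R_n,\sigma_{ij}^n,G_n$ are as defined in the context.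
   Context: $W$ is a one-dimensional standard Brownian motion; $X_0$ is a given (deterministic) initial condition; $I(\cdot)$ is the indicator function; $\Gamma$ is the Gamma function; $\Rightarrow$ denotes convergence in distribution; $\mathbf N(\mu,\Sigma)$ is the normal random vector with mean $\mu$ and covariance matrix $\Sigma$. The stationary density of $X$ is $$\psi_1(x)=\frac{2\sqrt{\alpha_1\alpha_2}}{\sqrt\pi(\sqrt{\alpha_1}+\sqrt{\alpha_2})\sigma}\left[\exp\left(-\frac{\alpha_1x^2}{\sigma^2}\right)I(x\le0)+\exp\left(-\frac{\alpha_2x^2}{\sigma^2}\right)I(x>0)\right].$$ $X_\infty$ denotes a random variable with density $\psi_1$, and $L_n=\mathbb E[(-X_\infty)^nI(X_\infty\le0)]$, $R_n=\mathbb E[X_\infty^nI(X_\infty>0)]$. Functions on $(0,\infty)^2$: $$G_{1,n}(x,y)=\left\{\frac{\sigma^n\Gamma\left(\frac{n+1}2\right)}{\sqrt\pi\,x\left[\left(\frac yx\right)^{\frac1{n+1}}+1\right]}\right\}^{\frac2n},\qquad G_{2,n}(x,y)=\left\{\frac{\sigma^n\Gamma\left(\frac{n+1}2\right)}{\sqrt\pi\,y\left[\left(\frac xy\right)^{\frac1{n+1}}+1\right]}\right\}^{\frac2n},$$ $G_n=(G_{1,n},G_{2,n})$, and $\nabla G_n$ is its $2\times2$ Jacobian matrix. Let $g_{1n}(x)=(-x)^nI(x\le0)$ and $g_{2n}(x)=x^nI(x>0)$. Let $\widetilde X_0$ be a random variable with density $\psi_1$, independent of the Brownian motion, and let $\widetilde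 X$ be the solution of the same stochastic differential equation with initial condition $\widetilde X_0$. For $i,j=1,2$, $$\sigma^n_{ij}=\mathrm{Cov}(g_{in}(\widetilde X_0),g_{jn}(\widetilde X_0))+\sum_{k=1}^\infty\left[\mathrm{Cov}(g_{in}(\widetilde X_0),g_{jn}(\widetilde X_{kh}))+\mathrm{Cov}(g_{jn}(\widetilde X_0),g_{in}(\widetilde X_{kh}))\right],$$ which are well defined (the series converge). *)

theory Defs
  imports "HOL-Probability.Probability"
begin

section \<open>Brownian motion and the stochastic differential equation\<close>

text \<open>Processes are indexed by \<^typ>\<open>real\<close>; only times \<open>t \<ge> 0\<close> matter.\<close>

definition brownian_motion :: "'a measure \<Rightarrow> (real \<Rightarrow> 'a \<Rightarrow> real) \<Rightarrow> bool" where
  "brownian_motion M W \<longleftrightarrow>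
     prob_space M \<and>
     (\<forall>t\<ge>0. W t \<in> borel_measurable M) \<and>
     (AE \<omega> in M. W 0 \<omega> = 0) \<and>
     (\<forall>s t. 0 \<le> s \<longrightarrow> s < t \<longrightarrow>
        distributed M lborel (\<lambda>\<omega>. W t \<omega> - W s \<omega>) (normal_density 0 (sqrt (t - s)))) \<and>
     (\<forall>(m::nat) (t::nat \<Rightarrow> real). 0 \<le> t 0 \<longrightarrow> mono t \<longrightarrow>
        prob_space.indep_vars M (\<lambda>_. borel) (\<lambda>i \<omega>. W (t (Suc i)) \<omega> - W (t i) \<omega>) {..<m}) \<and>
     (AE \<omega> in M. continuous_on {0..} (\<lambda>t. W t \<omega>))"

text \<open>
  The equation \<open>dX = b(X) dt + \<sigma> dW\<close> with \<open>X\<^sub>0 = \<xi>\<close>. Since the diffusion coefficient is the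
  constant \<open>\<sigma>\<close>, the stochastic integral is \<open>\<sigma> * W t\<close> and the integral form of the equation is
  pathwise. Adaptedness is not required: for a Lipschitz drift \<open>b\<close> the pathwise equation has a
  unique continuous solution, which is a nonanticipative functional of \<open>\<xi>\<close> and \<open>W\<close>.
\<close>

definition sde_solution ::
  "'a measure \<Rightarrow> (real \<Rightarrow> 'a \<Rightarrow> real) \<Rightarrow> (real \<Rightarrow> real) \<Rightarrow> real \<Rightarrow> ('a \<Rightarrow> real) \<Rightarrow>
   (real \<Rightarrow> 'a \<Rightarrow> real) \<Rightarrow> bool" where
  "sde_solution M W b \<sigma> \<xi> X \<longleftrightarrow>
     (\<forall>t\<ge>0. X t \<in> borel_measurable M) \<and>
     (AE \<omega> in M.
        continuous_on {0..} (\<lambda>t. X t \<omega>) \<and>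
        (\<forall>t\<ge>0. X t \<omega> = \<xi> \<omega> + integral {0..t} (\<lambda>s. b (X s \<omega>)) + \<sigma> * W t \<omega>))"

text \<open>
  The library's \<open>indep_var\<close> needs both variables to have the same value type, so independence of
  a random variable from a whole process is stated through the generated sigma-algebras.
\<close>

definition independent_of_process ::
  "'a measure \<Rightarrow> ('a \<Rightarrow> real) \<Rightarrow> (real \<Rightarrow> 'a \<Rightarrow> real) \<Rightarrow> bool" where
  "independent_of_process M U W \<longleftrightarrow>
     prob_space.indep_set M
       (sets (vimage_algebra (space M) U borel))
       (sets (vimage_algebra (space M) (\<lambda>\<omega>. \<lambda>t\<in>{0..}. W t \<omega>) (PiM {0..} (\<lambda>_. borel))))"

definition drift :: "real \<Rightarrow> real \<Rightarrow> real \<Rightarrow> real" where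
  "drift \<alpha>1 \<alpha>2 x = - \<alpha>1 * x * indicator {..0} x - \<alpha>2 * x * indicator {0<..} x"

definition stat_density :: "real \<Rightarrow> real \<Rightarrow> real \<Rightarrow> real \<Rightarrow> real" where
  "stat_density \<alpha>1 \<alpha>2 \<sigma> x =
     2 * sqrt (\<alpha>1 * \<alpha>2) / (sqrt pi * (sqrt \<alpha>1 + sqrt \<alpha>2) * \<sigma>) *
     (exp (- (\<alpha>1 * x\<^sup>2 / \<sigma>\<^sup>2)) * indicator {..0} x +
      exp (- (\<alpha>2 * x\<^sup>2 / \<sigma>\<^sup>2)) * indicator {0<..} x)"

section \<open>Moments and the estimator\<close>

definition g1 :: "real \<Rightarrow> real \<Rightarrow> real" where
  "g1 n x = (- x) powr n * indicator {..0} x"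

definition g2 :: "real \<Rightarrow> real \<Rightarrow> real" where
  "g2 n x = x powr n * indicator {0<..} x"

text \<open>The stationary law is used as the law of \<open>X\<^sub>\<infinity>\<close>.\<close>

definition stat_law :: "real \<Rightarrow> real \<Rightarrow> real \<Rightarrow> real measure" where
  "stat_law \<alpha>1 \<alpha>2 \<sigma> = density lborel (\<lambda>x. ennreal (stat_density \<alpha>1 \<alpha>2 \<sigma> x))"

definition stat_L :: "real \<Rightarrow> real \<Rightarrow> real \<Rightarrow> real \<Rightarrow> real" where
  "stat_L \<alpha>1 \<alpha>2 \<sigma> n = (\<integral>x. g1 n x \<partial>stat_law \<alpha>1 \<alpha>2 \<sigma>)"

definition stat_R :: "real \<Rightarrow> real \<Rightarrow> real \<Rightarrow> real \<Rightarrow> real" where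
  "stat_R \<alpha>1 \<alpha>2 \<sigma> n = (\<integral>x. g2 n x \<partial>stat_law \<alpha>1 \<alpha>2 \<sigma>)"

definition emp_L :: "(real \<Rightarrow> 'a \<Rightarrow> real) \<Rightarrow> real \<Rightarrow> real \<Rightarrow> nat \<Rightarrow> 'a \<Rightarrow> real" where
  "emp_L X n h N \<omega> = (1 / real N) * (\<Sum>k = 1..N. g1 n (X (real k * h) \<omega>))"

definition emp_R :: "(real \<Rightarrow> 'a \<Rightarrow> real) \<Rightarrow> real \<Rightarrow> real \<Rightarrow> nat \<Rightarrow> 'a \<Rightarrow> real" where
  "emp_R X n h N \<omega> = (1 / real N) * (\<Sum>k = 1..N. g2 n (X (real k * h) \<omega>))"

text \<open>
  \<open>G1\<close> and \<open>G2\<close> are meant on \<open>(0,\<infinity>)\<^sup>2\<close>; elsewhere they take the values given by the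
  conventions for division by zero and for \<open>powr\<close>.
\<close>

definition G1 :: "real \<Rightarrow> real \<Rightarrow> real \<Rightarrow> real \<Rightarrow> real" where
  "G1 \<sigma> n x y =
     (\<sigma> powr n * Gamma ((n + 1) / 2) / (sqrt pi * x * ((y / x) powr (1 / (n + 1)) + 1)))
       powr (2 / n)"

definition G2 :: "real \<Rightarrow> real \<Rightarrow> real \<Rightarrow> real \<Rightarrow> real" where
  "G2 \<sigma> n x y =
     (\<sigma> powr n * Gamma ((n + 1) / 2) / (sqrt pi * y * ((x / y) powr (1 / (n + 1)) + 1)))
       powr (2 / n)"

definition G :: "real \<Rightarrow> real \<Rightarrow> real^2 \<Rightarrow> real^2" where
  "G \<sigma> n z = vector [G1 \<sigma> n (z $ 1) (z $ 2), G2 \<sigma> n (z $ 1) (z $ 2)]"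

definition estimator ::
  "(real \<Rightarrow> 'a \<Rightarrow> real) \<Rightarrow> real \<Rightarrow> real \<Rightarrow> real \<Rightarrow> nat \<Rightarrow> 'a \<Rightarrow> real^2" where
  "estimator X \<sigma> n h N \<omega> = G \<sigma> n (vector [emp_L X n h N \<omega>, emp_R X n h N \<omega>])"

section \<open>Asymptotic covariance\<close>

definition covariance :: "'a measure \<Rightarrow> ('a \<Rightarrow> real) \<Rightarrow> ('a \<Rightarrow> real) \<Rightarrow> real" where
  "covariance M U V =
     (\<integral>\<omega>. (U \<omega> - (\<integral>\<omega>'. U \<omega>' \<partial>M)) * (V \<omega> - (\<integral>\<omega>'. V \<omega>' \<partial>M)) \<partial>M)"

definition long_run_cov ::
  "'a measure \<Rightarrow> (real \<Rightarrow> 'a \<Rightarrow> real) \<Rightarrow> real \<Rightarrow> (real \<Rightarrow> real) \<Rightarrow> (real \<Rightarrow> real) \<Rightarrow> real" where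
  "long_run_cov M Y h f g =
     covariance M (\<lambda>\<omega>. f (Y 0 \<omega>)) (\<lambda>\<omega>. g (Y 0 \<omega>)) +
     (\<Sum>j. let k = Suc j in
        covariance M (\<lambda>\<omega>. f (Y 0 \<omega>)) (\<lambda>\<omega>. g (Y (real k * h) \<omega>)) +
        covariance M (\<lambda>\<omega>. g (Y 0 \<omega>)) (\<lambda>\<omega>. f (Y (real k * h) \<omega>)))"

definition Sigma_mat ::
  "'a measure \<Rightarrow> (real \<Rightarrow> 'a \<Rightarrow> real) \<Rightarrow> real \<Rightarrow> real \<Rightarrow> real^2^2" where
  "Sigma_mat M Y n h =
     vector [vector [long_run_cov M Y h (g1 n) (g1 n), long_run_cov M Y h (g1 n) (g2 n)],
             vector [long_run_cov M Y h (g2 n) (g1 n), long_run_cov M Y h (g2 n) (g2 n)]]"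

section \<open>Normal random vectors and convergence in distribution\<close>

text \<open>
  \<open>\<nu>\<close> is the law \<open>N(\<mu>, S)\<close>: every linear functional is normally distributed (a constant being
  normal with variance 0), with mean vector \<open>\<mu>\<close> and covariance matrix \<open>S\<close>. This determines
  \<open>\<nu>\<close> and allows a singular \<open>S\<close>; no such \<open>\<nu>\<close> exists unless \<open>S\<close> is symmetric and positive
  semidefinite.
\<close>

definition multivariate_normal ::
  "(real^'d) measure \<Rightarrow> real^'d \<Rightarrow> real^'d^'d \<Rightarrow> bool" where
  "multivariate_normal \<nu> \<mu> S \<longleftrightarrow>
     prob_space \<nu> \<and> sets \<nu> = sets borel \<and>
     (\<forall>a. \<exists>m s. 0 \<le> s \<and>
        distr \<nu> borel (\<lambda>x. a \<bullet> x) =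
          (if s = 0 then return borel m
           else density lborel (\<lambda>x. ennreal (normal_density m s x)))) \<and>
     (\<forall>i. (\<integral>x. x $ i \<partial>\<nu>) = \<mu> $ i) \<and>
     (\<forall>i j. covariance \<nu> (\<lambda>x. x $ i) (\<lambda>x. x $ j) = S $ i $ j)"

definition conv_in_distribution ::
  "'a measure \<Rightarrow> (nat \<Rightarrow> 'a \<Rightarrow> 'b::real_normed_vector) \<Rightarrow> 'b measure \<Rightarrow> bool" where
  "conv_in_distribution M Z \<nu> \<longleftrightarrow>
     (\<forall>N. Z N \<in> borel_measurable M) \<and>
     (\<forall>f :: 'b \<Rightarrow> real. continuous_on UNIV f \<longrightarrow> bounded (range f) \<longrightarrow>
        (\<lambda>N. \<integral>\<omega>. f (Z N \<omega>) \<partial>M) \<longlonglongrightarrow> (\<integral>x. f x \<partial>\<nu>))"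

end

theory Submission
  imports Defs
begin

text \<open>
  The drift is decreasing with slope at most \<open>- min \<alpha>1 \<alpha>2\<close>, so two
  solutions driven by the same Brownian motion approach each other exponentially. Sampled at
  multiples of \<open>h\<close>, a solution is therefore a Markov chain
  \<open>X\<^sub>k\<^sub>+\<^sub>1 = F(X\<^sub>k, \<xi>\<^sub>k)\<close>, where
  \<open>\<xi>\<^sub>k\<close> is the Brownian path on the \<open>k\<close>-th block and every
  \<open>F(\<cdot>, s)\<close> contracts distances by the factor \<open>exp (- min \<alpha>1
  \<alpha>2 * h)\<close> (\<open>flow_contraction\<close>,
  \<open>sampled_solution_eq_chain\<close>). The solution started at \<open>x0\<close> and the
  stationary solution follow the same recursion, with noises of the same law.

  Contraction implies geometric ergodicity for polynomially weighted Hoelder functions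
  (\<open>P_iter_hoelder\<close>), a class that contains \<open>g1 n\<close> and \<open>g2
  n\<close> for every \<open>n > 0\<close>. So the Poisson equation \<open>u - P u = f -
  \<integral> f d\<pi>\<close> has a solution in the class, and a centred sum of \<open>f\<close>
  along the chain is a martingale plus two boundary terms. The characteristic function of the
  martingale obeys a recursion whose random conditional variance is replaced by its mean, with the
  help of a second Poisson equation; this gives the central limit theorem from any starting point
  (\<open>chain_clt\<close>), and the limiting variance is the covariance series.

  Applied to all linear combinations of \<open>g1 n\<close> and \<open>g2 n\<close>, this is the
  joint central limit theorem for the two empirical moments. The moments of the stationary law are
  explicit Gamma values, and \<open>G\<close> recovers \<open>(\<alpha>1, \<alpha>2)\<close> from
  them (\<open>G_stat\<close>). The delta method at this point (\<open>delta_method_char\<close>)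
  and Levy's continuity theorem in the plane (\<open>levy_continuity_euclidean\<close>) finish the
  proof.

  It remains to see that the stationary density is invariant (\<open>stationary_law\<close>). The
  flow is approximated by the scheme that damps \<open>x\<close> by \<open>sqrt (1 - 2 \<alpha>
  \<delta>)\<close>, with the \<open>\<alpha>\<close> of the half-line that contains
  \<open>x\<close>, and then adds the Brownian increment. With this damping each half-line
  dynamics satisfies detailed balance with respect to its Gaussian weight, so invariance fails
  only near the kink at 0, by order \<open>\<delta> sqrt \<delta>\<close> in one step; over
  \<open>h / \<delta>\<close> steps the error tends to 0. The same scheme yields the measurability
  and the contraction of \<open>F\<close>.
\<close>

section \<open>Characteristic functions and convergence in distribution on Euclidean spaces\<close>

text \<open>
  Only the plane waves that occur in characteristic functions are summed, phases included, so that
  integrals of members are controlled by characteristic functions and products stay in the class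
  by \<open>2 cos A cos B = cos (A - B) + cos (A + B)\<close>.
\<close>

inductive trigpoly :: "('a::real_inner \<Rightarrow> real) \<Rightarrow> bool" where
  wave: "trigpoly (\<lambda>x. c * cos (a \<bullet> x + b))"
| add: "trigpoly f \<Longrightarrow> trigpoly g \<Longrightarrow> trigpoly (\<lambda>x. f x + g x)"

lemma trigpoly_const: "trigpoly (\<lambda>x. c)"
  using trigpoly.wave[of c 0 0] by simp

lemma trigpoly_wave_mult:
  assumes "trigpoly f" shows "trigpoly (\<lambda>x. c * cos (a \<bullet> x + b) * f x)"
  using assms
proof induction
  case (wave c' a' b')
  have "c * cos (a \<bullet> x + b) * (c' * cos (a' \<bullet> x + b'))
    = c * c' / 2 * cos ((a - a') \<bullet> x + (b - b')) + c * c' / 2 * cos ((a + a') \<bullet> x + (b + b'))" for x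
  proof -
    have "(a - a') \<bullet> x + (b - b') = (a \<bullet> x + b) - (a' \<bullet> x + b')"
      "(a + a') \<bullet> x + (b + b') = (a \<bullet> x + b) + (a' \<bullet> x + b')"
      by (simp_all add: inner_diff_left inner_add_left)
    moreover have "c * cos A * (c' * cos B) = c * c' / 2 * cos (A - B) + c * c' / 2 * cos (A + B)" for A B
      unfolding cos_diff cos_add by (simp add: algebra_simps)
    ultimately show ?thesis by metis
  qed
  then show ?case by (simp only:) (intro trigpoly.add trigpoly.wave)
next
  case (add f g)
  then show ?case by (simp add: distrib_left trigpoly.add)
qed

lemma trigpoly_mult:
  assumes "trigpoly f" "trigpoly g" shows "trigpoly (\<lambda>x. f x * g x)"
  using assms(1)
proof induction
  case (wave c a b)
  then show ?case using trigpoly_wave_mult[OF assms(2)] .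
next
  case (add f1 f2)
  then show ?case by (simp add: distrib_right trigpoly.add)
qed

lemma continuous_on_trigpoly: "trigpoly f \<Longrightarrow> continuous_on S f"
  by (induction rule: trigpoly.induct) (auto intro!: continuous_intros)

text \<open>
  A continuous function cannot be approximated by trigonometric polynomials uniformly on the whole
  space, but it suffices to be close on a large ball while staying bounded everywhere. Composition
  with the coordinatewise map \<open>x \<mapsto> sin (c x)\<close> achieves both: this map sends
  the space into a cube and is inverted by \<open>arcsin\<close> on the ball, so an algebraic
  (Stone--Weierstrass) approximation of \<open>f \<circ> arcsin\<close> on the cube pulls back to
  a trigonometric polynomial, with the same bound outside the ball as inside.
\<close>

lemma trigpoly_approx:
  fixes f :: "'a::euclidean_space \<Rightarrow> real"
  assumes f: "continuous_on UNIV f" and B: "\<And>x. \<bar>f x\<bar> \<le> B" and "\<epsilon> > 0" "K > 0"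
  obtains p where "trigpoly p" "\<And>x. \<bar>p x\<bar> \<le> B + \<epsilon>" "\<And>x. norm x \<le> K \<Longrightarrow> \<bar>f x - p x\<bar> \<le> \<epsilon>"
proof -
  define c where "c = pi / (2 * K)"
  have "c > 0" using \<open>K > 0\<close> by (simp add: c_def)
  define \<tau> :: "'a \<Rightarrow> 'a" where "\<tau> x = (\<Sum>i\<in>Basis. sin (c * (x \<bullet> i)) *\<^sub>R i)" for x
  define \<upsilon> :: "'a \<Rightarrow> 'a" where "\<upsilon> y = (\<Sum>i\<in>Basis. (arcsin (y \<bullet> i) / c) *\<^sub>R i)" for y
  let ?S = "cbox (\<Sum>i\<in>Basis. (-1) *\<^sub>R i) (\<Sum>i\<in>Basis. 1 *\<^sub>R i) :: 'a set"
  have S: "y \<in> ?S \<longleftrightarrow> (\<forall>i\<in>Basis. -1 \<le> y \<bullet> i \<and> y \<bullet> i \<le> 1)" for y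
    unfolding mem_box by (simp only: inner_sum_left_Basis cong: ball_cong)
  have \<tau>S: "\<tau> x \<in> ?S" for x
    unfolding S \<tau>_def by (auto simp: inner_sum_left_Basis)
  have cont: "continuous_on ?S (\<lambda>y. f (\<upsilon> y))"
  proof (rule continuous_on_compose2[OF f])
    show "continuous_on ?S \<upsilon>" unfolding \<upsilon>_def
      using \<open>c > 0\<close> by (intro continuous_intros ballI; simp only: S; blast)
  qed auto
  define P where "P g \<longleftrightarrow> continuous_on UNIV g \<and> trigpoly (\<lambda>x. g (\<tau> x))" for g :: "'a \<Rightarrow> real"
  have Pcoord: "P (\<lambda>y. y \<bullet> i)" if "i \<in> Basis" for i
  proof -
    have "\<tau> x \<bullet> i = 1 * cos ((c *\<^sub>R i) \<bullet> x + (- pi / 2))" for x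
      using that by (simp add: \<tau>_def inner_sum_left_Basis cos_add cos_diff inner_commute[of i x])
    then show ?thesis unfolding P_def using trigpoly.wave[of 1 "c *\<^sub>R i" "- pi/2"]
      by (auto intro!: continuous_intros)
  qed
  have "\<exists>g. P g \<and> (\<forall>y\<in>?S. \<bar>f (\<upsilon> y) - g y\<bar> < \<epsilon>)"
  proof (rule Stone_Weierstrass_HOL[where P=P, OF compact_cbox _ _ _ _ _ cont \<open>\<epsilon> > 0\<close>])
    show "P (\<lambda>x. k)" for k unfolding P_def by (auto intro: trigpoly_const)
    show "continuous_on ?S g" if "P g" for g
      using that continuous_on_subset unfolding P_def by blast
    show "P (\<lambda>x. f x + g x)" if "P f \<and> P g" for f g
      using that unfolding P_def by (auto intro: trigpoly.add continuous_on_add)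
    show "P (\<lambda>x. f x * g x)" if "P f \<and> P g" for f g
      using that unfolding P_def by (auto intro: trigpoly_mult continuous_on_mult)
    show "\<exists>g. P g \<and> g x \<noteq> g y" if "x \<in> ?S \<and> y \<in> ?S \<and> x \<noteq> y" for x y
      using that Pcoord euclidean_eq_iff[of x y] by auto
  qed
  then obtain g where g: "P g" "\<And>y. y \<in> ?S \<Longrightarrow> \<bar>f (\<upsilon> y) - g y\<bar> < \<epsilon>" by blast
  show ?thesis
  proof
    show "trigpoly (\<lambda>x. g (\<tau> x))" using g(1) unfolding P_def by blast
    show "\<bar>g (\<tau> x)\<bar> \<le> B + \<epsilon>" for x
      using g(2)[OF \<tau>S[of x]] B[of "\<upsilon> (\<tau> x)"] by linarith
    show "\<bar>f x - g (\<tau> x)\<bar> \<le> \<epsilon>" if "norm x \<le> K" for x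
    proof -
      have "\<upsilon> (\<tau> x) = x"
      proof (rule euclidean_eqI)
        fix i :: 'a assume i: "i \<in> Basis"
        have "\<bar>x \<bullet> i\<bar> \<le> K" using that Basis_le_norm[OF i, of x] by linarith
        then have "c * \<bar>x \<bullet> i\<bar> \<le> c * K" using \<open>c > 0\<close> by simp
        moreover have "c * K = pi / 2" using \<open>K > 0\<close> by (simp add: c_def)
        moreover have "c * \<bar>x \<bullet> i\<bar> = \<bar>c * (x \<bullet> i)\<bar>" using \<open>c > 0\<close> by (simp add: abs_mult)
        ultimately have "- (pi/2) \<le> c * (x \<bullet> i)" "c * (x \<bullet> i) \<le> pi/2"
          by linarith+
        then show "\<upsilon> (\<tau> x) \<bullet> i = x \<bullet> i"
          using i \<open>c > 0\<close> by (simp add: \<upsilon>_def \<tau>_def inner_sum_left_Basis arcsin_sin)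
      qed
      then show ?thesis using g(2)[OF \<tau>S[of x]] by simp
    qed
  qed
qed

text \<open>
  Along each basis vector the one-dimensional continuity theorem applies, and testing against a
  continuous cut-off that vanishes on \<open>[-K, K]\<close> bounds the mass outside a slab.
  Finitely many slabs confine the vector.
\<close>

lemma tight_of_char_convergence:
  fixes Z :: "nat \<Rightarrow> 'a \<Rightarrow> 'b::euclidean_space" and \<nu> :: "'b measure"
  assumes "prob_space M" "prob_space \<nu>" and sets_\<nu>: "sets \<nu> = sets borel"
    and Z[measurable]: "\<And>N. Z N \<in> borel_measurable M"
    and conv: "\<And>a. (\<lambda>N. \<integral>\<omega>. iexp (a \<bullet> Z N \<omega>) \<partial>M) \<longlonglongrightarrow> (\<integral>x. iexp (a \<bullet> x) \<partial>\<nu>)"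
    and "\<epsilon> > 0"
  obtains K where "K > 0" "\<forall>\<^sub>F N in sequentially. measure M {\<omega>\<in>space M. norm (Z N \<omega>) > K} < \<epsilon>"
proof -
  interpret M: prob_space M by fact
  interpret \<nu>: prob_space \<nu> by fact
  note [measurable_cong] = sets_\<nu>
  define d where "d = real DIM('b)"
  have "d > 0" by (simp add: d_def)
  define cut :: "real \<Rightarrow> real \<Rightarrow> real" where "cut K x = min 1 (max 0 (\<bar>x\<bar> - K))" for K x
  have cut_cont: "isCont (cut K) x" for K x unfolding cut_def by (intro continuous_intros)
  have [measurable]: "cut K \<in> borel_measurable borel" for K unfolding cut_def by measurable
  have cut_bd: "0 \<le> cut K x" "cut K x \<le> 1" for K x by (auto simp: cut_def)
  have wc: "(\<lambda>N. \<integral>\<omega>. cut K (u \<bullet> Z N \<omega>) \<partial>M) \<longlonglongrightarrow> (\<integral>x. cut K (u \<bullet> x) \<partial>\<nu>)" for K u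
  proof -
    let ?M = "\<lambda>N. distr M borel (\<lambda>\<omega>. u \<bullet> Z N \<omega>)" and ?N = "distr \<nu> borel (\<lambda>x. u \<bullet> x)"
    have rd: "real_distribution (?M N)" for N
      by (rule M.real_distribution_distr) measurable
    have rd': "real_distribution ?N"
      by (rule \<nu>.real_distribution_distr) measurable
    have "weak_conv_m ?M ?N"
    proof (rule levy_continuity[OF rd rd'])
      fix t
      show "(\<lambda>n. char (?M n) t) \<longlonglongrightarrow> char ?N t"
        using conv[of "t *\<^sub>R u"] by (simp add: char_def integral_distr)
    qed
    then have "(\<lambda>n. integral\<^sup>L (?M n) (cut K)) \<longlonglongrightarrow> integral\<^sup>L ?N (cut K)"
      using cut_cont cut_bd by (intro weak_conv_imp_integral_bdd_continuous_conv[where B=1, OF rd rd']) auto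
    then show ?thesis by (simp add: integral_distr)
  qed
  have "(\<lambda>K. \<integral>x. cut (real K) (u \<bullet> x) \<partial>\<nu>) \<longlonglongrightarrow> (\<integral>x. 0 \<partial>\<nu>)" for u
  proof (rule integral_dominated_convergence[where w="\<lambda>_. 1"])
    show "AE x in \<nu>. (\<lambda>K. cut (real K) (u \<bullet> x)) \<longlonglongrightarrow> 0"
    proof (intro AE_I2)
      fix x
      have "cut (real K) (u \<bullet> x) = 0" if "K \<ge> nat \<lceil>\<bar>u \<bullet> x\<bar>\<rceil>" for K
        using that by (simp add: cut_def)
      then have "\<forall>\<^sub>F K in sequentially. cut (real K) (u \<bullet> x) = 0"
        unfolding eventually_sequentially by blast
      then show "(\<lambda>K. cut (real K) (u \<bullet> x)) \<longlonglongrightarrow> 0" by (rule tendsto_eventually)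
    qed
  qed (simp_all add: cut_bd \<nu>.emeasure_space_1)
  then have "\<forall>\<^sub>F K in sequentially. (\<integral>x. cut (real K) (u \<bullet> x) \<partial>\<nu>) < \<epsilon> / d" for u
    using \<open>\<epsilon> > 0\<close> \<open>d > 0\<close> by (intro order_tendstoD(2)[where y=0]) auto
  then have "\<forall>\<^sub>F K in sequentially. \<forall>u\<in>Basis. (\<integral>x. cut (real K) (u \<bullet> x) \<partial>\<nu>) < \<epsilon> / d"
    by (intro eventually_ball_finite) auto
  then obtain K where K: "\<And>u. u \<in> Basis \<Longrightarrow> (\<integral>x. cut (real K) (u \<bullet> x) \<partial>\<nu>) < \<epsilon> / d"
    unfolding eventually_sequentially by blast
  have "\<forall>\<^sub>F N in sequentially. \<forall>u\<in>Basis. (\<integral>\<omega>. cut (real K) (u \<bullet> Z N \<omega>) \<partial>M) < \<epsilon> / d"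
    using K wc by (intro eventually_ball_finite ballI order_tendstoD(2)) auto
  then have "\<forall>\<^sub>F N in sequentially. measure M {\<omega>\<in>space M. norm (Z N \<omega>) > d * (real K + 1)} < \<epsilon>"
  proof eventually_elim
    case (elim N)
    have "measure M {\<omega>\<in>space M. norm (Z N \<omega>) > d * (real K + 1)}
       = (\<integral>\<omega>. indicator {\<omega>\<in>space M. norm (Z N \<omega>) > d * (real K + 1)} \<omega> \<partial>M)" by simp
    also have "\<dots> \<le> (\<integral>\<omega>. (\<Sum>u\<in>Basis. cut (real K) (u \<bullet> Z N \<omega>)) \<partial>M)"
    proof (rule integral_mono)
      show "integrable M (\<lambda>\<omega>. \<Sum>u\<in>Basis. cut (real K) (u \<bullet> Z N \<omega>))"
        by (intro Bochner_Integration.integrable_sum M.integrable_const_bound[where B=1]) (auto simp: cut_bd abs_of_nonneg)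
      show "integrable M (indicat_real {\<omega>\<in>space M. norm (Z N \<omega>) > d * (real K + 1)})"
        by (simp add: less_top[symmetric])
      fix \<omega> assume "\<omega> \<in> space M"
      have "\<exists>u\<in>Basis. \<bar>u \<bullet> x\<bar> > real K + 1" if "norm x > d * (real K + 1)" for x :: 'b
      proof (rule ccontr)
        assume "\<not> ?thesis"
        then have "(\<Sum>u\<in>Basis. \<bar>x \<bullet> u\<bar>) \<le> d * (real K + 1)"
          unfolding d_def by (intro sum_bounded_above) (auto simp: inner_commute not_less)
        then show False using norm_le_l1[of x] that by linarith
      qed
      moreover have "(\<Sum>u\<in>Basis. cut (real K) (u \<bullet> x)) \<ge> 1" if "u \<in> Basis" "\<bar>u \<bullet> x\<bar> > real K + 1" for u x :: 'b
      proof -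
        have "1 = cut (real K) (u \<bullet> x)" using that by (simp add: cut_def)
        also have "\<dots> \<le> (\<Sum>u\<in>Basis. cut (real K) (u \<bullet> x))"
          using that by (intro member_le_sum) (auto simp: cut_bd)
        finally show ?thesis .
      qed
      ultimately show "indicat_real {\<omega>\<in>space M. norm (Z N \<omega>) > d * (real K + 1)} \<omega> \<le> (\<Sum>u\<in>Basis. cut (real K) (u \<bullet> Z N \<omega>))"
        by (auto simp: indicator_def intro!: sum_nonneg cut_bd)
    qed
    also have "\<dots> = (\<Sum>u\<in>Basis. (\<integral>\<omega>. cut (real K) (u \<bullet> Z N \<omega>) \<partial>M))"
      by (intro Bochner_Integration.integral_sum M.integrable_const_bound[where B=1]) (auto simp: cut_bd abs_of_nonneg)
    also have "\<dots> < (\<Sum>u\<in>(Basis::'b set). \<epsilon> / d)"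
      using elim by (intro sum_strict_mono) auto
    also have "\<dots> = \<epsilon>" using \<open>d > 0\<close> by (simp add: d_def)
    finally show ?case .
  qed
  moreover have "d * (real K + 1) > 0" using \<open>d > 0\<close> by (simp add: add_pos_nonneg)
  ultimately show ?thesis using that by blast
qed

lemma trigpoly_integral_convergence:
  fixes Z :: "nat \<Rightarrow> 'a \<Rightarrow> 'b::euclidean_space" and \<nu> :: "'b measure"
  assumes "prob_space M" "prob_space \<nu>" and sets_\<nu>: "sets \<nu> = sets borel"
    and Z[measurable]: "\<And>N. Z N \<in> borel_measurable M"
    and conv: "\<And>a. (\<lambda>N. \<integral>\<omega>. iexp (a \<bullet> Z N \<omega>) \<partial>M) \<longlonglongrightarrow> (\<integral>x. iexp (a \<bullet> x) \<partial>\<nu>)"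
    and p: "trigpoly p"
  shows "(\<lambda>N. \<integral>\<omega>. p (Z N \<omega>) \<partial>M) \<longlonglongrightarrow> (\<integral>x. p x \<partial>\<nu>) \<and> (\<forall>N. integrable M (\<lambda>\<omega>. p (Z N \<omega>))) \<and> integrable \<nu> p"
proof -
  interpret M: prob_space M by fact
  interpret \<nu>: prob_space \<nu> by fact
  note [measurable_cong] = sets_\<nu>
  show ?thesis using p
  proof induction
    case (wave c a b)
    have ie: "c * cos (a \<bullet> x + b) = Re (complex_of_real c * iexp b * iexp (a \<bullet> x))" for x
      by (simp add: cos_add Re_exp Im_exp exp_add[symmetric] algebra_simps)
    have iM: "integrable M (\<lambda>\<omega>. iexp (a \<bullet> Z N \<omega>))" for N
      by (intro M.integrable_iexp) measurable
    have i\<nu>: "integrable \<nu> (\<lambda>x. iexp (a \<bullet> x))"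
      by (intro \<nu>.integrable_iexp) measurable
    have 1: "(\<integral>\<omega>. c * cos (a \<bullet> Z N \<omega> + b) \<partial>M) = Re (c * iexp b * (\<integral>\<omega>. iexp (a \<bullet> Z N \<omega>) \<partial>M))" for N
      unfolding ie by (subst integral_Re) (use iM in \<open>auto intro!: integrable_mult_right\<close>)
    have 2: "(\<integral>x. c * cos (a \<bullet> x + b) \<partial>\<nu>) = Re (c * iexp b * (\<integral>x. iexp (a \<bullet> x) \<partial>\<nu>))"
      unfolding ie by (subst integral_Re) (use i\<nu> in \<open>auto intro!: integrable_mult_right\<close>)
    show ?case unfolding 1 2
    proof (intro conjI allI)
      show "(\<lambda>N. Re (c * iexp b * (\<integral>\<omega>. iexp (a \<bullet> Z N \<omega>) \<partial>M))) \<longlonglongrightarrow> Re (c * iexp b * (\<integral>x. iexp (a \<bullet> x) \<partial>\<nu>))"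
        by (intro tendsto_intros conv)
      show "integrable M (\<lambda>\<omega>. c * cos (a \<bullet> Z N \<omega> + b))" for N
        by (intro M.integrable_const_bound[where B="\<bar>c\<bar>"]) (auto simp: abs_mult mult_left_le)
      show "integrable \<nu> (\<lambda>x. c * cos (a \<bullet> x + b))"
        by (intro \<nu>.integrable_const_bound[where B="\<bar>c\<bar>"]) (auto simp: abs_mult mult_left_le)
    qed
  next
    case (add f g)
    then show ?case by (auto intro!: tendsto_add)
  qed
qed

text \<open>
  The comparison that turns closeness on a ball into closeness of expectations: outside the ball
  the integrands are only bounded, which costs the mass of the complement.
\<close>

lemma integral_diff_le_of_close_on_ball:
  fixes f p :: "'b::euclidean_space \<Rightarrow> real"
  assumes "prob_space L" and V[measurable]: "V \<in> borel_measurable L"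
    and f: "continuous_on UNIV f" and p: "continuous_on UNIV p"
    and B: "\<And>x. \<bar>f x\<bar> \<le> B" and pB: "\<And>x. \<bar>p x\<bar> \<le> B + \<epsilon>"
    and close: "\<And>x. norm x \<le> K \<Longrightarrow> \<bar>f x - p x\<bar> \<le> \<epsilon>" and "\<epsilon> > 0"
  shows "\<bar>(\<integral>x. f (V x) \<partial>L) - (\<integral>x. p (V x) \<partial>L)\<bar>
    \<le> \<epsilon> + (2*B+\<epsilon>) * measure L {x\<in>space L. norm (V x) > K}"
proof -
  interpret L: prob_space L by fact
  have [measurable]: "p \<in> borel_measurable borel"
    using p by (rule borel_measurable_continuous_onI)
  have [measurable]: "f \<in> borel_measurable borel"
    using f by (rule borel_measurable_continuous_onI)
  have i1: "integrable L (\<lambda>x. f (V x))" by (rule L.integrable_const_bound[where B=B]) (auto simp: B)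
  have i2: "integrable L (\<lambda>x. p (V x))" by (rule L.integrable_const_bound[where B="B+\<epsilon>"]) (auto simp: pB)
  have "\<bar>(\<integral>x. f (V x) \<partial>L) - (\<integral>x. p (V x) \<partial>L)\<bar> = \<bar>\<integral>x. f (V x) - p (V x) \<partial>L\<bar>"
    using i1 i2 by simp
  also have "\<dots> \<le> (\<integral>x. \<bar>f (V x) - p (V x)\<bar> \<partial>L)" by (rule integral_abs_bound)
  also have "\<dots> \<le> (\<integral>x. \<epsilon> + (2*B+\<epsilon>) * indicator {x\<in>space L. norm (V x) > K} x \<partial>L)"
  proof (rule integral_mono)
    show "integrable L (\<lambda>x. \<bar>f (V x) - p (V x)\<bar>)" using i1 i2 by simp
    show "integrable L (\<lambda>x. \<epsilon> + (2*B+\<epsilon>) * indicat_real {x\<in>space L. norm (V x) > K} x)"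
      by (auto intro!: integrable_add integrable_mult_right simp: less_top[symmetric])
    fix x assume "x \<in> space L"
    then show "\<bar>f (V x) - p (V x)\<bar> \<le> \<epsilon> + (2*B+\<epsilon>) * indicat_real {x\<in>space L. norm (V x) > K} x"
      using close[of "V x"] pB[of "V x"] B[of "V x"] \<open>\<epsilon> > 0\<close> by (auto simp: indicator_def)
  qed
  also have "\<dots> = \<epsilon> + (2*B+\<epsilon>) * measure L {x\<in>space L. norm (V x) > K}"
    by (subst Bochner_Integration.integral_add) (auto simp: L.prob_space less_top[symmetric])
  finally show ?thesis .
qed

text \<open>
  Levy's continuity theorem in several dimensions with a known limit law: tightness reduces a
  bounded continuous test function to a trigonometric polynomial, whose expectations converge
  because they are linear combinations of characteristic functions.
\<close>

lemma levy_continuity_euclidean: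
  fixes Z :: "nat \<Rightarrow> 'a \<Rightarrow> 'b::euclidean_space" and \<nu> :: "'b measure"
  assumes M: "prob_space M" and \<nu>: "prob_space \<nu>" and sets_\<nu>: "sets \<nu> = sets borel"
    and Z[measurable]: "\<And>N. Z N \<in> borel_measurable M"
    and conv: "\<And>a. (\<lambda>N. \<integral>\<omega>. iexp (a \<bullet> Z N \<omega>) \<partial>M) \<longlonglongrightarrow> (\<integral>x. iexp (a \<bullet> x) \<partial>\<nu>)"
  shows "conv_in_distribution M Z \<nu>"
  unfolding conv_in_distribution_def
proof (intro conjI allI impI Z)
  interpret M: prob_space M by fact
  interpret \<nu>: prob_space \<nu> by fact
  note [measurable_cong] = sets_\<nu>
  fix f :: "'b \<Rightarrow> real" assume f: "continuous_on UNIV f" and "bounded (range f)"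
  then obtain B0 where B0: "\<And>x. \<bar>f x\<bar> \<le> B0" by (auto simp: bounded_iff)
  define B where "B = max B0 1"
  have B: "\<bar>f x\<bar> \<le> B" for x using B0[of x] by (simp add: B_def)
  have "B \<ge> 1" by (simp add: B_def)
  have [measurable]: "f \<in> borel_measurable borel" using f by (rule borel_measurable_continuous_onI)
  show "(\<lambda>N. \<integral>\<omega>. f (Z N \<omega>) \<partial>M) \<longlonglongrightarrow> (\<integral>x. f x \<partial>\<nu>)"
  proof (rule tendstoI, goal_cases)
    case (1 e)
    define \<epsilon> where "\<epsilon> = min 1 (e / (6 * (B + 1)))"
    have \<epsilon>: "\<epsilon> > 0" "\<epsilon> \<le> 1" using \<open>B \<ge> 1\<close> 1 by (auto simp: \<epsilon>_def)
    have \<epsilon>': "6 * (B + 1) * \<epsilon> \<le> e" using \<open>B \<ge> 1\<close>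
      by (metis \<epsilon>_def add_nonneg_nonneg dual_order.trans le_divide_eq linorder_not_le min.cobounded2 mult.commute zero_le_one 1 divide_pos_pos order_less_le_trans mult_pos_pos zero_less_numeral add_pos_pos zero_less_one)
    obtain K1 where K1: "K1 > 0" "\<forall>\<^sub>F N in sequentially. measure M {\<omega>\<in>space M. norm (Z N \<omega>) > K1} < \<epsilon>"
      using tight_of_char_convergence[OF M \<nu> sets_\<nu> Z conv \<open>\<epsilon> > 0\<close>] by blast
    obtain K2 where K2: "K2 > 0" "\<forall>\<^sub>F N::nat in sequentially. measure \<nu> {x\<in>space \<nu>. norm x > K2} < \<epsilon>"
      by (rule tight_of_char_convergence[OF \<nu> \<nu> sets_\<nu> _ _ \<open>\<epsilon> > 0\<close>, where Z="\<lambda>_ x. x"]) auto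
    define K where "K = max K1 K2"
    obtain p where p: "trigpoly p" "\<And>x. \<bar>p x\<bar> \<le> B + \<epsilon>" "\<And>x. norm x \<le> K \<Longrightarrow> \<bar>f x - p x\<bar> \<le> \<epsilon>"
      using trigpoly_approx[OF f B \<open>\<epsilon> > 0\<close>, of K] K1(1) unfolding K_def by (metis max_less_iff_conj less_max_iff_disj)
    have cp: "continuous_on UNIV p" using p(1) by (rule continuous_on_trigpoly)
    have pc: "(\<lambda>N. \<integral>\<omega>. p (Z N \<omega>) \<partial>M) \<longlonglongrightarrow> (\<integral>x. p x \<partial>\<nu>)"
      using trigpoly_integral_convergence[OF M \<nu> sets_\<nu> Z conv p(1)] by blast
    have mono2: "(2*B+\<epsilon>) * q \<le> (2*B+1) * \<epsilon>" if "q \<le> \<epsilon>" "0 \<le> q" for q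
      using that \<epsilon> \<open>B \<ge> 1\<close> by (intro mult_mono) auto
    have "measure \<nu> {x\<in>space \<nu>. norm x > K} \<le> measure \<nu> {x\<in>space \<nu>. norm x > K2}"
      by (rule \<nu>.finite_measure_mono) (auto simp: K_def)
    then have m\<nu>: "measure \<nu> {x\<in>space \<nu>. norm x > K} \<le> \<epsilon>"
      using K2(2) by simp
    have c\<nu>: "\<bar>(\<integral>x. f x \<partial>\<nu>) - (\<integral>x. p x \<partial>\<nu>)\<bar> \<le> \<epsilon> + (2*B+1) * \<epsilon>"
      using integral_diff_le_of_close_on_ball[OF \<nu> _ f cp B p(2) _ \<epsilon>(1), of "\<lambda>x. x" K] p(3) mono2[OF m\<nu>] by simp
    have "\<forall>\<^sub>F N in sequentially. dist (\<integral>\<omega>. p (Z N \<omega>) \<partial>M) (\<integral>x. p x \<partial>\<nu>) < \<epsilon>"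
      using pc \<epsilon>(1) by (rule tendstoD)
    with K1(2) show ?case
    proof eventually_elim
      case (elim N)
      have "measure M {x\<in>space M. norm (Z N x) > K} \<le> measure M {x\<in>space M. norm (Z N x) > K1}"
        by (rule M.finite_measure_mono) (auto simp: K_def)
      then have mM: "measure M {x\<in>space M. norm (Z N x) > K} \<le> \<epsilon>" using elim by simp
      have cM: "\<bar>(\<integral>\<omega>. f (Z N \<omega>) \<partial>M) - (\<integral>\<omega>. p (Z N \<omega>) \<partial>M)\<bar> \<le> \<epsilon> + (2*B+1) * \<epsilon>"
        using integral_diff_le_of_close_on_ball[OF M Z[of N] f cp B p(2) _ \<epsilon>(1), of K] p(3) mono2[OF mM] by simp
      have "dist (\<integral>\<omega>. f (Z N \<omega>) \<partial>M) (\<integral>x. f x \<partial>\<nu>) < \<epsilon> + 2 * (\<epsilon> + (2*B+1) * \<epsilon>)"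
        using elim(2) cM c\<nu> by (simp only: dist_real_def abs_less_iff abs_le_iff) argo
      also have "\<dots> \<le> 6 * (B + 1) * \<epsilon>" using \<epsilon>(1) \<open>B \<ge> 1\<close> by (simp add: algebra_simps)
      finally show ?case using \<epsilon>' by linarith
    qed
  qed
qed

section \<open>The delta method and bivariate normal laws\<close>

lemma norm_iexp_diff_le: "norm (iexp u - iexp v) \<le> \<bar>u - v\<bar>"
proof -
  have "iexp v * iexp (u - v) = iexp u"
    by (simp only: exp_add[symmetric]) (simp add: right_diff_distrib)
  then have "iexp u - iexp v = iexp v * (iexp (u - v) - 1)"
    by (simp add: right_diff_distrib)
  moreover have "norm (iexp (u - v) - 1) \<le> \<bar>u - v\<bar>"
    using iexp_approx1[of "u - v" 0] by simp
  ultimately show ?thesis by (simp add: norm_mult)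
qed

text \<open>
  Convergence of the characteristic functions makes the scaled error tight. On the event that the
  scaled error stays below \<open>K\<close> the argument of \<open>g\<close> is within \<open>K /
  sqrt N\<close> of \<open>\<theta>\<close>, where \<open>g\<close> is close to its linearisation,
  and the complementary event has small probability for all large \<open>N\<close>.
\<close>

lemma delta_method_char:
  fixes \<Theta> :: "nat \<Rightarrow> 'a \<Rightarrow> 'b::euclidean_space" and g :: "'b \<Rightarrow> 'c::euclidean_space"
  assumes M: "prob_space M" and \<nu>: "prob_space \<nu>" and sets_\<nu>: "sets \<nu> = sets borel"
    and [measurable]: "\<And>N. \<Theta> N \<in> borel_measurable M"
    and [measurable]: "g \<in> borel_measurable borel"
    and conv: "\<And>a. (\<lambda>N. \<integral>\<omega>. iexp (a \<bullet> (sqrt (real N) *\<^sub>R (\<Theta> N \<omega> - \<theta>))) \<partial>M) \<longlonglongrightarrow> (\<integral>x. iexp (a \<bullet> x) \<partial>\<nu>)"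
    and D: "(g has_derivative D) (at \<theta>)"
  shows "(\<lambda>N. \<integral>\<omega>. iexp (a \<bullet> (sqrt (real N) *\<^sub>R (g (\<Theta> N \<omega>) - g \<theta>))) \<partial>M) \<longlonglongrightarrow> (\<integral>x. iexp (a \<bullet> D x) \<partial>\<nu>)"
proof -
  interpret M: prob_space M by fact
  define Z where "Z N \<omega> = sqrt (real N) *\<^sub>R (\<Theta> N \<omega> - \<theta>)" for N \<omega>
  define V where "V N \<omega> = sqrt (real N) *\<^sub>R (g (\<Theta> N \<omega>) - g \<theta>)" for N \<omega>
  have [measurable]: "Z N \<in> borel_measurable M" for N unfolding Z_def by measurable
  have [measurable]: "V N \<in> borel_measurable M" for N unfolding V_def by measurable
  have bl: "bounded_linear D" using D by (rule has_derivative_bounded_linear)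
  then have lin: "linear D" by (rule bounded_linear.linear)
  have [measurable]: "D \<in> borel_measurable borel"
    using bl by (intro borel_measurable_continuous_onI linear_continuous_on)
  have conv': "(\<lambda>N. \<integral>\<omega>. iexp (c \<bullet> Z N \<omega>) \<partial>M) \<longlonglongrightarrow> (\<integral>x. iexp (c \<bullet> x) \<partial>\<nu>)" for c
    using conv unfolding Z_def .
  have aD: "a \<bullet> D x = adjoint D a \<bullet> x" for x
    using adjoint_works[OF lin, of x a] by (simp add: inner_commute)
  have main: "(\<lambda>N. (\<integral>\<omega>. iexp (a \<bullet> V N \<omega>) \<partial>M) - (\<integral>\<omega>. iexp (a \<bullet> D (Z N \<omega>)) \<partial>M)) \<longlonglongrightarrow> 0"
  proof (rule LIMSEQ_I, goal_cases)
    case (1 e)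
    define \<epsilon> where "\<epsilon> = e / 4"
    have "\<epsilon> > 0" using 1 by (simp add: \<epsilon>_def)
    obtain K where K: "K > 0" "\<forall>\<^sub>F N in sequentially. measure M {\<omega>\<in>space M. norm (Z N \<omega>) > K} < \<epsilon>"
      by (rule tight_of_char_convergence[OF M \<nu> sets_\<nu> _ conv' \<open>\<epsilon> > 0\<close>]) auto
    \<comment> \<open>the slope error allowed so that it contributes at most \<open>\<epsilon>\<close> to the phase when the scaled error is at most \<open>K\<close>\<close>
    define \<eta> where "\<eta> = \<epsilon> / ((norm a + 1) * K)"
    have "\<eta> > 0" using \<open>\<epsilon> > 0\<close> K by (simp add: \<eta>_def add_nonneg_pos)
    then obtain d where d: "d > 0" "\<And>y. norm (y - \<theta>) < d \<Longrightarrow> norm (g y - g \<theta> - D (y - \<theta>)) \<le> \<eta> * norm (y - \<theta>)"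
      using D unfolding has_derivative_at_alt by blast
    obtain N0 where N0: "real N0 > (K / d)^2" using reals_Archimedean2 by blast
    have "\<forall>\<^sub>F N in sequentially. norm ((\<integral>\<omega>. iexp (a \<bullet> V N \<omega>) \<partial>M) - (\<integral>\<omega>. iexp (a \<bullet> D (Z N \<omega>)) \<partial>M)) < e"
      using K(2) eventually_ge_at_top[of "Suc N0"]
    proof eventually_elim
      case (elim N)
      have sN: "sqrt (real N) > K / d"
      proof -
        have "(K / d)^2 < real N" using N0 elim by linarith
        then show ?thesis by (rule real_less_rsqrt)
      qed
      have sN0: "sqrt (real N) > 0" using elim by simp
      have small: "norm (iexp (a \<bullet> V N \<omega>) - iexp (a \<bullet> D (Z N \<omega>))) \<le> \<epsilon>" if "norm (Z N \<omega>) \<le> K" for \<omega>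
      proof -
        have nZ: "norm (Z N \<omega>) = sqrt (real N) * norm (\<Theta> N \<omega> - \<theta>)" by (simp add: Z_def)
        have "norm (\<Theta> N \<omega> - \<theta>) \<le> K / sqrt (real N)" using that nZ sN0 by (simp add: field_simps)
        also have "\<dots> < d" using sN sN0 d by (simp add: field_simps)
        finally have le: "norm (g (\<Theta> N \<omega>) - g \<theta> - D (\<Theta> N \<omega> - \<theta>)) \<le> \<eta> * norm (\<Theta> N \<omega> - \<theta>)" by (rule d(2))
        have "V N \<omega> - D (Z N \<omega>) = sqrt (real N) *\<^sub>R (g (\<Theta> N \<omega>) - g \<theta> - D (\<Theta> N \<omega> - \<theta>))"
          using linear_scale[OF lin, of "sqrt (real N)" "\<Theta> N \<omega> - \<theta>"] by (simp add: V_def Z_def del: scaleR_diff_right) (simp add: scaleR_diff_right)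
        then have "norm (V N \<omega> - D (Z N \<omega>)) \<le> \<eta> * norm (Z N \<omega>)"
          using mult_left_mono[OF le, of "sqrt (real N)"] by (simp add: nZ mult_ac)
        also have "\<dots> \<le> \<eta> * K" using that \<open>\<eta> > 0\<close> by simp
        finally have *: "norm (V N \<omega> - D (Z N \<omega>)) \<le> \<eta> * K" .
        have "norm (iexp (a \<bullet> V N \<omega>) - iexp (a \<bullet> D (Z N \<omega>))) \<le> \<bar>a \<bullet> (V N \<omega> - D (Z N \<omega>))\<bar>"
          using norm_iexp_diff_le by (simp add: inner_diff_right)
        also have "\<dots> \<le> norm a * norm (V N \<omega> - D (Z N \<omega>))" by (rule Cauchy_Schwarz_ineq2)
        also have "\<dots> \<le> (norm a + 1) * (\<eta> * K)"
          using * by (intro mult_mono) auto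
        also have "\<dots> = \<epsilon>"
        proof -
          have "norm a + 1 \<noteq> 0" using norm_ge_zero[of a] by linarith
          then show ?thesis using K by (simp add: \<eta>_def)
        qed
        finally show ?thesis .
      qed
      have two: "norm (iexp (a \<bullet> V N \<omega>) - iexp (a \<bullet> D (Z N \<omega>))) \<le> 2" for \<omega>
        by (rule order_trans[OF norm_triangle_ineq4]) simp
      have i1: "integrable M (\<lambda>\<omega>. iexp (a \<bullet> V N \<omega>))" by (intro M.integrable_iexp) measurable
      have i2: "integrable M (\<lambda>\<omega>. iexp (a \<bullet> D (Z N \<omega>)))" by (intro M.integrable_iexp) measurable
      have "norm ((\<integral>\<omega>. iexp (a \<bullet> V N \<omega>) \<partial>M) - (\<integral>\<omega>. iexp (a \<bullet> D (Z N \<omega>)) \<partial>M))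
        = norm (\<integral>\<omega>. iexp (a \<bullet> V N \<omega>) - iexp (a \<bullet> D (Z N \<omega>)) \<partial>M)" using i1 i2 by simp
      also have "\<dots> \<le> (\<integral>\<omega>. norm (iexp (a \<bullet> V N \<omega>) - iexp (a \<bullet> D (Z N \<omega>))) \<partial>M)"
        by (rule integral_norm_bound)
      also have "\<dots> \<le> (\<integral>\<omega>. \<epsilon> + 2 * indicator {\<omega>\<in>space M. norm (Z N \<omega>) > K} \<omega> \<partial>M)"
      proof (rule integral_mono)
        show "integrable M (\<lambda>\<omega>. norm (iexp (a \<bullet> V N \<omega>) - iexp (a \<bullet> D (Z N \<omega>))))" using i1 i2 by auto
        show "integrable M (\<lambda>\<omega>. \<epsilon> + 2 * indicat_real {\<omega>\<in>space M. norm (Z N \<omega>) > K} \<omega>)"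
          by (auto intro!: Bochner_Integration.integrable_add integrable_mult_right simp: less_top[symmetric])
        show "norm (iexp (a \<bullet> V N \<omega>) - iexp (a \<bullet> D (Z N \<omega>))) \<le> \<epsilon> + 2 * indicat_real {\<omega>\<in>space M. norm (Z N \<omega>) > K} \<omega>"
          if "\<omega> \<in> space M" for \<omega>
          using small[of \<omega>] two[of \<omega>] that \<open>\<epsilon> > 0\<close> by (auto simp: indicator_def not_less)
      qed
      also have "\<dots> = \<epsilon> + 2 * measure M {\<omega>\<in>space M. norm (Z N \<omega>) > K}"
        by (subst Bochner_Integration.integral_add) (auto simp: M.prob_space less_top[symmetric])
      also have "\<dots> < e" using elim 1 unfolding \<epsilon>_def by linarith
      finally show ?case .
    qed
    then show ?case by (simp add: eventually_sequentially)
  qed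
  have "(\<lambda>N. \<integral>\<omega>. iexp (a \<bullet> D (Z N \<omega>)) \<partial>M) \<longlonglongrightarrow> (\<integral>x. iexp (a \<bullet> D x) \<partial>\<nu>)"
    unfolding aD by (rule conv')
  from tendsto_add[OF main this] show ?thesis unfolding V_def by simp
qed

lemma (in pair_prob_space) integral_prod_mult:
  fixes f :: "'a \<Rightarrow> 'c::{real_normed_field, banach, second_countable_topology}"
  assumes f: "integrable M1 f" and g: "integrable M2 g"
  shows "integrable (M1 \<Otimes>\<^sub>M M2) (\<lambda>z. f (fst z) * g (snd z))"
    and "(\<integral>z. f (fst z) * g (snd z) \<partial>(M1 \<Otimes>\<^sub>M M2)) = (\<integral>x. f x \<partial>M1) * (\<integral>y. g y \<partial>M2)"
proof -
  note [measurable] = borel_measurable_integrable[OF f] borel_measurable_integrable[OF g]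
  show i: "integrable (M1 \<Otimes>\<^sub>M M2) (\<lambda>z. f (fst z) * g (snd z))"
  proof (rule Fubini_integrable)
    show "integrable M1 (\<lambda>x. \<integral>y. norm (f (fst (x, y)) * g (snd (x, y))) \<partial>M2)"
      using f by (simp add: norm_mult)
  qed (use g in auto)
  show "(\<integral>z. f (fst z) * g (snd z) \<partial>(M1 \<Otimes>\<^sub>M M2)) = (\<integral>x. f x \<partial>M1) * (\<integral>y. g y \<partial>M2)"
    using integral_fst'[OF i] by simp
qed

abbreviation std2 :: "(real \<times> real) measure" where
  "std2 \<equiv> std_normal_distribution \<Otimes>\<^sub>M std_normal_distribution"

lemma prob_space_std2: "pair_prob_space std_normal_distribution std_normal_distribution"
  by (intro pair_prob_space.intro pair_sigma_finite.intro prob_space_imp_sigma_finite prob_space_normal_density) auto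

lemma std2_iexp: "(\<integral>z. iexp (p * fst z + q * snd z) \<partial>std2) = exp (- ((p^2 + q^2) / 2))"
proof -
  interpret pair_prob_space std_normal_distribution std_normal_distribution by (rule prob_space_std2)
  have "(\<integral>z. iexp (p * fst z + q * snd z) \<partial>std2) = (\<integral>z. iexp (p * fst z) * iexp (q * snd z) \<partial>std2)"
    by (simp only: exp_add[symmetric]) (simp add: distrib_left)
  also have "\<dots> = char std_normal_distribution p * char std_normal_distribution q"
    unfolding char_def by (rule integral_prod_mult) (auto intro!: M1.integrable_iexp)
  also have "\<dots> = exp (- (p^2)/2) * exp (-(q^2)/2)"
    unfolding char_std_normal_distribution by simp
  also have "\<dots> = exp (- ((p^2 + q^2) / 2))"
    by (simp only: exp_add[symmetric] of_real_mult[symmetric]) (simp add: field_simps)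
  finally show ?thesis by (simp add: exp_of_real)
qed

lemma std2_moments:
  "integrable std2 (\<lambda>z. fst z)" "integrable std2 (\<lambda>z. snd z)"
  "(\<integral>z. fst z \<partial>std2) = 0" "(\<integral>z. snd z \<partial>std2) = 0"
  "integrable std2 (\<lambda>z. fst z * fst z)" "integrable std2 (\<lambda>z. snd z * snd z)"
  "(\<integral>z. fst z * fst z \<partial>std2) = 1" "(\<integral>z. snd z * snd z \<partial>std2) = 1"
  "integrable std2 (\<lambda>z. fst z * snd z)" "(\<integral>z. fst z * snd z \<partial>std2) = 0"
proof -
  interpret pair_prob_space std_normal_distribution std_normal_distribution by (rule prob_space_std2)
  have i1: "integrable std_normal_distribution (\<lambda>x. x)" and v1: "(\<integral>x. x \<partial>std_normal_distribution) = 0"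
    using integrable_std_normal_distribution_moment[of 1] integral_std_normal_distribution_moment_odd[of 1] by auto
  have i2: "integrable std_normal_distribution (\<lambda>x. x * x)" and v2: "(\<integral>x. x * x \<partial>std_normal_distribution) = 1"
    using integrable_std_normal_distribution_moment[of 2] std_normal_distribution_even_moments(1)[of 1]
    by (auto simp: power2_eq_square fact_numeral)
  have c: "integrable std_normal_distribution (\<lambda>x. 1::real)" "(\<integral>x. 1 \<partial>std_normal_distribution) = (1::real)"
    using M1.prob_space by auto
  show "integrable std2 (\<lambda>z. fst z)" "integrable std2 (\<lambda>z. snd z)"
  "(\<integral>z. fst z \<partial>std2) = 0" "(\<integral>z. snd z \<partial>std2) = 0"
  "integrable std2 (\<lambda>z. fst z * fst z)" "integrable std2 (\<lambda>z. snd z * snd z)"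
  "(\<integral>z. fst z * fst z \<partial>std2) = 1" "(\<integral>z. snd z * snd z \<partial>std2) = 1"
  "integrable std2 (\<lambda>z. fst z * snd z)" "(\<integral>z. fst z * snd z \<partial>std2) = 0"
    using integral_prod_mult[OF i1 c(1)] integral_prod_mult[OF c(1) i1] integral_prod_mult[OF i2 c(1)]
      integral_prod_mult[OF c(1) i2] integral_prod_mult[OF i1 i1] v1 v2 c(2) by simp_all
qed

text \<open>
  A linear form in two independent standard normal variables is again normal. The degenerate form
  has to be split off because \<open>normal_density\<close> is not a density for standard
  deviation zero.
\<close>

lemma distr_std2_linear:
  "distr std2 borel (\<lambda>z. p * fst z + q * snd z) =
    (if sqrt (p^2+q^2) = 0 then return borel 0 else density lborel (\<lambda>x. ennreal (normal_density 0 (sqrt (p^2+q^2)) x)))"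
proof -
  interpret pair_prob_space std_normal_distribution std_normal_distribution by (rule prob_space_std2)
  define s where "s = sqrt (p^2 + q^2)"
  show ?thesis
  proof (cases "s = 0")
    case True
    then have "p = 0" "q = 0" unfolding s_def by (simp_all add: sum_power2_eq_zero_iff)
    then show ?thesis by (simp add: P.distr_const)
  next
    case False
    have "s > 0" using False unfolding s_def by (simp add: less_le)
    have "distributed std_normal_distribution lborel (\<lambda>x. s * x) (normal_density 0 s)"
      unfolding M1.normal_standard_normal_convert[OF \<open>s > 0\<close>] using \<open>s > 0\<close>
      by (simp add: distributed_def distr_id2 sets_eq_imp_space_eq)
    then have dens: "distr std_normal_distribution borel (\<lambda>x. s * x) = density lborel (normal_density 0 s)"
      by (auto simp: distributed_def cong: distr_cong)
    have rd: "real_distribution (distr std_normal_distribution borel (\<lambda>x. s * x))"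
      by (rule M1.real_distribution_distr) measurable
    have rd2: "real_distribution (distr std2 borel (\<lambda>z. p * fst z + q * snd z))"
      by (rule P.real_distribution_distr) measurable
    have "distr std2 borel (\<lambda>z. p * fst z + q * snd z) = distr std_normal_distribution borel (\<lambda>x. s * x)"
    proof (rule Levy_uniqueness[OF rd2 rd], rule ext)
      fix t
      have "char (distr std2 borel (\<lambda>z. p * fst z + q * snd z)) t = (\<integral>z. iexp ((t*p) * fst z + (t*q) * snd z) \<partial>std2)"
        by (simp add: char_def integral_distr algebra_simps)
      also have "\<dots> = exp (- ((t * s)^2 / 2))"
        unfolding std2_iexp s_def by (simp add: power_mult_distrib algebra_simps)
      also have "\<dots> = char std_normal_distribution (t * s)"
        unfolding char_std_normal_distribution by (simp add: exp_of_real)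
      also have "\<dots> = char (distr std_normal_distribution borel (\<lambda>x. s * x)) t"
        by (simp add: char_def integral_distr algebra_simps)
      finally show "char (distr std2 borel (\<lambda>z. p * fst z + q * snd z)) t = char (distr std_normal_distribution borel (\<lambda>x. s * x)) t" .
    qed
    then show ?thesis using False dens unfolding s_def by auto
  qed
qed

text \<open>
  The Cholesky factorisation \<open>S = p p\<^sup>T + q q\<^sup>T\<close>, allowing singular
  \<open>S\<close>: if the corner entry is zero, positive semidefiniteness forces the off-diagonal
  entry to vanish.
\<close>

lemma psd_2x2_factor:
  fixes S :: "real^2^2"
  assumes sym: "S $ 1 $ 2 = S $ 2 $ 1" and psd: "\<And>a. 0 \<le> a \<bullet> (S *v a)"
  obtains p q :: "2 \<Rightarrow> real" where "\<And>i j. S $ i $ j = p i * p j + q i * q j"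
proof -
  define A B C where "A = S $ 1 $ 1" and "B = S $ 1 $ 2" and "C = S $ 2 $ 2"
  have q: "0 \<le> A * x^2 + 2 * B * x * y + C * y^2" for x y
    using psd[of "vector [x, y]"] sym
    by (simp add: inner_vec_def sum_2 matrix_vector_mult_def A_def B_def C_def power2_eq_square algebra_simps)
  have "A \<ge> 0" "C \<ge> 0" using q[of 1 0] q[of 0 1] by auto
  have S: "S $ i $ j = (if i = 1 then if j = 1 then A else B else if j = 1 then B else C)" for i j :: 2
    using exhaust_2[of i] exhaust_2[of j] sym by (auto simp: A_def B_def C_def)
  show ?thesis
  proof (cases "A = 0")
    case True
    have "B = 0"
    proof (rule ccontr)
      assume "B \<noteq> 0"
      with q[of "- (C+1) / (2*B)" 1] True show False by simp
    qed
    show ?thesis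
      by (rule that[of "\<lambda>_. 0" "\<lambda>i. if i = 1 then 0 else sqrt C"]) (use True \<open>B = 0\<close> \<open>C \<ge> 0\<close> S in auto)
  next
    case False
    then have "A > 0" using \<open>A \<ge> 0\<close> by simp
    have d: "C - B^2 / A \<ge> 0"
      using q[of "- B / A" 1] \<open>A > 0\<close> by (simp add: field_simps power2_eq_square)
    show ?thesis
    proof (rule that[of "\<lambda>i. if i = 1 then sqrt A else B / sqrt A" "\<lambda>i. if i = 1 then 0 else sqrt (C - B^2/A)"])
      fix i j :: 2
      have "B / sqrt A * (B / sqrt A) = B^2 / A" using \<open>A > 0\<close> by (simp add: power2_eq_square)
      then show "S $ i $ j = (if i = 1 then sqrt A else B / sqrt A) * (if j = 1 then sqrt A else B / sqrt A) +
           (if i = 1 then 0 else sqrt (C - B^2/A)) * (if j = 1 then 0 else sqrt (C - B^2/A))"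
        using \<open>A > 0\<close> d S[of i j] by simp
    qed
  qed
qed

text \<open>
  With \<open>S = p p\<^sup>T + q q\<^sup>T\<close>, the law of \<open>\<xi> p + \<eta> q\<close>
  for independent standard normal \<open>\<xi>, \<eta>\<close> has covariance matrix
  \<open>S\<close>; every linear form in it is a linear form in \<open>(\<xi>, \<eta>)\<close>.
\<close>

lemma exists_centered_normal:
  fixes S :: "real^2^2"
  assumes sym: "S $ 1 $ 2 = S $ 2 $ 1" and psd: "\<And>a. 0 \<le> a \<bullet> (S *v a)"
  obtains \<nu> where "multivariate_normal \<nu> 0 S" "\<And>a. (\<integral>x. iexp (a \<bullet> x) \<partial>\<nu>) = exp (- (a \<bullet> (S *v a)) / 2)"
proof -
  obtain p q :: "2 \<Rightarrow> real" where S: "\<And>i j. S $ i $ j = p i * p j + q i * q j"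
    using psd_2x2_factor[OF assms] by metis
  interpret pair_prob_space std_normal_distribution std_normal_distribution by (rule prob_space_std2)
  define T :: "real \<times> real \<Rightarrow> real^2" where "T z = fst z *\<^sub>R vec_lambda p + snd z *\<^sub>R vec_lambda q" for z
  have [measurable]: "T \<in> borel_measurable std2"
    unfolding T_def by measurable
  define \<nu> where "\<nu> = distr std2 borel T"
  have T: "a \<bullet> T z = (\<Sum>i\<in>UNIV. a $ i * p i) * fst z + (\<Sum>i\<in>UNIV. a $ i * q i) * snd z" for a z
    by (simp add: T_def inner_vec_def sum_2 algebra_simps)
  have quad: "(\<Sum>i\<in>UNIV. a $ i * p i)^2 + (\<Sum>i\<in>UNIV. a $ i * q i)^2 = a \<bullet> (S *v a)" for a
    by (simp add: inner_vec_def sum_2 matrix_vector_mult_def S power2_eq_square algebra_simps)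
  have mean: "(\<integral>x. x $ i \<partial>\<nu>) = 0" for i
    unfolding \<nu>_def by (simp add: integral_distr) (simp add: T_def std2_moments)
  have cov: "covariance \<nu> (\<lambda>x. x $ i) (\<lambda>x. x $ j) = S $ i $ j" for i j
  proof -
    have "covariance \<nu> (\<lambda>x. x $ i) (\<lambda>x. x $ j) = (\<integral>z. T z $ i * T z $ j \<partial>std2)"
      unfolding covariance_def mean unfolding \<nu>_def by (simp add: integral_distr)
    also have "\<dots> = (\<integral>z. p i * p j * (fst z * fst z) + q i * q j * (snd z * snd z) + (p i * q j + q i * p j) * (fst z * snd z) \<partial>std2)"
      by (rule Bochner_Integration.integral_cong) (simp_all add: T_def algebra_simps)
    also have "\<dots> = S $ i $ j" by (simp add: std2_moments S)
    finally show ?thesis .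
  qed
  show ?thesis
  proof (rule that[of \<nu>])
    show "multivariate_normal \<nu> 0 S" unfolding multivariate_normal_def
    proof (intro conjI allI)
      show "prob_space \<nu>" unfolding \<nu>_def by (rule P.prob_space_distr) measurable
      show "sets \<nu> = sets borel" by (simp add: \<nu>_def)
      show "\<exists>m s. 0 \<le> s \<and> distr \<nu> borel (\<lambda>x. a \<bullet> x) =
          (if s = 0 then return borel m else density lborel (\<lambda>x. ennreal (normal_density m s x)))" for a
      proof (intro exI conjI)
        have "distr \<nu> borel (\<lambda>x. a \<bullet> x) = distr std2 borel (\<lambda>z. (\<Sum>i\<in>UNIV. a $ i * p i) * fst z + (\<Sum>i\<in>UNIV. a $ i * q i) * snd z)"
          unfolding \<nu>_def by (subst distr_distr) (auto simp: comp_def T)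
        then show "distr \<nu> borel (\<lambda>x. a \<bullet> x) = (if sqrt ((\<Sum>i\<in>UNIV. a $ i * p i)^2 + (\<Sum>i\<in>UNIV. a $ i * q i)^2) = 0 then return borel 0
           else density lborel (\<lambda>x. ennreal (normal_density 0 (sqrt ((\<Sum>i\<in>UNIV. a $ i * p i)^2 + (\<Sum>i\<in>UNIV. a $ i * q i)^2)) x)))"
          unfolding distr_std2_linear .
      qed simp
    qed (simp_all add: mean cov)
    show "(\<integral>x. iexp (a \<bullet> x) \<partial>\<nu>) = exp (- (a \<bullet> (S *v a)) / 2)" for a
    proof -
      have "(\<integral>x. iexp (a \<bullet> x) \<partial>\<nu>) = (\<integral>z. iexp (a \<bullet> T z) \<partial>std2)"
        unfolding \<nu>_def by (rule integral_distr) measurable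
      also have "\<dots> = exp (- (a \<bullet> (S *v a)) / 2)"
        unfolding T std2_iexp quad by simp
      finally show ?thesis .
    qed
  qed
qed

section \<open>Markov kernels that contract the state\<close>

lemma prod_le_sum_squares: "a * b \<le> a\<^sup>2 + b\<^sup>2" if "0 \<le> a" "0 \<le> b" for a b :: real
  using sum_squares_bound[of a b] mult_nonneg_nonneg[OF that] by linarith

text \<open>
  The Markov chain is given by its random recursion \<open>x \<mapsto> F x s\<close> with
  \<open>s\<close> drawn from \<open>Q\<close>, and one realisation of the noise contracts all
  states by the same factor. Two copies of the chain driven by the same noise approach each other
  geometrically, and this is the source of ergodicity. The exponent \<open>\<theta>\<close> is the
  Hoelder exponent of the observables: powers \<open>x powr n\<close> with \<open>n < 1\<close>
  are not Lipschitz at the origin.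
\<close>

locale contractive_kernel =
  fixes Q :: "'s measure" and F :: "real \<Rightarrow> 's \<Rightarrow> real" and \<rho> \<theta> :: real and \<pi> :: "real measure"
  assumes prob_Q: "prob_space Q"
    and F_measurable[measurable]: "(\<lambda>(x, s). F x s) \<in> borel_measurable (borel \<Otimes>\<^sub>M Q)"
    and rho: "0 \<le> \<rho>" "\<rho> < 1"
    and theta: "0 < \<theta>" "\<theta> \<le> 1"
    and contraction: "\<And>x y s. s \<in> space Q \<Longrightarrow> \<bar>F x s - F y s\<bar> \<le> \<rho> * \<bar>x - y\<bar>"
    and prob_pi: "prob_space \<pi>"
    and sets_pi[measurable_cong]: "sets \<pi> = sets borel"
    and pi_moments: "\<And>q::nat. integrable \<pi> (\<lambda>x. \<bar>x\<bar> ^ q)"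
    and invariant: "distr (\<pi> \<Otimes>\<^sub>M Q) borel (\<lambda>(x, s). F x s) = \<pi>"
begin

sublocale Q: prob_space Q by (rule prob_Q)
sublocale \<pi>: prob_space \<pi> by (rule prob_pi)
sublocale \<pi>Q: pair_prob_space \<pi> Q ..

lemma F_measurable'[measurable]:
  assumes [measurable]: "f \<in> borel_measurable N" "g \<in> measurable N Q"
  shows "(\<lambda>z. F (f z) (g z)) \<in> borel_measurable N"
  using measurable_compose[of "\<lambda>z. (f z, g z)" N "borel \<Otimes>\<^sub>M Q" "\<lambda>(x, s). F x s" borel] by simp

text \<open>
  Polynomially weighted Hoelder functions. For \<open>\<theta> = min 1 n\<close> the class
  contains the one-sided \<open>n\<close>-th powers; it is closed under products and stable under
  the kernel, so that all observables, their conditional variances and the solutions of the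
  Poisson equation live in it.
\<close>

definition poly_hoelder :: "(real \<Rightarrow> real) \<Rightarrow> bool" where
  "poly_hoelder f \<longleftrightarrow> (\<exists>C\<ge>0. \<exists>q::nat. \<forall>x y. \<bar>f x - f y\<bar> \<le> C * \<bar>x - y\<bar> powr \<theta> * ((1 + \<bar>x\<bar>) * (1 + \<bar>y\<bar>)) ^ q)"

lemma poly_hoelderI:
  assumes "C \<ge> 0" "\<And>x y. \<bar>f x - f y\<bar> \<le> C * \<bar>x - y\<bar> powr \<theta> * ((1 + \<bar>x\<bar>) * (1 + \<bar>y\<bar>)) ^ q"
  shows "poly_hoelder f"
  using assms unfolding poly_hoelder_def by blast

lemma poly_hoelderE:
  assumes "poly_hoelder f"
  obtains C q where "C \<ge> 0" "\<And>x y. \<bar>f x - f y\<bar> \<le> C * \<bar>x - y\<bar> powr \<theta> * ((1 + \<bar>x\<bar>) * (1 + \<bar>y\<bar>)) ^ q"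
  using assms unfolding poly_hoelder_def by blast

lemma powr_dist_le: "\<bar>x - y\<bar> powr \<theta> \<le> (1 + \<bar>x\<bar>) * (1 + \<bar>y\<bar>)" for x y :: real
proof -
  have "\<bar>x - y\<bar> powr \<theta> \<le> (1 + \<bar>x - y\<bar>) powr \<theta>" using theta by (intro powr_mono2) auto
  also have "\<dots> \<le> (1 + \<bar>x - y\<bar>) powr 1" using theta by (intro powr_mono) auto
  also have "\<dots> = 1 + \<bar>x - y\<bar>" by simp
  also have "\<dots> \<le> (1 + \<bar>x\<bar>) * (1 + \<bar>y\<bar>)" by (simp add: algebra_simps) (smt (verit) mult_nonneg_nonneg)
  finally show ?thesis .
qed

lemma weight_ge_1: "1 \<le> (1 + \<bar>x\<bar>) * (1 + \<bar>y\<bar>)" for x y :: real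
proof -
  have "1 * 1 \<le> (1 + \<bar>x\<bar>) * (1 + \<bar>y\<bar>)" by (intro mult_mono) auto
  then show ?thesis by simp
qed

lemma poly_hoelder_growth:
  assumes "poly_hoelder f"
  obtains C q where "C \<ge> 0" "\<And>x. \<bar>f x\<bar> \<le> C * (1 + \<bar>x\<bar>) ^ q"
proof -
  obtain C q where C: "C \<ge> 0" "\<And>x y. \<bar>f x - f y\<bar> \<le> C * \<bar>x - y\<bar> powr \<theta> * ((1 + \<bar>x\<bar>) * (1 + \<bar>y\<bar>)) ^ q"
    using assms by (rule poly_hoelderE) blast
  show ?thesis
  proof (rule that[of "\<bar>f 0\<bar> + C" "Suc q"])
    fix x
    have "\<bar>f x - f 0\<bar> \<le> C * \<bar>x\<bar> powr \<theta> * (1 + \<bar>x\<bar>) ^ q" using C(2)[of x 0] by simp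
    also have "\<dots> \<le> C * (1 + \<bar>x\<bar>) * (1 + \<bar>x\<bar>) ^ q"
      using powr_dist_le[of x 0] C(1) by (intro mult_right_mono mult_left_mono) auto
    finally have "\<bar>f x\<bar> \<le> \<bar>f 0\<bar> + C * (1 + \<bar>x\<bar>) ^ Suc q" by (simp add: mult_ac)
    also have "\<dots> \<le> \<bar>f 0\<bar> * (1 + \<bar>x\<bar>) ^ Suc q + C * (1 + \<bar>x\<bar>) ^ Suc q"
      using one_le_power[of "1 + \<bar>x\<bar>" "Suc q"] mult_left_mono[of 1 "(1 + \<bar>x\<bar>) ^ Suc q" "\<bar>f 0\<bar>"] by simp
    finally show "\<bar>f x\<bar> \<le> (\<bar>f 0\<bar> + C) * (1 + \<bar>x\<bar>) ^ Suc q" by (simp add: distrib_right)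
  qed (use C(1) in auto)
qed

lemma poly_hoelder_continuous:
  assumes "poly_hoelder f" shows "continuous_on UNIV f"
proof -
  obtain C q where C: "C \<ge> 0" "\<And>x y. \<bar>f x - f y\<bar> \<le> C * \<bar>x - y\<bar> powr \<theta> * ((1 + \<bar>x\<bar>) * (1 + \<bar>y\<bar>)) ^ q"
    using assms by (rule poly_hoelderE) blast
  have "isCont f x" for x
  proof -
    have "((\<lambda>y. \<bar>y - x\<bar>) \<longlongrightarrow> \<bar>x - x\<bar>) (at x)" by (intro tendsto_intros)
    then have "((\<lambda>y. \<bar>y - x\<bar> powr \<theta>) \<longlongrightarrow> 0) (at x)"
      using theta tendsto_powr'[of "\<lambda>y. \<bar>y - x\<bar>" 0 "at x" "\<lambda>_. \<theta>" \<theta>] by simp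
    moreover have "((\<lambda>y. ((1 + \<bar>y\<bar>) * (1 + \<bar>x\<bar>)) ^ q) \<longlongrightarrow> ((1 + \<bar>x\<bar>) * (1 + \<bar>x\<bar>)) ^ q) (at x)"
      by (intro tendsto_intros)
    ultimately have "((\<lambda>y. C * \<bar>y - x\<bar> powr \<theta> * ((1 + \<bar>y\<bar>) * (1 + \<bar>x\<bar>)) ^ q) \<longlongrightarrow> C * 0 * ((1 + \<bar>x\<bar>) * (1 + \<bar>x\<bar>)) ^ q) (at x)"
      by (intro tendsto_intros)
    then have lim: "((\<lambda>y. C * \<bar>y - x\<bar> powr \<theta> * ((1 + \<bar>y\<bar>) * (1 + \<bar>x\<bar>)) ^ q) \<longlongrightarrow> 0) (at x)" by simp
    have "((\<lambda>y. f y - f x) \<longlongrightarrow> 0) (at x)"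
      by (rule Lim_null_comparison[OF _ lim]) (use C(2) in auto)
    then show ?thesis by (simp add: isCont_def LIM_zero_iff)
  qed
  then show ?thesis by (simp add: continuous_at_imp_continuous_on)
qed

lemma poly_hoelder_measurable: "poly_hoelder f \<Longrightarrow> f \<in> borel_measurable borel"
  using poly_hoelder_continuous borel_measurable_continuous_onI by blast

lemma poly_hoelder_const: "poly_hoelder (\<lambda>_. c)"
  by (rule poly_hoelderI[of 0]) auto

lemma weight_power_mono: "((1 + \<bar>x\<bar>) * (1 + \<bar>y\<bar>)) ^ q \<le> ((1 + \<bar>x\<bar>) * (1 + \<bar>y\<bar>)) ^ r" if "q \<le> r" for x y :: real
  using that weight_ge_1 by (intro power_increasing) auto

lemma poly_hoelder_add:
  assumes "poly_hoelder f" "poly_hoelder g" shows "poly_hoelder (\<lambda>x. f x + g x)"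
proof -
  obtain C q where C: "C \<ge> 0" "\<And>x y. \<bar>f x - f y\<bar> \<le> C * \<bar>x - y\<bar> powr \<theta> * ((1 + \<bar>x\<bar>) * (1 + \<bar>y\<bar>)) ^ q"
    using assms(1) by (rule poly_hoelderE) blast
  obtain D r where D: "D \<ge> 0" "\<And>x y. \<bar>g x - g y\<bar> \<le> D * \<bar>x - y\<bar> powr \<theta> * ((1 + \<bar>x\<bar>) * (1 + \<bar>y\<bar>)) ^ r"
    using assms(2) by (rule poly_hoelderE) blast
  show ?thesis
  proof (rule poly_hoelderI[of "C + D" _ "max q r"])
    fix x y :: real
    let ?w = "(1 + \<bar>x\<bar>) * (1 + \<bar>y\<bar>)"
    have "\<bar>f x + g x - (f y + g y)\<bar> \<le> \<bar>f x - f y\<bar> + \<bar>g x - g y\<bar>" by simp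
    also have "\<dots> \<le> C * \<bar>x - y\<bar> powr \<theta> * ?w ^ max q r + D * \<bar>x - y\<bar> powr \<theta> * ?w ^ max q r"
    proof (rule add_mono)
      show "\<bar>f x - f y\<bar> \<le> C * \<bar>x - y\<bar> powr \<theta> * ?w ^ max q r"
        by (rule order_trans[OF C(2)]) (intro mult_left_mono weight_power_mono mult_nonneg_nonneg C(1); simp)
      show "\<bar>g x - g y\<bar> \<le> D * \<bar>x - y\<bar> powr \<theta> * ?w ^ max q r"
        by (rule order_trans[OF D(2)]) (intro mult_left_mono weight_power_mono mult_nonneg_nonneg D(1); simp)
    qed
    finally show "\<bar>f x + g x - (f y + g y)\<bar> \<le> (C + D) * \<bar>x - y\<bar> powr \<theta> * ?w ^ max q r"
      by (simp add: distrib_right)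
  qed (use C(1) D(1) in auto)
qed

lemma poly_hoelder_mult:
  assumes "poly_hoelder f" "poly_hoelder g" shows "poly_hoelder (\<lambda>x. f x * g x)"
proof -
  obtain C q where C: "C \<ge> 0" "\<And>x y. \<bar>f x - f y\<bar> \<le> C * \<bar>x - y\<bar> powr \<theta> * ((1 + \<bar>x\<bar>) * (1 + \<bar>y\<bar>)) ^ q"
    using assms(1) by (rule poly_hoelderE) blast
  obtain D r where D: "D \<ge> 0" "\<And>x y. \<bar>g x - g y\<bar> \<le> D * \<bar>x - y\<bar> powr \<theta> * ((1 + \<bar>x\<bar>) * (1 + \<bar>y\<bar>)) ^ r"
    using assms(2) by (rule poly_hoelderE) blast
  obtain C' q' where C': "C' \<ge> 0" "\<And>x. \<bar>f x\<bar> \<le> C' * (1 + \<bar>x\<bar>) ^ q'"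
    using assms(1) by (rule poly_hoelder_growth) blast
  obtain D' r' where D': "D' \<ge> 0" "\<And>x. \<bar>g x\<bar> \<le> D' * (1 + \<bar>x\<bar>) ^ r'"
    using assms(2) by (rule poly_hoelder_growth) blast
  show ?thesis
  proof (rule poly_hoelderI[of "C' * D + D' * C" _ "q' + r + (r' + q)"])
    fix x y :: real
    let ?w = "(1 + \<bar>x\<bar>) * (1 + \<bar>y\<bar>)" and ?d = "\<bar>x - y\<bar> powr \<theta>"
    have wx: "(1 + \<bar>x\<bar>) ^ k \<le> ?w ^ k" for k by (intro power_mono) (auto simp: mult_le_cancel_left1)
    have wy: "(1 + \<bar>y\<bar>) ^ k \<le> ?w ^ k" for k by (intro power_mono) (auto simp: mult_le_cancel_right1)
    have "\<bar>f x * g x - f y * g y\<bar> = \<bar>f x * (g x - g y) + g y * (f x - f y)\<bar>" by (simp add: algebra_simps)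
    also have "\<dots> \<le> \<bar>f x\<bar> * \<bar>g x - g y\<bar> + \<bar>g y\<bar> * \<bar>f x - f y\<bar>"
      by (metis abs_triangle_ineq abs_mult)
    also have "\<dots> \<le> (C' * ?w ^ q') * (D * ?d * ?w ^ r) + (D' * ?w ^ r') * (C * ?d * ?w ^ q)"
    proof -
      have f: "\<bar>f x\<bar> \<le> C' * ?w ^ q'"
        by (rule order_trans[OF C'(2)]) (intro mult_left_mono wx C')
      have g: "\<bar>g y\<bar> \<le> D' * ?w ^ r'"
        by (rule order_trans[OF D'(2)]) (intro mult_left_mono wy D')
      show ?thesis
        by (intro add_mono mult_mono f g C(2) D(2) abs_ge_zero mult_nonneg_nonneg C'(1) D'(1)) simp_all
    qed
    also have "\<dots> = C' * D * ?d * ?w ^ (q' + r) + D' * C * ?d * ?w ^ (r' + q)"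
      by (simp add: power_add mult_ac)
    also have "\<dots> \<le> C' * D * ?d * ?w ^ (q' + r + (r' + q)) + D' * C * ?d * ?w ^ (q' + r + (r' + q))"
      using C(1) D(1) C'(1) D'(1) by - (rule add_mono; (intro mult_left_mono weight_power_mono mult_nonneg_nonneg; simp))
    finally show "\<bar>f x * g x - f y * g y\<bar> \<le> (C' * D + D' * C) * ?d * ?w ^ (q' + r + (r' + q))"
      by (simp add: distrib_right)
  qed (use C(1) D(1) C'(1) D'(1) in auto)
qed

lemma poly_hoelder_cmult: "poly_hoelder f \<Longrightarrow> poly_hoelder (\<lambda>x. c * f x)"
  by (rule poly_hoelder_mult[OF poly_hoelder_const])

lemma poly_hoelder_diff: "poly_hoelder f \<Longrightarrow> poly_hoelder g \<Longrightarrow> poly_hoelder (\<lambda>x. f x - g x)"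
  using poly_hoelder_add[of f "\<lambda>x. -1 * g x"] poly_hoelder_cmult[of g "-1"] by simp

lemma poly_hoelder_lipschitz:
  assumes "L \<ge> 0" "\<And>x y. \<bar>f x - f y\<bar> \<le> L * \<bar>x - y\<bar>" shows "poly_hoelder f"
proof (rule poly_hoelderI[of L _ 1])
  fix x y
  have "\<bar>x - y\<bar> = \<bar>x - y\<bar> powr \<theta> * \<bar>x - y\<bar> powr (1 - \<theta>)" by (simp add: powr_add[symmetric])
  also have "\<dots> \<le> \<bar>x - y\<bar> powr \<theta> * ((1 + \<bar>x\<bar>) * (1 + \<bar>y\<bar>))"
  proof (intro mult_left_mono)
    have "\<bar>x - y\<bar> powr (1 - \<theta>) \<le> (1 + \<bar>x - y\<bar>) powr (1 - \<theta>)" using theta by (intro powr_mono2) auto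
    also have "\<dots> \<le> (1 + \<bar>x - y\<bar>) powr 1" using theta by (intro powr_mono) auto
    also have "\<dots> = 1 + \<bar>x - y\<bar>" by simp
    also have "\<dots> \<le> (1 + \<bar>x\<bar>) * (1 + \<bar>y\<bar>)" by (simp add: algebra_simps) (smt (verit) mult_nonneg_nonneg)
    finally show "\<bar>x - y\<bar> powr (1 - \<theta>) \<le> (1 + \<bar>x\<bar>) * (1 + \<bar>y\<bar>)" .
  qed simp
  finally have "L * \<bar>x - y\<bar> \<le> L * (\<bar>x - y\<bar> powr \<theta> * ((1 + \<bar>x\<bar>) * (1 + \<bar>y\<bar>)))"
    using assms(1) by (rule mult_left_mono)
  then show "\<bar>f x - f y\<bar> \<le> L * \<bar>x - y\<bar> powr \<theta> * ((1 + \<bar>x\<bar>) * (1 + \<bar>y\<bar>)) ^ 1"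
    using assms(2)[of x y] by (simp add: mult_ac)
qed (fact assms)

lemma poly_hoelder_power: "poly_hoelder f \<Longrightarrow> poly_hoelder (\<lambda>x. f x ^ k)"
  by (induction k) (auto intro: poly_hoelder_const poly_hoelder_mult)

lemma poly_hoelder_weight: "poly_hoelder (\<lambda>x. (1 + \<bar>x\<bar>) ^ q)"
  by (intro poly_hoelder_power poly_hoelder_lipschitz[of 1]) auto

lemma pi_weight: "integrable \<pi> (\<lambda>x. (1 + \<bar>x\<bar>) ^ q)"
proof -
  have "(1 + \<bar>x\<bar>) ^ q = (\<Sum>k\<le>q. of_nat (q choose k) * \<bar>x\<bar> ^ (q - k))" for x :: real
    using binomial_ring[of 1 "\<bar>x\<bar>" q] by simp
  then show ?thesis using pi_moments by simp
qed

lemma pi_integrable: assumes "poly_hoelder f" shows "integrable \<pi> f"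
proof -
  obtain C q where "C \<ge> 0" and C: "\<And>x. \<bar>f x\<bar> \<le> C * (1 + \<bar>x\<bar>) ^ q" using poly_hoelder_growth[OF assms] by blast
  show ?thesis
    by (rule Bochner_Integration.integrable_bound[OF integrable_mult_right[OF pi_weight[of q], of C]])
       (use C \<open>C \<ge> 0\<close> poly_hoelder_measurable[OF assms] in \<open>auto simp: abs_mult\<close>)
qed

lemma invariant_integral:
  fixes f :: "real \<Rightarrow> 'c::{banach, second_countable_topology}"
  assumes [measurable]: "f \<in> borel_measurable borel"
  shows "integrable \<pi> f \<longleftrightarrow> integrable (\<pi> \<Otimes>\<^sub>M Q) (\<lambda>z. f (F (fst z) (snd z)))"
    and "(\<integral>x. f x \<partial>\<pi>) = (\<integral>z. f (F (fst z) (snd z)) \<partial>(\<pi> \<Otimes>\<^sub>M Q))"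
proof -
  have "integrable (distr (\<pi> \<Otimes>\<^sub>M Q) borel (\<lambda>(x, s). F x s)) f \<longleftrightarrow> integrable (\<pi> \<Otimes>\<^sub>M Q) (\<lambda>z. f ((\<lambda>(x, s). F x s) z))"
    using integrable_distr_eq[of "\<lambda>(x, s). F x s" "\<pi> \<Otimes>\<^sub>M Q" borel f] by simp
  then show "integrable \<pi> f \<longleftrightarrow> integrable (\<pi> \<Otimes>\<^sub>M Q) (\<lambda>z. f (F (fst z) (snd z)))"
    unfolding invariant by (simp add: split_beta)
  have "(\<integral>x. f x \<partial>(distr (\<pi> \<Otimes>\<^sub>M Q) borel (\<lambda>(x, s). F x s))) = (\<integral>z. f ((\<lambda>(x, s). F x s) z) \<partial>(\<pi> \<Otimes>\<^sub>M Q))"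
    using integral_distr[of "\<lambda>(x, s). F x s" "\<pi> \<Otimes>\<^sub>M Q" borel f] by simp
  then show "(\<integral>x. f x \<partial>\<pi>) = (\<integral>z. f (F (fst z) (snd z)) \<partial>(\<pi> \<Otimes>\<^sub>M Q))"
    unfolding invariant by (simp add: split_beta)
qed

text \<open>
  The noise inherits its moments from \<open>\<pi>\<close>: \<open>\<bar>F 0 s\<bar> \<le> \<bar>F
  x s\<bar> + \<bar>x\<bar>\<close>, and under \<open>\<pi> \<Otimes>\<^sub>M Q\<close> both terms
  on the right have law \<open>\<pi>\<close>.
\<close>

lemma F0_moments: "integrable Q (\<lambda>s. (1 + \<bar>F 0 s\<bar>) ^ q)"
proof -
  have i1: "integrable (\<pi> \<Otimes>\<^sub>M Q) (\<lambda>z. (1 + \<bar>F (fst z) (snd z)\<bar>) ^ (2*q))"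
    using invariant_integral(1)[of "\<lambda>x. (1 + \<bar>x\<bar>) ^ (2*q)"] pi_weight by simp
  have i2: "integrable (\<pi> \<Otimes>\<^sub>M Q) (\<lambda>z. (1 + \<bar>fst z\<bar>) ^ (2*q))"
  proof (rule \<pi>Q.Fubini_integrable)
    show "integrable \<pi> (\<lambda>x. \<integral>y. norm ((1 + \<bar>fst (x, y)\<bar>) ^ (2*q)) \<partial>Q)"
      using pi_weight[of "2*q"] by (simp add: Q.prob_space)
  qed auto
  have "integrable (\<pi> \<Otimes>\<^sub>M Q) (\<lambda>z. (1 + \<bar>F 0 (snd z)\<bar>) ^ q)"
  proof (rule Bochner_Integration.integrable_bound[OF Bochner_Integration.integrable_add[OF i1 i2]])
    show "AE z in \<pi> \<Otimes>\<^sub>M Q. norm ((1 + \<bar>F 0 (snd z)\<bar>) ^ q) \<le> norm ((1 + \<bar>F (fst z) (snd z)\<bar>) ^ (2*q) + (1 + \<bar>fst z\<bar>) ^ (2*q))"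
    proof (intro AE_I2)
      fix z assume "z \<in> space (\<pi> \<Otimes>\<^sub>M Q)"
      then have "snd z \<in> space Q" by (auto simp: space_pair_measure)
      then have "\<bar>F 0 (snd z) - F (fst z) (snd z)\<bar> \<le> \<rho> * \<bar>0 - fst z\<bar>" by (rule contraction)
      also have "\<dots> \<le> \<bar>fst z\<bar>" using rho by (simp add: mult_left_le_one_le)
      finally have a: "1 + \<bar>F 0 (snd z)\<bar> \<le> 1 + \<bar>F (fst z) (snd z)\<bar> + \<bar>fst z\<bar>" by linarith
      let ?a = "1 + \<bar>F (fst z) (snd z)\<bar>" and ?b = "1 + \<bar>fst z\<bar>"
      have "?a + \<bar>fst z\<bar> \<le> ?a * ?b" by (simp add: algebra_simps)
      then have "(1 + \<bar>F 0 (snd z)\<bar>) ^ q \<le> (?a * ?b) ^ q"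
        using a by (intro power_mono) auto
      also have "\<dots> = ?a ^ q * ?b ^ q" by (rule power_mult_distrib)
      also have "\<dots> \<le> (?a ^ q)\<^sup>2 + (?b ^ q)\<^sup>2"
        by (intro prod_le_sum_squares) simp_all
      also have "\<dots> = ?a ^ (2*q) + ?b ^ (2*q)" by (simp add: power_mult[symmetric] mult.commute)
      finally show "norm ((1 + \<bar>F 0 (snd z)\<bar>) ^ q) \<le> norm (?a ^ (2*q) + ?b ^ (2*q))" by simp
    qed
  qed measurable
  then have "AE x in \<pi>. integrable Q (\<lambda>s. (1 + \<bar>F 0 (snd (x, s))\<bar>) ^ q)"
    by (rule \<pi>Q.AE_integrable_fst')
  then have "AE x in \<pi>. integrable Q (\<lambda>s. (1 + \<bar>F 0 s\<bar>) ^ q)" by simp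
  then show ?thesis using \<pi>.AE_const by blast
qed

lemma F_growth: "s \<in> space Q \<Longrightarrow> 0 \<le> \<epsilon> \<Longrightarrow> 1 + \<epsilon> * \<bar>F x s\<bar> \<le> (1 + \<epsilon> * \<bar>F 0 s\<bar>) * (1 + \<epsilon> * \<bar>x\<bar>)"
proof -
  assume "s \<in> space Q" and \<epsilon>: "0 \<le> \<epsilon>"
  have "\<bar>F x s - F 0 s\<bar> \<le> \<rho> * \<bar>x - 0\<bar>" by (rule contraction) fact
  also have "\<dots> \<le> \<bar>x\<bar>" using rho by (simp add: mult_left_le_one_le)
  finally have "\<bar>F x s\<bar> \<le> \<bar>F 0 s\<bar> + \<bar>x\<bar>" by linarith
  then have "\<epsilon> * \<bar>F x s\<bar> \<le> \<epsilon> * (\<bar>F 0 s\<bar> + \<bar>x\<bar>)" using \<epsilon> by (rule mult_left_mono)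
  moreover have "0 \<le> (\<epsilon> * \<bar>F 0 s\<bar>) * (\<epsilon> * \<bar>x\<bar>)" using \<epsilon> by simp
  ultimately show ?thesis by (simp add: algebra_simps)
qed

lemma F_integrable:
  assumes "poly_hoelder f" shows "integrable Q (\<lambda>s. f (F x s))"
proof -
  obtain C q where "C \<ge> 0" and C: "\<And>x. \<bar>f x\<bar> \<le> C * (1 + \<bar>x\<bar>) ^ q" using poly_hoelder_growth[OF assms] by blast
  note [measurable] = poly_hoelder_measurable[OF assms]
  show ?thesis
  proof (rule Bochner_Integration.integrable_bound[OF integrable_mult_right[OF F0_moments[of q], of "C * (1 + \<bar>x\<bar>) ^ q"]])
    show "AE s in Q. norm (f (F x s)) \<le> norm (C * (1 + \<bar>x\<bar>) ^ q * (1 + \<bar>F 0 s\<bar>) ^ q)"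
    proof (intro AE_I2)
      fix s assume "s \<in> space Q"
      then have "1 + \<bar>F x s\<bar> \<le> (1 + \<bar>F 0 s\<bar>) * (1 + \<bar>x\<bar>)" using F_growth[of s 1 x] by simp
      then have "C * (1 + \<bar>F x s\<bar>) ^ q \<le> C * ((1 + \<bar>F 0 s\<bar>) * (1 + \<bar>x\<bar>)) ^ q"
        using \<open>C \<ge> 0\<close> by (intro mult_left_mono power_mono) auto
      then show "norm (f (F x s)) \<le> norm (C * (1 + \<bar>x\<bar>) ^ q * (1 + \<bar>F 0 s\<bar>) ^ q)"
        using C[of "F x s"] \<open>C \<ge> 0\<close> by (simp add: power_mult_distrib mult_ac abs_mult)
    qed
  qed measurable
qed

definition P :: "(real \<Rightarrow> real) \<Rightarrow> real \<Rightarrow> real" where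
  "P f x = (\<integral>s. f (F x s) \<partial>Q)"

lemma pi_P:
  assumes "poly_hoelder f" shows "(\<integral>x. P f x \<partial>\<pi>) = (\<integral>x. f x \<partial>\<pi>)"
proof -
  have "integrable (\<pi> \<Otimes>\<^sub>M Q) (\<lambda>z. f (F (fst z) (snd z)))"
    using invariant_integral(1)[OF poly_hoelder_measurable[OF assms]] pi_integrable[OF assms] by simp
  from \<pi>Q.integral_fst'[OF this] show ?thesis
    unfolding P_def by (simp add: invariant_integral(2)[OF poly_hoelder_measurable[OF assms]])
qed

text \<open>
  Convexity of \<open>t \<mapsto> (1 + t a) ^ p\<close> on \<open>[0, 1]\<close>. It shows that
  replacing the weight \<open>1 + \<bar>x\<bar>\<close> by \<open>1 + \<epsilon>
  \<bar>x\<bar>\<close> makes the expected growth of the weight in one step as close to 1 as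
  desired.
\<close>

lemma power_eps_le: "(1 + \<epsilon> * a) ^ p \<le> 1 + \<epsilon> * ((1 + a) ^ p - 1)" if "0 \<le> \<epsilon>" "\<epsilon> \<le> 1" "0 \<le> a" for \<epsilon> a :: real
proof (induction p)
  case (Suc p)
  let ?b = "(1 + a) ^ p - 1"
  have b: "0 \<le> ?b" using that by (simp add: one_le_power)
  have "(1 + \<epsilon> * a) ^ Suc p \<le> (1 + \<epsilon> * a) * (1 + \<epsilon> * ?b)"
    using Suc that by (simp add: mult_left_mono)
  also have "\<dots> = 1 + \<epsilon> * a + \<epsilon> * ?b + \<epsilon> * (\<epsilon> * (a * ?b))" by (simp add: algebra_simps)
  also have "\<dots> \<le> 1 + \<epsilon> * a + \<epsilon> * ?b + \<epsilon> * (1 * (a * ?b))"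
    using that b by (intro add_left_mono mult_left_mono mult_right_mono) auto
  also have "\<dots> = 1 + \<epsilon> * ((1 + a) ^ Suc p - 1)" by (simp add: algebra_simps)
  finally show ?case .
qed simp

text \<open>
  One step multiplies the Hoelder seminorm by \<open>\<rho> powr \<theta> < 1\<close> but lets the
  weight grow by a factor that may exceed 1. Passing to the equivalent weight \<open>1 +
  \<epsilon> \<bar>x\<bar>\<close> with small \<open>\<epsilon>\<close> brings the growth close
  enough to 1 for the product of both factors to stay below \<open>r < 1\<close>.
\<close>

lemma P_iter_hoelder:
  assumes "poly_hoelder f"
  obtains C r :: real and q :: nat where "C \<ge> 0" "0 < r" "r < 1"
    "\<And>k. poly_hoelder ((P ^^ k) f)"
    "\<And>k x y. \<bar>(P ^^ k) f x - (P ^^ k) f y\<bar> \<le> C * r ^ k * \<bar>x - y\<bar> powr \<theta> * ((1 + \<bar>x\<bar>) * (1 + \<bar>y\<bar>)) ^ q"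
proof -
  obtain C q where C: "C \<ge> 0" "\<And>x y. \<bar>f x - f y\<bar> \<le> C * \<bar>x - y\<bar> powr \<theta> * ((1 + \<bar>x\<bar>) * (1 + \<bar>y\<bar>)) ^ q"
    using assms by (rule poly_hoelderE) blast
  define M where "M = (\<integral>s. (1 + \<bar>F 0 s\<bar>) ^ (q+q) \<partial>Q)"
  have "M \<ge> 1"
  proof -
    have "(\<integral>s. 1 \<partial>Q) \<le> M" unfolding M_def
      by (rule integral_mono) (auto intro: F0_moments one_le_power simp: Q.integrable_const)
    then show ?thesis by (simp add: Q.prob_space)
  qed
  define rt where "rt = \<rho> powr \<theta>"
  have rt: "0 \<le> rt" "rt < 1"
    using rho theta powr_less_mono2[of \<theta> \<rho> 1] by (auto simp: rt_def)
  \<comment> \<open>chosen so that the expected growth \<open>1 + \<epsilon> * M\<close> of the weight equals \<open>1 + (1 - rt) / 2\<close>\<close>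
  define \<epsilon> where "\<epsilon> = (1 - rt) / (2 * M)"
  have \<epsilon>: "0 < \<epsilon>" "\<epsilon> \<le> 1" using rt \<open>M \<ge> 1\<close> by (auto simp: \<epsilon>_def)
  \<comment> \<open>\<open>rt * (1 + (1 - rt) / 2) \<le> (1 + rt) / 2\<close>, because \<open>(1 - rt)\<^sup>2\<close> is nonnegative\<close>
  define r where "r = (1 + rt) / 2"
  have r: "0 < r" "r < 1" using rt by (auto simp: r_def)
  define w where "w x = (1 + \<epsilon> * \<bar>x\<bar>) ^ q" for x :: real
  have w1: "1 \<le> w x" for x using \<epsilon> by (simp add: w_def one_le_power)
  have [measurable]: "w \<in> borel_measurable borel" unfolding w_def by measurable
  have wle: "w x \<le> (1 + \<bar>x\<bar>) ^ q" for x
    using \<epsilon> by (auto simp: w_def intro!: power_mono mult_left_le_one_le)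
  have wge: "(1 + \<bar>x\<bar>) ^ q \<le> (1/\<epsilon>)^q * w x" for x
  proof -
    have "1 + \<bar>x\<bar> \<le> (1/\<epsilon>) * (1 + \<epsilon> * \<bar>x\<bar>)" using \<epsilon> by (simp add: field_simps)
    then have "(1 + \<bar>x\<bar>) ^ q \<le> ((1/\<epsilon>) * (1 + \<epsilon> * \<bar>x\<bar>)) ^ q" by (intro power_mono) auto
    then show ?thesis unfolding w_def by (simp only: power_mult_distrib)
  qed
  have wF: "w (F x s) \<le> (1 + \<epsilon> * \<bar>F 0 s\<bar>) ^ q * w x" if "s \<in> space Q" for x s
    unfolding w_def power_mult_distrib[symmetric] using F_growth[OF that, of \<epsilon> x] \<epsilon> by (intro power_mono) auto
  have key: "rt * (\<integral>s. (1 + \<epsilon> * \<bar>F 0 s\<bar>) ^ (q+q) \<partial>Q) \<le> r"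
    and keyi: "integrable Q (\<lambda>s. (1 + \<epsilon> * \<bar>F 0 s\<bar>) ^ (q+q))"
  proof -
    show i: "integrable Q (\<lambda>s. (1 + \<epsilon> * \<bar>F 0 s\<bar>) ^ (q+q))"
    proof (rule Bochner_Integration.integrable_bound[OF F0_moments[of "q+q"]])
      show "AE s in Q. norm ((1 + \<epsilon> * \<bar>F 0 s\<bar>) ^ (q+q)) \<le> norm ((1 + \<bar>F 0 s\<bar>) ^ (q+q))"
        using \<epsilon> by (auto simp: power_abs[symmetric] abs_of_nonneg intro!: power_mono mult_left_le_one_le AE_I2)
    qed measurable
    have "(\<integral>s. (1 + \<epsilon> * \<bar>F 0 s\<bar>) ^ (q+q) \<partial>Q) \<le> (\<integral>s. 1 + \<epsilon> * ((1 + \<bar>F 0 s\<bar>) ^ (q+q) - 1) \<partial>Q)"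
      using \<epsilon> by (intro integral_mono i power_eps_le) (auto intro!: F0_moments Bochner_Integration.integrable_add integrable_mult_right Bochner_Integration.integrable_diff)
    also have "\<dots> = 1 + \<epsilon> * (M - 1)"
      unfolding M_def using F0_moments[of "q+q"] by (simp add: Q.prob_space)
    also have "\<dots> \<le> 1 + \<epsilon> * M" using \<epsilon> by simp
    also have "\<dots> = 1 + (1 - rt) / 2" using \<open>M \<ge> 1\<close> by (simp add: \<epsilon>_def)
    finally have "rt * (\<integral>s. (1 + \<epsilon> * \<bar>F 0 s\<bar>) ^ (q+q) \<partial>Q) \<le> rt * (1 + (1 - rt) / 2)"
      using rt by (intro mult_left_mono)
    also have "\<dots> \<le> r"
      using rt mult_nonneg_nonneg[of "1 - rt" "1 - rt"] by (simp add: r_def field_simps)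
    finally show "rt * (\<integral>s. (1 + \<epsilon> * \<bar>F 0 s\<bar>) ^ (q+q) \<partial>Q) \<le> r" .
  qed
  define C' where "C' = C * ((1/\<epsilon>)^q * (1/\<epsilon>)^q)"
  have "C' \<ge> 0" using C \<epsilon> by (simp add: C'_def)
  have I: "poly_hoelder ((P ^^ k) f) \<and> (\<forall>x y. \<bar>(P ^^ k) f x - (P ^^ k) f y\<bar> \<le> C' * r ^ k * \<bar>x - y\<bar> powr \<theta> * (w x * w y))" for k
  proof (induction k)
    case 0
    have "\<bar>f x - f y\<bar> \<le> C' * \<bar>x - y\<bar> powr \<theta> * (w x * w y)" for x y
    proof -
      have "\<bar>f x - f y\<bar> \<le> C * \<bar>x - y\<bar> powr \<theta> * ((1 + \<bar>x\<bar>) ^ q * (1 + \<bar>y\<bar>) ^ q)"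
        using C(2)[of x y] by (simp add: power_mult_distrib)
      also have "\<dots> \<le> C * \<bar>x - y\<bar> powr \<theta> * (((1/\<epsilon>)^q * w x) * ((1/\<epsilon>)^q * w y))"
        using C(1) wge[of x] wge[of y] w1[of x] \<epsilon> by (intro mult_left_mono mult_mono) auto
      finally show ?thesis by (simp add: C'_def mult_ac)
    qed
    then show ?case using assms by simp
  next
    case (Suc k)
    define g where "g = (P ^^ k) f"
    have g: "poly_hoelder g" "\<And>x y. \<bar>g x - g y\<bar> \<le> C' * r ^ k * \<bar>x - y\<bar> powr \<theta> * (w x * w y)"
      using Suc by (auto simp: g_def)
    have b: "\<bar>P g x - P g y\<bar> \<le> C' * r ^ Suc k * \<bar>x - y\<bar> powr \<theta> * (w x * w y)" for x y
    proof -
      have i: "integrable Q (\<lambda>s. g (F x s))" for x by (rule F_integrable[OF g(1)])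
      have "\<bar>P g x - P g y\<bar> = \<bar>\<integral>s. g (F x s) - g (F y s) \<partial>Q\<bar>" unfolding P_def using i by simp
      also have "\<dots> \<le> (\<integral>s. \<bar>g (F x s) - g (F y s)\<bar> \<partial>Q)" by (rule integral_abs_bound)
      also have "\<dots> \<le> (\<integral>s. C' * r ^ k * (rt * \<bar>x - y\<bar> powr \<theta>) * (w x * w y) * (1 + \<epsilon> * \<bar>F 0 s\<bar>) ^ (q+q) \<partial>Q)"
      proof (rule integral_mono)
        show "integrable Q (\<lambda>s. \<bar>g (F x s) - g (F y s)\<bar>)" using i by simp
        show "integrable Q (\<lambda>s. C' * r ^ k * (rt * \<bar>x - y\<bar> powr \<theta>) * (w x * w y) * (1 + \<epsilon> * \<bar>F 0 s\<bar>) ^ (q+q))"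
          using keyi by simp
        fix s assume s: "s \<in> space Q"
        let ?m = "(1 + \<epsilon> * \<bar>F 0 s\<bar>) ^ q"
        have "\<bar>F x s - F y s\<bar> powr \<theta> \<le> (\<rho> * \<bar>x - y\<bar>) powr \<theta>"
          using contraction[OF s] theta by (intro powr_mono2) auto
        also have "\<dots> = rt * \<bar>x - y\<bar> powr \<theta>" using rho by (simp add: rt_def powr_mult)
        finally have d: "\<bar>F x s - F y s\<bar> powr \<theta> \<le> rt * \<bar>x - y\<bar> powr \<theta>" .
        have "w (F x s) * w (F y s) \<le> (?m * w x) * (?m * w y)"
          using \<epsilon> by (intro mult_mono wF[OF s] mult_nonneg_nonneg order_trans[OF zero_le_one w1]) auto
        then have "\<bar>g (F x s) - g (F y s)\<bar> \<le> C' * r ^ k * (rt * \<bar>x - y\<bar> powr \<theta>) * ((?m * w x) * (?m * w y))"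
          using \<open>C' \<ge> 0\<close> r rt
          by (intro order_trans[OF g(2)[of "F x s" "F y s"]] mult_mono d wF[OF s] mult_nonneg_nonneg order_trans[OF zero_le_one w1]) (use \<epsilon> in auto)
        then show "\<bar>g (F x s) - g (F y s)\<bar> \<le> C' * r ^ k * (rt * \<bar>x - y\<bar> powr \<theta>) * (w x * w y) * (1 + \<epsilon> * \<bar>F 0 s\<bar>) ^ (q+q)"
          by (simp add: power_add mult_ac)
      qed
      also have "\<dots> = C' * r ^ k * \<bar>x - y\<bar> powr \<theta> * (w x * w y) * (rt * (\<integral>s. (1 + \<epsilon> * \<bar>F 0 s\<bar>) ^ (q+q) \<partial>Q))"
        by simp
      also have "\<dots> \<le> C' * r ^ k * \<bar>x - y\<bar> powr \<theta> * (w x * w y) * r"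
        using key \<open>C' \<ge> 0\<close> r w1[of x] w1[of y] by (intro mult_left_mono mult_nonneg_nonneg) auto
      finally show ?thesis by (simp add: mult_ac)
    qed
    have "poly_hoelder (P g)"
    proof (rule poly_hoelderI[of "C' * r ^ Suc k" _ q])
      fix x y
      have "C' * r ^ Suc k * \<bar>x - y\<bar> powr \<theta> * (w x * w y) \<le> C' * r ^ Suc k * \<bar>x - y\<bar> powr \<theta> * ((1 + \<bar>x\<bar>) ^ q * (1 + \<bar>y\<bar>) ^ q)"
        using \<open>C' \<ge> 0\<close> r w1[of x] w1[of y] by (intro mult_left_mono mult_mono wle) auto
      then show "\<bar>P g x - P g y\<bar> \<le> C' * r ^ Suc k * \<bar>x - y\<bar> powr \<theta> * ((1 + \<bar>x\<bar>) * (1 + \<bar>y\<bar>)) ^ q"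
        using b[of x y] by (simp add: power_mult_distrib)
    qed (use \<open>C' \<ge> 0\<close> r in auto)
    then show ?case using b by (simp add: g_def)
  qed
  show ?thesis
  proof (rule that[of C' r q])
    show "poly_hoelder ((P ^^ k) f)" for k using I by blast
    fix k x y
    have "C' * r ^ k * \<bar>x - y\<bar> powr \<theta> * (w x * w y) \<le> C' * r ^ k * \<bar>x - y\<bar> powr \<theta> * ((1 + \<bar>x\<bar>) ^ q * (1 + \<bar>y\<bar>) ^ q)"
      using \<open>C' \<ge> 0\<close> r w1[of x] w1[of y] by (intro mult_left_mono mult_mono wle) auto
    then show "\<bar>(P ^^ k) f x - (P ^^ k) f y\<bar> \<le> C' * r ^ k * \<bar>x - y\<bar> powr \<theta> * ((1 + \<bar>x\<bar>) * (1 + \<bar>y\<bar>)) ^ q"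
      using I[of k] by (auto simp: power_mult_distrib intro: order_trans)
  qed (use \<open>C' \<ge> 0\<close> r in auto)
qed

end

section \<open>Geometric ergodicity, the Poisson equation and asymptotic covariances\<close>

context contractive_kernel
begin

lemma P_iter_poly_hoelder: "poly_hoelder f \<Longrightarrow> poly_hoelder ((P ^^ k) f)"
  using P_iter_hoelder by metis

lemma P_poly_hoelder: "poly_hoelder f \<Longrightarrow> poly_hoelder (P f)"
  using P_iter_poly_hoelder[of f 1] by simp

lemma pi_P_iter: "poly_hoelder f \<Longrightarrow> (\<integral>x. (P ^^ k) f x \<partial>\<pi>) = (\<integral>x. f x \<partial>\<pi>)"
  by (induction k) (simp_all add: pi_P P_iter_poly_hoelder)

text \<open>
  Since \<open>\<pi>\<close> is invariant, \<open>\<integral> f d\<pi>\<close> is the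
  \<open>\<pi>\<close>-average of \<open>y \<mapsto> (P ^^ k) f y\<close>; the geometric Hoelder
  bound compares the value at \<open>x\<close> with each of these, and \<open>\<pi>\<close>
  integrates the weight.
\<close>

lemma P_iter_geometric:
  assumes "poly_hoelder f"
  obtains C r :: real and q :: nat where "C \<ge> 0" "0 < r" "r < 1"
    "\<And>k x. \<bar>(P ^^ k) f x - (\<integral>y. f y \<partial>\<pi>)\<bar> \<le> C * r ^ k * (1 + \<bar>x\<bar>) ^ q"
proof -
  obtain C r q where C: "C \<ge> 0" "0 < r" "r < 1" and hc: "\<And>k. poly_hoelder ((P ^^ k) f)"
    and b: "\<And>k x y. \<bar>(P ^^ k) f x - (P ^^ k) f y\<bar> \<le> C * r ^ k * \<bar>x - y\<bar> powr \<theta> * ((1 + \<bar>x\<bar>) * (1 + \<bar>y\<bar>)) ^ q"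
    using P_iter_hoelder[OF assms] by metis
  define m where "m = (\<integral>y. (1 + \<bar>y\<bar>) ^ Suc q \<partial>\<pi>)"
  have "m \<ge> 0" unfolding m_def by (rule Bochner_Integration.integral_nonneg) simp
  show ?thesis
  proof (rule that[of "C * m" r "Suc q"])
    fix k x
    have i: "integrable \<pi> ((P ^^ k) f)" by (rule pi_integrable[OF hc])
    have "\<bar>(P ^^ k) f x - (\<integral>y. f y \<partial>\<pi>)\<bar> = \<bar>\<integral>y. (P ^^ k) f x - (P ^^ k) f y \<partial>\<pi>\<bar>"
      using i by (simp add: pi_P_iter[OF assms] \<pi>.prob_space)
    also have "\<dots> \<le> (\<integral>y. \<bar>(P ^^ k) f x - (P ^^ k) f y\<bar> \<partial>\<pi>)" by (rule integral_abs_bound)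
    also have "\<dots> \<le> (\<integral>y. C * r ^ k * (1 + \<bar>x\<bar>) ^ Suc q * (1 + \<bar>y\<bar>) ^ Suc q \<partial>\<pi>)"
    proof (rule integral_mono)
      show "integrable \<pi> (\<lambda>y. \<bar>(P ^^ k) f x - (P ^^ k) f y\<bar>)" using i by simp
      show "integrable \<pi> (\<lambda>y. C * r ^ k * (1 + \<bar>x\<bar>) ^ Suc q * (1 + \<bar>y\<bar>) ^ Suc q)"
        by (intro integrable_mult_right pi_weight)
      fix y
      have "C * r ^ k * \<bar>x - y\<bar> powr \<theta> * ((1 + \<bar>x\<bar>) * (1 + \<bar>y\<bar>)) ^ q
          \<le> C * r ^ k * ((1 + \<bar>x\<bar>) * (1 + \<bar>y\<bar>)) * ((1 + \<bar>x\<bar>) * (1 + \<bar>y\<bar>)) ^ q"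
        using C by (intro mult_right_mono mult_left_mono powr_dist_le) auto
      also have "\<dots> = C * r ^ k * (1 + \<bar>x\<bar>) ^ Suc q * (1 + \<bar>y\<bar>) ^ Suc q"
        by (simp only: power_mult_distrib power_Suc mult_ac)
      finally show "\<bar>(P ^^ k) f x - (P ^^ k) f y\<bar> \<le> C * r ^ k * (1 + \<bar>x\<bar>) ^ Suc q * (1 + \<bar>y\<bar>) ^ Suc q"
        by (rule order_trans[OF b])
    qed
    also have "\<dots> = C * m * r ^ k * (1 + \<bar>x\<bar>) ^ Suc q" by (simp add: m_def)
    finally show "\<bar>(P ^^ k) f x - (\<integral>y. f y \<partial>\<pi>)\<bar> \<le> C * m * r ^ k * (1 + \<bar>x\<bar>) ^ Suc q" .
  qed (use C \<open>m \<ge> 0\<close> in auto)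
qed

text \<open>
  The potential of the centred observable, which solves the Poisson equation \<open>u - P u = f -
  \<integral> f d\<pi>\<close>.
\<close>

definition poisson :: "(real \<Rightarrow> real) \<Rightarrow> real \<Rightarrow> real" where
  "poisson f x = (\<Sum>k. (P ^^ k) f x - (\<integral>y. f y \<partial>\<pi>))"

lemma poisson_summable_abs:
  assumes "poly_hoelder f" shows "summable (\<lambda>k. \<bar>(P ^^ k) f x - (\<integral>y. f y \<partial>\<pi>)\<bar>)"
proof -
  obtain C r q where C: "C \<ge> 0" "0 < r" "r < 1"
    and b: "\<And>k x. \<bar>(P ^^ k) f x - (\<integral>y. f y \<partial>\<pi>)\<bar> \<le> C * r ^ k * (1 + \<bar>x\<bar>) ^ q"
    using P_iter_geometric[OF assms] by metis
  show ?thesis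
    by (rule summable_comparison_test'[where g="\<lambda>k. C * r ^ k * (1 + \<bar>x\<bar>) ^ q"])
       (use C b in \<open>auto intro!: summable_mult summable_mult2 summable_geometric\<close>)
qed

lemma poisson_summable:
  assumes "poly_hoelder f" shows "summable (\<lambda>k. (P ^^ k) f x - (\<integral>y. f y \<partial>\<pi>))"
  by (rule summable_rabs_cancel[OF poisson_summable_abs[OF assms]])

text \<open>
  Geometric decay of the seminorms of \<open>(P ^^ k) f\<close> with one fixed weight makes the
  series converge inside the class.
\<close>

lemma poisson_poly_hoelder:
  assumes "poly_hoelder f" shows "poly_hoelder (poisson f)"
proof -
  obtain C r q where C: "C \<ge> 0" "0 < r" "r < 1"
    and b: "\<And>k x y. \<bar>(P ^^ k) f x - (P ^^ k) f y\<bar> \<le> C * r ^ k * \<bar>x - y\<bar> powr \<theta> * ((1 + \<bar>x\<bar>) * (1 + \<bar>y\<bar>)) ^ q"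
    using P_iter_hoelder[OF assms] by metis
  show ?thesis
  proof (rule poly_hoelderI[of "C / (1 - r)" _ q])
    fix x y :: real
    let ?w = "\<bar>x - y\<bar> powr \<theta> * ((1 + \<bar>x\<bar>) * (1 + \<bar>y\<bar>)) ^ q"
    have b': "\<bar>(P ^^ k) f x - (P ^^ k) f y\<bar> \<le> C * ?w * r ^ k" for k using b[of k x y] by (simp add: mult_ac)
    have s: "summable (\<lambda>k. C * ?w * r ^ k)" using C by (intro summable_mult summable_geometric) auto
    have sa: "summable (\<lambda>k. \<bar>(P ^^ k) f x - (P ^^ k) f y\<bar>)"
      by (rule summable_comparison_test'[OF s, of 0]) (use b' in auto)
    have "poisson f x - poisson f y = (\<Sum>k. (P ^^ k) f x - (P ^^ k) f y)"
      unfolding poisson_def by (subst suminf_diff) (auto intro!: poisson_summable assms)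
    then have "\<bar>poisson f x - poisson f y\<bar> \<le> (\<Sum>k. \<bar>(P ^^ k) f x - (P ^^ k) f y\<bar>)"
      using summable_rabs[OF sa] by simp
    also have "\<dots> \<le> (\<Sum>k. C * ?w * r ^ k)" by (rule suminf_le[OF b' sa s])
    also have "\<dots> = C * ?w / (1 - r)" using C by (subst suminf_mult) (auto simp: suminf_geometric)
    finally show "\<bar>poisson f x - poisson f y\<bar> \<le> C / (1 - r) * \<bar>x - y\<bar> powr \<theta> * ((1 + \<bar>x\<bar>) * (1 + \<bar>y\<bar>)) ^ q"
      by (simp add: mult_ac)
  qed (use C in auto)
qed

lemma poisson_equation:
  assumes "poly_hoelder f" shows "poisson f x - P (poisson f) x = f x - (\<integral>y. f y \<partial>\<pi>)"
proof -
  obtain C r q where C: "C \<ge> 0" "0 < r" "r < 1"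
    and b: "\<And>k x. \<bar>(P ^^ k) f x - (\<integral>y. f y \<partial>\<pi>)\<bar> \<le> C * r ^ k * (1 + \<bar>x\<bar>) ^ q"
    using P_iter_geometric[OF assms] by metis
  let ?m = "\<integral>y. f y \<partial>\<pi>"
  have i: "integrable Q (\<lambda>s. (P ^^ k) f (F x s))" for k by (intro F_integrable P_iter_poly_hoelder assms)
  have iw: "integrable Q (\<lambda>s. (1 + \<bar>F x s\<bar>) ^ q)" using F_integrable[OF poly_hoelder_weight[of q]] .
  have "P (poisson f) x = (\<integral>s. (\<Sum>k. (P ^^ k) f (F x s) - ?m) \<partial>Q)" unfolding P_def poisson_def ..
  also have "\<dots> = (\<Sum>k. \<integral>s. (P ^^ k) f (F x s) - ?m \<partial>Q)"
  proof (rule integral_suminf)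
    show "integrable Q (\<lambda>s. (P ^^ k) f (F x s) - ?m)" for k using i by simp
    show "AE s in Q. summable (\<lambda>k. norm ((P ^^ k) f (F x s) - ?m))"
      using poisson_summable_abs[OF assms] by simp
    show "summable (\<lambda>k. \<integral>s. norm ((P ^^ k) f (F x s) - ?m) \<partial>Q)"
    proof (rule summable_comparison_test'[of "\<lambda>k. C * (\<integral>s. (1 + \<bar>F x s\<bar>) ^ q \<partial>Q) * r ^ k" 0])
      show "summable (\<lambda>k. C * (\<integral>s. (1 + \<bar>F x s\<bar>) ^ q \<partial>Q) * r ^ k)"
        using C by (intro summable_mult summable_geometric) auto
      fix k
      have "(\<integral>s. norm ((P ^^ k) f (F x s) - ?m) \<partial>Q) \<le> (\<integral>s. C * r ^ k * (1 + \<bar>F x s\<bar>) ^ q \<partial>Q)"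
        using i iw b by (intro integral_mono) auto
      then show "norm (\<integral>s. norm ((P ^^ k) f (F x s) - ?m) \<partial>Q) \<le> C * (\<integral>s. (1 + \<bar>F x s\<bar>) ^ q \<partial>Q) * r ^ k"
        by (simp add: integral_nonneg mult_ac)
    qed
  qed
  also have "\<dots> = (\<Sum>k. (P ^^ Suc k) f x - ?m)"
    using i by (simp add: P_def Q.prob_space)
  also have "\<dots> = poisson f x - (f x - ?m)"
    unfolding poisson_def using suminf_split_head[OF poisson_summable[OF assms, of x]] by simp
  finally show ?thesis by simp
qed

text \<open>
  The stationary covariance of \<open>f\<close> now and \<open>g\<close> after \<open>k\<close>
  steps, written through the kernel so that it does not refer to a particular realisation of the
  chain.
\<close>

definition lag_cov :: "nat \<Rightarrow> (real \<Rightarrow> real) \<Rightarrow> (real \<Rightarrow> real) \<Rightarrow> real" where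
  "lag_cov k f g = (\<integral>x. f x * (P ^^ k) g x \<partial>\<pi>) - (\<integral>x. f x \<partial>\<pi>) * (\<integral>x. g x \<partial>\<pi>)"

definition asym_cov :: "(real \<Rightarrow> real) \<Rightarrow> (real \<Rightarrow> real) \<Rightarrow> real" where
  "asym_cov f g = lag_cov 0 f g + (\<Sum>k. lag_cov (Suc k) f g + lag_cov (Suc k) g f)"

lemma lag_cov_summable:
  assumes f: "poly_hoelder f" and g: "poly_hoelder g"
  shows "summable (\<lambda>k. lag_cov k f g)"
    and "(\<Sum>k. lag_cov k f g) = (\<integral>x. f x * poisson g x \<partial>\<pi>)"
proof -
  obtain C r q where C: "C \<ge> 0" "0 < r" "r < 1"
    and b: "\<And>k x. \<bar>(P ^^ k) g x - (\<integral>y. g y \<partial>\<pi>)\<bar> \<le> C * r ^ k * (1 + \<bar>x\<bar>) ^ q"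
    using P_iter_geometric[OF g] by metis
  let ?m = "\<integral>y. g y \<partial>\<pi>"
  have i: "integrable \<pi> (\<lambda>x. f x * ((P ^^ k) g x - ?m))" for k
    by (intro pi_integrable poly_hoelder_mult f poly_hoelder_diff P_iter_poly_hoelder g poly_hoelder_const)
  have iw: "integrable \<pi> (\<lambda>x. \<bar>f x\<bar> * (1 + \<bar>x\<bar>) ^ q)"
    using integrable_abs[OF pi_integrable[OF poly_hoelder_mult[OF f poly_hoelder_weight[of q]]]] by (simp add: abs_mult)
  have lc: "lag_cov k f g = (\<integral>x. f x * ((P ^^ k) g x - ?m) \<partial>\<pi>)" for k
    unfolding lag_cov_def right_diff_distrib
    by (subst Bochner_Integration.integral_diff)
       (auto intro!: pi_integrable poly_hoelder_mult f P_iter_poly_hoelder g)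
  have sn: "summable (\<lambda>k. \<integral>x. norm (f x * ((P ^^ k) g x - ?m)) \<partial>\<pi>)"
  proof (rule summable_comparison_test'[of "\<lambda>k. C * (\<integral>x. \<bar>f x\<bar> * (1 + \<bar>x\<bar>) ^ q \<partial>\<pi>) * r ^ k" 0])
    show "summable (\<lambda>k. C * (\<integral>x. \<bar>f x\<bar> * (1 + \<bar>x\<bar>) ^ q \<partial>\<pi>) * r ^ k)"
      using C by (intro summable_mult summable_geometric) auto
    fix k
    have "(\<integral>x. norm (f x * ((P ^^ k) g x - ?m)) \<partial>\<pi>) \<le> (\<integral>x. C * r ^ k * (\<bar>f x\<bar> * (1 + \<bar>x\<bar>) ^ q) \<partial>\<pi>)"
    proof (rule integral_mono)
      show "norm (f x * ((P ^^ k) g x - ?m)) \<le> C * r ^ k * (\<bar>f x\<bar> * (1 + \<bar>x\<bar>) ^ q)" for x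
        using mult_left_mono[OF b[of k x], of "\<bar>f x\<bar>"] by (simp add: abs_mult mult_ac)
    qed (use i iw in auto)
    also have "\<dots> = C * (\<integral>x. \<bar>f x\<bar> * (1 + \<bar>x\<bar>) ^ q \<partial>\<pi>) * r ^ k"
      unfolding integral_mult_right_zero by (simp only: mult_ac)
    finally show "norm (\<integral>x. norm (f x * ((P ^^ k) g x - ?m)) \<partial>\<pi>) \<le> C * (\<integral>x. \<bar>f x\<bar> * (1 + \<bar>x\<bar>) ^ q \<partial>\<pi>) * r ^ k"
      by simp
  qed
  have ae: "AE x in \<pi>. summable (\<lambda>k. norm (f x * ((P ^^ k) g x - ?m)))"
    using summable_mult[OF poisson_summable_abs[OF g]] by (simp add: abs_mult)
  show "summable (\<lambda>k. lag_cov k f g)"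
    unfolding lc using summable_integral[OF i ae sn] by simp
  have "(\<Sum>k. lag_cov k f g) = (\<integral>x. (\<Sum>k. f x * ((P ^^ k) g x - ?m)) \<partial>\<pi>)"
    unfolding lc by (rule integral_suminf[OF i ae sn, symmetric])
  also have "\<dots> = (\<integral>x. f x * poisson g x \<partial>\<pi>)"
    unfolding poisson_def by (simp add: suminf_mult poisson_summable g)
  finally show "(\<Sum>k. lag_cov k f g) = (\<integral>x. f x * poisson g x \<partial>\<pi>)" .
qed

text \<open>
  The conditional variance of the martingale increment \<open>u (X (k + 1)) - P u (X k)\<close>
  given \<open>X k = x\<close>.
\<close>

definition cond_var :: "(real \<Rightarrow> real) \<Rightarrow> real \<Rightarrow> real" where
  "cond_var u x = (\<integral>s. (u (F x s) - P u x)\<^sup>2 \<partial>Q)"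

lemma cond_var_nonneg: "0 \<le> cond_var u x"
  unfolding cond_var_def by simp

lemma cond_var_eq:
  assumes "poly_hoelder u" shows "cond_var u x = P (\<lambda>y. (u y)\<^sup>2) x - (P u x)\<^sup>2"
proof -
  have i1: "integrable Q (\<lambda>s. u (F x s))" by (rule F_integrable[OF assms])
  have i2: "integrable Q (\<lambda>s. (u (F x s))\<^sup>2)" by (rule F_integrable[OF poly_hoelder_power[OF assms]])
  have "cond_var u x = (\<integral>s. (u (F x s))\<^sup>2 - 2 * P u x * u (F x s) + (P u x)\<^sup>2 \<partial>Q)"
    unfolding cond_var_def by (simp add: power2_diff algebra_simps)
  also have "\<dots> = P (\<lambda>y. (u y)\<^sup>2) x - 2 * P u x * P u x + (P u x)\<^sup>2"
    using i1 i2 by (simp add: P_def Q.prob_space)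
  finally show ?thesis by (simp add: power2_eq_square)
qed

lemma cond_var_poly_hoelder:
  assumes "poly_hoelder u" shows "poly_hoelder (cond_var u)"
proof -
  have "cond_var u = (\<lambda>x. P (\<lambda>y. (u y)\<^sup>2) x - (P u x)\<^sup>2)"
    by (rule ext) (rule cond_var_eq[OF assms])
  then show ?thesis using assms by (simp add: poly_hoelder_diff P_poly_hoelder poly_hoelder_power)
qed

text \<open>
  The martingale and the covariance-series expressions of the asymptotic variance agree. With
  \<open>u = poisson f\<close> and \<open>f\<close> centred, invariance gives \<open>\<integral>
  cond_var u d\<pi> = \<integral> u\<^sup>2 - (P u)\<^sup>2 d\<pi> = \<integral> f (2 u - f)
  d\<pi>\<close>, and \<open>\<integral> f u d\<pi>\<close> is the sum of all lagged covariances,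
  lag zero included.
\<close>

lemma asym_cov_eq_cond_var:
  assumes f: "poly_hoelder f"
  shows "(\<integral>x. cond_var (poisson f) x \<partial>\<pi>) = asym_cov f f"
proof -
  let ?u = "poisson f" and ?m = "\<integral>x. f x \<partial>\<pi>"
  have u: "poly_hoelder ?u" by (rule poisson_poly_hoelder[OF f])
  have Pu: "P ?u x = ?u x - (f x - ?m)" for x using poisson_equation[OF f, of x] by linarith
  have iu: "integrable \<pi> ?u" by (rule pi_integrable[OF u])
  have ifu: "integrable \<pi> (\<lambda>x. f x * ?u x)" by (intro pi_integrable poly_hoelder_mult f u)
  have iff: "integrable \<pi> (\<lambda>x. f x * f x)" by (intro pi_integrable poly_hoelder_mult f)
  have i_f: "integrable \<pi> f" by (rule pi_integrable[OF f])
  have u0: "?m * (\<integral>x. ?u x \<partial>\<pi>) = 0"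
  proof -
    have "(\<Sum>k. lag_cov k (\<lambda>_. 1) f) = (\<integral>x. 1 * ?u x \<partial>\<pi>)"
      by (rule lag_cov_summable(2)[OF poly_hoelder_const f])
    moreover have "lag_cov k (\<lambda>_. 1) f = 0" for k
      unfolding lag_cov_def by (simp add: pi_P_iter[OF f] \<pi>.prob_space)
    ultimately show ?thesis by simp
  qed
  have "(\<integral>x. cond_var ?u x \<partial>\<pi>) = (\<integral>x. P (\<lambda>y. (?u y)\<^sup>2) x - (P ?u x)\<^sup>2 \<partial>\<pi>)"
    unfolding cond_var_eq[OF u] ..
  also have "\<dots> = (\<integral>x. P (\<lambda>y. (?u y)\<^sup>2) x \<partial>\<pi>) - (\<integral>x. (P ?u x)\<^sup>2 \<partial>\<pi>)"
    by (intro Bochner_Integration.integral_diff pi_integrable P_poly_hoelder poly_hoelder_power u)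
  also have "\<dots> = (\<integral>x. (?u x)\<^sup>2 \<partial>\<pi>) - (\<integral>x. (P ?u x)\<^sup>2 \<partial>\<pi>)"
    by (simp add: pi_P poly_hoelder_power u)
  also have "\<dots> = (\<integral>x. (?u x)\<^sup>2 - (P ?u x)\<^sup>2 \<partial>\<pi>)"
    by (intro Bochner_Integration.integral_diff[symmetric] pi_integrable P_poly_hoelder poly_hoelder_power u)
  also have "\<dots> = (\<integral>x. 2 * (f x * ?u x) - 2 * ?m * ?u x - f x * f x + 2 * ?m * f x - ?m\<^sup>2 \<partial>\<pi>)"
    unfolding Pu by (intro Bochner_Integration.integral_cong refl) (simp add: power2_eq_square algebra_simps)
  also have "\<dots> = 2 * (\<integral>x. f x * ?u x \<partial>\<pi>) - 2 * ?m * (\<integral>x. ?u x \<partial>\<pi>) - (\<integral>x. f x * f x \<partial>\<pi>) + 2 * ?m * ?m - ?m\<^sup>2"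
    using iu ifu iff i_f by (simp add: \<pi>.prob_space)
  also have "\<dots> = 2 * (\<integral>x. f x * ?u x \<partial>\<pi>) - lag_cov 0 f f"
    using u0 by (simp add: lag_cov_def power2_eq_square algebra_simps)
  also have "\<dots> = asym_cov f f"
  proof -
    have "(\<Sum>k. lag_cov (Suc k) f f + lag_cov (Suc k) f f) = 2 * (\<Sum>k. lag_cov (Suc k) f f)"
      using summable_ignore_initial_segment[OF lag_cov_summable(1)[OF f f], of 1]
      by (subst suminf_mult[symmetric]) auto
    then show ?thesis
      unfolding asym_cov_def using lag_cov_summable[OF f f] suminf_split_head[OF lag_cov_summable(1)[OF f f]] by simp
  qed
  finally show ?thesis .
qed

end

section \<open>Chains driven by independent noise\<close>

text \<open>
  A realisation of the recursion on some probability space. The noise of step \<open>k\<close> is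
  revealed in the \<open>\<sigma>\<close>-algebra with index \<open>k + 1\<close> and is
  independent of the one with index \<open>k\<close>. Independence is stated for events because
  the state and the noise have different value types.
\<close>

locale driven_chain = prob_space M
  for M :: "'a measure" +
  fixes Q :: "'s measure" and F :: "real \<Rightarrow> 's \<Rightarrow> real"
    and Fil :: "nat \<Rightarrow> 'a measure" and \<xi> :: "nat \<Rightarrow> 'a \<Rightarrow> 's" and X0 :: "'a \<Rightarrow> real"
  assumes prob_noise: "prob_space Q"
    and F_meas: "(\<lambda>(x, s). F x s) \<in> borel_measurable (borel \<Otimes>\<^sub>M Q)"
    and Fil_sub: "\<And>k. subalgebra M (Fil k)"
    and Fil_mono: "\<And>k. subalgebra (Fil (Suc k)) (Fil k)"
    and X0_meas: "X0 \<in> borel_measurable (Fil 0)"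
    and xi_meas: "\<And>k. \<xi> k \<in> measurable (Fil (Suc k)) Q"
    and xi_distr: "\<And>k. distr M Q (\<xi> k) = Q"
    and xi_indep: "\<And>k A B. A \<in> sets (Fil k) \<Longrightarrow> B \<in> sets Q \<Longrightarrow>
        prob (A \<inter> (\<xi> k -` B \<inter> space M)) = prob A * prob (\<xi> k -` B \<inter> space M)"
begin

primrec chain :: "nat \<Rightarrow> 'a \<Rightarrow> real" where
  "chain 0 \<omega> = X0 \<omega>"
| "chain (Suc k) \<omega> = F (chain k \<omega>) (\<xi> k \<omega>)"

lemma measurable_Fil: "f \<in> measurable (Fil k) N \<Longrightarrow> f \<in> measurable M N"
  using measurable_from_subalg[OF Fil_sub] .

lemma measurable_Fil_Suc: "f \<in> measurable (Fil k) N \<Longrightarrow> f \<in> measurable (Fil (Suc k)) N"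
  using measurable_from_subalg[OF Fil_mono] .

lemma F_meas':
  assumes [measurable]: "f \<in> borel_measurable N" "g \<in> measurable N Q"
  shows "(\<lambda>z. F (f z) (g z)) \<in> borel_measurable N"
  using measurable_compose[of "\<lambda>z. (f z, g z)" N "borel \<Otimes>\<^sub>M Q" "\<lambda>(x, s). F x s" borel] F_meas by simp

lemma chain_measurable_Fil: "chain k \<in> borel_measurable (Fil k)"
proof (induction k)
  case 0 then show ?case using X0_meas by (simp cong: measurable_cong)
next
  case (Suc k)
  have "(\<lambda>\<omega>. F (chain k \<omega>) (\<xi> k \<omega>)) \<in> borel_measurable (Fil (Suc k))"
    using measurable_Fil_Suc[OF Suc] xi_meas by (rule F_meas')
  then show ?case by (simp cong: measurable_cong)
qed

lemma chain_measurable[measurable]: "chain k \<in> borel_measurable M"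
  by (rule measurable_Fil[OF chain_measurable_Fil])

lemma xi_measurable[measurable]: "\<xi> k \<in> measurable M Q"
  by (rule measurable_Fil[OF xi_meas])

lemma joint_distr:
  assumes U: "U \<in> measurable (Fil k) N"
  shows "distr M (N \<Otimes>\<^sub>M Q) (\<lambda>\<omega>. (U \<omega>, \<xi> k \<omega>)) = distr M N U \<Otimes>\<^sub>M Q"
proof -
  note U' = measurable_Fil[OF U]
  interpret Q: prob_space Q by (rule prob_noise)
  interpret D: prob_space "distr M N U" by (rule prob_space_distr) fact
  show ?thesis
  proof (rule pair_measure_eqI[symmetric])
    note [measurable] = U'
    fix A B assume "A \<in> sets (distr M N U)" and B[measurable]: "B \<in> sets Q"
    then have A[measurable]: "A \<in> sets N" by simp
    have "space (Fil k) = space M" using Fil_sub[of k] by (simp add: subalgebra_def)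
    then have "U -` A \<inter> space M \<in> sets (Fil k)" using measurable_sets[OF U A] by simp
    from xi_indep[OF this B]
    have "emeasure M ((U -` A \<inter> space M) \<inter> (\<xi> k -` B \<inter> space M))
      = emeasure M (U -` A \<inter> space M) * emeasure M (\<xi> k -` B \<inter> space M)"
      by (simp add: emeasure_eq_measure ennreal_mult'[symmetric])
    also have "emeasure M (\<xi> k -` B \<inter> space M) = emeasure Q B"
      using emeasure_distr[OF xi_measurable B] by (simp add: xi_distr)
    also have "(U -` A \<inter> space M) \<inter> (\<xi> k -` B \<inter> space M) = (\<lambda>\<omega>. (U \<omega>, \<xi> k \<omega>)) -` (A \<times> B) \<inter> space M"
      by auto
    finally show "emeasure (distr M N U) A * emeasure Q B = emeasure (distr M (N \<Otimes>\<^sub>M Q) (\<lambda>\<omega>. (U \<omega>, \<xi> k \<omega>))) (A \<times> B)"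
      by (simp add: emeasure_distr)
  qed (unfold_locales, simp)
qed

text \<open>
  The Markov property in integrated form: given the past, the next noise can be averaged out.
\<close>

lemma expect_step:
  fixes h :: "'b \<times> 's \<Rightarrow> 'c::{banach, second_countable_topology}"
  assumes U: "U \<in> measurable (Fil k) N" and h[measurable]: "h \<in> borel_measurable (N \<Otimes>\<^sub>M Q)"
    and i: "integrable M (\<lambda>\<omega>. h (U \<omega>, \<xi> k \<omega>))"
  shows "(\<integral>\<omega>. h (U \<omega>, \<xi> k \<omega>) \<partial>M) = (\<integral>\<omega>. (\<integral>s. h (U \<omega>, s) \<partial>Q) \<partial>M)"
proof -
  note [measurable] = measurable_Fil[OF U]
  interpret D: prob_space "distr M N U" by (rule prob_space_distr) measurable
  interpret Q: prob_space Q by (rule prob_noise)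
  interpret DQ: pair_prob_space "distr M N U" Q ..
  have i': "integrable (distr M N U \<Otimes>\<^sub>M Q) h"
    unfolding joint_distr[OF U, symmetric] using i by (subst integrable_distr_eq) auto
  have "(\<integral>\<omega>. h (U \<omega>, \<xi> k \<omega>) \<partial>M) = (\<integral>z. h z \<partial>(distr M N U \<Otimes>\<^sub>M Q))"
    unfolding joint_distr[OF U, symmetric] by (subst integral_distr) auto
  also have "\<dots> = (\<integral>x. (\<integral>s. h (x, s) \<partial>Q) \<partial>distr M N U)"
    using DQ.integral_fst'[OF i'] by simp
  also have "\<dots> = (\<integral>\<omega>. (\<integral>s. h (U \<omega>, s) \<partial>Q) \<partial>M)"
    by (subst integral_distr) auto
  finally show ?thesis .
qed

end

text \<open>
  The starting law is arbitrary apart from its moments, so that the same results cover the chain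
  started at a point and the stationary chain.
\<close>

locale clt_chain = contractive_kernel Q F \<rho> \<theta> \<pi> + driven_chain M Q F Fil \<xi> X0
  for Q :: "'s measure" and F :: "real \<Rightarrow> 's \<Rightarrow> real" and \<rho> \<theta> :: real and \<pi> :: "real measure"
    and M :: "'a measure" and Fil \<xi> X0 +
  assumes X0_moments: "\<And>q::nat. integrable M (\<lambda>\<omega>. \<bar>X0 \<omega>\<bar> ^ q)"
begin

lemma noise_moments:
  shows "integrable M (\<lambda>\<omega>. (1 + \<bar>F 0 (\<xi> k \<omega>)\<bar>) ^ q)"
    and "(\<integral>\<omega>. (1 + \<bar>F 0 (\<xi> k \<omega>)\<bar>) ^ q \<partial>M) = (\<integral>s. (1 + \<bar>F 0 s\<bar>) ^ q \<partial>Q)"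
proof -
  have "integrable (distr M Q (\<xi> k)) (\<lambda>s. (1 + \<bar>F 0 s\<bar>) ^ q)" unfolding xi_distr by (rule F0_moments)
  then show "integrable M (\<lambda>\<omega>. (1 + \<bar>F 0 (\<xi> k \<omega>)\<bar>) ^ q)"
    by (subst (asm) integrable_distr_eq) auto
  have "(\<integral>s. (1 + \<bar>F 0 s\<bar>) ^ q \<partial>(distr M Q (\<xi> k))) = (\<integral>\<omega>. (1 + \<bar>F 0 (\<xi> k \<omega>)\<bar>) ^ q \<partial>M)"
    by (rule integral_distr) auto
  then show "(\<integral>\<omega>. (1 + \<bar>F 0 (\<xi> k \<omega>)\<bar>) ^ q \<partial>M) = (\<integral>s. (1 + \<bar>F 0 s\<bar>) ^ q \<partial>Q)"
    unfolding xi_distr by simp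
qed

lemma weight_step_le:
  assumes "\<omega> \<in> space M"
  shows "(1 + \<bar>chain (Suc k) \<omega>\<bar>) ^ q \<le> (1 + \<bar>F 0 (\<xi> k \<omega>)\<bar>) ^ q * (1 + \<bar>chain k \<omega>\<bar>) ^ q"
proof -
  have "\<xi> k \<omega> \<in> space Q" using measurable_space[OF xi_measurable assms] .
  from F_growth[OF this, of 1 "chain k \<omega>"] show ?thesis
    by (simp add: power_mult_distrib[symmetric] power_mono)
qed

lemma chain_weight_integrable: "integrable M (\<lambda>\<omega>. (1 + \<bar>chain k \<omega>\<bar>) ^ q)"
proof (induction k arbitrary: q)
  case 0
  have "(1 + \<bar>x\<bar>) ^ q = (\<Sum>k\<le>q. of_nat (q choose k) * \<bar>x\<bar> ^ (q - k))" for x :: real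
    using binomial_ring[of 1 "\<bar>x\<bar>" q] by simp
  then show ?case using X0_moments by simp
next
  case (Suc k)
  show ?case
  proof (rule Bochner_Integration.integrable_bound[OF Bochner_Integration.integrable_add[OF noise_moments(1)[of k "2*q"] Suc[of "2*q"]]])
    show "AE \<omega> in M. norm ((1 + \<bar>chain (Suc k) \<omega>\<bar>) ^ q) \<le> norm ((1 + \<bar>F 0 (\<xi> k \<omega>)\<bar>) ^ (2 * q) + (1 + \<bar>chain k \<omega>\<bar>) ^ (2 * q))"
    proof (intro AE_I2)
      fix \<omega> assume \<omega>: "\<omega> \<in> space M"
      let ?a = "(1 + \<bar>F 0 (\<xi> k \<omega>)\<bar>) ^ q" and ?b = "(1 + \<bar>chain k \<omega>\<bar>) ^ q"
      have "?a * ?b \<le> ?a\<^sup>2 + ?b\<^sup>2" by (intro prod_le_sum_squares) auto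
      then have "(1 + \<bar>chain (Suc k) \<omega>\<bar>) ^ q \<le> ?a\<^sup>2 + ?b\<^sup>2" using weight_step_le[OF \<omega>] by (rule order_trans[rotated])
      then show "norm ((1 + \<bar>chain (Suc k) \<omega>\<bar>) ^ q) \<le> norm ((1 + \<bar>F 0 (\<xi> k \<omega>)\<bar>) ^ (2 * q) + (1 + \<bar>chain k \<omega>\<bar>) ^ (2 * q))"
        by (simp add: power_mult[symmetric] mult.commute)
    qed
  qed measurable
qed

lemma chain_integrable:
  assumes "poly_hoelder f" shows "integrable M (\<lambda>\<omega>. f (chain k \<omega>))"
proof -
  obtain C q where "C \<ge> 0" and C: "\<And>x. \<bar>f x\<bar> \<le> C * (1 + \<bar>x\<bar>) ^ q" using poly_hoelder_growth[OF assms] by blast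
  note [measurable] = poly_hoelder_measurable[OF assms]
  show ?thesis
    by (rule Bochner_Integration.integrable_bound[OF integrable_mult_right[OF chain_weight_integrable[of k q], of C]])
       (use C \<open>C \<ge> 0\<close> in \<open>auto simp: abs_mult\<close>)
qed

lemma expect_P_step:
  assumes f: "poly_hoelder f" and Z: "Z \<in> borel_measurable (Fil k)"
    and i: "integrable M (\<lambda>\<omega>. Z \<omega> * of_real (f (chain (Suc k) \<omega>)))"
  shows "(\<integral>\<omega>. Z \<omega> * of_real (f (chain (Suc k) \<omega>)) \<partial>M)
       = (\<integral>\<omega>. Z \<omega> * of_real (P f (chain k \<omega>)) \<partial>M :: 'c::{real_normed_field, banach, second_countable_topology})"
proof -
  note [measurable] = poly_hoelder_measurable[OF f] Z chain_measurable_Fil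
  have U: "(\<lambda>\<omega>. (Z \<omega>, chain k \<omega>)) \<in> measurable (Fil k) (borel \<Otimes>\<^sub>M borel)" by measurable
  have "(\<integral>\<omega>. Z \<omega> * of_real (f (chain (Suc k) \<omega>)) \<partial>M)
      = (\<integral>\<omega>. (\<integral>s. Z \<omega> * of_real (f (F (chain k \<omega>) s)) \<partial>Q) \<partial>M)"
    using expect_step[OF U, of "\<lambda>p. fst (fst p) * of_real (f (F (snd (fst p)) (snd p)))"] i by simp
  then show ?thesis using F_integrable[OF f] by (simp add: P_def)
qed

lemma expect_chain:
  assumes "poly_hoelder f" shows "(\<integral>\<omega>. f (chain k \<omega>) \<partial>M) = (\<integral>\<omega>. (P ^^ k) f (X0 \<omega>) \<partial>M)"
  using assms
proof (induction k arbitrary: f)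
  case (Suc k)
  have "(\<integral>\<omega>. f (chain (Suc k) \<omega>) \<partial>M) = (\<integral>\<omega>. P f (chain k \<omega>) \<partial>M)"
    using expect_P_step[of f "\<lambda>_. 1::real" k] chain_integrable[OF Suc.prems, of "Suc k"] Suc.prems by simp
  also have "\<dots> = (\<integral>\<omega>. (P ^^ k) (P f) (X0 \<omega>) \<partial>M)" by (rule Suc.IH[OF P_poly_hoelder[OF Suc.prems]])
  finally show ?case by (simp add: funpow_swap1)
qed simp

text \<open>
  The expectation of a weight at time \<open>k\<close> is that of its \<open>k\<close>-fold image
  under the kernel at time zero, which converges geometrically to a constant.
\<close>

lemma chain_moments_bounded:
  obtains K where "\<And>k. (\<integral>\<omega>. (1 + \<bar>chain k \<omega>\<bar>) ^ q \<partial>M) \<le> K"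
proof -
  let ?f = "\<lambda>x::real. (1 + \<bar>x\<bar>) ^ q"
  obtain C r p where C: "C \<ge> 0" "0 < r" "r < 1"
    and b: "\<And>k x. \<bar>(P ^^ k) ?f x - (\<integral>y. ?f y \<partial>\<pi>)\<bar> \<le> C * r ^ k * (1 + \<bar>x\<bar>) ^ p"
    using P_iter_geometric[OF poly_hoelder_weight[of q]] by metis
  show ?thesis
  proof (rule that)
    fix k
    have "(\<integral>\<omega>. ?f (chain k \<omega>) \<partial>M) = (\<integral>\<omega>. (P ^^ k) ?f (X0 \<omega>) \<partial>M)" by (rule expect_chain[OF poly_hoelder_weight])
    also have "\<dots> \<le> (\<integral>\<omega>. (\<integral>y. ?f y \<partial>\<pi>) + C * (1 + \<bar>X0 \<omega>\<bar>) ^ p \<partial>M)"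
    proof (rule integral_mono)
      show "integrable M (\<lambda>\<omega>. (P ^^ k) ?f (X0 \<omega>))"
        using chain_integrable[OF P_iter_poly_hoelder[OF poly_hoelder_weight], of k q 0] by simp
      show "integrable M (\<lambda>\<omega>. (\<integral>y. ?f y \<partial>\<pi>) + C * (1 + \<bar>X0 \<omega>\<bar>) ^ p)"
        using chain_weight_integrable[of 0 p] by simp
      fix \<omega>
      have "C * r ^ k * (1 + \<bar>X0 \<omega>\<bar>) ^ p \<le> C * 1 * (1 + \<bar>X0 \<omega>\<bar>) ^ p"
        using C by (intro mult_right_mono mult_left_mono power_le_one) auto
      then show "(P ^^ k) ?f (X0 \<omega>) \<le> (\<integral>y. ?f y \<partial>\<pi>) + C * (1 + \<bar>X0 \<omega>\<bar>) ^ p"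
        using b[of k "X0 \<omega>"] by linarith
    qed
    finally show "(\<integral>\<omega>. (1 + \<bar>chain k \<omega>\<bar>) ^ q \<partial>M) \<le> (\<integral>\<omega>. (\<integral>y. ?f y \<partial>\<pi>) + C * (1 + \<bar>X0 \<omega>\<bar>) ^ p \<partial>M)" .
  qed
qed

end

section \<open>The central limit theorem for contracting chains\<close>

context contractive_kernel
begin

lemma P_measurable: "poly_hoelder f \<Longrightarrow> P f \<in> borel_measurable borel"
  by (rule poly_hoelder_measurable[OF P_poly_hoelder])

lemma increment_growth:
  assumes "poly_hoelder u"
  obtains C q where "C \<ge> 0"
    "\<And>x s. s \<in> space Q \<Longrightarrow> \<bar>u (F x s) - P u x\<bar> \<le> C * ((1 + \<bar>x\<bar>) ^ q * (1 + \<bar>F 0 s\<bar>) ^ q)"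
proof -
  obtain C q where C: "C \<ge> 0" "\<And>x. \<bar>u x\<bar> \<le> C * (1 + \<bar>x\<bar>) ^ q" using poly_hoelder_growth[OF assms] by blast
  obtain D r where D: "D \<ge> 0" "\<And>x. \<bar>P u x\<bar> \<le> D * (1 + \<bar>x\<bar>) ^ r" using poly_hoelder_growth[OF P_poly_hoelder[OF assms]] by blast
  show ?thesis
  proof (rule that[of "C + D" "max q r"])
    fix x s assume s: "s \<in> space Q"
    let ?w = "\<lambda>k. (1 + \<bar>x\<bar>) ^ k * (1 + \<bar>F 0 s\<bar>) ^ k"
    have "\<bar>u (F x s)\<bar> \<le> C * (1 + \<bar>F x s\<bar>) ^ q" by (rule C(2))
    also have "\<dots> \<le> C * ((1 + \<bar>F 0 s\<bar>) * (1 + \<bar>x\<bar>)) ^ q"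
      using F_growth[OF s, of 1 x] C(1) by (intro mult_left_mono power_mono) auto
    also have "\<dots> = C * ?w q" by (simp add: power_mult_distrib mult_ac)
    also have "\<dots> \<le> C * ?w (max q r)"
      using C(1) by (intro mult_left_mono mult_mono power_increasing) auto
    finally have 1: "\<bar>u (F x s)\<bar> \<le> C * ?w (max q r)" .
    have "(1 + \<bar>x\<bar>) ^ r * 1 \<le> ?w (max q r)"
      by (intro mult_mono power_increasing one_le_power) auto
    then have "\<bar>P u x\<bar> \<le> D * ?w (max q r)"
      using D(1) by (intro order_trans[OF D(2)] mult_left_mono) auto
    with 1 show "\<bar>u (F x s) - P u x\<bar> \<le> (C + D) * ?w (max q r)"
      using abs_triangle_ineq4[of "u (F x s)" "P u x"] by (simp only: distrib_right)
  qed (use C(1) D(1) in auto)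
qed

text \<open>
  Second-order Taylor expansion of the conditional characteristic function of a martingale
  increment. The linear term vanishes by centring and the cubic remainder is integrable because
  increments grow at most polynomially.
\<close>

lemma conditional_char_expansion:
  assumes u: "poly_hoelder u"
  obtains K q where "K \<ge> 0"
    "\<And>\<tau> x. norm ((\<integral>s. iexp (\<tau> * (u (F x s) - P u x)) \<partial>Q) - of_real (1 - \<tau>\<^sup>2 / 2 * cond_var u x))
        \<le> K * \<bar>\<tau>\<bar> ^ 3 * (1 + \<bar>x\<bar>) ^ q"
proof -
  obtain C q where C: "C \<ge> 0"
    "\<And>x s. s \<in> space Q \<Longrightarrow> \<bar>u (F x s) - P u x\<bar> \<le> C * ((1 + \<bar>x\<bar>) ^ q * (1 + \<bar>F 0 s\<bar>) ^ q)"
    using increment_growth[OF u] by metis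
  note [measurable] = poly_hoelder_measurable[OF u]
  let ?m = "\<integral>s. (1 + \<bar>F 0 s\<bar>) ^ (q * 3) \<partial>Q"
  show ?thesis
  proof (rule that[of "C ^ 3 / 6 * ?m" "q * 3"])
    fix \<tau> x
    define D where "D s = u (F x s) - P u x" for s
    have iu: "integrable Q (\<lambda>s. u (F x s))" by (rule F_integrable[OF u])
    have iD: "integrable Q D" unfolding D_def using iu by simp
    have D0: "(\<integral>s. D s \<partial>Q) = 0" unfolding D_def using iu by (simp add: P_def Q.prob_space)
    have "integrable Q (\<lambda>s. (u (F x s))\<^sup>2)" by (rule F_integrable[OF poly_hoelder_power[OF u]])
    then have iD2: "integrable Q (\<lambda>s. (D s)\<^sup>2)" unfolding D_def power2_diff using iu by simp
    have [measurable]: "D \<in> borel_measurable Q" using iD by simp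
    have ie: "integrable Q (\<lambda>s. iexp (\<tau> * D s))" by (rule Q.integrable_iexp) measurable
    have ic: "integrable Q (\<lambda>s. 1 + \<i> * of_real (\<tau> * D s) - of_real (\<tau>\<^sup>2 / 2 * (D s)\<^sup>2))"
      using iD iD2 by (intro Bochner_Integration.integrable_diff Bochner_Integration.integrable_add integrable_mult_right integrable_of_real) auto
    have "(\<integral>s. 1 + \<i> * of_real (\<tau> * D s) - of_real (\<tau>\<^sup>2 / 2 * (D s)\<^sup>2) \<partial>Q)
        = (\<integral>s. 1 + \<i> * of_real (\<tau> * D s) \<partial>Q) - (\<integral>s. of_real (\<tau>\<^sup>2 / 2 * (D s)\<^sup>2) \<partial>Q)"
      using iD iD2 by (intro Bochner_Integration.integral_diff Bochner_Integration.integrable_add integrable_mult_right integrable_of_real) auto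
    also have "(\<integral>s. 1 + \<i> * of_real (\<tau> * D s) \<partial>Q) = 1 + \<i> * of_real (\<tau> * (\<integral>s. D s \<partial>Q))"
      using iD by (subst Bochner_Integration.integral_add) (auto simp: Q.prob_space)
    also have "(\<integral>s. complex_of_real (\<tau>\<^sup>2 / 2 * (D s)\<^sup>2) \<partial>Q) = of_real (\<tau>\<^sup>2 / 2 * cond_var u x)"
      by (simp only: integral_complex_of_real) (simp add: cond_var_def D_def)
    finally have c: "(\<integral>s. 1 + \<i> * of_real (\<tau> * D s) - of_real (\<tau>\<^sup>2 / 2 * (D s)\<^sup>2) \<partial>Q)
        = of_real (1 - \<tau>\<^sup>2 / 2 * cond_var u x)" by (simp add: D0)
    have "norm ((\<integral>s. iexp (\<tau> * D s) \<partial>Q) - of_real (1 - \<tau>\<^sup>2 / 2 * cond_var u x))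
       = norm (\<integral>s. iexp (\<tau> * D s) - (1 + \<i> * of_real (\<tau> * D s) - of_real (\<tau>\<^sup>2 / 2 * (D s)\<^sup>2)) \<partial>Q)"
      unfolding c[symmetric] using ie ic by (subst Bochner_Integration.integral_diff) auto
    also have "\<dots> \<le> (\<integral>s. norm (iexp (\<tau> * D s) - (1 + \<i> * of_real (\<tau> * D s) - of_real (\<tau>\<^sup>2 / 2 * (D s)\<^sup>2))) \<partial>Q)"
      by (rule integral_norm_bound)
    also have "\<dots> \<le> (\<integral>s. \<bar>\<tau>\<bar> ^ 3 * (C ^ 3 / 6) * (1 + \<bar>x\<bar>) ^ (q * 3) * (1 + \<bar>F 0 s\<bar>) ^ (q * 3) \<partial>Q)"
    proof (rule integral_mono)
      show "integrable Q (\<lambda>s. norm (iexp (\<tau> * D s) - (1 + \<i> * of_real (\<tau> * D s) - of_real (\<tau>\<^sup>2 / 2 * (D s)\<^sup>2))))"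
        using Bochner_Integration.integrable_diff[OF ie ic] by (rule integrable_norm)
      show "integrable Q (\<lambda>s. \<bar>\<tau>\<bar> ^ 3 * (C ^ 3 / 6) * (1 + \<bar>x\<bar>) ^ (q * 3) * (1 + \<bar>F 0 s\<bar>) ^ (q * 3))"
        by (intro integrable_mult_right F0_moments)
      fix s assume s: "s \<in> space Q"
      have "norm (iexp (\<tau> * D s) - (1 + \<i> * of_real (\<tau> * D s) - of_real (\<tau>\<^sup>2 / 2 * (D s)\<^sup>2))) \<le> \<bar>\<tau> * D s\<bar> ^ 3 / 6"
        using iexp_approx1[of "\<tau> * D s" 2]
        by (simp add: fact_numeral eval_nat_numeral power_mult_distrib algebra_simps)
      also have "\<dots> = \<bar>\<tau>\<bar> ^ 3 * \<bar>D s\<bar> ^ 3 / 6" by (simp add: abs_mult power_mult_distrib)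
      also have "\<dots> \<le> \<bar>\<tau>\<bar> ^ 3 * (C * ((1 + \<bar>x\<bar>) ^ q * (1 + \<bar>F 0 s\<bar>) ^ q)) ^ 3 / 6"
        unfolding D_def by (intro divide_right_mono mult_left_mono power_mono C(2) s) auto
      finally show "norm (iexp (\<tau> * D s) - (1 + \<i> * of_real (\<tau> * D s) - of_real (\<tau>\<^sup>2 / 2 * (D s)\<^sup>2)))
          \<le> \<bar>\<tau>\<bar> ^ 3 * (C ^ 3 / 6) * (1 + \<bar>x\<bar>) ^ (q * 3) * (1 + \<bar>F 0 s\<bar>) ^ (q * 3)"
        by (simp add: power_mult_distrib power_mult)
    qed
    also have "\<dots> = C ^ 3 / 6 * ?m * \<bar>\<tau>\<bar> ^ 3 * (1 + \<bar>x\<bar>) ^ (q * 3)" by simp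
    finally show "norm ((\<integral>s. iexp (\<tau> * (u (F x s) - P u x)) \<partial>Q) - of_real (1 - \<tau>\<^sup>2 / 2 * cond_var u x))
        \<le> C ^ 3 / 6 * ?m * \<bar>\<tau>\<bar> ^ 3 * (1 + \<bar>x\<bar>) ^ (q * 3)" unfolding D_def .
  qed (use C(1) in \<open>auto intro!: mult_nonneg_nonneg Bochner_Integration.integral_nonneg\<close>)
qed

end

context clt_chain
begin

text \<open>
  Gordin's martingale: its increments are the innovations of \<open>u\<close> along the chain.
\<close>

primrec mart :: "(real \<Rightarrow> real) \<Rightarrow> nat \<Rightarrow> 'a \<Rightarrow> real" where
  "mart u 0 \<omega> = 0"
| "mart u (Suc k) \<omega> = mart u k \<omega> + (u (chain (Suc k) \<omega>) - P u (chain k \<omega>))"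

lemma mart_measurable_Fil: "poly_hoelder u \<Longrightarrow> mart u k \<in> borel_measurable (Fil k)"
proof (induction k)
  case 0 then show ?case by (simp cong: measurable_cong)
next
  case (Suc k)
  note [measurable] = measurable_Fil_Suc[OF Suc.IH[OF Suc.prems]] poly_hoelder_measurable[OF Suc.prems] P_measurable[OF Suc.prems]
    chain_measurable_Fil[of "Suc k"] measurable_Fil_Suc[OF chain_measurable_Fil[of k]]
  have "(\<lambda>\<omega>. mart u k \<omega> + (u (chain (Suc k) \<omega>) - P u (chain k \<omega>))) \<in> borel_measurable (Fil (Suc k))"
    by measurable
  then show ?case by (simp cong: measurable_cong)
qed

lemma increment_moment_bounded:
  assumes u: "poly_hoelder u" and w: "poly_hoelder w"
  obtains K where "\<And>k. integrable M (\<lambda>\<omega>. (u (chain (Suc k) \<omega>) - P u (chain k \<omega>)) * w (chain (Suc k) \<omega>))"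
    "\<And>k. (\<integral>\<omega>. \<bar>(u (chain (Suc k) \<omega>) - P u (chain k \<omega>)) * w (chain (Suc k) \<omega>)\<bar> \<partial>M) \<le> K"
proof -
  obtain C q where C: "C \<ge> 0"
    "\<And>x s. s \<in> space Q \<Longrightarrow> \<bar>u (F x s) - P u x\<bar> \<le> C * ((1 + \<bar>x\<bar>) ^ q * (1 + \<bar>F 0 s\<bar>) ^ q)"
    using increment_growth[OF u] by metis
  obtain D r where D: "D \<ge> 0" "\<And>x. \<bar>w x\<bar> \<le> D * (1 + \<bar>x\<bar>) ^ r" using poly_hoelder_growth[OF w] by blast
  obtain K0 where K0: "\<And>k. (\<integral>\<omega>. (1 + \<bar>chain k \<omega>\<bar>) ^ (2 * (q + r)) \<partial>M) \<le> K0"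
    using chain_moments_bounded by metis
  note [measurable] = poly_hoelder_measurable[OF u] poly_hoelder_measurable[OF w] P_measurable[OF u]
  let ?Y = "\<lambda>k \<omega>. (u (chain (Suc k) \<omega>) - P u (chain k \<omega>)) * w (chain (Suc k) \<omega>)"
  let ?B = "\<lambda>k \<omega>. C * D * ((1 + \<bar>chain k \<omega>\<bar>) ^ (2 * (q + r)) + (1 + \<bar>F 0 (\<xi> k \<omega>)\<bar>) ^ (2 * (q + r)))"
  have iB: "integrable M (?B k)" for k
    by (intro integrable_mult_right Bochner_Integration.integrable_add chain_weight_integrable noise_moments)
  have le: "\<bar>?Y k \<omega>\<bar> \<le> ?B k \<omega>" if \<omega>: "\<omega> \<in> space M" for k \<omega>
  proof -
    let ?a = "1 + \<bar>chain k \<omega>\<bar>" and ?b = "1 + \<bar>F 0 (\<xi> k \<omega>)\<bar>"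
    have s: "\<xi> k \<omega> \<in> space Q" using measurable_space[OF xi_measurable \<omega>] .
    have "\<bar>w (chain (Suc k) \<omega>)\<bar> \<le> D * (1 + \<bar>chain (Suc k) \<omega>\<bar>) ^ r" by (rule D(2))
    also have "\<dots> \<le> D * (?b ^ r * ?a ^ r)" using D(1) by (intro mult_left_mono weight_step_le \<omega>)
    finally have w: "\<bar>w (chain (Suc k) \<omega>)\<bar> \<le> D * (?b ^ r * ?a ^ r)" .
    have "\<bar>?Y k \<omega>\<bar> = \<bar>u (F (chain k \<omega>) (\<xi> k \<omega>)) - P u (chain k \<omega>)\<bar> * \<bar>w (chain (Suc k) \<omega>)\<bar>"
      by (simp add: abs_mult)
    also have "\<dots> \<le> (C * (?a ^ q * ?b ^ q)) * (D * (?b ^ r * ?a ^ r))"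
      using C(1) by (intro mult_mono C(2) s w) auto
    also have "\<dots> = C * D * (?a ^ (q + r) * ?b ^ (q + r))" by (simp add: power_add mult_ac)
    also have "\<dots> \<le> C * D * ((?a ^ (q + r))\<^sup>2 + (?b ^ (q + r))\<^sup>2)"
      using C(1) D(1) by (intro mult_left_mono prod_le_sum_squares) auto
    finally show ?thesis by (simp only: power_mult[symmetric] mult.commute[of _ 2])
  qed
  have i: "integrable M (?Y k)" for k
    by (rule Bochner_Integration.integrable_bound[OF iB[of k]]) (use le in \<open>auto intro!: AE_I2 order_trans[OF _ abs_ge_self]\<close>)
  show ?thesis
  proof (rule that[OF i])
    fix k
    have "(\<integral>\<omega>. \<bar>?Y k \<omega>\<bar> \<partial>M) \<le> (\<integral>\<omega>. ?B k \<omega> \<partial>M)"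
      using i iB le by (intro integral_mono) auto
    also have "\<dots> = C * D * ((\<integral>\<omega>. (1 + \<bar>chain k \<omega>\<bar>) ^ (2 * (q + r)) \<partial>M) + (\<integral>s. (1 + \<bar>F 0 s\<bar>) ^ (2 * (q + r)) \<partial>Q))"
      by (simp add: chain_weight_integrable noise_moments)
    also have "\<dots> \<le> C * D * (K0 + (\<integral>s. (1 + \<bar>F 0 s\<bar>) ^ (2 * (q + r)) \<partial>Q))"
      using C(1) D(1) K0 by (intro mult_left_mono add_right_mono) auto
    finally show "(\<integral>\<omega>. \<bar>?Y k \<omega>\<bar> \<partial>M) \<le> C * D * (K0 + (\<integral>s. (1 + \<bar>F 0 s\<bar>) ^ (2 * (q + r)) \<partial>Q))" .
  qed
qed

lemma chain_abs_moment_bounded: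
  assumes w: "poly_hoelder w"
  obtains K where "\<And>k. (\<integral>\<omega>. \<bar>w (chain k \<omega>)\<bar> \<partial>M) \<le> K"
proof -
  obtain D r where D: "D \<ge> 0" "\<And>x. \<bar>w x\<bar> \<le> D * (1 + \<bar>x\<bar>) ^ r" using poly_hoelder_growth[OF w] by blast
  obtain K0 where K0: "\<And>k. (\<integral>\<omega>. (1 + \<bar>chain k \<omega>\<bar>) ^ r \<partial>M) \<le> K0"
    using chain_moments_bounded by metis
  show ?thesis
  proof (rule that)
    fix k
    have "(\<integral>\<omega>. \<bar>w (chain k \<omega>)\<bar> \<partial>M) \<le> (\<integral>\<omega>. D * (1 + \<bar>chain k \<omega>\<bar>) ^ r \<partial>M)"
      by (intro integral_mono integrable_abs chain_integrable[OF w] integrable_mult_right chain_weight_integrable D(2))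
    also have "\<dots> \<le> D * K0" using K0[of k] D(1) by (simp add: mult_left_mono)
    finally show "(\<integral>\<omega>. \<bar>w (chain k \<omega>)\<bar> \<partial>M) \<le> D * K0" .
  qed
qed

text \<open>
  The characteristic function after one more step, up to an error of order
  \<open>\<bar>\<tau>\<bar> ^ 3\<close> uniformly in time. The conditional variance is random, so
  this is not yet a closed recursion.
\<close>

lemma mart_char_step:
  assumes u: "poly_hoelder u"
  obtains K where "\<And>\<tau> k. norm ((\<integral>\<omega>. iexp (\<tau> * mart u (Suc k) \<omega>) \<partial>M) - (\<integral>\<omega>. iexp (\<tau> * mart u k \<omega>) \<partial>M)
      + of_real (\<tau>\<^sup>2 / 2) * (\<integral>\<omega>. iexp (\<tau> * mart u k \<omega>) * of_real (cond_var u (chain k \<omega>)) \<partial>M)) \<le> K * \<bar>\<tau>\<bar> ^ 3"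
proof -
  obtain K0 q where K0: "K0 \<ge> 0"
    "\<And>\<tau> x. norm ((\<integral>s. iexp (\<tau> * (u (F x s) - P u x)) \<partial>Q) - of_real (1 - \<tau>\<^sup>2 / 2 * cond_var u x))
        \<le> K0 * \<bar>\<tau>\<bar> ^ 3 * (1 + \<bar>x\<bar>) ^ q"
    using conditional_char_expansion[OF u] by metis
  obtain K1 where K1: "\<And>k. (\<integral>\<omega>. (1 + \<bar>chain k \<omega>\<bar>) ^ q \<partial>M) \<le> K1" using chain_moments_bounded by metis
  note [measurable] = poly_hoelder_measurable[OF u] P_measurable[OF u] poly_hoelder_measurable[OF cond_var_poly_hoelder[OF u]]
  show ?thesis
  proof (rule that[of "K0 * K1"])
    fix \<tau> k
    note [measurable] = measurable_Fil[OF mart_measurable_Fil[OF u]]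
    define c where "c x = (\<integral>s. iexp (\<tau> * (u (F x s) - P u x)) \<partial>Q)" for x
    have c_meas[measurable]: "c \<in> borel_measurable borel" unfolding c_def by measurable
    have c_le: "norm (c x) \<le> 1" for x
    proof -
      have "norm (c x) \<le> (\<integral>s. norm (iexp (\<tau> * (u (F x s) - P u x))) \<partial>Q)" unfolding c_def by (rule integral_norm_bound)
      then show ?thesis by (simp add: Q.prob_space)
    qed
    have U: "(\<lambda>\<omega>. (mart u k \<omega>, chain k \<omega>)) \<in> measurable (Fil k) (borel \<Otimes>\<^sub>M borel)"
      using mart_measurable_Fil[OF u] chain_measurable_Fil by measurable
    have ie: "integrable M (\<lambda>\<omega>. iexp (\<tau> * mart u k \<omega>))" for k by (rule integrable_iexp) measurable
    have icv: "integrable M (\<lambda>\<omega>. cond_var u (chain k \<omega>))" by (rule chain_integrable[OF cond_var_poly_hoelder[OF u]])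
    have iecv: "integrable M (\<lambda>\<omega>. iexp (\<tau> * mart u k \<omega>) * of_real (cond_var u (chain k \<omega>)))"
      by (rule Bochner_Integration.integrable_bound[OF icv]) (auto simp: norm_mult)
    have iec: "integrable M (\<lambda>\<omega>. iexp (\<tau> * mart u k \<omega>) * c (chain k \<omega>))"
      by (rule integrable_const_bound[where B=1]) (auto simp: norm_mult c_le)
    have iexp_split: "iexp (\<tau> * (a + b)) = iexp (\<tau> * a) * iexp (\<tau> * b)" for a b
      by (simp only: exp_add[symmetric]) (simp add: distrib_left)
    let ?h = "\<lambda>p. iexp (\<tau> * fst (fst p)) * iexp (\<tau> * (u (F (snd (fst p)) (snd p)) - P u (snd (fst p))))"
    have "(\<integral>\<omega>. iexp (\<tau> * mart u (Suc k) \<omega>) \<partial>M) = (\<integral>\<omega>. ?h ((mart u k \<omega>, chain k \<omega>), \<xi> k \<omega>) \<partial>M)"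
      by (simp add: iexp_split del: of_real_mult)
    also have "\<dots> = (\<integral>\<omega>. (\<integral>s. ?h ((mart u k \<omega>, chain k \<omega>), s) \<partial>Q) \<partial>M)"
    proof (rule expect_step[OF U])
      show "integrable M (\<lambda>\<omega>. ?h ((mart u k \<omega>, chain k \<omega>), \<xi> k \<omega>))"
        by (rule integrable_const_bound[where B=1]) (auto simp: norm_mult)
    qed measurable
    also have "\<dots> = (\<integral>\<omega>. iexp (\<tau> * mart u k \<omega>) * c (chain k \<omega>) \<partial>M)"
      unfolding c_def by simp
    finally have A: "(\<integral>\<omega>. iexp (\<tau> * mart u (Suc k) \<omega>) \<partial>M) = (\<integral>\<omega>. iexp (\<tau> * mart u k \<omega>) * c (chain k \<omega>) \<partial>M)" .
    have "(\<integral>\<omega>. iexp (\<tau> * mart u (Suc k) \<omega>) \<partial>M) - (\<integral>\<omega>. iexp (\<tau> * mart u k \<omega>) \<partial>M)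
      + of_real (\<tau>\<^sup>2 / 2) * (\<integral>\<omega>. iexp (\<tau> * mart u k \<omega>) * of_real (cond_var u (chain k \<omega>)) \<partial>M)
      = (\<integral>\<omega>. iexp (\<tau> * mart u k \<omega>) * c (chain k \<omega>) - iexp (\<tau> * mart u k \<omega>)
           + of_real (\<tau>\<^sup>2 / 2) * (iexp (\<tau> * mart u k \<omega>) * of_real (cond_var u (chain k \<omega>))) \<partial>M)"
      unfolding A using iec ie[of k] iecv
      by (subst Bochner_Integration.integral_add, simp, simp, subst Bochner_Integration.integral_diff, simp_all)
    also have "\<dots> = (\<integral>\<omega>. iexp (\<tau> * mart u k \<omega>) * (c (chain k \<omega>) - of_real (1 - \<tau>\<^sup>2 / 2 * cond_var u (chain k \<omega>))) \<partial>M)"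
      by (intro Bochner_Integration.integral_cong refl) (simp add: algebra_simps)
    finally have E: "(\<integral>\<omega>. iexp (\<tau> * mart u (Suc k) \<omega>) \<partial>M) - (\<integral>\<omega>. iexp (\<tau> * mart u k \<omega>) \<partial>M)
      + of_real (\<tau>\<^sup>2 / 2) * (\<integral>\<omega>. iexp (\<tau> * mart u k \<omega>) * of_real (cond_var u (chain k \<omega>)) \<partial>M)
      = (\<integral>\<omega>. iexp (\<tau> * mart u k \<omega>) * (c (chain k \<omega>) - of_real (1 - \<tau>\<^sup>2 / 2 * cond_var u (chain k \<omega>))) \<partial>M)" .
    have "norm (\<integral>\<omega>. iexp (\<tau> * mart u k \<omega>) * (c (chain k \<omega>) - of_real (1 - \<tau>\<^sup>2 / 2 * cond_var u (chain k \<omega>))) \<partial>M)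
      \<le> (\<integral>\<omega>. norm (iexp (\<tau> * mart u k \<omega>) * (c (chain k \<omega>) - of_real (1 - \<tau>\<^sup>2 / 2 * cond_var u (chain k \<omega>)))) \<partial>M)"
      by (rule integral_norm_bound)
    also have "\<dots> \<le> (\<integral>\<omega>. K0 * \<bar>\<tau>\<bar> ^ 3 * (1 + \<bar>chain k \<omega>\<bar>) ^ q \<partial>M)"
    proof (rule integral_mono)
      show i3: "integrable M (\<lambda>\<omega>. K0 * \<bar>\<tau>\<bar> ^ 3 * (1 + \<bar>chain k \<omega>\<bar>) ^ q)"
        by (intro integrable_mult_right chain_weight_integrable)
      show le: "norm (iexp (\<tau> * mart u k \<omega>) * (c (chain k \<omega>) - of_real (1 - \<tau>\<^sup>2 / 2 * cond_var u (chain k \<omega>))))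
          \<le> K0 * \<bar>\<tau>\<bar> ^ 3 * (1 + \<bar>chain k \<omega>\<bar>) ^ q" for \<omega>
        using K0(2)[of \<tau> "chain k \<omega>"] by (simp add: norm_mult c_def)
      show "integrable M (\<lambda>\<omega>. norm (iexp (\<tau> * mart u k \<omega>) * (c (chain k \<omega>) - of_real (1 - \<tau>\<^sup>2 / 2 * cond_var u (chain k \<omega>)))))"
      proof (rule Bochner_Integration.integrable_bound[OF i3])
        show "AE \<omega> in M. norm (norm (iexp (\<tau> * mart u k \<omega>) * (c (chain k \<omega>) - of_real (1 - \<tau>\<^sup>2 / 2 * cond_var u (chain k \<omega>)))))
            \<le> norm (K0 * \<bar>\<tau>\<bar> ^ 3 * (1 + \<bar>chain k \<omega>\<bar>) ^ q)"
          unfolding real_norm_def abs_norm_cancel by (intro AE_I2 order_trans[OF le abs_ge_self])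
      qed measurable
    qed
    also have "\<dots> = K0 * \<bar>\<tau>\<bar> ^ 3 * (\<integral>\<omega>. (1 + \<bar>chain k \<omega>\<bar>) ^ q \<partial>M)" by simp
    also have "\<dots> \<le> K0 * \<bar>\<tau>\<bar> ^ 3 * K1" using K0(1) by (intro mult_left_mono K1) auto
    finally show "norm ((\<integral>\<omega>. iexp (\<tau> * mart u (Suc k) \<omega>) \<partial>M) - (\<integral>\<omega>. iexp (\<tau> * mart u k \<omega>) \<partial>M)
      + of_real (\<tau>\<^sup>2 / 2) * (\<integral>\<omega>. iexp (\<tau> * mart u k \<omega>) * of_real (cond_var u (chain k \<omega>)) \<partial>M)) \<le> K0 * K1 * \<bar>\<tau>\<bar> ^ 3"
      unfolding E by (simp add: mult_ac)
  qed
qed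

text \<open>
  This closes the recursion when \<open>f\<close> is the conditional variance and \<open>m\<close>
  its mean: \<open>E[e\<^sub>k f(X\<^sub>k)]\<close>, where \<open>e\<^sub>k\<close> is the
  exponential of the martingale, equals \<open>m E[e\<^sub>k]\<close> plus \<open>E[e\<^sub>k
  (w(X\<^sub>k) - w(X\<^sub>k\<^sub>+\<^sub>1))]\<close>; exchanging \<open>e\<^sub>k\<close> for
  \<open>e\<^sub>k\<^sub>+\<^sub>1\<close> in the last term costs order \<open>\<tau>\<close> and
  turns it into a telescoping difference.
\<close>

lemma mart_char_poisson_step:
  assumes u: "poly_hoelder u" and f: "poly_hoelder f" and v: "\<And>x. w x - P w x = f x - m" and w: "poly_hoelder w"
  obtains K where "\<And>\<tau> k. norm ((\<integral>\<omega>. iexp (\<tau> * mart u k \<omega>) * of_real (f (chain k \<omega>)) \<partial>M)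
      - (of_real m * (\<integral>\<omega>. iexp (\<tau> * mart u k \<omega>) \<partial>M)
         + (\<integral>\<omega>. iexp (\<tau> * mart u k \<omega>) * of_real (w (chain k \<omega>)) \<partial>M)
         - (\<integral>\<omega>. iexp (\<tau> * mart u (Suc k) \<omega>) * of_real (w (chain (Suc k) \<omega>)) \<partial>M))) \<le> K * \<bar>\<tau>\<bar>"
proof -
  obtain K where Ki: "\<And>k. integrable M (\<lambda>\<omega>. (u (chain (Suc k) \<omega>) - P u (chain k \<omega>)) * w (chain (Suc k) \<omega>))"
    and K: "\<And>k. (\<integral>\<omega>. \<bar>(u (chain (Suc k) \<omega>) - P u (chain k \<omega>)) * w (chain (Suc k) \<omega>)\<bar> \<partial>M) \<le> K"
    using increment_moment_bounded[OF u w] by metis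
  note [measurable] = poly_hoelder_measurable[OF u] P_measurable[OF u] poly_hoelder_measurable[OF w] P_measurable[OF w]
  show ?thesis
  proof (rule that[of K])
    fix \<tau> k
    let ?e = "\<lambda>k \<omega>. iexp (\<tau> * mart u k \<omega>)"
    note [measurable] = measurable_Fil[OF mart_measurable_Fil[OF u]]
    have ie: "integrable M (?e k)" for k by (rule integrable_iexp) measurable
    have im: "integrable M (\<lambda>\<omega>. ?e k \<omega> * of_real (g (chain l \<omega>)))" if "poly_hoelder g" for g k l
      by (rule Bochner_Integration.integrable_bound[OF chain_integrable[OF that, of l]])
         (use poly_hoelder_measurable[OF that] in \<open>auto simp: norm_mult\<close>)
    have eZ: "?e k \<in> borel_measurable (Fil k)"
      using mart_measurable_Fil[OF u, of k] by measurable
    have "(\<integral>\<omega>. ?e k \<omega> * of_real (f (chain k \<omega>)) \<partial>M)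
      = (\<integral>\<omega>. of_real m * ?e k \<omega> + ?e k \<omega> * of_real (w (chain k \<omega>)) - ?e k \<omega> * of_real (P w (chain k \<omega>)) \<partial>M)"
    proof (intro Bochner_Integration.integral_cong refl)
      fix \<omega>
      have "f (chain k \<omega>) = m + w (chain k \<omega>) - P w (chain k \<omega>)" using v[of "chain k \<omega>"] by linarith
      then show "?e k \<omega> * of_real (f (chain k \<omega>)) = of_real m * ?e k \<omega> + ?e k \<omega> * of_real (w (chain k \<omega>)) - ?e k \<omega> * of_real (P w (chain k \<omega>))"
        by (simp only:) (simp add: algebra_simps)
    qed
    also have "\<dots> = of_real m * (\<integral>\<omega>. ?e k \<omega> \<partial>M) + (\<integral>\<omega>. ?e k \<omega> * of_real (w (chain k \<omega>)) \<partial>M)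
       - (\<integral>\<omega>. ?e k \<omega> * of_real (P w (chain k \<omega>)) \<partial>M)"
      using ie[of k] im[OF w, of k k] im[OF P_poly_hoelder[OF w], of k k]
      by (subst Bochner_Integration.integral_diff, simp, simp, subst Bochner_Integration.integral_add, simp_all)
    also have "(\<integral>\<omega>. ?e k \<omega> * of_real (P w (chain k \<omega>)) \<partial>M) = (\<integral>\<omega>. ?e k \<omega> * of_real (w (chain (Suc k) \<omega>)) \<partial>M)"
      by (rule expect_P_step[OF w eZ im[OF w], symmetric])
    finally have E: "(\<integral>\<omega>. ?e k \<omega> * of_real (f (chain k \<omega>)) \<partial>M)
      - (of_real m * (\<integral>\<omega>. ?e k \<omega> \<partial>M) + (\<integral>\<omega>. ?e k \<omega> * of_real (w (chain k \<omega>)) \<partial>M)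
         - (\<integral>\<omega>. ?e (Suc k) \<omega> * of_real (w (chain (Suc k) \<omega>)) \<partial>M))
      = (\<integral>\<omega>. ?e (Suc k) \<omega> * of_real (w (chain (Suc k) \<omega>)) - ?e k \<omega> * of_real (w (chain (Suc k) \<omega>)) \<partial>M)"
      using im[OF w, of "Suc k" "Suc k"] im[OF w, of k "Suc k"] by (subst Bochner_Integration.integral_diff) auto
    have "norm (\<integral>\<omega>. ?e (Suc k) \<omega> * of_real (w (chain (Suc k) \<omega>)) - ?e k \<omega> * of_real (w (chain (Suc k) \<omega>)) \<partial>M)
      \<le> (\<integral>\<omega>. norm (?e (Suc k) \<omega> * of_real (w (chain (Suc k) \<omega>)) - ?e k \<omega> * of_real (w (chain (Suc k) \<omega>))) \<partial>M)"
      by (rule integral_norm_bound)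
    also have "\<dots> \<le> (\<integral>\<omega>. \<bar>\<tau>\<bar> * \<bar>(u (chain (Suc k) \<omega>) - P u (chain k \<omega>)) * w (chain (Suc k) \<omega>)\<bar> \<partial>M)"
    proof (rule integral_mono)
      show "integrable M (\<lambda>\<omega>. norm (?e (Suc k) \<omega> * of_real (w (chain (Suc k) \<omega>)) - ?e k \<omega> * of_real (w (chain (Suc k) \<omega>))))"
        using Bochner_Integration.integrable_diff[OF im[OF w, of "Suc k" "Suc k"] im[OF w, of k "Suc k"]] by (rule integrable_norm)
      show "integrable M (\<lambda>\<omega>. \<bar>\<tau>\<bar> * \<bar>(u (chain (Suc k) \<omega>) - P u (chain k \<omega>)) * w (chain (Suc k) \<omega>)\<bar>)"
        using Ki[of k] by (intro integrable_mult_right integrable_abs)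
      fix \<omega>
      have "norm (?e (Suc k) \<omega> * of_real (w (chain (Suc k) \<omega>)) - ?e k \<omega> * of_real (w (chain (Suc k) \<omega>)))
        = norm (?e (Suc k) \<omega> - ?e k \<omega>) * \<bar>w (chain (Suc k) \<omega>)\<bar>"
        by (simp only: left_diff_distrib[symmetric] norm_mult norm_of_real)
      also have "\<dots> \<le> \<bar>\<tau> * mart u (Suc k) \<omega> - \<tau> * mart u k \<omega>\<bar> * \<bar>w (chain (Suc k) \<omega>)\<bar>"
        by (intro mult_right_mono norm_iexp_diff_le) simp
      also have "\<tau> * mart u (Suc k) \<omega> - \<tau> * mart u k \<omega> = \<tau> * (u (chain (Suc k) \<omega>) - P u (chain k \<omega>))"
        by (simp add: algebra_simps)
      finally show "norm (?e (Suc k) \<omega> * of_real (w (chain (Suc k) \<omega>)) - ?e k \<omega> * of_real (w (chain (Suc k) \<omega>)))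
        \<le> \<bar>\<tau>\<bar> * \<bar>(u (chain (Suc k) \<omega>) - P u (chain k \<omega>)) * w (chain (Suc k) \<omega>)\<bar>"
        by (simp only: abs_mult mult.assoc)
    qed
    also have "\<dots> \<le> \<bar>\<tau>\<bar> * K" using K[of k] by (simp add: mult_left_mono)
    finally show "norm ((\<integral>\<omega>. ?e k \<omega> * of_real (f (chain k \<omega>)) \<partial>M)
      - (of_real m * (\<integral>\<omega>. ?e k \<omega> \<partial>M)
         + (\<integral>\<omega>. ?e k \<omega> * of_real (w (chain k \<omega>)) \<partial>M)
         - (\<integral>\<omega>. ?e (Suc k) \<omega> * of_real (w (chain (Suc k) \<omega>)) \<partial>M))) \<le> K * \<bar>\<tau>\<bar>"
      unfolding E by (simp add: mult_ac)
  qed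
qed

text \<open>
  After subtracting the corrector \<open>\<tau>\<^sup>2 / 2 \<cdot> B\<close>, which is negligible
  for \<open>\<tau> = 1 / sqrt N\<close>, the characteristic function satisfies
  \<open>E\<^sub>k\<^sub>+\<^sub>1 = (1 - \<tau>\<^sup>2 m / 2) E\<^sub>k +
  O(\<bar>\<tau>\<bar>\<^sup>3)\<close>. Over \<open>N\<close> steps the errors add up to order
  \<open>\<tau>\<close>, and \<open>(1 - m / (2 N)) ^ N\<close> tends to \<open>exp (- m /
  2)\<close>.
\<close>

lemma mart_char_limit:
  assumes u: "poly_hoelder u"
  defines "m \<equiv> (\<integral>x. cond_var u x \<partial>\<pi>)"
  shows "(\<lambda>N. \<integral>\<omega>. iexp (1 / sqrt (real N) * mart u N \<omega>) \<partial>M) \<longlonglongrightarrow> exp (- m / 2)"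
proof -
  define v where "v = cond_var u"
  define w where "w = poisson v"
  have v: "poly_hoelder v" unfolding v_def by (rule cond_var_poly_hoelder[OF u])
  have w: "poly_hoelder w" unfolding w_def by (rule poisson_poly_hoelder[OF v])
  have pe: "w x - P w x = v x - m" for x unfolding w_def m_def v_def[symmetric] by (rule poisson_equation[OF v])
  have "m \<ge> 0" unfolding m_def by (intro Bochner_Integration.integral_nonneg cond_var_nonneg)
  define A where "A \<tau> k = (\<integral>\<omega>. iexp (\<tau> * mart u k \<omega>) \<partial>M)" for \<tau> k
  define B where "B \<tau> k = (\<integral>\<omega>. iexp (\<tau> * mart u k \<omega>) * of_real (w (chain k \<omega>)) \<partial>M)" for \<tau> k
  define V where "V \<tau> k = (\<integral>\<omega>. iexp (\<tau> * mart u k \<omega>) * of_real (v (chain k \<omega>)) \<partial>M)" for \<tau> k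
  obtain K1 where K1: "\<And>\<tau> k. norm (A \<tau> (Suc k) - A \<tau> k + of_real (\<tau>\<^sup>2 / 2) * V \<tau> k) \<le> K1 * \<bar>\<tau>\<bar> ^ 3"
    by (rule mart_char_step[OF u, folded v_def, folded A_def V_def]) (rule that)
  obtain K2 where K2: "\<And>\<tau> k. norm (V \<tau> k - (of_real m * A \<tau> k + B \<tau> k - B \<tau> (Suc k))) \<le> K2 * \<bar>\<tau>\<bar>"
    by (rule mart_char_poisson_step[OF u v pe w, folded A_def B_def V_def]) (rule that)
  obtain K3 where K3: "\<And>k. (\<integral>\<omega>. \<bar>w (chain k \<omega>)\<bar> \<partial>M) \<le> K3" using chain_abs_moment_bounded[OF w] by metis
  have Bb: "norm (B \<tau> k) \<le> K3" for \<tau> k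
  proof -
    have "norm (B \<tau> k) \<le> (\<integral>\<omega>. norm (iexp (\<tau> * mart u k \<omega>) * of_real (w (chain k \<omega>))) \<partial>M)"
      unfolding B_def by (rule integral_norm_bound)
    also have "\<dots> = (\<integral>\<omega>. \<bar>w (chain k \<omega>)\<bar> \<partial>M)" by (simp add: norm_mult)
    finally show ?thesis using K3[of k] by linarith
  qed
  have K3nn: "0 \<le> K3" using Bb[of 0 0] norm_ge_zero order_trans by blast
  define E where "E \<tau> k = A \<tau> k - of_real (\<tau>\<^sup>2 / 2) * B \<tau> k" for \<tau> k
  define \<kappa> where "\<kappa> = K1 + K2 / 2 + m * K3 / 4"
  have stepE: "norm (E \<tau> (Suc k) - of_real (1 - \<tau>\<^sup>2 * m / 2) * E \<tau> k) \<le> \<kappa> * \<bar>\<tau>\<bar> ^ 3" if "\<bar>\<tau>\<bar> \<le> 1" for \<tau> k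
  proof -
    have t2': "\<bar>\<tau>\<bar> * \<bar>\<tau>\<bar> = \<tau>\<^sup>2" by (simp add: power2_eq_square abs_mult[symmetric])
    have t3: "\<bar>\<tau>\<bar> ^ 3 = \<tau>\<^sup>2 * \<bar>\<tau>\<bar>" by (simp only: power3_eq_cube t2')
    let ?a = "A \<tau> (Suc k) - A \<tau> k + of_real (\<tau>\<^sup>2 / 2) * V \<tau> k"
    let ?b = "V \<tau> k - (of_real m * A \<tau> k + B \<tau> k - B \<tau> (Suc k))"
    have eq: "E \<tau> (Suc k) - of_real (1 - \<tau>\<^sup>2 * m / 2) * E \<tau> k
       = ?a - of_real (\<tau>\<^sup>2 / 2) * ?b - of_real (\<tau>\<^sup>2 / 2 * (\<tau>\<^sup>2 * m / 2)) * B \<tau> k"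
    proof -
      define c where "c = complex_of_real (\<tau>\<^sup>2 / 2)"
      have h: "complex_of_real (1 - \<tau>\<^sup>2 * m / 2) = 1 - c * of_real m"
        "complex_of_real (\<tau>\<^sup>2 / 2 * (\<tau>\<^sup>2 * m / 2)) = c * (c * of_real m)" by (simp_all add: c_def)
      show ?thesis unfolding E_def h c_def[symmetric] by (simp add: algebra_simps)
    qed
    have "norm (E \<tau> (Suc k) - of_real (1 - \<tau>\<^sup>2 * m / 2) * E \<tau> k) \<le> norm ?a + norm (of_real (\<tau>\<^sup>2 / 2) * ?b) + norm (of_real (\<tau>\<^sup>2 / 2 * (\<tau>\<^sup>2 * m / 2)) * B \<tau> k)"
      unfolding eq by (rule order_trans[OF norm_triangle_ineq4 add_right_mono[OF norm_triangle_ineq4]])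
    also have "\<dots> \<le> K1 * \<bar>\<tau>\<bar> ^ 3 + \<tau>\<^sup>2 / 2 * (K2 * \<bar>\<tau>\<bar>) + \<tau>\<^sup>2 / 2 * (\<tau>\<^sup>2 * m / 2) * K3"
    proof -
      have 2: "norm (of_real (\<tau>\<^sup>2 / 2) * ?b) \<le> \<tau>\<^sup>2 / 2 * (K2 * \<bar>\<tau>\<bar>)"
        using mult_left_mono[OF K2[of \<tau> k], of "\<tau>\<^sup>2 / 2"] by (simp only: norm_mult norm_of_real) simp
      have "0 \<le> \<tau>\<^sup>2 / 2 * (\<tau>\<^sup>2 * m / 2)" using \<open>m \<ge> 0\<close> by simp
      then have 3: "norm (of_real (\<tau>\<^sup>2 / 2 * (\<tau>\<^sup>2 * m / 2)) * B \<tau> k) \<le> \<tau>\<^sup>2 / 2 * (\<tau>\<^sup>2 * m / 2) * K3"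
        using mult_left_mono[OF Bb[of \<tau> k]] by (simp only: norm_mult norm_of_real abs_of_nonneg)
      show ?thesis by (rule add_mono[OF add_mono[OF K1[of \<tau> k] 2] 3])
    qed
    also have "\<tau>\<^sup>2 / 2 * (K2 * \<bar>\<tau>\<bar>) = K2 / 2 * \<bar>\<tau>\<bar> ^ 3"
      unfolding t3 by simp
    also have "\<tau>\<^sup>2 / 2 * (\<tau>\<^sup>2 * m / 2) * K3 = m * K3 / 4 * (\<bar>\<tau>\<bar> ^ 3 * \<bar>\<tau>\<bar>)"
      unfolding t3 mult.assoc t2' by simp
    also have "\<dots> \<le> m * K3 / 4 * (\<bar>\<tau>\<bar> ^ 3 * 1)"
      using that \<open>m \<ge> 0\<close> K3nn by (intro mult_left_mono) auto
    finally show ?thesis unfolding \<kappa>_def by (simp add: distrib_right)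
  qed
  have iterE: "norm (E \<tau> k - of_real ((1 - \<tau>\<^sup>2 * m / 2) ^ k) * E \<tau> 0) \<le> real k * (\<kappa> * \<bar>\<tau>\<bar> ^ 3)"
    if "\<bar>\<tau>\<bar> \<le> 1" "\<tau>\<^sup>2 * m \<le> 2" for \<tau> k
  proof (induction k)
    case (Suc k)
    let ?l = "1 - \<tau>\<^sup>2 * m / 2"
    have l: "\<bar>?l\<bar> \<le> 1" using that \<open>m \<ge> 0\<close> by (simp add: abs_le_iff)
    have eq: "E \<tau> (Suc k) - of_real (?l ^ Suc k) * E \<tau> 0
      = (E \<tau> (Suc k) - of_real ?l * E \<tau> k) + of_real ?l * (E \<tau> k - of_real (?l ^ k) * E \<tau> 0)"
      by (simp add: algebra_simps)
    have "norm (E \<tau> (Suc k) - of_real (?l ^ Suc k) * E \<tau> 0) \<le> norm (E \<tau> (Suc k) - of_real ?l * E \<tau> k) + norm (complex_of_real ?l) * norm (E \<tau> k - of_real (?l ^ k) * E \<tau> 0)"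
      unfolding eq norm_mult[symmetric] by (rule norm_triangle_ineq)
    also have "\<dots> \<le> \<kappa> * \<bar>\<tau>\<bar> ^ 3 + 1 * (real k * (\<kappa> * \<bar>\<tau>\<bar> ^ 3))"
    proof -
      have "norm (complex_of_real ?l) * norm (E \<tau> k - of_real (?l ^ k) * E \<tau> 0) \<le> 1 * (real k * (\<kappa> * \<bar>\<tau>\<bar> ^ 3))"
        unfolding norm_of_real by (rule mult_mono[OF l Suc.IH]) simp_all
      then show ?thesis by (rule add_mono[OF stepE[OF that(1)]])
    qed
    finally show ?case by (simp add: algebra_simps)
  qed simp
  have E0: "E \<tau> 0 = 1 - of_real (\<tau>\<^sup>2 / 2) * B \<tau> 0" for \<tau> unfolding E_def A_def by (simp add: prob_space)
  define t where "t N = 1 / sqrt (real N)" for N :: nat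
  have t2: "(t N)\<^sup>2 = 1 / real N" for N by (simp add: t_def power_divide)
  have t0: "t \<longlonglongrightarrow> 0" unfolding t_def
    using tendsto_inverse_0_at_top[OF filterlim_compose[OF sqrt_at_top filterlim_real_sequentially]] by (simp add: inverse_eq_divide)
  have bound: "norm (A (t N) N - of_real ((1 - m / 2 / real N) ^ N)) \<le> \<bar>\<kappa>\<bar> * t N + (t N)\<^sup>2 * K3"
    if N: "N \<ge> 1" "real N \<ge> m" for N
  proof -
    have tle: "\<bar>t N\<bar> \<le> 1" using N by (simp add: t_def divide_le_eq)
    have tm: "(t N)\<^sup>2 * m \<le> 2" using N by (simp add: t2 divide_le_eq)
    let ?l = "(1 - (t N)\<^sup>2 * m / 2) ^ N"
    have lle: "\<bar>?l\<bar> \<le> 1" unfolding power_abs using tm \<open>m \<ge> 0\<close> by (intro power_le_one) (auto simp: abs_le_iff)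
    have Nt: "real N * \<bar>t N\<bar> ^ 3 = t N"
    proof -
      have "\<bar>t N\<bar> = t N" by (simp add: t_def)
      moreover have "real N * ((t N)\<^sup>2 * t N) = t N" using N by (simp add: t2)
      ultimately show ?thesis by (simp add: power3_eq_cube power2_eq_square mult_ac)
    qed
    have eq: "A (t N) N - of_real ?l = (E (t N) N - of_real ?l * E (t N) 0)
        + of_real ((t N)\<^sup>2 / 2) * B (t N) N - of_real ?l * (of_real ((t N)\<^sup>2 / 2) * B (t N) 0)"
      unfolding E0 unfolding E_def by (simp add: algebra_simps)
    have "norm (A (t N) N - of_real ?l) \<le> norm (E (t N) N - of_real ?l * E (t N) 0)
        + norm (of_real ((t N)\<^sup>2 / 2) * B (t N) N) + norm (of_real ?l * (of_real ((t N)\<^sup>2 / 2) * B (t N) 0))"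
      unfolding eq by (rule order_trans[OF norm_triangle_ineq4 add_right_mono[OF norm_triangle_ineq]])
    also have "\<dots> \<le> real N * (\<kappa> * \<bar>t N\<bar> ^ 3) + (t N)\<^sup>2 / 2 * K3 + 1 * ((t N)\<^sup>2 / 2 * K3)"
    proof -
      have 2: "norm (of_real ((t N)\<^sup>2 / 2) * B (t N) N) \<le> (t N)\<^sup>2 / 2 * K3"
        unfolding norm_mult norm_of_real using Bb by (simp add: mult_left_mono)
      have 3: "norm (of_real ?l * (of_real ((t N)\<^sup>2 / 2) * B (t N) 0)) \<le> 1 * ((t N)\<^sup>2 / 2 * K3)"
        unfolding norm_mult norm_of_real using lle Bb[of "t N" 0] by (intro mult_mono) (auto simp: mult_left_mono)
      show ?thesis by (rule add_mono[OF add_mono[OF iterE[OF tle tm] 2] 3])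
    qed
    also have "real N * (\<kappa> * \<bar>t N\<bar> ^ 3) = \<kappa> * t N" using Nt by (simp add: mult.left_commute)
    also have "\<kappa> * t N \<le> \<bar>\<kappa>\<bar> * t N" by (intro mult_right_mono) (auto simp: t_def)
    finally have "norm (A (t N) N - of_real ?l) \<le> \<bar>\<kappa>\<bar> * t N + (t N)\<^sup>2 / 2 * K3 + 1 * ((t N)\<^sup>2 / 2 * K3)" by simp
    moreover have "?l = (1 - m / 2 / real N) ^ N" by (simp add: t2 mult.commute)
    moreover have "(t N)\<^sup>2 / 2 * K3 + 1 * ((t N)\<^sup>2 / 2 * K3) = (t N)\<^sup>2 * K3" by simp
    ultimately show ?thesis by (simp only: add.assoc)
  qed
  have lim0: "(\<lambda>N. \<bar>\<kappa>\<bar> * t N + (t N)\<^sup>2 * K3) \<longlonglongrightarrow> 0"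
    by (rule tendsto_eq_intros t0 refl)+ simp
  have ev: "\<forall>\<^sub>F N in sequentially. N \<ge> 1 \<and> real N \<ge> m"
    using eventually_ge_at_top[of "max 1 (nat \<lceil>m\<rceil>)"] by eventually_elim (simp add: nat_le_iff ceiling_le_iff)
  have d0: "(\<lambda>N. A (t N) N - of_real ((1 - m / 2 / real N) ^ N)) \<longlonglongrightarrow> 0"
    by (rule Lim_null_comparison[OF eventually_mono[OF ev] lim0]) (use bound in auto)
  have "(\<lambda>N. (1 + (- m / 2) / real N) ^ N) \<longlonglongrightarrow> exp (- m / 2)"
    by (rule tendsto_exp_limit_sequentially)
  then have "(\<lambda>N. (1 - m / 2 / real N) ^ N) \<longlonglongrightarrow> exp (- m / 2)" by simp
  then have "(\<lambda>N. complex_of_real ((1 - m / 2 / real N) ^ N)) \<longlonglongrightarrow> of_real (exp (- m / 2))"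
    by (rule tendsto_of_real)
  from tendsto_add[OF d0 this] show ?thesis unfolding A_def t_def by simp
qed

text \<open>
  By the Poisson equation the centred sum differs from the martingale by the two boundary terms
  \<open>P u (X\<^sub>0) - P u (X\<^sub>N)\<close>, which are bounded in mean and vanish after
  division by \<open>sqrt N\<close>. Hence the limit is the same for every initial law.
\<close>

theorem chain_clt:
  assumes f: "poly_hoelder f"
  shows "(\<lambda>N. \<integral>\<omega>. iexp (1 / sqrt (real N) * (\<Sum>k=1..N. f (chain k \<omega>) - (\<integral>x. f x \<partial>\<pi>))) \<partial>M)
     \<longlonglongrightarrow> exp (- asym_cov f f / 2)"
proof -
  define u where "u = poisson f"
  have u: "poly_hoelder u" unfolding u_def by (rule poisson_poly_hoelder[OF f])
  have pe: "f x - (\<integral>x. f x \<partial>\<pi>) = u x - P u x" for x unfolding u_def by (rule poisson_equation[OF f, symmetric])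
  note [measurable] = poly_hoelder_measurable[OF f] P_measurable[OF u] measurable_Fil[OF mart_measurable_Fil[OF u]]
  define S where "S N \<omega> = (\<Sum>k=1..N. f (chain k \<omega>) - (\<integral>x. f x \<partial>\<pi>))" for N \<omega>
  have [measurable]: "S N \<in> borel_measurable M" for N unfolding S_def by measurable
  have S: "S N \<omega> - mart u N \<omega> = P u (chain 0 \<omega>) - P u (chain N \<omega>)" for N \<omega>
    unfolding S_def pe by (induction N) (simp_all del: chain.simps)
  obtain K where K: "\<And>k. (\<integral>\<omega>. \<bar>P u (chain k \<omega>)\<bar> \<partial>M) \<le> K" using chain_abs_moment_bounded[OF P_poly_hoelder[OF u]] by metis
  define t where "t N = 1 / sqrt (real N)" for N :: nat
  have t0: "t \<longlonglongrightarrow> 0" unfolding t_def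
    using tendsto_inverse_0_at_top[OF filterlim_compose[OF sqrt_at_top filterlim_real_sequentially]] by (simp add: inverse_eq_divide)
  have tnn: "0 \<le> t N" for N by (simp add: t_def)
  have d: "norm ((\<integral>\<omega>. iexp (t N * S N \<omega>) \<partial>M) - (\<integral>\<omega>. iexp (t N * mart u N \<omega>) \<partial>M)) \<le> t N * (2 * K)" for N
  proof -
    have i1: "integrable M (\<lambda>\<omega>. iexp (t N * S N \<omega>))" and i2: "integrable M (\<lambda>\<omega>. iexp (t N * mart u N \<omega>))"
      by (rule integrable_iexp; measurable)+
    have ip: "integrable M (\<lambda>\<omega>. \<bar>P u (chain k \<omega>)\<bar>)" for k
      by (intro integrable_abs chain_integrable P_poly_hoelder u)
    have "norm ((\<integral>\<omega>. iexp (t N * S N \<omega>) \<partial>M) - (\<integral>\<omega>. iexp (t N * mart u N \<omega>) \<partial>M))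
      \<le> (\<integral>\<omega>. norm (iexp (t N * S N \<omega>) - iexp (t N * mart u N \<omega>)) \<partial>M)"
      unfolding Bochner_Integration.integral_diff[OF i1 i2, symmetric] by (rule integral_norm_bound)
    also have "\<dots> \<le> (\<integral>\<omega>. t N * (\<bar>P u (chain 0 \<omega>)\<bar> + \<bar>P u (chain N \<omega>)\<bar>) \<partial>M)"
    proof (rule integral_mono)
      show "integrable M (\<lambda>\<omega>. norm (iexp (t N * S N \<omega>) - iexp (t N * mart u N \<omega>)))"
        using Bochner_Integration.integrable_diff[OF i1 i2] by (rule integrable_norm)
      show "integrable M (\<lambda>\<omega>. t N * (\<bar>P u (chain 0 \<omega>)\<bar> + \<bar>P u (chain N \<omega>)\<bar>))"
        by (intro integrable_mult_right Bochner_Integration.integrable_add ip)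
      fix \<omega>
      have "norm (iexp (t N * S N \<omega>) - iexp (t N * mart u N \<omega>)) \<le> \<bar>t N * (S N \<omega> - mart u N \<omega>)\<bar>"
        using norm_iexp_diff_le by (simp only: right_diff_distrib)
      also have "\<dots> = t N * \<bar>P u (chain 0 \<omega>) - P u (chain N \<omega>)\<bar>"
        unfolding S abs_mult using tnn by simp
      also have "\<dots> \<le> t N * (\<bar>P u (chain 0 \<omega>)\<bar> + \<bar>P u (chain N \<omega>)\<bar>)"
        using tnn by (intro mult_left_mono abs_triangle_ineq4)
      finally show "norm (iexp (t N * S N \<omega>) - iexp (t N * mart u N \<omega>)) \<le> t N * (\<bar>P u (chain 0 \<omega>)\<bar> + \<bar>P u (chain N \<omega>)\<bar>)" .
    qed
    also have "\<dots> = t N * ((\<integral>\<omega>. \<bar>P u (chain 0 \<omega>)\<bar> \<partial>M) + (\<integral>\<omega>. \<bar>P u (chain N \<omega>)\<bar> \<partial>M))"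
      using ip[of 0] ip[of N] by (simp del: chain.simps)
    also have "\<dots> \<le> t N * (K + K)" using tnn by (intro mult_left_mono add_mono K)
    finally show ?thesis by simp
  qed
  have "(\<lambda>N. t N * (2 * K)) \<longlonglongrightarrow> 0" by (rule tendsto_eq_intros t0 refl)+ simp
  then have "(\<lambda>N. (\<integral>\<omega>. iexp (t N * S N \<omega>) \<partial>M) - (\<integral>\<omega>. iexp (t N * mart u N \<omega>) \<partial>M)) \<longlonglongrightarrow> 0"
    by (rule Lim_null_comparison[rotated]) (use d in auto)
  from tendsto_add[OF this mart_char_limit[OF u, folded t_def]] show ?thesis
    unfolding asym_cov_eq_cond_var[OF f, folded u_def] by (simp add: S_def t_def)
qed

end

section \<open>Brownian noise on dyadic grids\<close>

abbreviation noise_space :: "(nat \<times> nat \<Rightarrow> real) measure" where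
  "noise_space \<equiv> PiM UNIV (\<lambda>_. borel)"

definition dyadic_inc :: "(real \<Rightarrow> 'a \<Rightarrow> real) \<Rightarrow> real \<Rightarrow> nat \<Rightarrow> nat \<Rightarrow> 'a \<Rightarrow> real" where
  "dyadic_inc W h m i \<omega> = W (real (Suc i) * h / 2 ^ m) \<omega> - W (real i * h / 2 ^ m) \<omega>"

text \<open>
  Everything that the path of \<open>W\<close> does on the block \<open>[k h, (k + 1) h]\<close>,
  recorded through its increments over all dyadic subintervals. A countable family suffices for a
  continuous path and keeps the state space of the noise a countable product. Indices outside the
  block are padded with 0.
\<close>

definition noise :: "(real \<Rightarrow> 'a \<Rightarrow> real) \<Rightarrow> real \<Rightarrow> nat \<Rightarrow> 'a \<Rightarrow> nat \<times> nat \<Rightarrow> real" where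
  "noise W h k \<omega> = (\<lambda>(m, i). if i < 2 ^ m then dyadic_inc W h m (k * 2 ^ m + i) \<omega> else 0)"

text \<open>
  How the increments of level \<open>m\<close> determine those of a coarser level
  \<open>m'\<close>.
\<close>

definition coarse_inc :: "nat \<Rightarrow> nat \<times> nat \<Rightarrow> (nat \<Rightarrow> real) \<Rightarrow> real" where
  "coarse_inc m = (\<lambda>(m', i) v. if i < 2 ^ m' then \<Sum>l<2 ^ (m - m'). v (i * 2 ^ (m - m') + l) else 0)"

lemma dyadic_inc_refine:
  "dyadic_inc W h m i \<omega> = (\<Sum>l<2 ^ d. dyadic_inc W h (m + d) (i * 2 ^ d + l) \<omega>)"
proof -
  let ?f = "\<lambda>j. W (real j * h / 2 ^ (m + d)) \<omega>"
  have "(\<Sum>l<2 ^ d. dyadic_inc W h (m + d) (i * 2 ^ d + l) \<omega>) = (\<Sum>l<2 ^ d. ?f (i * 2 ^ d + Suc l) - ?f (i * 2 ^ d + l))"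
    by (simp add: dyadic_inc_def)
  also have "\<dots> = ?f (i * 2 ^ d + 2 ^ d) - ?f (i * 2 ^ d + 0)"
    by (rule sum_lessThan_telescope[of "\<lambda>l. ?f (i * 2 ^ d + l)"])
  also have "real (i * 2 ^ d + 2 ^ d) * h / 2 ^ (m + d) = real (Suc i) * h / 2 ^ m"
    by (simp add: power_add field_simps)
  also have "real (i * 2 ^ d + 0) * h / 2 ^ (m + d) = real i * h / 2 ^ m"
    by (simp add: power_add)
  finally show ?thesis by (simp add: dyadic_inc_def)
qed

definition level_algebra :: "'a measure \<Rightarrow> (real \<Rightarrow> 'a \<Rightarrow> real) \<Rightarrow> real \<Rightarrow> nat \<Rightarrow> nat \<Rightarrow> nat \<Rightarrow> 'a measure" where
  "level_algebra M W h m a b =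
     vimage_algebra (space M) (\<lambda>\<omega>. \<lambda>i\<in>{a..<b}. dyadic_inc W h m i \<omega>) (PiM {a..<b} (\<lambda>_. borel))"

lemma sets_vimage_algebra_factor:
  assumes v: "v \<in> X \<rightarrow> space N" and H: "H \<in> measurable N N'" and f: "\<And>x. x \<in> X \<Longrightarrow> f x = H (v x)"
  shows "sets (vimage_algebra X f N') \<subseteq> sets (vimage_algebra X v N)"
proof
  have f': "f \<in> X \<rightarrow> space N'"
  proof
    fix x assume "x \<in> X"
    then show "f x \<in> space N'" using f measurable_space[OF H, of "v x"] Pi_mem[OF v] by metis
  qed
  fix S assume "S \<in> sets (vimage_algebra X f N')"
  then obtain C where C: "C \<in> sets N'" "S = f -` C \<inter> X" unfolding sets_vimage_algebra2[OF f'] by blast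
  have "S = v -` (H -` C \<inter> space N) \<inter> X" using C(2) v f by auto
  moreover have "H -` C \<inter> space N \<in> sets N" using measurable_sets[OF H C(1)] .
  ultimately show "S \<in> sets (vimage_algebra X v N)" unfolding sets_vimage_algebra2[OF v] by blast
qed

lemma space_level_algebra[simp]: "space (level_algebra M W h m a b) = space M"
  by (simp add: level_algebra_def)

lemma level_algebra_mono:
  assumes "a' \<le> a * 2 ^ d" "b * 2 ^ d \<le> b'"
  shows "sets (level_algebra M W h m a b) \<subseteq> sets (level_algebra M W h (m + d) a' b')"
  unfolding level_algebra_def
proof (rule sets_vimage_algebra_factor)
  let ?H = "\<lambda>v. \<lambda>i\<in>{a..<b}. \<Sum>l<2 ^ d. v (i * 2 ^ d + l) :: real"
  have in_range: "i * 2 ^ d + l \<in> {a'..<b'}" if "i \<in> {a..<b}" "l < 2 ^ d" for i l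
  proof -
    have "a * 2 ^ d \<le> i * 2 ^ d" using that by simp
    moreover have "Suc i * 2 ^ d \<le> b * 2 ^ d" using that by (intro mult_right_mono) auto
    moreover have "Suc i * 2 ^ d = i * 2 ^ d + 2 ^ d" by simp
    ultimately have "a' \<le> i * 2 ^ d + l" "i * 2 ^ d + l < b'" using assms that(2) by linarith+
    then show ?thesis by simp
  qed
  show "?H \<in> measurable (PiM {a'..<b'} (\<lambda>_. borel)) (PiM {a..<b} (\<lambda>_. borel))"
    using in_range by (intro measurable_restrict borel_measurable_sum measurable_component_singleton) auto
  show "(\<lambda>i\<in>{a..<b}. dyadic_inc W h m i \<omega>) = ?H (\<lambda>i\<in>{a'..<b'}. dyadic_inc W h (m + d) i \<omega>)" for \<omega>
  proof (rule restrict_ext)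
    fix i assume i: "i \<in> {a..<b}"
    show "dyadic_inc W h m i \<omega> = (\<Sum>l<2 ^ d. (\<lambda>i\<in>{a'..<b'}. dyadic_inc W h (m + d) i \<omega>) (i * 2 ^ d + l))"
      unfolding dyadic_inc_refine[of W h m i \<omega> d] using in_range[OF i] by (intro sum.cong refl) auto
  qed
qed (auto simp: space_PiM)

lemma level_algebra_component:
  assumes "i \<in> {a..<b}"
  shows "dyadic_inc W h m i \<in> borel_measurable (level_algebra M W h m a b)"
proof -
  have "(\<lambda>\<omega>. \<lambda>i\<in>{a..<b}. dyadic_inc W h m i \<omega>) \<in> measurable (level_algebra M W h m a b) (PiM {a..<b} (\<lambda>_. borel))"
    unfolding level_algebra_def by (rule measurable_vimage_algebra1) (auto simp: space_PiM)
  from measurable_compose[OF this measurable_component_singleton[OF assms]] show ?thesis using assms by simp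
qed

text \<open>
  Events decided by finitely many dyadic increments before time \<open>k h\<close>. Levels are
  nested, so these events are closed under intersection, although their union over all levels is
  no \<open>\<sigma>\<close>-algebra.
\<close>

definition past_sets :: "'a measure \<Rightarrow> (real \<Rightarrow> 'a \<Rightarrow> real) \<Rightarrow> real \<Rightarrow> nat \<Rightarrow> 'a set set" where
  "past_sets M W h k = (\<Union>m. sets (level_algebra M W h m 0 (k * 2 ^ m)))"

definition future_sets :: "'a measure \<Rightarrow> (real \<Rightarrow> 'a \<Rightarrow> real) \<Rightarrow> real \<Rightarrow> nat \<Rightarrow> 'a set set" where
  "future_sets M W h k = (\<Union>m. sets (level_algebra M W h m (k * 2 ^ m) (Suc k * 2 ^ m)))"

definition past_rects :: "'a measure \<Rightarrow> (real \<Rightarrow> 'a \<Rightarrow> real) \<Rightarrow> real \<Rightarrow> ('a \<Rightarrow> real) \<Rightarrow> nat \<Rightarrow> 'a set set" where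
  "past_rects M W h \<zeta> k = {(\<zeta> -` A \<inter> space M) \<inter> B | A B. A \<in> sets borel \<and> B \<in> past_sets M W h k}"

text \<open>
  The past also contains the initial condition. It is generated by rectangles, an
  intersection-stable family on which independence from the future can be read off directly.
\<close>

definition past_filtration :: "'a measure \<Rightarrow> (real \<Rightarrow> 'a \<Rightarrow> real) \<Rightarrow> real \<Rightarrow> ('a \<Rightarrow> real) \<Rightarrow> nat \<Rightarrow> 'a measure" where
  "past_filtration M W h \<zeta> k = sigma (space M) (past_rects M W h \<zeta> k)"

lemma past_level_up:
  assumes "m \<le> m'" shows "sets (level_algebra M W h m 0 (k * 2 ^ m)) \<subseteq> sets (level_algebra M W h m' 0 (k * 2 ^ m'))"
  using level_algebra_mono[of 0 0 "m' - m" "k * 2 ^ m" "k * 2 ^ m'" M W h m] assms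
  by (simp add: power_add[symmetric])

lemma future_level_up:
  assumes "m \<le> m'"
  shows "sets (level_algebra M W h m (k * 2 ^ m) (Suc k * 2 ^ m)) \<subseteq> sets (level_algebra M W h m' (k * 2 ^ m') (Suc k * 2 ^ m'))"
proof -
  have "(2::nat) ^ m' = 2 ^ m * 2 ^ (m' - m)" using assms by (simp add: power_add[symmetric])
  then show ?thesis
    using level_algebra_mono[of "k * 2 ^ m'" "k * 2 ^ m" "m' - m" "Suc k * 2 ^ m" "Suc k * 2 ^ m'" M W h m] assms
    by (simp only: mult.assoc le_add_diff_inverse order_refl simp_thms)
qed

lemma past_sets_common_level:
  assumes "A \<in> past_sets M W h k" "B \<in> past_sets M W h k"
  obtains m where "A \<in> sets (level_algebra M W h m 0 (k * 2 ^ m))" "B \<in> sets (level_algebra M W h m 0 (k * 2 ^ m))"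
proof -
  obtain m1 m2 where m1: "A \<in> sets (level_algebra M W h m1 0 (k * 2 ^ m1))"
    and m2: "B \<in> sets (level_algebra M W h m2 0 (k * 2 ^ m2))"
    using assms unfolding past_sets_def by blast
  show ?thesis
    by (rule that[OF past_level_up[THEN subsetD, OF max.cobounded1 m1] past_level_up[THEN subsetD, OF max.cobounded2 m2]])
qed

lemma Int_stable_past_rects: "Int_stable (past_rects M W h \<zeta> k)"
  unfolding Int_stable_def
proof (intro ballI)
  fix R S assume "R \<in> past_rects M W h \<zeta> k" "S \<in> past_rects M W h \<zeta> k"
  then obtain A B A' B' where *: "A \<in> sets borel" "B \<in> past_sets M W h k" "R = (\<zeta> -` A \<inter> space M) \<inter> B"
    "A' \<in> sets borel" "B' \<in> past_sets M W h k" "S = (\<zeta> -` A' \<inter> space M) \<inter> B'"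
    unfolding past_rects_def by blast
  obtain m where "B \<in> sets (level_algebra M W h m 0 (k * 2 ^ m))" "B' \<in> sets (level_algebra M W h m 0 (k * 2 ^ m))"
    using past_sets_common_level[OF *(2,5)] .
  then have "B \<inter> B' \<in> past_sets M W h k" unfolding past_sets_def by blast
  moreover have "R \<inter> S = (\<zeta> -` (A \<inter> A') \<inter> space M) \<inter> (B \<inter> B')" using * by auto
  moreover have "A \<inter> A' \<in> sets borel" using * by blast
  ultimately show "R \<inter> S \<in> past_rects M W h \<zeta> k" unfolding past_rects_def by blast
qed

lemma Int_stable_future_sets: "Int_stable (future_sets M W h k)"
  unfolding Int_stable_def
proof (intro ballI)
  fix A B assume "A \<in> future_sets M W h k" "B \<in> future_sets M W h k"
  then obtain m1 m2 where m1: "A \<in> sets (level_algebra M W h m1 (k * 2 ^ m1) (Suc k * 2 ^ m1))"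
    and m2: "B \<in> sets (level_algebra M W h m2 (k * 2 ^ m2) (Suc k * 2 ^ m2))"
    unfolding future_sets_def by blast
  define m where "m = max m1 m2"
  have "A \<in> sets (level_algebra M W h m (k * 2 ^ m) (Suc k * 2 ^ m))"
    unfolding m_def by (rule future_level_up[THEN subsetD, OF max.cobounded1 m1])
  moreover have "B \<in> sets (level_algebra M W h m (k * 2 ^ m) (Suc k * 2 ^ m))"
    unfolding m_def by (rule future_level_up[THEN subsetD, OF max.cobounded2 m2])
  ultimately have "A \<inter> B \<in> sets (level_algebra M W h m (k * 2 ^ m) (Suc k * 2 ^ m))" by (rule sets.Int)
  then show "A \<inter> B \<in> future_sets M W h k" unfolding future_sets_def by blast
qed

locale brownian =
  fixes M :: "'a measure" and W :: "real \<Rightarrow> 'a \<Rightarrow> real" and h :: real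
  assumes bm: "brownian_motion M W" and h_pos: "h > 0"
begin

sublocale prob_space M using bm by (simp add: brownian_motion_def)

lemma W_meas: "t \<ge> 0 \<Longrightarrow> W t \<in> borel_measurable M"
  using bm by (simp add: brownian_motion_def)

lemma dyadic_inc_meas[measurable]: "dyadic_inc W h m i \<in> borel_measurable M"
  unfolding dyadic_inc_def using h_pos by (intro borel_measurable_diff W_meas) auto

lemma dyadic_inc_distributed:
  "distributed M lborel (dyadic_inc W h m i) (normal_density 0 (sqrt (h / 2 ^ m)))"
proof -
  have *: "real (Suc i) * h / 2 ^ m - real i * h / 2 ^ m = h / 2 ^ m" by (simp add: field_simps)
  have "0 \<le> real i * h / 2 ^ m" "real i * h / 2 ^ m < real (Suc i) * h / 2 ^ m"
    using h_pos by (simp_all add: divide_strict_right_mono)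
  then have "distributed M lborel (\<lambda>\<omega>. W (real (Suc i) * h / 2 ^ m) \<omega> - W (real i * h / 2 ^ m) \<omega>)
      (normal_density 0 (sqrt (real (Suc i) * h / 2 ^ m - real i * h / 2 ^ m)))"
    using bm unfolding brownian_motion_def by blast
  then show ?thesis unfolding * dyadic_inc_def[abs_def] .
qed

lemma dyadic_inc_indep: "indep_vars (\<lambda>_. borel) (\<lambda>i. dyadic_inc W h m (a + i)) {..<n}"
proof -
  define t where "t i = real (a + i) * h / 2 ^ m" for i
  have "0 \<le> t 0" "mono t"
    using h_pos by (auto simp: t_def mono_def intro!: divide_right_mono mult_right_mono)
  then have "indep_vars (\<lambda>_. borel) (\<lambda>i \<omega>. W (t (Suc i)) \<omega> - W (t i) \<omega>) {..<n}"
    using bm unfolding brownian_motion_def by blast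
  then show ?thesis unfolding t_def dyadic_inc_def[abs_def] by simp
qed

lemma level_algebra_sub_events: "sets (level_algebra M W h m a b) \<subseteq> events"
proof
  have meas: "(\<lambda>\<omega>. \<lambda>i\<in>{a..<b}. dyadic_inc W h m i \<omega>) \<in> measurable M (PiM {a..<b} (\<lambda>_. borel))" by measurable
  have f: "(\<lambda>\<omega>. \<lambda>i\<in>{a..<b}. dyadic_inc W h m i \<omega>) \<in> space M \<rightarrow> space (PiM {a..<b} (\<lambda>_. borel))"
    by (auto simp: space_PiM)
  fix S assume "S \<in> sets (level_algebra M W h m a b)"
  then show "S \<in> events"
    unfolding level_algebra_def sets_vimage_algebra2[OF f] using measurable_sets[OF meas] by blast
qed

lemma level_algebra_sub_process:
  "sets (level_algebra M W h m a b) \<subseteq>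
     sets (vimage_algebra (space M) (\<lambda>\<omega>. \<lambda>t\<in>{0..}. W t \<omega>) (PiM {0..} (\<lambda>_. borel)))"
  unfolding level_algebra_def
proof (rule sets_vimage_algebra_factor)
  let ?H = "\<lambda>w. \<lambda>i\<in>{a..<b}. w (real (Suc i) * h / 2 ^ m) - w (real i * h / 2 ^ m) :: real"
  show "?H \<in> measurable (PiM {0..} (\<lambda>_. borel)) (PiM {a..<b} (\<lambda>_. borel))"
    using h_pos by (intro measurable_restrict borel_measurable_diff measurable_component_singleton) auto
  show "(\<lambda>i\<in>{a..<b}. dyadic_inc W h m i \<omega>) = ?H (\<lambda>t\<in>{0..}. W t \<omega>)" for \<omega>
    using h_pos by (intro restrict_ext) (simp add: dyadic_inc_def)
qed (auto simp: space_PiM)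

lemma level_past_future_indep:
  assumes B: "B \<in> sets (level_algebra M W h m 0 c)" and D: "D \<in> sets (level_algebra M W h m c d)" and "c \<le> d"
  shows "prob (B \<inter> D) = prob B * prob D"
proof -
  let ?v = "\<lambda>a b \<omega>. \<lambda>i\<in>{a..<b}. dyadic_inc W h m i \<omega>"
  have f: "?v a b \<in> space M \<rightarrow> space (PiM {a..<b} (\<lambda>_. borel))" for a b by (auto simp: space_PiM)
  have "indep_var (PiM {0..<c} (\<lambda>_. borel)) (?v 0 c) (PiM {c..<d} (\<lambda>_. borel)) (?v c d)"
    using dyadic_inc_indep[of m 0 d] \<open>c \<le> d\<close> by (intro indep_var_restrict[of _ _ "{..<d}"]) auto
  from indep_varD[OF this]
  have *: "prob ((\<lambda>x. (?v 0 c x, ?v c d x)) -` (A \<times> C) \<inter> space M) = prob (?v 0 c -` A \<inter> space M) * prob (?v c d -` C \<inter> space M)"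
    if "A \<in> sets (PiM {0..<c} (\<lambda>_. borel))" "C \<in> sets (PiM {c..<d} (\<lambda>_. borel))" for A C using that by blast
  obtain A where A: "A \<in> sets (PiM {0..<c} (\<lambda>_. borel))" "B = ?v 0 c -` A \<inter> space M"
    using B unfolding level_algebra_def sets_vimage_algebra2[OF f] by blast
  obtain C where C: "C \<in> sets (PiM {c..<d} (\<lambda>_. borel))" "D = ?v c d -` C \<inter> space M"
    using D unfolding level_algebra_def sets_vimage_algebra2[OF f] by blast
  have "B \<inter> D = (\<lambda>x. (?v 0 c x, ?v c d x)) -` (A \<times> C) \<inter> space M" using A C by auto
  then show ?thesis using *[OF A(1) C(1)] A(2) C(2) by simp
qed

lemma past_sub_events: "past_sets M W h k \<subseteq> events"
  unfolding past_sets_def using level_algebra_sub_events by blast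

lemma future_sub_events: "future_sets M W h k \<subseteq> events"
  unfolding future_sets_def using level_algebra_sub_events by blast

lemma past_rects_sub_events:
  assumes "\<zeta> \<in> borel_measurable M" shows "past_rects M W h \<zeta> k \<subseteq> events"
  unfolding past_rects_def using past_sub_events measurable_sets[OF assms] by blast

lemma past_rects_space: "past_rects M W h \<zeta> k \<subseteq> Pow (space M)"
  unfolding past_rects_def by blast

lemma sets_past_filtration: "sets (past_filtration M W h \<zeta> k) = sigma_sets (space M) (past_rects M W h \<zeta> k)"
  unfolding past_filtration_def using past_rects_space by (rule sets_measure_of)

lemma space_past_filtration: "space (past_filtration M W h \<zeta> k) = space M"
  unfolding past_filtration_def using past_rects_space by (rule space_measure_of)

lemma past_filtration_sub:
  assumes "\<zeta> \<in> borel_measurable M" shows "subalgebra M (past_filtration M W h \<zeta> k)"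
  unfolding subalgebra_def sets_past_filtration space_past_filtration
  using sets.sigma_sets_subset[OF past_rects_sub_events[OF assms]] by simp

lemma past_sets_in_filtration: "B \<in> past_sets M W h k \<Longrightarrow> B \<in> sets (past_filtration M W h \<zeta> k)"
proof -
  assume B: "B \<in> past_sets M W h k"
  then have "B \<subseteq> space M" using past_sub_events sets.sets_into_space by blast
  then have "B = (\<zeta> -` UNIV \<inter> space M) \<inter> B" by auto
  moreover have "(\<zeta> -` UNIV \<inter> space M) \<inter> B \<in> past_rects M W h \<zeta> k"
    unfolding past_rects_def using B by (intro CollectI exI[of _ UNIV] exI[of _ B] conjI refl) auto
  ultimately have "B \<in> past_rects M W h \<zeta> k" by simp
  then show ?thesis unfolding sets_past_filtration by blast
qed

lemma past_sets_mono: "past_sets M W h k \<subseteq> past_sets M W h (Suc k)"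
  unfolding past_sets_def
proof (intro UN_mono subset_refl)
  show "sets (level_algebra M W h m 0 (k * 2 ^ m)) \<subseteq> sets (level_algebra M W h m 0 (Suc k * 2 ^ m))" for m
    using level_algebra_mono[of 0 0 0 "k * 2 ^ m" "Suc k * 2 ^ m" M W h m] by simp
qed

lemma past_filtration_mono:
  "subalgebra (past_filtration M W h \<zeta> (Suc k)) (past_filtration M W h \<zeta> k)"
proof -
  have "past_rects M W h \<zeta> k \<subseteq> past_rects M W h \<zeta> (Suc k)"
    unfolding past_rects_def using past_sets_mono by blast
  then show ?thesis
    unfolding subalgebra_def sets_past_filtration space_past_filtration by (simp add: sigma_sets_mono')
qed

lemma initial_meas_past: "\<zeta> \<in> borel_measurable (past_filtration M W h \<zeta> 0)"
proof (rule measurableI)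
  fix A :: "real set" assume A: "A \<in> sets borel"
  have "space M \<in> past_sets M W h 0"
    unfolding past_sets_def using sets.top[of "level_algebra M W h 0 0 (0 * 2 ^ 0)"] by auto
  then have "\<zeta> -` A \<inter> space M \<in> past_rects M W h \<zeta> 0"
    unfolding past_rects_def using A by blast
  then show "\<zeta> -` A \<inter> space (past_filtration M W h \<zeta> 0) \<in> sets (past_filtration M W h \<zeta> 0)"
    unfolding sets_past_filtration space_past_filtration by blast
qed simp

lemma noise_meas_gen:
  assumes "\<And>m i. i < 2 ^ m \<Longrightarrow> dyadic_inc W h m (k * 2 ^ m + i) \<in> borel_measurable N"
  shows "noise W h k \<in> measurable N noise_space"
proof (rule measurable_PiM_single')
  fix p :: "nat \<times> nat"
  obtain m i where p: "p = (m, i)" by (cases p)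
  show "(\<lambda>\<omega>. noise W h k \<omega> p) \<in> borel_measurable N"
    using assms[of i m] by (cases "i < 2 ^ m") (simp_all add: p noise_def)
qed auto

lemma noise_meas_past: "noise W h k \<in> measurable (past_filtration M W h \<zeta> (Suc k)) noise_space"
proof (rule noise_meas_gen)
  fix m i :: nat assume "i < 2 ^ m"
  then have c: "dyadic_inc W h m (k * 2 ^ m + i) \<in> borel_measurable (level_algebra M W h m 0 (Suc k * 2 ^ m))"
    by (intro level_algebra_component) auto
  have "subalgebra (past_filtration M W h \<zeta> (Suc k)) (level_algebra M W h m 0 (Suc k * 2 ^ m))"
    unfolding subalgebra_def space_past_filtration space_level_algebra
  proof (intro conjI refl subsetI)
    fix S assume "S \<in> sets (level_algebra M W h m 0 (Suc k * 2 ^ m))"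
    then have "S \<in> past_sets M W h (Suc k)" unfolding past_sets_def by blast
    then show "S \<in> sets (past_filtration M W h \<zeta> (Suc k))" by (rule past_sets_in_filtration)
  qed
  then show "dyadic_inc W h m (k * 2 ^ m + i) \<in> borel_measurable (past_filtration M W h \<zeta> (Suc k))"
    using c by (rule measurable_from_subalg)
qed

lemma noise_measurable[measurable]: "noise W h k \<in> measurable M noise_space"
  by (rule noise_meas_gen) measurable

text \<open>
  On a common dyadic level past and future increments are disjoint subfamilies of an independent
  family, and the initial condition is independent of both together. This gives independence of
  two intersection-stable generators, which extends to the generated
  \<open>\<sigma>\<close>-algebras.
\<close>

lemma noise_indep_past:
  assumes \<zeta>: "\<zeta> \<in> borel_measurable M" and ind: "independent_of_process M \<zeta> W"
    and A: "A \<in> sets (past_filtration M W h \<zeta> k)" and B: "B \<in> sets noise_space"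
  shows "prob (A \<inter> (noise W h k -` B \<inter> space M)) = prob A * prob (noise W h k -` B \<inter> space M)"
proof -
  let ?SW = "vimage_algebra (space M) (\<lambda>\<omega>. \<lambda>t\<in>{0..}. W t \<omega>) (PiM {0..} (\<lambda>_. borel))"
  have zsets: "\<zeta> -` C \<inter> space M \<in> sets (vimage_algebra (space M) \<zeta> borel)" if "C \<in> sets borel" for C
    using that by (rule in_vimage_algebra)
  have iz: "prob ((\<zeta> -` C \<inter> space M) \<inter> B) = prob (\<zeta> -` C \<inter> space M) * prob B" if "C \<in> sets borel" "B \<in> sets ?SW" for C B
    using indep_setD[OF ind[unfolded independent_of_process_def] zsets[OF that(1)] that(2)] .
  have "indep_set (past_rects M W h \<zeta> k) (future_sets M W h k)"
  proof (rule indep_setI)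
    fix R D assume "R \<in> past_rects M W h \<zeta> k" and D: "D \<in> future_sets M W h k"
    then obtain C B where R: "C \<in> sets borel" "B \<in> past_sets M W h k" "R = (\<zeta> -` C \<inter> space M) \<inter> B"
      unfolding past_rects_def by blast
    obtain m1 m2 where mB: "B \<in> sets (level_algebra M W h m1 0 (k * 2 ^ m1))"
      and mD: "D \<in> sets (level_algebra M W h m2 (k * 2 ^ m2) (Suc k * 2 ^ m2))"
      using R(2) D unfolding past_sets_def future_sets_def by blast
    define m where "m = max m1 m2"
    have B: "B \<in> sets (level_algebra M W h m 0 (k * 2 ^ m))"
      unfolding m_def by (rule past_level_up[THEN subsetD, OF max.cobounded1 mB])
    have D': "D \<in> sets (level_algebra M W h m (k * 2 ^ m) (Suc k * 2 ^ m))"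
      unfolding m_def by (rule future_level_up[THEN subsetD, OF max.cobounded2 mD])
    have SW: "B \<in> sets ?SW" "D \<in> sets ?SW" using B D' level_algebra_sub_process by blast+
    have "prob (R \<inter> D) = prob ((\<zeta> -` C \<inter> space M) \<inter> (B \<inter> D))" unfolding R(3) by (simp add: Int_assoc)
    also have "\<dots> = prob (\<zeta> -` C \<inter> space M) * prob (B \<inter> D)" using SW by (intro iz R(1)) blast
    also have "prob (B \<inter> D) = prob B * prob D" by (rule level_past_future_indep[OF B D']) simp
    also have "prob (\<zeta> -` C \<inter> space M) * (prob B * prob D) = prob R * prob D"
      unfolding R(3) iz[OF R(1) SW(1)] by simp
    finally show "prob (R \<inter> D) = prob R * prob D" .
  qed (rule past_rects_sub_events[OF \<zeta>], rule future_sub_events)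
  then have isig: "indep_set (sigma_sets (space M) (past_rects M W h \<zeta> k)) (sigma_sets (space M) (future_sets M W h k))"
    using Int_stable_past_rects Int_stable_future_sets by (rule indep_set_sigma_sets)
  have fp: "future_sets M W h k \<subseteq> Pow (space M)" using future_sub_events sets.sets_into_space by blast
  have "noise W h k \<in> measurable (sigma (space M) (future_sets M W h k)) noise_space"
  proof (rule noise_meas_gen)
    fix m i :: nat assume "i < 2 ^ m"
    then have c: "dyadic_inc W h m (k * 2 ^ m + i) \<in> borel_measurable (level_algebra M W h m (k * 2 ^ m) (Suc k * 2 ^ m))"
      by (intro level_algebra_component) auto
    have "subalgebra (sigma (space M) (future_sets M W h k)) (level_algebra M W h m (k * 2 ^ m) (Suc k * 2 ^ m))"
      unfolding subalgebra_def using fp by (auto simp: future_sets_def)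
    then show "dyadic_inc W h m (k * 2 ^ m + i) \<in> borel_measurable (sigma (space M) (future_sets M W h k))"
      using c by (rule measurable_from_subalg)
  qed
  from measurable_sets[OF this B] have "noise W h k -` B \<inter> space M \<in> sigma_sets (space M) (future_sets M W h k)"
    using fp by (simp add: space_measure_of sets_measure_of)
  then show ?thesis using indep_setD[OF isig] A unfolding sets_past_filtration by blast
qed

lemma level_distr:
  "distr M (PiM {..<2 ^ m} (\<lambda>_. borel)) (\<lambda>\<omega>. \<lambda>i\<in>{..<2 ^ m}. dyadic_inc W h m (k * 2 ^ m + i) \<omega>)
     = PiM {..<2 ^ m} (\<lambda>_. density lborel (\<lambda>x. ennreal (normal_density 0 (sqrt (h / 2 ^ m)) x)))"
proof -
  have "distr M (PiM {..<2 ^ m} (\<lambda>_. borel)) (\<lambda>\<omega>. \<lambda>i\<in>{..<2 ^ m}. dyadic_inc W h m (k * 2 ^ m + i) \<omega>)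
    = PiM {..<2 ^ m} (\<lambda>i. distr M borel (dyadic_inc W h m (k * 2 ^ m + i)))"
    using dyadic_inc_indep[of m "k * 2 ^ m" "2 ^ m"]
    by (subst (asm) indep_vars_iff_distr_eq_PiM') (auto simp: lessThan_empty_iff)
  also have "\<dots> = PiM {..<2 ^ m} (\<lambda>_. density lborel (\<lambda>x. ennreal (normal_density 0 (sqrt (h / 2 ^ m)) x)))"
    using dyadic_inc_distributed by (intro PiM_cong refl) (auto simp: distributed_def cong: distr_cong)
  finally show ?thesis .
qed

text \<open>
  A cylinder event involves finitely many levels, hence is a function of the increments of one
  fine level, which are independent normal variables whatever the Brownian motion and the block.
\<close>

lemma noise_cylinder:
  fixes J :: "(nat \<times> nat) set"
  assumes J: "finite J" and A: "\<And>p. p \<in> J \<Longrightarrow> A p \<in> sets borel" and m: "\<And>p. p \<in> J \<Longrightarrow> fst p \<le> m"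
  shows "emeasure (distr M noise_space (noise W h k)) (prod_emb UNIV (\<lambda>_. borel) J (Pi\<^sub>E J A))
     = emeasure (PiM {..<2 ^ m} (\<lambda>_. density lborel (\<lambda>x. ennreal (normal_density 0 (sqrt (h / 2 ^ m)) x))))
         {v \<in> space (PiM {..<2 ^ m} (\<lambda>_. borel)). \<forall>p\<in>J. coarse_inc m p v \<in> A p}"
proof -
  let ?N = "PiM {..<2 ^ m} (\<lambda>_. borel :: real measure) :: (nat \<Rightarrow> real) measure"
  let ?C = "{v \<in> space ?N. \<forall>p\<in>J. coarse_inc m p v \<in> A p}"
  let ?v = "\<lambda>\<omega>. \<lambda>i\<in>{..<2 ^ m}. dyadic_inc W h m (k * 2 ^ m + i) \<omega>"
  have idx: "i * 2 ^ (m - m') + l \<in> {..<2 ^ m}" if "(m', i) \<in> J" "i < 2 ^ m'" "l < 2 ^ (m - m')" for m' i l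
  proof -
    have "Suc i * 2 ^ (m - m') \<le> 2 ^ m' * 2 ^ (m - m')" using that by (intro mult_right_mono) auto
    also have "\<dots> = (2::nat) ^ m" using m[OF that(1)] by (simp add: power_add[symmetric])
    finally show ?thesis using that by simp
  qed
  have Rm: "coarse_inc m p \<in> borel_measurable ?N" if "p \<in> J" for p
  proof (cases p)
    case (Pair m' i)
    show ?thesis
    proof (cases "i < 2 ^ m'")
      case True
      have "(\<lambda>v. \<Sum>l<2 ^ (m - m'). v (i * 2 ^ (m - m') + l) :: real) \<in> borel_measurable ?N"
        using idx[of m' i] that Pair True by (intro borel_measurable_sum measurable_component_singleton) auto
      then show ?thesis using True by (simp add: Pair coarse_inc_def)
    qed (simp add: Pair coarse_inc_def)
  qed
  have C: "?C \<in> sets ?N"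
  proof -
    have "{v \<in> space ?N. coarse_inc m p v \<in> A p} = coarse_inc m p -` A p \<inter> space ?N" for p by auto
    then show ?thesis
      using measurable_sets[OF Rm A] J by (intro sets.sets_Collect_finite_All) simp_all
  qed
  have v: "?v \<in> measurable M ?N" by measurable
  have R: "coarse_inc m p (?v \<omega>) = noise W h k \<omega> p" if "p \<in> J" for p \<omega>
  proof (cases p)
    case (Pair m' i)
    have m': "m' \<le> m" using m[OF that] Pair by simp
    then have e: "(2::nat) ^ m = 2 ^ m' * 2 ^ (m - m')" by (simp add: power_add[symmetric])
    have "dyadic_inc W h m' (k * 2 ^ m' + i) \<omega> = (\<Sum>l<2 ^ (m - m'). ?v \<omega> (i * 2 ^ (m - m') + l))" if i: "i < 2 ^ m'"
    proof -
      have "(k * 2 ^ m' + i) * 2 ^ (m - m') + l = k * 2 ^ m + (i * 2 ^ (m - m') + l)" for l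
        unfolding e by (simp add: algebra_simps)
      then have "dyadic_inc W h m ((k * 2 ^ m' + i) * 2 ^ (m - m') + l) \<omega> = ?v \<omega> (i * 2 ^ (m - m') + l)"
        if "l < 2 ^ (m - m')" for l
        using idx[OF _ i that] \<open>p \<in> J\<close> Pair by (simp add: add.assoc)
      then have "(\<Sum>l<2 ^ (m - m'). dyadic_inc W h m ((k * 2 ^ m' + i) * 2 ^ (m - m') + l) \<omega>)
          = (\<Sum>l<2 ^ (m - m'). ?v \<omega> (i * 2 ^ (m - m') + l))"
        by (intro sum.cong refl) blast
      then show ?thesis
        using dyadic_inc_refine[of W h m' "k * 2 ^ m' + i" \<omega> "m - m'"] m' by (simp only: le_add_diff_inverse)
    qed
    then show ?thesis by (simp add: Pair coarse_inc_def noise_def)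
  qed
  have "prod_emb UNIV (\<lambda>_. borel) J (Pi\<^sub>E J A) \<in> sets noise_space"
    using J A by (intro sets_PiM_I) auto
  then have "emeasure (distr M noise_space (noise W h k)) (prod_emb UNIV (\<lambda>_. borel) J (Pi\<^sub>E J A))
    = emeasure M (noise W h k -` prod_emb UNIV (\<lambda>_. borel) J (Pi\<^sub>E J A) \<inter> space M)"
    by (rule emeasure_distr[OF noise_measurable])
  also have "noise W h k -` prod_emb UNIV (\<lambda>_. borel) J (Pi\<^sub>E J A) \<inter> space M = ?v -` ?C \<inter> space M"
  proof -
    have "noise W h k \<omega> \<in> prod_emb UNIV (\<lambda>_. borel) J (Pi\<^sub>E J A) \<longleftrightarrow> ?v \<omega> \<in> ?C" for \<omega>
    proof -
      have "noise W h k \<omega> \<in> prod_emb UNIV (\<lambda>_. borel) J (Pi\<^sub>E J A) \<longleftrightarrow> (\<forall>p\<in>J. noise W h k \<omega> p \<in> A p)"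
        by (simp add: prod_emb_def PiE_iff)
      also have "\<dots> \<longleftrightarrow> (\<forall>p\<in>J. coarse_inc m p (?v \<omega>) \<in> A p)" by (intro ball_cong refl) (simp only: R)
      also have "\<dots> \<longleftrightarrow> ?v \<omega> \<in> ?C" by (simp add: space_PiM)
      finally show ?thesis .
    qed
    then show ?thesis by blast
  qed
  also have "emeasure M (?v -` ?C \<inter> space M) = emeasure (distr M ?N ?v) ?C"
    by (rule emeasure_distr[OF v C, symmetric])
  finally show ?thesis unfolding level_distr .
qed

end

text \<open>
  The noise has the same law in every block and for every Brownian motion, because the cylinder
  probabilities are given by a formula that mentions neither.
\<close>

lemma noise_distr_unique:
  assumes "brownian M W h" "brownian M' W' h"
  shows "distr M noise_space (noise W h k) = distr M' noise_space (noise W' h k')"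
proof (rule measure_eqI_PiM_infinite)
  interpret B: brownian M W h by fact
  interpret B': brownian M' W' h by fact
  show "finite_measure (distr M noise_space (noise W h k))"
    using B.prob_space_distr[OF B.noise_measurable] by (rule prob_space.finite_measure)
  fix A :: "nat \<times> nat \<Rightarrow> real set" and J :: "(nat \<times> nat) set"
  assume J: "finite J" and A: "\<And>i. i \<in> J \<Longrightarrow> A i \<in> sets borel"
  define m where "m = Max (insert 0 (fst ` J))"
  have m: "fst p \<le> m" if "p \<in> J" for p using that J by (auto simp: m_def intro!: Max_ge)
  show "emeasure (distr M noise_space (noise W h k)) (prod_emb UNIV (\<lambda>_. borel) J (Pi\<^sub>E J A))
     = emeasure (distr M' noise_space (noise W' h k')) (prod_emb UNIV (\<lambda>_. borel) J (Pi\<^sub>E J A))"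
    by (rule trans[OF B.noise_cylinder[OF J A m] B'.noise_cylinder[OF J A m, symmetric]])
qed simp_all

text \<open>
  A constant generates only the trivial events, of probability 0 or 1.
\<close>

lemma independent_of_process_const:
  assumes "brownian_motion M W" shows "independent_of_process M (\<lambda>_. c) W"
proof -
  interpret brownian M W 1 using assms by unfold_locales auto
  have pf: "(\<lambda>\<omega>. \<lambda>t\<in>{0..}. W t \<omega>) \<in> measurable M (PiM {0..} (\<lambda>_. borel))"
    using W_meas by (intro measurable_restrict) auto
  have f: "(\<lambda>\<omega>. \<lambda>t\<in>{0..}. W t \<omega>) \<in> space M \<rightarrow> space (PiM {0..} (\<lambda>_. borel))" by (auto simp: space_PiM)
  have SW: "sets (vimage_algebra (space M) (\<lambda>\<omega>. \<lambda>t\<in>{0..}. W t \<omega>) (PiM {0..} (\<lambda>_. borel))) \<subseteq> events"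
    unfolding sets_vimage_algebra2[OF f] using measurable_sets[OF pf] by blast
  have c: "S = {} \<or> S = space M" if "S \<in> sets (vimage_algebra (space M) (\<lambda>_. c) (borel :: real measure))" for S
    using that by (subst (asm) sets_vimage_algebra2) (auto split: if_splits)
  show ?thesis unfolding independent_of_process_def
  proof (rule indep_setI[OF _ SW])
    show "sets (vimage_algebra (space M) (\<lambda>_. c) borel) \<subseteq> events" using c by auto
    fix a b assume a: "a \<in> sets (vimage_algebra (space M) (\<lambda>_. c) borel)"
      and b: "b \<in> sets (vimage_algebra (space M) (\<lambda>\<omega>. \<lambda>t\<in>{0..}. W t \<omega>) (PiM {0..} (\<lambda>_. borel)))"
    have "b \<subseteq> space M" using b SW sets.sets_into_space by blast
    then show "prob (a \<inter> b) = prob a * prob b" using c[OF a] by (auto simp: prob_space Int_absorb1)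
  qed
qed

section \<open>A contracting scheme for the stochastic differential equation\<close>

lemma drift_min_max: "drift \<alpha>1 \<alpha>2 x = - \<alpha>1 * min x 0 - \<alpha>2 * max x 0"
  by (auto simp: drift_def min_def max_def)

lemma drift_continuous: "continuous_on S (drift \<alpha>1 \<alpha>2)"
  unfolding drift_min_max[abs_def] by (intro continuous_intros)

text \<open>
  The damping factor of one time step \<open>\<delta>\<close>. It differs from \<open>exp (-
  \<alpha> \<delta>)\<close> and from \<open>1 - \<alpha> \<delta>\<close> by terms of second
  order; the square root makes the half-Gaussian weight \<open>exp (- \<alpha> x\<^sup>2 /
  \<sigma>\<^sup>2)\<close> exactly reversible for the discretised dynamics. For large steps,
  where the root would be undefined, the value is 0.
\<close>

definition decay :: "real \<Rightarrow> real \<Rightarrow> real" where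
  "decay \<alpha> \<delta> = sqrt (max 0 (1 - 2 * \<alpha> * \<delta>))"

definition kink :: "real \<Rightarrow> real \<Rightarrow> real \<Rightarrow> real" where
  "kink c1 c2 x = c1 * min x 0 + c2 * max x 0"

lemma decay_nonneg: "0 \<le> decay \<alpha> \<delta>" by (simp add: decay_def)

lemma decay_le_exp: "decay \<alpha> \<delta> \<le> exp (- \<alpha> * \<delta>)"
proof -
  have "max 0 (1 - 2 * \<alpha> * \<delta>) \<le> exp (- 2 * \<alpha> * \<delta>)"
    using exp_ge_add_one_self[of "- 2 * \<alpha> * \<delta>"] by simp
  also have "\<dots> = (exp (- \<alpha> * \<delta>))\<^sup>2" by (simp add: power2_eq_square exp_add[symmetric])
  finally show ?thesis unfolding decay_def by (intro real_le_lsqrt) auto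
qed

lemma kink_lipschitz:
  assumes "\<bar>c1\<bar> \<le> c" "\<bar>c2\<bar> \<le> c"
  shows "\<bar>kink c1 c2 x - kink c1 c2 y\<bar> \<le> c * \<bar>x - y\<bar>"
proof -
  have "kink c1 c2 x - kink c1 c2 y = c1 * (min x 0 - min y 0) + c2 * (max x 0 - max y 0)"
    by (simp add: kink_def algebra_simps)
  also have "\<bar>\<dots>\<bar> \<le> \<bar>c1\<bar> * \<bar>min x 0 - min y 0\<bar> + \<bar>c2\<bar> * \<bar>max x 0 - max y 0\<bar>"
    by (metis abs_mult abs_triangle_ineq)
  also have "\<dots> \<le> c * \<bar>min x 0 - min y 0\<bar> + c * \<bar>max x 0 - max y 0\<bar>"
    using assms by (intro add_mono mult_right_mono) auto
  also have "\<dots> = c * (\<bar>min x 0 - min y 0\<bar> + \<bar>max x 0 - max y 0\<bar>)" by (simp add: distrib_left)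
  also have "\<bar>min x 0 - min y 0\<bar> + \<bar>max x 0 - max y 0\<bar> = \<bar>x - y\<bar>" by (auto simp: min_def max_def)
  finally show ?thesis .
qed

lemma drift_kink: "drift \<alpha>1 \<alpha>2 x = kink (- \<alpha>1) (- \<alpha>2) x"
  by (simp add: drift_min_max kink_def)

lemma kink_measurable[measurable]: "kink c1 c2 \<in> borel_measurable borel"
  unfolding kink_def[abs_def] by measurable

text \<open>
  The list \<open>z\<close> contains the Brownian increments. They enter additively, as the
  diffusion coefficient is constant, so the scheme can be compared with the solution path by path.
\<close>

primrec scheme :: "real \<Rightarrow> real \<Rightarrow> real \<Rightarrow> real \<Rightarrow> (nat \<Rightarrow> real) \<Rightarrow> real \<Rightarrow> nat \<Rightarrow> real" where
  "scheme \<alpha>1 \<alpha>2 \<sigma> \<delta> z x 0 = x"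
| "scheme \<alpha>1 \<alpha>2 \<sigma> \<delta> z x (Suc j) = kink (decay \<alpha>1 \<delta>) (decay \<alpha>2 \<delta>) (scheme \<alpha>1 \<alpha>2 \<sigma> \<delta> z x j) + \<sigma> * z j"

lemma scheme_contraction:
  assumes "\<delta> \<ge> 0"
  shows "\<bar>scheme \<alpha>1 \<alpha>2 \<sigma> \<delta> z x j - scheme \<alpha>1 \<alpha>2 \<sigma> \<delta> z y j\<bar> \<le> exp (- min \<alpha>1 \<alpha>2 * \<delta>) ^ j * \<bar>x - y\<bar>"
proof (induction j)
  case (Suc j)
  let ?a = "scheme \<alpha>1 \<alpha>2 \<sigma> \<delta> z x j" and ?b = "scheme \<alpha>1 \<alpha>2 \<sigma> \<delta> z y j" and ?c = "exp (- min \<alpha>1 \<alpha>2 * \<delta>)"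
  have "exp (- \<alpha>1 * \<delta>) \<le> ?c" "exp (- \<alpha>2 * \<delta>) \<le> ?c"
    using assms by (auto intro!: mult_right_mono)
  then have "\<bar>decay \<alpha>1 \<delta>\<bar> \<le> ?c" "\<bar>decay \<alpha>2 \<delta>\<bar> \<le> ?c"
    using decay_le_exp[of \<alpha>1 \<delta>] decay_le_exp[of \<alpha>2 \<delta>] decay_nonneg[of \<alpha>1 \<delta>] decay_nonneg[of \<alpha>2 \<delta>] by linarith+
  then have "\<bar>kink (decay \<alpha>1 \<delta>) (decay \<alpha>2 \<delta>) ?a - kink (decay \<alpha>1 \<delta>) (decay \<alpha>2 \<delta>) ?b\<bar> \<le> ?c * \<bar>?a - ?b\<bar>"
    by (rule kink_lipschitz)
  also have "\<dots> \<le> ?c * (?c ^ j * \<bar>x - y\<bar>)" by (intro mult_left_mono Suc.IH) simp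
  finally show ?case by (simp add: mult.assoc)
qed simp

definition block_step :: "real \<Rightarrow> real \<Rightarrow> real \<Rightarrow> real \<Rightarrow> nat \<Rightarrow> real \<Rightarrow> (nat \<times> nat \<Rightarrow> real) \<Rightarrow> real" where
  "block_step \<alpha>1 \<alpha>2 \<sigma> h m x s = scheme \<alpha>1 \<alpha>2 \<sigma> (h / 2 ^ m) (\<lambda>j. s (m, j)) x (2 ^ m)"

lemma block_step_contraction:
  assumes "h \<ge> 0"
  shows "\<bar>block_step \<alpha>1 \<alpha>2 \<sigma> h m x s - block_step \<alpha>1 \<alpha>2 \<sigma> h m y s\<bar> \<le> exp (- min \<alpha>1 \<alpha>2 * h) * \<bar>x - y\<bar>"
proof -
  have "exp (- min \<alpha>1 \<alpha>2 * (h / 2 ^ m)) ^ (2 ^ m) = exp (- min \<alpha>1 \<alpha>2 * h)"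
    by (simp add: exp_of_nat_mult[symmetric])
  then show ?thesis
    using scheme_contraction[of "h / 2 ^ m" \<alpha>1 \<alpha>2 \<sigma> "\<lambda>j. s (m, j)" x "2 ^ m" y] assms by (simp add: block_step_def)
qed

lemma scheme_measurable:
  assumes "f \<in> borel_measurable N" "\<And>j. (\<lambda>\<omega>. z \<omega> j) \<in> borel_measurable N"
  shows "(\<lambda>\<omega>. scheme \<alpha>1 \<alpha>2 \<sigma> \<delta> (z \<omega>) (f \<omega>) j) \<in> borel_measurable N"
proof (induction j)
  case (Suc j)
  note [measurable] = Suc assms(2)
  show ?case by simp
qed (simp add: assms)

lemma block_step_measurable[measurable]:
  assumes [measurable]: "f \<in> borel_measurable N" "g \<in> measurable N noise_space"
  shows "(\<lambda>\<omega>. block_step \<alpha>1 \<alpha>2 \<sigma> h m (f \<omega>) (g \<omega>)) \<in> borel_measurable N"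
  unfolding block_step_def
  by (rule scheme_measurable) (auto intro: measurable_compose[OF assms(2) measurable_component_singleton])

text \<open>
  The solution at time \<open>h\<close> as a function of the initial state and the noise of the
  block. The scheme converges for almost every noise only, but the recursion \<open>x \<mapsto> F
  x s\<close> has to be measurable and contractive for every \<open>s\<close>. A limit superior
  serves both; it is finite on the set where the scheme stays bounded, and boundedness does not
  depend on the starting point because the scheme does not expand distances.
\<close>

definition flow :: "real \<Rightarrow> real \<Rightarrow> real \<Rightarrow> real \<Rightarrow> real \<Rightarrow> (nat \<times> nat \<Rightarrow> real) \<Rightarrow> real" where
  "flow \<alpha>1 \<alpha>2 \<sigma> h x s =
     (if \<exists>B::nat. \<forall>m. \<bar>block_step \<alpha>1 \<alpha>2 \<sigma> h m 0 s\<bar> \<le> real B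
      then real_of_ereal (limsup (\<lambda>m. ereal (block_step \<alpha>1 \<alpha>2 \<sigma> h m x s))) else 0)"

lemma flow_measurable: "(\<lambda>(x, s). flow \<alpha>1 \<alpha>2 \<sigma> h x s) \<in> borel_measurable (borel \<Otimes>\<^sub>M noise_space)"
  unfolding flow_def split_beta by measurable

text \<open>
  Contraction of all approximations passes to the limit superior.
\<close>

lemma limsup_real_diff_le:
  fixes a b :: "nat \<Rightarrow> real"
  assumes a: "\<And>m. \<bar>a m\<bar> \<le> A" and b: "\<And>m. \<bar>b m\<bar> \<le> B" and d: "\<And>m. \<bar>a m - b m\<bar> \<le> c"
  shows "\<bar>real_of_ereal (limsup (\<lambda>m. ereal (a m))) - real_of_ereal (limsup (\<lambda>m. ereal (b m)))\<bar> \<le> c"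
proof -
  have fin: "\<exists>r. limsup (\<lambda>m. ereal (u m)) = ereal r" if "\<And>m. \<bar>u m\<bar> \<le> U" for u :: "nat \<Rightarrow> real" and U
  proof -
    have "limsup (\<lambda>m. ereal (u m)) \<le> ereal U"
      using that by (intro Limsup_bounded always_eventually) (auto simp: abs_le_iff)
    moreover have "ereal (- U) \<le> limsup (\<lambda>m. ereal (u m))"
      using that by (intro order_trans[OF Liminf_bounded Liminf_le_Limsup] always_eventually)
         (auto simp: abs_le_iff minus_le_iff)
    ultimately show ?thesis by (cases "limsup (\<lambda>m. ereal (u m))") auto
  qed
  obtain r where r: "limsup (\<lambda>m. ereal (a m)) = ereal r" using fin[of a A] a by blast
  obtain r' where r': "limsup (\<lambda>m. ereal (b m)) = ereal r'" using fin[of b B] b by blast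
  have one: "limsup (\<lambda>m. ereal (u m)) \<le> limsup (\<lambda>m. ereal (v m)) + ereal c" if "\<And>m. u m \<le> v m + c" for u v :: "nat \<Rightarrow> real"
  proof -
    have "limsup (\<lambda>m. ereal (u m)) \<le> limsup (\<lambda>m. ereal (v m) + ereal c)"
      using that by (intro Limsup_mono always_eventually) auto
    also have "\<dots> = limsup (\<lambda>m. ereal (v m)) + ereal c"
      by (rule Limsup_add_ereal_right) auto
    finally show ?thesis .
  qed
  have "a m \<le> b m + c" for m using d[of m] by linarith
  then have 1: "limsup (\<lambda>m. ereal (a m)) \<le> limsup (\<lambda>m. ereal (b m)) + ereal c" by (rule one)
  have "b m \<le> a m + c" for m using d[of m] by linarith
  then have 2: "limsup (\<lambda>m. ereal (b m)) \<le> limsup (\<lambda>m. ereal (a m)) + ereal c" by (rule one)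
  show ?thesis using 1 2 unfolding r r' by simp
qed

lemma flow_contraction:
  assumes "h \<ge> 0"
  shows "\<bar>flow \<alpha>1 \<alpha>2 \<sigma> h x s - flow \<alpha>1 \<alpha>2 \<sigma> h y s\<bar> \<le> exp (- min \<alpha>1 \<alpha>2 * h) * \<bar>x - y\<bar>"
proof (cases "\<exists>B::nat. \<forall>m. \<bar>block_step \<alpha>1 \<alpha>2 \<sigma> h m 0 s\<bar> \<le> real B")
  case True
  then obtain B :: nat where B: "\<And>m. \<bar>block_step \<alpha>1 \<alpha>2 \<sigma> h m 0 s\<bar> \<le> real B" by blast
  have bd: "\<bar>block_step \<alpha>1 \<alpha>2 \<sigma> h m u s\<bar> \<le> real B + exp (- min \<alpha>1 \<alpha>2 * h) * \<bar>u\<bar>" for m u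
    using B[of m] block_step_contraction[OF assms, of \<alpha>1 \<alpha>2 \<sigma> m u s 0] by (simp add: abs_le_iff)
  show ?thesis
    using True limsup_real_diff_le[OF bd bd block_step_contraction[OF assms]] by (simp add: flow_def)
next
  case False
  have "flow \<alpha>1 \<alpha>2 \<sigma> h u s = 0" for u unfolding flow_def using False by (rule if_not_P)
  then show ?thesis by simp
qed

lemma flow_eq_lim:
  assumes "h \<ge> 0" and lim: "(\<lambda>m. block_step \<alpha>1 \<alpha>2 \<sigma> h m x s) \<longlonglongrightarrow> l"
  shows "flow \<alpha>1 \<alpha>2 \<sigma> h x s = l"
proof -
  obtain K where K: "\<And>m. \<bar>block_step \<alpha>1 \<alpha>2 \<sigma> h m x s\<bar> \<le> K"
    using convergent_imp_Bseq[OF convergentI[OF lim]] by (auto simp: Bseq_def)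
  obtain B :: nat where B: "K + exp (- min \<alpha>1 \<alpha>2 * h) * \<bar>x\<bar> \<le> real B" using real_arch_simple by blast
  have "\<bar>block_step \<alpha>1 \<alpha>2 \<sigma> h m 0 s\<bar> \<le> real B" for m
    using K[of m] B block_step_contraction[OF assms(1), of \<alpha>1 \<alpha>2 \<sigma> m 0 s x] by (simp add: abs_le_iff)
  then have "\<exists>B::nat. \<forall>m. \<bar>block_step \<alpha>1 \<alpha>2 \<sigma> h m 0 s\<bar> \<le> real B" by blast
  moreover have "limsup (\<lambda>m. ereal (block_step \<alpha>1 \<alpha>2 \<sigma> h m x s)) = ereal l"
    using lim by (intro lim_imp_Limsup tendsto_ereal) auto
  ultimately show ?thesis by (simp add: flow_def)
qed

text \<open>
  With \<open>e = \<alpha> \<delta>\<close> and \<open>c\<close> the damping factor, \<open>(1 - e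
  - c) (1 - e + c) = e\<^sup>2\<close>, and the second factor is at least a half.
\<close>

lemma decay_first_order:
  assumes "0 \<le> \<alpha>" "0 \<le> \<delta>" "2 * \<alpha> * \<delta> \<le> 1"
  shows "\<bar>1 - \<alpha> * \<delta> - decay \<alpha> \<delta>\<bar> \<le> 2 * (\<alpha> * \<delta>)\<^sup>2"
proof -
  define e where "e = \<alpha> * \<delta>"
  have e: "0 \<le> e" "e \<le> 1 / 2" using assms by (auto simp: e_def)
  define c where "c = decay \<alpha> \<delta>"
  have c: "0 \<le> c" "c\<^sup>2 = 1 - 2 * e"
    using e unfolding c_def decay_def e_def by (auto simp: algebra_simps max_def)
  have "(1 - e - c) * (1 - e + c) = e\<^sup>2" using c(2) by (simp add: power2_eq_square algebra_simps)
  moreover have "1 - e + c \<ge> 1 / 2" using e c by linarith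
  ultimately have "1 - e - c \<ge> 0"
    by (metis (no_types, opaque_lifting) less_eq_real_def linorder_not_less mult_neg_pos zero_le_power2 half_gt_zero_iff less_le_trans zero_less_one)
  have "(1 - e - c) * (1/2) \<le> (1 - e - c) * (1 - e + c)"
    using \<open>1 - e - c \<ge> 0\<close> \<open>1 - e + c \<ge> 1 / 2\<close> by (rule mult_left_mono[rotated])
  then have "(1 - e - c) * (1/2) \<le> e\<^sup>2" unfolding \<open>(1 - e - c) * (1 - e + c) = e\<^sup>2\<close> .
  then have "1 - e - c \<le> 2 * e\<^sup>2" by (simp add: field_simps)
  then show ?thesis using \<open>1 - e - c \<ge> 0\<close> unfolding e_def c_def by simp
qed

text \<open>
  A pathwise statement about one continuous solution of the integral equation on \<open>[a, a +
  h]\<close>: uniform continuity makes the local error \<open>\<le> \<delta> \<epsilon>\<close>,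
  and since a step of the scheme does not expand distances the \<open>h / \<delta>\<close> local
  errors add up to at most \<open>h \<epsilon>\<close>.
\<close>

lemma scheme_converges:
  fixes y w :: "real \<Rightarrow> real"
  assumes pos: "\<alpha>1 > 0" "\<alpha>2 > 0" and h: "h > 0"
    and y: "continuous_on {a..a + h} y"
    and eq: "\<And>r t. a \<le> r \<Longrightarrow> r \<le> t \<Longrightarrow> t \<le> a + h \<Longrightarrow>
        y t - y r = integral {r..t} (\<lambda>u. drift \<alpha>1 \<alpha>2 (y u)) + \<sigma> * (w t - w r)"
    and s: "\<And>m j. j < 2 ^ m \<Longrightarrow> s (m, j) = w (a + real (Suc j) * h / 2 ^ m) - w (a + real j * h / 2 ^ m)"
  shows "(\<lambda>m. block_step \<alpha>1 \<alpha>2 \<sigma> h m (y a) s) \<longlonglongrightarrow> y (a + h)"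
proof (rule LIMSEQ_I, goal_cases)
  case (1 e)
  define A where "A = max \<alpha>1 \<alpha>2"
  have A: "A > 0" "\<alpha>1 \<le> A" "\<alpha>2 \<le> A" using pos by (auto simp: A_def)
  have "bounded (y ` {a..a + h})"
    by (rule compact_imp_bounded[OF compact_continuous_image[OF y compact_Icc]])
  then obtain Y0 where "\<forall>x\<in>y ` {a..a + h}. norm x \<le> Y0" unfolding bounded_iff by blast
  then have Y0: "\<bar>y t\<bar> \<le> Y0" if "t \<in> {a..a + h}" for t using that by simp
  have "Y0 \<ge> 0" using Y0[of a] h by auto
  define \<epsilon> where "\<epsilon> = e / (2 * h)"
  have "\<epsilon> > 0" using 1 h by (simp add: \<epsilon>_def)
  have uc: "uniformly_continuous_on {a..a + h} y" by (rule compact_uniformly_continuous[OF y compact_Icc])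
  obtain d where d: "d > 0" "\<And>t u. t \<in> {a..a + h} \<Longrightarrow> u \<in> {a..a + h} \<Longrightarrow> \<bar>u - t\<bar> < d \<Longrightarrow> \<bar>y u - y t\<bar> < \<epsilon> / (2 * A)"
  proof -
    have "0 < \<epsilon> / (2 * A)" using \<open>\<epsilon> > 0\<close> A(1) by simp
    then have "\<exists>d>0. \<forall>t\<in>{a..a + h}. \<forall>u\<in>{a..a + h}. dist u t < d \<longrightarrow> dist (y u) (y t) < \<epsilon> / (2 * A)"
      using uc unfolding uniformly_continuous_on_def by (elim allE impE)
    then show ?thesis using that unfolding dist_real_def by blast
  qed
  have "(\<lambda>m. h * (1 / 2) ^ m) \<longlonglongrightarrow> h * 0" by (intro tendsto_intros LIMSEQ_realpow_zero) auto
  then have lim: "(\<lambda>m. h / 2 ^ m) \<longlonglongrightarrow> 0" by (simp add: power_divide)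
  \<comment> \<open>below \<open>\<eta>\<close> the modulus of continuity of \<open>y\<close> applies, the damping factors are genuine square roots, and their second-order deviation from \<open>1 - \<alpha> \<delta>\<close> is covered by \<open>\<epsilon>\<close>\<close>
  define \<eta> where "\<eta> = min d (min (1 / (2 * A)) (\<epsilon> / (4 * A\<^sup>2 * (Y0 + 1))))"
  have "\<eta> > 0" using d(1) A(1) \<open>\<epsilon> > 0\<close> \<open>Y0 \<ge> 0\<close> by (auto simp: \<eta>_def)
  have "\<forall>\<^sub>F m in sequentially. h / 2 ^ m < \<eta>" using order_tendstoD(2)[OF lim \<open>\<eta> > 0\<close>] .
  then have "\<forall>\<^sub>F m in sequentially. norm (block_step \<alpha>1 \<alpha>2 \<sigma> h m (y a) s - y (a + h)) < e"
  proof eventually_elim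
    case (elim m)
    define \<delta> where "\<delta> = h / 2 ^ m"
    have \<delta>: "\<delta> > 0" "\<delta> < d" "2 * A * \<delta> \<le> 1" "\<delta> * (4 * A\<^sup>2 * (Y0 + 1)) \<le> \<epsilon>"
    proof -
      have lt: "\<delta> < \<eta>" using elim by (simp add: \<delta>_def)
      show "\<delta> > 0" using h by (simp add: \<delta>_def)
      show "\<delta> < d" using lt by (simp add: \<eta>_def)
      have "\<delta> \<le> 1 / (2 * A)" using lt by (simp add: \<eta>_def)
      then have "\<delta> * (2 * A) \<le> 1" using A(1) by (subst (asm) pos_le_divide_eq) simp_all
      then show "2 * A * \<delta> \<le> 1" by (simp only: mult.commute)
      have "0 < 4 * A\<^sup>2 * (Y0 + 1)" using A(1) \<open>Y0 \<ge> 0\<close> by simp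
      moreover have "\<delta> \<le> \<epsilon> / (4 * A\<^sup>2 * (Y0 + 1))" using lt by (simp add: \<eta>_def)
      ultimately show "\<delta> * (4 * A\<^sup>2 * (Y0 + 1)) \<le> \<epsilon>" by (simp only: pos_le_divide_eq)
    qed
    define t where "t j = a + real j * \<delta>" for j
    define z where "z = (\<lambda>j. s (m, j))"
    let ?c1 = "decay \<alpha>1 \<delta>" and ?c2 = "decay \<alpha>2 \<delta>"
    let ?u = "\<lambda>j. scheme \<alpha>1 \<alpha>2 \<sigma> \<delta> z (y a) j"
    have t_le: "t j \<le> a + h" if "j \<le> 2 ^ m" for j
    proof -
      have "real j * \<delta> \<le> 2 ^ m * \<delta>" using that \<delta>(1) by (intro mult_right_mono) auto
      then show ?thesis by (simp add: t_def \<delta>_def)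
    qed
    have local: "\<bar>y (t (Suc j)) - kink ?c1 ?c2 (y (t j)) - \<sigma> * z j\<bar> \<le> \<delta> * \<epsilon>" if j: "j < 2 ^ m" for j
    proof -
      let ?r = "t j" and ?t = "t (Suc j)"
      have rt: "a \<le> ?r" "?r \<le> ?t" "?t \<le> a + h" "?t - ?r = \<delta>"
        using \<delta>(1) t_le[of "Suc j"] j by (auto simp: t_def algebra_simps)
      have rin: "?r \<in> {a..a + h}" using rt by auto
      have zj: "z j = w ?t - w ?r" unfolding z_def s[OF j] t_def \<delta>_def by (simp add: mult.commute)
      have cont: "continuous_on {?r..?t} (\<lambda>u. drift \<alpha>1 \<alpha>2 (y u))"
        using rt by (intro continuous_on_compose2[OF drift_continuous[of UNIV] continuous_on_subset[OF y]]) auto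
      then have int: "(\<lambda>u. drift \<alpha>1 \<alpha>2 (y u)) integrable_on {?r..?t}" by (rule integrable_continuous_real)
      have int_eq: "integral {?r..?t} (\<lambda>u. drift \<alpha>1 \<alpha>2 (y u)) - \<delta> * drift \<alpha>1 \<alpha>2 (y ?r)
          = integral {?r..?t} (\<lambda>u. drift \<alpha>1 \<alpha>2 (y u) - drift \<alpha>1 \<alpha>2 (y ?r))"
        using int rt(2,4) by (subst Henstock_Kurzweil_Integration.integral_diff) auto
      have "norm (integral {?r..?t} (\<lambda>u. drift \<alpha>1 \<alpha>2 (y u) - drift \<alpha>1 \<alpha>2 (y ?r))) \<le> (\<epsilon> / 2) * (?t - ?r)"
      proof (rule integral_bound)
        show "?r \<le> ?t" by (rule rt)
        show "continuous_on {?r..?t} (\<lambda>u. drift \<alpha>1 \<alpha>2 (y u) - drift \<alpha>1 \<alpha>2 (y ?r))"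
          using cont by (intro continuous_intros)
        show "norm (drift \<alpha>1 \<alpha>2 (y u) - drift \<alpha>1 \<alpha>2 (y ?r)) \<le> \<epsilon> / 2" if u: "u \<in> {?r..?t}" for u
        proof -
          have "\<bar>drift \<alpha>1 \<alpha>2 (y u) - drift \<alpha>1 \<alpha>2 (y ?r)\<bar> \<le> A * \<bar>y u - y ?r\<bar>"
            unfolding drift_kink using A pos by (intro kink_lipschitz) auto
          also have "\<dots> \<le> A * (\<epsilon> / (2 * A))"
            using A(1) d(2)[OF rin, of u] u rt \<delta>(2) by (intro mult_left_mono less_imp_le[OF d(2)[OF rin]]) auto
          also have "\<dots> = \<epsilon> / 2" using A(1) by simp
          finally show ?thesis by simp
        qed
      qed
      then have i1: "\<bar>integral {?r..?t} (\<lambda>u. drift \<alpha>1 \<alpha>2 (y u)) - \<delta> * drift \<alpha>1 \<alpha>2 (y ?r)\<bar> \<le> \<epsilon> / 2 * \<delta>"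
        unfolding int_eq using rt(4) by simp
      have i2: "\<bar>\<delta> * drift \<alpha>1 \<alpha>2 (y ?r) + y ?r - kink ?c1 ?c2 (y ?r)\<bar> \<le> 2 * (A * \<delta>)\<^sup>2 * Y0"
      proof -
        have "2 * \<alpha>1 * \<delta> \<le> 2 * A * \<delta>" "2 * \<alpha>2 * \<delta> \<le> 2 * A * \<delta>" using A \<delta>(1) by auto
        then have "2 * \<alpha>1 * \<delta> \<le> 1" "2 * \<alpha>2 * \<delta> \<le> 1" using \<delta>(3) by linarith+
        then have b: "\<bar>1 - \<alpha>1 * \<delta> - ?c1\<bar> \<le> 2 * (\<alpha>1 * \<delta>)\<^sup>2" "\<bar>1 - \<alpha>2 * \<delta> - ?c2\<bar> \<le> 2 * (\<alpha>2 * \<delta>)\<^sup>2"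
          using pos \<delta>(1) by (intro decay_first_order; simp)+
        have "2 * (\<alpha>1 * \<delta>)\<^sup>2 \<le> 2 * (A * \<delta>)\<^sup>2" "2 * (\<alpha>2 * \<delta>)\<^sup>2 \<le> 2 * (A * \<delta>)\<^sup>2"
          using A pos \<delta>(1) by (auto intro!: power_mono mult_right_mono)
        then have b': "\<bar>1 - \<alpha>1 * \<delta> - ?c1\<bar> \<le> 2 * (A * \<delta>)\<^sup>2" "\<bar>1 - \<alpha>2 * \<delta> - ?c2\<bar> \<le> 2 * (A * \<delta>)\<^sup>2"
          using b by linarith+
        have "\<delta> * drift \<alpha>1 \<alpha>2 (y ?r) + y ?r - kink ?c1 ?c2 (y ?r) = kink (1 - \<alpha>1 * \<delta> - ?c1) (1 - \<alpha>2 * \<delta> - ?c2) (y ?r)"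
          by (cases "y ?r \<le> 0") (simp_all add: drift_min_max kink_def algebra_simps)
        also have "\<bar>\<dots>\<bar> \<le> 2 * (A * \<delta>)\<^sup>2 * \<bar>y ?r\<bar>"
          using kink_lipschitz[OF b', of "y ?r" 0] by (simp add: kink_def)
        also have "\<dots> \<le> 2 * (A * \<delta>)\<^sup>2 * Y0" using Y0[OF rin] by (intro mult_left_mono) auto
        finally show ?thesis .
      qed
      have i3: "2 * (A * \<delta>)\<^sup>2 * Y0 \<le> \<delta> * (\<epsilon> / 2)"
      proof -
        have "2 * (A * \<delta>)\<^sup>2 * Y0 = \<delta> * ((\<delta> * (4 * A\<^sup>2 * Y0)) / 2)"
          by (simp add: power_mult_distrib power2_eq_square mult_ac)
        also have "\<dots> \<le> \<delta> * ((\<delta> * (4 * A\<^sup>2 * (Y0 + 1))) / 2)"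
          using \<delta>(1) by (intro mult_left_mono divide_right_mono) auto
        also have "\<dots> \<le> \<delta> * (\<epsilon> / 2)" using \<delta>(1,4) by (intro mult_left_mono divide_right_mono) auto
        finally show ?thesis .
      qed
      have sum_eq: "y ?t - kink ?c1 ?c2 (y ?r) - \<sigma> * z j
        = (integral {?r..?t} (\<lambda>u. drift \<alpha>1 \<alpha>2 (y u)) - \<delta> * drift \<alpha>1 \<alpha>2 (y ?r))
          + (\<delta> * drift \<alpha>1 \<alpha>2 (y ?r) + y ?r - kink ?c1 ?c2 (y ?r))"
        using eq[OF rt(1,2,3)] by (simp add: zj)
      have "\<epsilon> / 2 * \<delta> + \<delta> * (\<epsilon> / 2) = \<delta> * \<epsilon>" by simp
      then show ?thesis
        unfolding sum_eq using abs_triangle_ineq add_mono[OF i1 order_trans[OF i2 i3]] by (metis order_trans)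
    qed
    have err: "\<bar>y (t j) - ?u j\<bar> \<le> real j * (\<delta> * \<epsilon>)" if "j \<le> 2 ^ m" for j
      using that
    proof (induction j)
      case 0 then show ?case by (simp add: t_def)
    next
      case (Suc j)
      have "\<bar>?c1\<bar> \<le> 1" "\<bar>?c2\<bar> \<le> 1"
        using pos \<delta>(1) by (auto simp: decay_def)
      then have "\<bar>kink ?c1 ?c2 (y (t j)) - kink ?c1 ?c2 (?u j)\<bar> \<le> 1 * \<bar>y (t j) - ?u j\<bar>" by (rule kink_lipschitz)
      also have "\<dots> \<le> real j * (\<delta> * \<epsilon>)" using Suc by simp
      finally have 1: "\<bar>kink ?c1 ?c2 (y (t j)) - kink ?c1 ?c2 (?u j)\<bar> \<le> real j * (\<delta> * \<epsilon>)" .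
      have 2: "\<bar>y (t (Suc j)) - kink ?c1 ?c2 (y (t j)) - \<sigma> * z j\<bar> \<le> \<delta> * \<epsilon>" using Suc.prems by (intro local) simp
      have "y (t (Suc j)) - ?u (Suc j) = (y (t (Suc j)) - kink ?c1 ?c2 (y (t j)) - \<sigma> * z j)
          + (kink ?c1 ?c2 (y (t j)) - kink ?c1 ?c2 (?u j))" by simp
      then have "\<bar>y (t (Suc j)) - ?u (Suc j)\<bar> \<le> \<delta> * \<epsilon> + real j * (\<delta> * \<epsilon>)"
        using order_trans[OF abs_triangle_ineq add_mono[OF 2 1]] by (simp only:)
      then show ?case by (simp add: algebra_simps)
    qed
    have "\<bar>y (a + h) - block_step \<alpha>1 \<alpha>2 \<sigma> h m (y a) s\<bar> \<le> h * \<epsilon>"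
      using err[of "2 ^ m"] by (simp add: t_def block_step_def \<delta>_def z_def)
    also have "\<dots> < e" using 1 h by (simp add: \<epsilon>_def)
    finally show ?case by (simp add: abs_minus_commute)
  qed
  then show ?case by (simp add: eventually_sequentially)
qed

text \<open>
  Every solution, for whatever initial condition, is obtained from the noise block by block. In
  particular the values at multiples of \<open>h\<close> form a chain driven by the block noises.
\<close>

lemma sde_block:
  assumes pos: "\<alpha>1 > 0" "\<alpha>2 > 0" and h: "h > 0" and bm: "brownian_motion M W"
    and sol: "sde_solution M W (drift \<alpha>1 \<alpha>2) \<sigma> \<zeta> X"
  shows "AE \<omega> in M. X 0 \<omega> = \<zeta> \<omega> \<and>
     (\<forall>k. (\<lambda>m. block_step \<alpha>1 \<alpha>2 \<sigma> h m (X (real k * h) \<omega>) (noise W h k \<omega>)) \<longlonglongrightarrow> X (real (Suc k) * h) \<omega>)"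
proof -
  have "AE \<omega> in M. W 0 \<omega> = 0" using bm by (simp add: brownian_motion_def)
  moreover have "AE \<omega> in M. continuous_on {0..} (\<lambda>t. X t \<omega>) \<and>
        (\<forall>t\<ge>0. X t \<omega> = \<zeta> \<omega> + integral {0..t} (\<lambda>s. drift \<alpha>1 \<alpha>2 (X s \<omega>)) + \<sigma> * W t \<omega>)"
    using sol by (simp add: sde_solution_def)
  ultimately show ?thesis
  proof eventually_elim
    case (elim \<omega>)
    let ?y = "\<lambda>t. X t \<omega>"
    have cont: "continuous_on {0..} ?y" and eq: "\<And>t. t \<ge> 0 \<Longrightarrow> ?y t = \<zeta> \<omega> + integral {0..t} (\<lambda>s. drift \<alpha>1 \<alpha>2 (?y s)) + \<sigma> * W t \<omega>"
      using elim by auto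
    have "X 0 \<omega> = \<zeta> \<omega>" using eq[of 0] elim(1) by simp
    moreover have "(\<lambda>m. block_step \<alpha>1 \<alpha>2 \<sigma> h m (X (real k * h) \<omega>) (noise W h k \<omega>)) \<longlonglongrightarrow> X (real (Suc k) * h) \<omega>" for k
    proof -
      have "(\<lambda>m. block_step \<alpha>1 \<alpha>2 \<sigma> h m (?y (real k * h)) (noise W h k \<omega>)) \<longlonglongrightarrow> ?y (real k * h + h)"
      proof (rule scheme_converges[OF pos h, where w="\<lambda>t. W t \<omega>"])
        show "continuous_on {real k * h..real k * h + h} ?y"
          using h by (intro continuous_on_subset[OF cont]) auto
        show "?y t - ?y r = integral {r..t} (\<lambda>u. drift \<alpha>1 \<alpha>2 (?y u)) + \<sigma> * (W t \<omega> - W r \<omega>)"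
          if "real k * h \<le> r" "r \<le> t" for r t
        proof -
          have r0: "0 \<le> r" using that h by (meson mult_nonneg_nonneg of_nat_0_le_iff less_imp_le order_trans)
          have "continuous_on {0..t} (\<lambda>u. drift \<alpha>1 \<alpha>2 (?y u))"
            by (intro continuous_on_compose2[OF drift_continuous[of UNIV] continuous_on_subset[OF cont]]) auto
          then have "(\<lambda>u. drift \<alpha>1 \<alpha>2 (?y u)) integrable_on {0..t}" by (rule integrable_continuous_real)
          from Henstock_Kurzweil_Integration.integral_combine[OF r0 that(2) this]
          have "integral {r..t} (\<lambda>u. drift \<alpha>1 \<alpha>2 (?y u)) = integral {0..t} (\<lambda>u. drift \<alpha>1 \<alpha>2 (?y u)) - integral {0..r} (\<lambda>u. drift \<alpha>1 \<alpha>2 (?y u))"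
            by linarith
          then show ?thesis using eq[of t] eq[of r] r0 that by (simp add: algebra_simps)
        qed
        show "noise W h k \<omega> (m, j) = W (real k * h + real (Suc j) * h / 2 ^ m) \<omega> - W (real k * h + real j * h / 2 ^ m) \<omega>"
          if "j < 2 ^ m" for m j
        proof -
          have "real (Suc (k * 2 ^ m + j)) * h / 2 ^ m = real k * h + real (Suc j) * h / 2 ^ m"
            "real (k * 2 ^ m + j) * h / 2 ^ m = real k * h + real j * h / 2 ^ m"
            by (simp_all add: field_simps)
          then show ?thesis using that by (simp only: noise_def dyadic_inc_def) simp
        qed
      qed
      then show ?thesis by (simp add: distrib_right add.commute)
    qed
    ultimately show ?case by blast
  qed
qed

section \<open>The scheme almost preserves the stationary density\<close>

definition gauss_half :: "real \<Rightarrow> real \<Rightarrow> real \<Rightarrow> real" where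
  "gauss_half \<alpha> \<sigma> x = exp (- (\<alpha> * x\<^sup>2 / \<sigma>\<^sup>2))"

definition stat_const :: "real \<Rightarrow> real \<Rightarrow> real \<Rightarrow> real" where
  "stat_const \<alpha>1 \<alpha>2 \<sigma> = 2 * sqrt (\<alpha>1 * \<alpha>2) / (sqrt pi * (sqrt \<alpha>1 + sqrt \<alpha>2) * \<sigma>)"

lemma stat_density_eq:
  "stat_density \<alpha>1 \<alpha>2 \<sigma> x =
     stat_const \<alpha>1 \<alpha>2 \<sigma> * (if x \<le> 0 then gauss_half \<alpha>1 \<sigma> x else gauss_half \<alpha>2 \<sigma> x)"
  by (simp add: stat_density_def stat_const_def gauss_half_def)

lemma stat_density_measurable[measurable]: "stat_density \<alpha>1 \<alpha>2 \<sigma> \<in> borel_measurable borel"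
  unfolding stat_density_def[abs_def] by measurable

lemma gauss_half_measurable[measurable]: "gauss_half \<alpha> \<sigma> \<in> borel_measurable borel"
  unfolding gauss_half_def[abs_def] by measurable

lemma gauss_half_bounds:
  assumes "\<alpha> \<ge> 0" shows "0 \<le> gauss_half \<alpha> \<sigma> x" "gauss_half \<alpha> \<sigma> x \<le> 1"
  using assms by (auto simp: gauss_half_def)

lemma gauss_half_diff:
  assumes "\<alpha>1 \<ge> 0" "\<alpha>2 \<ge> 0"
  shows "\<bar>gauss_half \<alpha>1 \<sigma> x - gauss_half \<alpha>2 \<sigma> x\<bar> \<le> \<bar>\<alpha>1 - \<alpha>2\<bar> / \<sigma>\<^sup>2 * x\<^sup>2"
proof -
  have lip: "exp (- a) - exp (- b) \<le> b - a" if "0 \<le> a" "a \<le> b" for a b :: real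
  proof -
    have "exp (- a) - exp (- b) = exp (- a) * (1 - exp (- (b - a)))" by (simp add: right_diff_distrib exp_add[symmetric])
    also have "\<dots> \<le> 1 * (b - a)"
    proof (rule mult_mono)
      show "1 - exp (- (b - a)) \<le> b - a" using exp_ge_add_one_self[of "- (b - a)"] by linarith
    qed (use that in auto)
    finally show ?thesis by simp
  qed
  have "\<bar>exp (- a) - exp (- b)\<bar> \<le> \<bar>a - b\<bar>" if "0 \<le> a" "0 \<le> b" for a b :: real
    using lip[of a b] lip[of b a] that by (cases "a \<le> b") auto
  then have "\<bar>gauss_half \<alpha>1 \<sigma> x - gauss_half \<alpha>2 \<sigma> x\<bar> \<le> \<bar>\<alpha>1 * x\<^sup>2 / \<sigma>\<^sup>2 - \<alpha>2 * x\<^sup>2 / \<sigma>\<^sup>2\<bar>"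
    unfolding gauss_half_def using assms by simp
  also have "\<alpha>1 * x\<^sup>2 / \<sigma>\<^sup>2 - \<alpha>2 * x\<^sup>2 / \<sigma>\<^sup>2 = (\<alpha>1 - \<alpha>2) / \<sigma>\<^sup>2 * x\<^sup>2"
    by (simp add: left_diff_distrib diff_divide_distrib)
  also have "\<bar>(\<alpha>1 - \<alpha>2) / \<sigma>\<^sup>2 * x\<^sup>2\<bar> = \<bar>\<alpha>1 - \<alpha>2\<bar> / \<sigma>\<^sup>2 * x\<^sup>2" by (simp add: abs_mult)
  finally show ?thesis .
qed

text \<open>
  Detailed balance: for \<open>c\<^sup>2 = 1 - 2 \<alpha> \<delta>\<close> the left-hand side is,
  up to a constant, the exponential of a quadratic form in \<open>(x, z)\<close> that is symmetric
  in the two variables.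
\<close>

lemma gauss_half_reversible:
  assumes \<sigma>: "\<sigma> > 0" and \<delta>: "\<delta> > 0" and c: "c\<^sup>2 = 1 - 2 * \<alpha> * \<delta>"
  shows "gauss_half \<alpha> \<sigma> x * normal_density 0 (\<sigma> * sqrt \<delta>) (z - c * x)
       = gauss_half \<alpha> \<sigma> z * normal_density 0 (\<sigma> * sqrt \<delta>) (x - c * z)"
proof -
  have s2: "(\<sigma> * sqrt \<delta>)\<^sup>2 = \<sigma>\<^sup>2 * \<delta>" using \<delta> by (simp add: power_mult_distrib)
  have "- (\<alpha> * x\<^sup>2 / \<sigma>\<^sup>2) - (z - c * x)\<^sup>2 / (2 * (\<sigma>\<^sup>2 * \<delta>)) = - (\<alpha> * z\<^sup>2 / \<sigma>\<^sup>2) - (x - c * z)\<^sup>2 / (2 * (\<sigma>\<^sup>2 * \<delta>))"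
  proof -
    have "- (\<alpha> * a\<^sup>2 / \<sigma>\<^sup>2) - (b - c * a)\<^sup>2 / (2 * (\<sigma>\<^sup>2 * \<delta>)) = - (a\<^sup>2 + b\<^sup>2 - 2 * c * a * b) / (2 * (\<sigma>\<^sup>2 * \<delta>))" for a b
    proof -
      have "- (\<alpha> * a\<^sup>2 / \<sigma>\<^sup>2) = - (2 * \<alpha> * \<delta> * a\<^sup>2) / (2 * (\<sigma>\<^sup>2 * \<delta>))" using \<sigma> \<delta> by simp
      then have "- (\<alpha> * a\<^sup>2 / \<sigma>\<^sup>2) - (b - c * a)\<^sup>2 / (2 * (\<sigma>\<^sup>2 * \<delta>)) = (- (2 * \<alpha> * \<delta> * a\<^sup>2) - (b - c * a)\<^sup>2) / (2 * (\<sigma>\<^sup>2 * \<delta>))"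
        by (simp only: diff_divide_distrib)
      also have "- (2 * \<alpha> * \<delta> * a\<^sup>2) - (b - c * a)\<^sup>2 = - (a\<^sup>2 + b\<^sup>2 - 2 * c * a * b)"
        using c by (simp add: power2_eq_square algebra_simps)
          (metis (no_types, opaque_lifting) add.commute distrib_left mult.commute mult.left_commute mult_1_right add_diff_cancel_left' right_diff_distrib)
      finally show ?thesis .
    qed
    from this[of x z] this[of z x] show ?thesis by (simp add: algebra_simps)
  qed
  then show ?thesis
    unfolding gauss_half_def normal_density_def s2
    by (simp add: exp_add[symmetric])
qed

text \<open>
  The two weights differ only if the noise \<open>v\<close> carries the state \<open>z\<close>
  across the kink. Either one indicator fires on the wrong side, which costs the difference
  \<open>\<bar>e1 - e2\<bar>\<close> of the two profiles for \<open>\<bar>z\<bar> \<le> 2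
  \<bar>v\<bar>\<close>, or both or neither fire, which is possible only in the thin shell between
  the two crossing thresholds.
\<close>

lemma indicator_comparison:
  fixes c1 c2 e1 e2 v z :: real
  assumes c: "1/2 \<le> c1" "1/2 \<le> c2" and e: "0 \<le> e1" "e1 \<le> 1" "0 \<le> e2" "e2 \<le> 1"
  shows "\<bar>((if v + c1 * z \<le> 0 then e1 else 0) + (if v + c2 * z > 0 then e2 else 0)) - (if z \<le> 0 then e1 else e2)\<bar>
     \<le> \<bar>e1 - e2\<bar> * (if \<bar>z\<bar> \<le> 2 * \<bar>v\<bar> then 1 else 0)
      + (if \<bar>v\<bar> / max c1 c2 \<le> \<bar>z\<bar> \<and> \<bar>z\<bar> \<le> \<bar>v\<bar> / min c1 c2 then 1 else 0)"
proof -
  have pos: "0 < c1" "0 < c2" "0 < max c1 c2" "0 < min c1 c2" using c by auto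
  have half: "c * \<bar>z\<bar> \<ge> \<bar>z\<bar> / 2" if "1/2 \<le> c" for c using mult_right_mono[OF that, of "\<bar>z\<bar>"] by simp
  have ring: "(\<bar>v\<bar> / max c1 c2 \<le> \<bar>z\<bar> \<and> \<bar>z\<bar> \<le> \<bar>v\<bar> / min c1 c2) \<longleftrightarrow>
      (\<bar>v\<bar> \<le> max (c1 * \<bar>z\<bar>) (c2 * \<bar>z\<bar>) \<and> min (c1 * \<bar>z\<bar>) (c2 * \<bar>z\<bar>) \<le> \<bar>v\<bar>)"
    using pos by (simp add: pos_divide_le_eq pos_le_divide_eq max_mult_distrib_left min_mult_distrib_left) (simp add: mult.commute)
  have aux1: "\<bar>((if v + p \<le> 0 then e1 else 0) + (if v + q > 0 then e2 else 0)) - e2\<bar>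
     \<le> \<bar>e1 - e2\<bar> * (if r \<le> 2 * \<bar>v\<bar> then 1 else 0) + (if \<bar>v\<bar> \<le> max p q \<and> min p q \<le> \<bar>v\<bar> then 1 else 0)"
    if "0 < r" "r / 2 \<le> p" "r / 2 \<le> q" for p q r
    using that e by (auto simp: max_def min_def)
  have aux2: "\<bar>((if v + - p \<le> 0 then e1 else 0) + (if v + - q > 0 then e2 else 0)) - e1\<bar>
     \<le> \<bar>e1 - e2\<bar> * (if r \<le> 2 * \<bar>v\<bar> then 1 else 0) + (if \<bar>v\<bar> \<le> max p q \<and> min p q \<le> \<bar>v\<bar> then 1 else 0)"
    if "0 < r" "r / 2 \<le> p" "r / 2 \<le> q" for p q r
    using that e by (auto simp: max_def min_def)
  consider "z = 0" | "z > 0" | "z < 0" by linarith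
  then show ?thesis
  proof cases
    case 1
    then show ?thesis unfolding ring using e by auto
  next
    case 2
    then show ?thesis unfolding ring using aux1[OF _ half[OF c(1)] half[OF c(2)]] by simp
  next
    case 3
    then have "\<bar>z\<bar> > 0" "c * z = - (c * \<bar>z\<bar>)" for c by auto
    then show ?thesis unfolding ring using aux2[OF _ half[OF c(1)] half[OF c(2)]] 3 by (simp only: if_True less_imp_le)
  qed
qed

context
  fixes \<alpha>1 \<alpha>2 \<sigma> \<delta> :: real
  assumes pos: "\<sigma> > 0" "\<alpha>1 > 0" "\<alpha>2 > 0" "\<delta> > 0"
    and small: "2 * \<alpha>1 * \<delta> \<le> 3/4" "2 * \<alpha>2 * \<delta> \<le> 3/4"
begin

private abbreviation "s \<equiv> \<sigma> * sqrt \<delta>"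
private abbreviation "c1 \<equiv> decay \<alpha>1 \<delta>"
private abbreviation "c2 \<equiv> decay \<alpha>2 \<delta>"
private abbreviation "e1 \<equiv> gauss_half \<alpha>1 \<sigma>"
private abbreviation "e2 \<equiv> gauss_half \<alpha>2 \<sigma>"
private abbreviation "\<psi>0 \<equiv> stat_const \<alpha>1 \<alpha>2 \<sigma>"
text \<open>
  Up to the normalising constant, \<open>R0 z\<close> is the stationary density at
  \<open>z\<close>, and the density after one step is the average of \<open>R z v\<close> over the
  noise \<open>v\<close>. \<open>Db z v\<close>, defined below, bounds their difference.
\<close>

private definition "R z v = (if v + c1 * z \<le> 0 then e1 z else 0) + (if v + c2 * z > 0 then e2 z else 0)"
private definition "R0 z = (if z \<le> 0 then e1 z else e2 z)"

private lemma \<psi>0_nonneg: "0 \<le> \<psi>0" using pos by (simp add: stat_const_def)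

private lemma csq: "c1\<^sup>2 = 1 - 2 * \<alpha>1 * \<delta>" "c2\<^sup>2 = 1 - 2 * \<alpha>2 * \<delta>"
  using small by (simp_all add: decay_def)

private lemma c_half: "1/2 \<le> c1" "1/2 \<le> c2"
  unfolding decay_def by (rule real_le_rsqrt; use small in \<open>simp add: power2_eq_square\<close>)+

private lemma R_meas[measurable]: "(\<lambda>(z, v). R z v) \<in> borel_measurable (borel \<Otimes>\<^sub>M borel)"
  unfolding R_def split_beta by measurable

private lemma R_nonneg: "0 \<le> R z v" using gauss_half_bounds[of \<alpha>1] gauss_half_bounds[of \<alpha>2] pos by (simp add: R_def)

text \<open>
  The density after one step at \<open>z\<close> is an integral over the starting point
  \<open>x\<close>. Detailed balance on each half-line exchanges the roles of \<open>x\<close> and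
  \<open>z\<close>, after which \<open>x\<close> is a damped \<open>z\<close> plus noise and only
  the sign conditions on \<open>x\<close> remain.
\<close>

lemma one_step_density:
  fixes \<phi> :: "real \<Rightarrow> real"
  assumes [measurable]: "\<phi> \<in> borel_measurable borel" and \<phi>: "\<And>x. 0 \<le> \<phi> x"
  shows "(\<integral>\<^sup>+x. ennreal (stat_density \<alpha>1 \<alpha>2 \<sigma> x) * (\<integral>\<^sup>+v. ennreal (normal_density 0 s v) * ennreal (\<phi> (kink c1 c2 x + v)) \<partial>lborel) \<partial>lborel)
      = (\<integral>\<^sup>+z. \<integral>\<^sup>+v. ennreal (\<phi> z * (\<psi>0 * (R z v * normal_density 0 s v))) \<partial>lborel \<partial>lborel)"
proof -
  let ?p = "normal_density 0 s"
  have sd: "0 \<le> stat_density \<alpha>1 \<alpha>2 \<sigma> x" for x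
    unfolding stat_density_eq using \<psi>0_nonneg by (simp add: gauss_half_def)
  have shift: "(\<integral>\<^sup>+v. f v \<partial>lborel) = (\<integral>\<^sup>+v. f (t + v) \<partial>lborel)" if [measurable]: "f \<in> borel_measurable borel" for f :: "real \<Rightarrow> ennreal" and t
    using nn_integral_real_affine[of f 1 t] by simp
  have "(\<integral>\<^sup>+x. ennreal (stat_density \<alpha>1 \<alpha>2 \<sigma> x) * (\<integral>\<^sup>+v. ennreal (?p v) * ennreal (\<phi> (kink c1 c2 x + v)) \<partial>lborel) \<partial>lborel)
     = (\<integral>\<^sup>+x. \<integral>\<^sup>+z. ennreal (\<phi> z * (stat_density \<alpha>1 \<alpha>2 \<sigma> x * ?p (z - kink c1 c2 x))) \<partial>lborel \<partial>lborel)"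
  proof (intro nn_integral_cong)
    fix x
    have "(\<integral>\<^sup>+v. ennreal (?p v) * ennreal (\<phi> (kink c1 c2 x + v)) \<partial>lborel)
       = (\<integral>\<^sup>+z. ennreal (?p (- kink c1 c2 x + z)) * ennreal (\<phi> (kink c1 c2 x + (- kink c1 c2 x + z))) \<partial>lborel)"
      by (rule shift) measurable
    then have "ennreal (stat_density \<alpha>1 \<alpha>2 \<sigma> x) * (\<integral>\<^sup>+v. ennreal (?p v) * ennreal (\<phi> (kink c1 c2 x + v)) \<partial>lborel)
       = (\<integral>\<^sup>+z. ennreal (stat_density \<alpha>1 \<alpha>2 \<sigma> x) * (ennreal (?p (- kink c1 c2 x + z)) * ennreal (\<phi> z)) \<partial>lborel)"
      by (subst nn_integral_cmult) auto
    also have "\<dots> = (\<integral>\<^sup>+z. ennreal (\<phi> z * (stat_density \<alpha>1 \<alpha>2 \<sigma> x * ?p (z - kink c1 c2 x))) \<partial>lborel)"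
      using \<phi> sd by (intro nn_integral_cong) (simp add: ennreal_mult[symmetric] normal_density_nonneg mult_ac)
    finally show "ennreal (stat_density \<alpha>1 \<alpha>2 \<sigma> x) * (\<integral>\<^sup>+v. ennreal (?p v) * ennreal (\<phi> (kink c1 c2 x + v)) \<partial>lborel)
       = (\<integral>\<^sup>+z. ennreal (\<phi> z * (stat_density \<alpha>1 \<alpha>2 \<sigma> x * ?p (z - kink c1 c2 x))) \<partial>lborel)" .
  qed
  also have "\<dots> = (\<integral>\<^sup>+z. \<integral>\<^sup>+x. ennreal (\<phi> z * (stat_density \<alpha>1 \<alpha>2 \<sigma> x * ?p (z - kink c1 c2 x))) \<partial>lborel \<partial>lborel)"
    by (rule lborel_pair.Fubini') measurable
  also have "\<dots> = (\<integral>\<^sup>+z. \<integral>\<^sup>+v. ennreal (\<phi> z * (\<psi>0 * (R z v * ?p v))) \<partial>lborel \<partial>lborel)"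
  proof (rule nn_integral_cong)
    fix z
    let ?f = "\<lambda>x. ennreal (\<phi> z * (\<psi>0 * ((if x \<le> 0 then e1 z else 0) * ?p (x - c1 * z))))"
    let ?g = "\<lambda>x. ennreal (\<phi> z * (\<psi>0 * ((if x > 0 then e2 z else 0) * ?p (x - c2 * z))))"
    have nn: "0 \<le> e1 z" "0 \<le> e2 z" "0 \<le> ?p x" for x using pos by (auto simp: gauss_half_def)
    have "(\<integral>\<^sup>+x. ennreal (\<phi> z * (stat_density \<alpha>1 \<alpha>2 \<sigma> x * ?p (z - kink c1 c2 x))) \<partial>lborel) = (\<integral>\<^sup>+x. ?f x + ?g x \<partial>lborel)"
    proof (intro nn_integral_cong)
      fix x
      have "stat_density \<alpha>1 \<alpha>2 \<sigma> x * ?p (z - kink c1 c2 x)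
         = \<psi>0 * ((if x \<le> 0 then e1 z else 0) * ?p (x - c1 * z)) + \<psi>0 * ((if x > 0 then e2 z else 0) * ?p (x - c2 * z))"
        using gauss_half_reversible[OF pos(1,4) csq(1), of x z] gauss_half_reversible[OF pos(1,4) csq(2), of x z]
        by (cases "x \<le> 0") (simp_all add: stat_density_eq kink_def mult.assoc)
      then show "ennreal (\<phi> z * (stat_density \<alpha>1 \<alpha>2 \<sigma> x * ?p (z - kink c1 c2 x))) = ?f x + ?g x"
        using \<phi> \<psi>0_nonneg nn by (simp add: distrib_left ennreal_plus[symmetric] del: ennreal_plus)
    qed
    also have "\<dots> = (\<integral>\<^sup>+x. ?f x \<partial>lborel) + (\<integral>\<^sup>+x. ?g x \<partial>lborel)" by (rule nn_integral_add) auto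
    also have "(\<integral>\<^sup>+x. ?f x \<partial>lborel) = (\<integral>\<^sup>+v. ?f (c1 * z + v) \<partial>lborel)" by (rule shift) measurable
    also have "(\<integral>\<^sup>+x. ?g x \<partial>lborel) = (\<integral>\<^sup>+v. ?g (c2 * z + v) \<partial>lborel)" by (rule shift) measurable
    also have "(\<integral>\<^sup>+v. ?f (c1 * z + v) \<partial>lborel) + (\<integral>\<^sup>+v. ?g (c2 * z + v) \<partial>lborel) = (\<integral>\<^sup>+v. ?f (c1 * z + v) + ?g (c2 * z + v) \<partial>lborel)"
      by (rule nn_integral_add[symmetric]) auto
    also have "\<dots> = (\<integral>\<^sup>+v. ennreal (\<phi> z * (\<psi>0 * (R z v * ?p v))) \<partial>lborel)"
      using \<phi> \<psi>0_nonneg nn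
      by (intro nn_integral_cong) (simp add: R_def distrib_left distrib_right add.commute[of _ "_ * z"] ennreal_plus[symmetric] del: ennreal_plus)
    finally show "(\<integral>\<^sup>+x. ennreal (\<phi> z * (stat_density \<alpha>1 \<alpha>2 \<sigma> x * ?p (z - kink c1 c2 x))) \<partial>lborel)
       = (\<integral>\<^sup>+v. ennreal (\<phi> z * (\<psi>0 * (R z v * ?p v))) \<partial>lborel)" .
  qed
  finally show ?thesis .
qed

lemma stat_as_double:
  fixes \<phi> :: "real \<Rightarrow> real"
  assumes [measurable]: "\<phi> \<in> borel_measurable borel" and \<phi>: "\<And>x. 0 \<le> \<phi> x"
  shows "(\<integral>\<^sup>+x. ennreal (stat_density \<alpha>1 \<alpha>2 \<sigma> x) * ennreal (\<phi> x) \<partial>lborel)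
      = (\<integral>\<^sup>+z. \<integral>\<^sup>+v. ennreal (\<phi> z * (\<psi>0 * (R0 z * normal_density 0 s v))) \<partial>lborel \<partial>lborel)"
proof (intro nn_integral_cong)
  fix z
  let ?p = "normal_density 0 s"
  have nn: "0 \<le> R0 z" "0 \<le> ?p x" for x using pos by (auto simp: R0_def gauss_half_def)
  have one: "(\<integral>\<^sup>+v. ennreal (?p v) \<partial>lborel) = 1"
    using pos by (subst nn_integral_eq_integral) auto
  have "(\<integral>\<^sup>+v. ennreal (\<phi> z * (\<psi>0 * (R0 z * ?p v))) \<partial>lborel) = (\<integral>\<^sup>+v. ennreal (\<phi> z * (\<psi>0 * R0 z)) * ennreal (?p v) \<partial>lborel)"
    using \<phi> \<psi>0_nonneg nn by (intro nn_integral_cong) (simp add: ennreal_mult[symmetric] mult.assoc)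
  also have "\<dots> = ennreal (\<phi> z * (\<psi>0 * R0 z))" by (simp add: nn_integral_cmult one)
  also have "\<dots> = ennreal (stat_density \<alpha>1 \<alpha>2 \<sigma> z) * ennreal (\<phi> z)"
    using \<phi> \<psi>0_nonneg nn by (simp add: stat_density_eq R0_def ennreal_mult[symmetric] mult.commute)
  finally show "ennreal (stat_density \<alpha>1 \<alpha>2 \<sigma> z) * ennreal (\<phi> z) = (\<integral>\<^sup>+v. ennreal (\<phi> z * (\<psi>0 * (R0 z * ?p v))) \<partial>lborel)" ..
qed

private definition "K1 = \<bar>\<alpha>1 - \<alpha>2\<bar> / \<sigma>\<^sup>2"
private definition "Db z v = 4 * K1 * v\<^sup>2 * indicator {- (2 * \<bar>v\<bar>)..2 * \<bar>v\<bar>} z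
  + (indicator {\<bar>v\<bar> / max c1 c2..\<bar>v\<bar> / min c1 c2} z + indicator {- (\<bar>v\<bar> / min c1 c2)..- (\<bar>v\<bar> / max c1 c2)} z :: real)"

private lemma R_close: "\<bar>R z v - R0 z\<bar> \<le> Db z v"
proof -
  have K1: "0 \<le> K1" by (simp add: K1_def)
  have "\<bar>R z v - R0 z\<bar> \<le> \<bar>e1 z - e2 z\<bar> * (if \<bar>z\<bar> \<le> 2 * \<bar>v\<bar> then 1 else 0)
      + (if \<bar>v\<bar> / max c1 c2 \<le> \<bar>z\<bar> \<and> \<bar>z\<bar> \<le> \<bar>v\<bar> / min c1 c2 then 1 else 0)"
    unfolding R_def R0_def using gauss_half_bounds[of \<alpha>1 \<sigma> z] gauss_half_bounds[of \<alpha>2 \<sigma> z] pos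
    by (intro indicator_comparison c_half) auto
  also have "\<dots> \<le> Db z v"
    unfolding Db_def
  proof (rule add_mono)
    show "\<bar>e1 z - e2 z\<bar> * (if \<bar>z\<bar> \<le> 2 * \<bar>v\<bar> then 1 else 0) \<le> 4 * K1 * v\<^sup>2 * indicator {- (2 * \<bar>v\<bar>)..2 * \<bar>v\<bar>} z"
    proof (cases "\<bar>z\<bar> \<le> 2 * \<bar>v\<bar>")
      case True
      have "\<bar>e1 z - e2 z\<bar> \<le> K1 * z\<^sup>2" unfolding K1_def using pos by (intro gauss_half_diff) auto
      also have "z\<^sup>2 \<le> (2 * \<bar>v\<bar>)\<^sup>2" using True by (metis abs_ge_zero power2_abs power_mono)
      then have "K1 * z\<^sup>2 \<le> K1 * (2 * \<bar>v\<bar>)\<^sup>2" using K1 by (rule mult_left_mono)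
      finally have "\<bar>e1 z - e2 z\<bar> \<le> 4 * K1 * v\<^sup>2" by (simp add: power_mult_distrib)
      moreover have "z \<in> {- (2 * \<bar>v\<bar>)..2 * \<bar>v\<bar>}" using True by (auto simp: abs_le_iff)
      ultimately show ?thesis using True by simp
    qed (use K1 in auto)
    show "(if \<bar>v\<bar> / max c1 c2 \<le> \<bar>z\<bar> \<and> \<bar>z\<bar> \<le> \<bar>v\<bar> / min c1 c2 then 1 else 0) \<le>
      (indicator {\<bar>v\<bar> / max c1 c2..\<bar>v\<bar> / min c1 c2} z + indicator {- (\<bar>v\<bar> / min c1 c2)..- (\<bar>v\<bar> / max c1 c2)} z :: real)"
      by (cases "z \<ge> 0") (auto simp: indicator_def)
  qed
  finally show ?thesis .
qed

private lemma Db_nonneg: "0 \<le> Db z v"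
  by (rule order_trans[OF abs_ge_zero R_close])

private lemma Db_meas[measurable]: "(\<lambda>(z, v). Db z v) \<in> borel_measurable (borel \<Otimes>\<^sub>M borel)"
  unfolding Db_def split_beta indicator_def atLeastAtMost_iff by measurable

private lemma c_diff: "1 / min c1 c2 - 1 / max c1 c2 \<le> 12 * max \<alpha>1 \<alpha>2 * \<delta>"
proof -
  define A where "A = max \<alpha>1 \<alpha>2"
  have b: "\<bar>1 - \<alpha> * \<delta> - decay \<alpha> \<delta>\<bar> \<le> \<alpha> * \<delta>" if "0 < \<alpha>" "2 * \<alpha> * \<delta> \<le> 3/4" for \<alpha>
  proof -
    have "\<bar>1 - \<alpha> * \<delta> - decay \<alpha> \<delta>\<bar> \<le> 2 * (\<alpha> * \<delta>)\<^sup>2" using that pos by (intro decay_first_order) auto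
    also have "\<dots> = (2 * (\<alpha> * \<delta>)) * (\<alpha> * \<delta>)" by (simp add: power2_eq_square)
    also have "\<dots> \<le> 1 * (\<alpha> * \<delta>)" using that pos by (intro mult_right_mono) auto
    finally show ?thesis by simp
  qed
  have le: "\<alpha>1 * \<delta> \<le> A * \<delta>" "\<alpha>2 * \<delta> \<le> A * \<delta>" using pos by (auto simp: A_def)
  have nn: "0 \<le> \<alpha>1 * \<delta>" "0 \<le> \<alpha>2 * \<delta>" using pos by auto
  have d: "\<bar>c1 - c2\<bar> \<le> 3 * (A * \<delta>)"
    using b[OF pos(2) small(1)] b[OF pos(3) small(2)] le nn by linarith
  have mm: "max c1 c2 - min c1 c2 = \<bar>c1 - c2\<bar>" by (auto simp: max_def min_def)
  have h: "1/2 \<le> min c1 c2" "1/2 \<le> max c1 c2" using c_half by auto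
  have nz: "min c1 c2 \<noteq> 0" "max c1 c2 \<noteq> 0" using h by linarith+
  have prod: "1/4 \<le> min c1 c2 * max c1 c2" using mult_mono[OF h] h by simp
  have "1 / min c1 c2 - 1 / max c1 c2 = \<bar>c1 - c2\<bar> / (min c1 c2 * max c1 c2)"
    using diff_frac_eq[of "min c1 c2" "max c1 c2" 1 1] nz unfolding mm[symmetric] by simp
  also have "\<dots> \<le> \<bar>c1 - c2\<bar> / (1/4)" using prod by (intro divide_left_mono) auto
  also have "\<dots> \<le> 12 * (A * \<delta>)" using d by simp
  finally show ?thesis by (simp add: A_def mult.assoc)
qed

text \<open>
  Integrating over \<open>z\<close> first, the region near the kink has width of order
  \<open>\<bar>v\<bar>\<close> and profile error of order \<open>v\<^sup>2\<close>, and the shell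
  has width of order \<open>\<delta> \<bar>v\<bar>\<close>. As \<open>v\<close> is of size
  \<open>\<sigma> sqrt \<delta>\<close>, both contributions are of order \<open>\<delta> sqrt
  \<delta>\<close>.
\<close>

lemma one_step_error:
  "(\<integral>\<^sup>+z. \<integral>\<^sup>+v. ennreal (\<psi>0 * (Db z v * normal_density 0 s v)) \<partial>lborel \<partial>lborel)
     \<le> ennreal (\<psi>0 * sqrt (2 / pi) * (32 * (\<bar>\<alpha>1 - \<alpha>2\<bar> / \<sigma>\<^sup>2) * \<sigma> ^ 3 + 24 * max \<alpha>1 \<alpha>2 * \<sigma>) * (\<delta> * sqrt \<delta>))"
proof -
  let ?p = "normal_density 0 s"
  define a where "a v = \<bar>v\<bar> / max c1 c2" for v
  define b where "b v = \<bar>v\<bar> / min c1 c2" for v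
  define k where "k = 24 * max \<alpha>1 \<alpha>2 * \<delta>"
  have K1: "0 \<le> K1" by (simp add: K1_def)
  have k: "0 \<le> k" using pos by (simp add: k_def)
  have h: "0 < min c1 c2" "min c1 c2 \<le> max c1 c2" "0 < max c1 c2" using c_half by auto
  have ab: "a v \<le> b v" for v unfolding a_def b_def using h by (intro divide_left_mono) auto
  have ba: "2 * (b v - a v) \<le> k * \<bar>v\<bar>" for v
  proof -
    have "b v - a v = (1 / min c1 c2 - 1 / max c1 c2) * \<bar>v\<bar>" by (simp add: a_def b_def left_diff_distrib)
    also have "\<dots> \<le> 12 * max \<alpha>1 \<alpha>2 * \<delta> * \<bar>v\<bar>" by (intro mult_right_mono c_diff) auto
    finally show ?thesis by (simp add: k_def)
  qed
  have inner: "(\<integral>\<^sup>+z. ennreal (\<psi>0 * (Db z v * ?p v)) \<partial>lborel) \<le> ennreal (\<psi>0 * (16 * K1 * (?p v * \<bar>v\<bar> ^ 3) + k * (?p v * \<bar>v\<bar>)))" for v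
  proof -
    have pv: "0 \<le> ?p v" using pos by simp
    have "(\<integral>\<^sup>+z. ennreal (\<psi>0 * (Db z v * ?p v)) \<partial>lborel) = (\<integral>\<^sup>+z. ennreal (\<psi>0 * ?p v) * ennreal (Db z v) \<partial>lborel)"
      using \<psi>0_nonneg pv Db_nonneg by (intro nn_integral_cong) (simp add: ennreal_mult[symmetric] mult_ac)
    also have "\<dots> = ennreal (\<psi>0 * ?p v) * (\<integral>\<^sup>+z. ennreal (Db z v) \<partial>lborel)"
      by (rule nn_integral_cmult) measurable
    also have "(\<integral>\<^sup>+z. ennreal (Db z v) \<partial>lborel) = (\<integral>\<^sup>+z. ennreal (4 * K1 * v\<^sup>2) * indicator {- (2 * \<bar>v\<bar>)..2 * \<bar>v\<bar>} z
         + (indicator {a v..b v} z + indicator {- b v..- a v} z) \<partial>lborel)"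
      unfolding Db_def a_def b_def using K1
      by (intro nn_integral_cong) (simp add: ennreal_mult ennreal_indicator)
    also have "\<dots> = ennreal (4 * K1 * v\<^sup>2) * emeasure lborel {- (2 * \<bar>v\<bar>)..2 * \<bar>v\<bar>}
         + (emeasure lborel {a v..b v} + emeasure lborel {- b v..- a v})"
      by (subst nn_integral_add, simp, simp, subst nn_integral_add) (auto simp: nn_integral_cmult)
    also have "\<dots> = ennreal (4 * K1 * v\<^sup>2 * (4 * \<bar>v\<bar>) + 2 * (b v - a v))"
      using K1 ab[of v] by (simp add: ennreal_mult[symmetric] ennreal_plus[symmetric] del: ennreal_plus)
    also have "\<dots> \<le> ennreal (16 * K1 * \<bar>v\<bar> ^ 3 + k * \<bar>v\<bar>)"
    proof (rule ennreal_leI, rule add_mono)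
      have "4 * K1 * v\<^sup>2 * (4 * \<bar>v\<bar>) = 16 * K1 * (\<bar>v\<bar>\<^sup>2 * \<bar>v\<bar>)" by simp
      then show "4 * K1 * v\<^sup>2 * (4 * \<bar>v\<bar>) \<le> 16 * K1 * \<bar>v\<bar> ^ 3" by (simp only: power3_eq_cube power2_eq_square mult.assoc order_refl)
    qed (rule ba)
    finally have "(\<integral>\<^sup>+z. ennreal (\<psi>0 * (Db z v * ?p v)) \<partial>lborel) \<le> ennreal (\<psi>0 * ?p v) * ennreal (16 * K1 * \<bar>v\<bar> ^ 3 + k * \<bar>v\<bar>)"
      by (simp add: mult_left_mono)
    also have "\<dots> = ennreal (\<psi>0 * (16 * K1 * (?p v * \<bar>v\<bar> ^ 3) + k * (?p v * \<bar>v\<bar>)))"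
      using \<psi>0_nonneg pv K1 k by (simp add: ennreal_mult[symmetric] algebra_simps)
    finally show ?thesis .
  qed
  have m3: "has_bochner_integral lborel (\<lambda>v. ?p v * \<bar>v\<bar> ^ 3) (2 * s ^ 3 * sqrt (2 / pi))"
    using normal_moment_abs_odd[of s 0 1] pos by (simp add: numeral_3_eq_3)
  have m1: "has_bochner_integral lborel (\<lambda>v. ?p v * \<bar>v\<bar>) (s * sqrt (2 / pi))"
    using normal_moment_abs_odd[of s 0 0] pos by simp
  have hb: "has_bochner_integral lborel (\<lambda>v. \<psi>0 * (16 * K1 * (?p v * \<bar>v\<bar> ^ 3) + k * (?p v * \<bar>v\<bar>)))
     (\<psi>0 * (16 * K1 * (2 * s ^ 3 * sqrt (2 / pi)) + k * (s * sqrt (2 / pi))))"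
    by (intro has_bochner_integral_mult_right has_bochner_integral_add m3 m1)
  have "(\<integral>\<^sup>+z. \<integral>\<^sup>+v. ennreal (\<psi>0 * (Db z v * ?p v)) \<partial>lborel \<partial>lborel) = (\<integral>\<^sup>+v. \<integral>\<^sup>+z. ennreal (\<psi>0 * (Db z v * ?p v)) \<partial>lborel \<partial>lborel)"
    by (rule lborel_pair.Fubini') measurable
  also have "\<dots> \<le> (\<integral>\<^sup>+v. ennreal (\<psi>0 * (16 * K1 * (?p v * \<bar>v\<bar> ^ 3) + k * (?p v * \<bar>v\<bar>))) \<partial>lborel)"
    by (intro nn_integral_mono inner)
  also have "\<dots> = ennreal (\<psi>0 * (16 * K1 * (2 * s ^ 3 * sqrt (2 / pi)) + k * (s * sqrt (2 / pi))))"
  proof -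
    have nn: "0 \<le> \<psi>0 * (16 * K1 * (?p v * \<bar>v\<bar> ^ 3) + k * (?p v * \<bar>v\<bar>))" for v
      using \<psi>0_nonneg K1 k pos by simp
    show ?thesis
      using nn_integral_eq_integral[OF integrable.intros[OF hb] AE_I2[OF nn]]
      unfolding has_bochner_integral_integral_eq[OF hb] .
  qed
  also have "\<psi>0 * (16 * K1 * (2 * s ^ 3 * sqrt (2 / pi)) + k * (s * sqrt (2 / pi)))
     = \<psi>0 * sqrt (2 / pi) * (32 * (\<bar>\<alpha>1 - \<alpha>2\<bar> / \<sigma>\<^sup>2) * \<sigma> ^ 3 + 24 * max \<alpha>1 \<alpha>2 * \<sigma>) * (\<delta> * sqrt \<delta>)"
  proof -
    have "s ^ 3 = \<sigma> ^ 3 * (\<delta> * sqrt \<delta>)" using pos by (simp add: power_mult_distrib power3_eq_cube)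
    then show ?thesis by (simp add: K1_def k_def algebra_simps)
  qed
  finally show ?thesis .
qed

text \<open>
  One step moves the stationary law by at most order \<open>\<delta> sqrt \<delta>\<close>, tested
  against all measurable functions with values in \<open>[0, 1]\<close>. The order is better than
  \<open>\<delta>\<close>, so the errors of \<open>h / \<delta>\<close> steps still vanish.
\<close>

lemma one_step_bound:
  fixes \<phi> :: "real \<Rightarrow> real"
  assumes prob: "prob_space (stat_law \<alpha>1 \<alpha>2 \<sigma>)"
    and [measurable]: "\<phi> \<in> borel_measurable borel" and \<phi>: "\<And>x. 0 \<le> \<phi> x" "\<And>x. \<phi> x \<le> 1"
  shows "\<bar>(\<integral>x. (\<integral>v. \<phi> (kink c1 c2 x + v) \<partial>density lborel (\<lambda>x. ennreal (normal_density 0 s x))) \<partial>stat_law \<alpha>1 \<alpha>2 \<sigma>)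
     - (\<integral>x. \<phi> x \<partial>stat_law \<alpha>1 \<alpha>2 \<sigma>)\<bar>
     \<le> \<psi>0 * sqrt (2 / pi) * (32 * (\<bar>\<alpha>1 - \<alpha>2\<bar> / \<sigma>\<^sup>2) * \<sigma> ^ 3 + 24 * max \<alpha>1 \<alpha>2 * \<sigma>) * (\<delta> * sqrt \<delta>)"
proof -
  let ?p = "normal_density 0 s" and ?\<pi> = "stat_law \<alpha>1 \<alpha>2 \<sigma>"
  let ?N = "density lborel (\<lambda>x. ennreal (?p x))"
  define C where "C = \<psi>0 * sqrt (2 / pi) * (32 * (\<bar>\<alpha>1 - \<alpha>2\<bar> / \<sigma>\<^sup>2) * \<sigma> ^ 3 + 24 * max \<alpha>1 \<alpha>2 * \<sigma>) * (\<delta> * sqrt \<delta>)"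
  have "C \<ge> 0" unfolding C_def using \<psi>0_nonneg pos by (intro mult_nonneg_nonneg add_nonneg_nonneg) auto
  interpret \<pi>: prob_space ?\<pi> by (rule prob)
  have [measurable_cong]: "sets ?\<pi> = sets borel" by (simp add: stat_law_def)
  interpret N: prob_space ?N using pos by (intro prob_space_normal_density) simp
  define g where "g x = (\<integral>v. \<phi> (kink c1 c2 x + v) \<partial>?N)" for x
  have [measurable]: "g \<in> borel_measurable borel" unfolding g_def by measurable
  have iN: "integrable ?N (\<lambda>v. \<phi> (kink c1 c2 x + v))" for x
    by (rule N.integrable_const_bound[where B=1]) (auto simp: \<phi>)
  have g: "0 \<le> g x" "g x \<le> 1" for x
  proof -
    show "0 \<le> g x" unfolding g_def by (intro Bochner_Integration.integral_nonneg \<phi>)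
    have "g x \<le> (\<integral>v. 1 \<partial>?N)" unfolding g_def by (intro integral_mono iN) (auto simp: \<phi>)
    then show "g x \<le> 1" using N.prob_space by simp
  qed
  have A: "ennreal (\<integral>x. g x \<partial>?\<pi>) = (\<integral>\<^sup>+z. \<integral>\<^sup>+v. ennreal (\<phi> z * (\<psi>0 * (R z v * ?p v))) \<partial>lborel \<partial>lborel)"
  proof -
    have "ennreal (\<integral>x. g x \<partial>?\<pi>) = (\<integral>\<^sup>+x. ennreal (g x) \<partial>?\<pi>)"
      by (intro nn_integral_eq_integral[symmetric] \<pi>.integrable_const_bound[where B=1]) (auto simp: g)
    also have "\<dots> = (\<integral>\<^sup>+x. ennreal (stat_density \<alpha>1 \<alpha>2 \<sigma> x) * ennreal (g x) \<partial>lborel)"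
      unfolding stat_law_def by (rule nn_integral_density) measurable
    also have "\<dots> = (\<integral>\<^sup>+x. ennreal (stat_density \<alpha>1 \<alpha>2 \<sigma> x) * (\<integral>\<^sup>+v. ennreal (?p v) * ennreal (\<phi> (kink c1 c2 x + v)) \<partial>lborel) \<partial>lborel)"
    proof (rule nn_integral_cong)
      fix x
      have "ennreal (g x) = (\<integral>\<^sup>+v. ennreal (\<phi> (kink c1 c2 x + v)) \<partial>?N)"
        unfolding g_def by (intro nn_integral_eq_integral[symmetric] iN) (auto simp: \<phi>)
      also have "\<dots> = (\<integral>\<^sup>+v. ennreal (?p v) * ennreal (\<phi> (kink c1 c2 x + v)) \<partial>lborel)"
        by (rule nn_integral_density) measurable
      finally show "ennreal (stat_density \<alpha>1 \<alpha>2 \<sigma> x) * ennreal (g x) = ennreal (stat_density \<alpha>1 \<alpha>2 \<sigma> x) * (\<integral>\<^sup>+v. ennreal (?p v) * ennreal (\<phi> (kink c1 c2 x + v)) \<partial>lborel)"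
        by simp
    qed
    also have "\<dots> = (\<integral>\<^sup>+z. \<integral>\<^sup>+v. ennreal (\<phi> z * (\<psi>0 * (R z v * ?p v))) \<partial>lborel \<partial>lborel)"
      by (rule one_step_density) (auto simp: \<phi>)
    finally show ?thesis .
  qed
  have B: "ennreal (\<integral>x. \<phi> x \<partial>?\<pi>) = (\<integral>\<^sup>+z. \<integral>\<^sup>+v. ennreal (\<phi> z * (\<psi>0 * (R0 z * ?p v))) \<partial>lborel \<partial>lborel)"
  proof -
    have "ennreal (\<integral>x. \<phi> x \<partial>?\<pi>) = (\<integral>\<^sup>+x. ennreal (\<phi> x) \<partial>?\<pi>)"
      by (intro nn_integral_eq_integral[symmetric] \<pi>.integrable_const_bound[where B=1]) (auto simp: \<phi>)
    also have "\<dots> = (\<integral>\<^sup>+x. ennreal (stat_density \<alpha>1 \<alpha>2 \<sigma> x) * ennreal (\<phi> x) \<partial>lborel)"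
      unfolding stat_law_def by (rule nn_integral_density) measurable
    finally show ?thesis by (simp only: stat_as_double[OF \<open>\<phi> \<in> borel_measurable borel\<close> \<phi>(1)])
  qed
  have [measurable]: "R0 \<in> borel_measurable borel" unfolding R0_def[abs_def] by measurable
  have cmp: "(\<integral>\<^sup>+z. \<integral>\<^sup>+v. ennreal (\<phi> z * (\<psi>0 * (S z v * ?p v))) \<partial>lborel \<partial>lborel)
      \<le> (\<integral>\<^sup>+z. \<integral>\<^sup>+v. ennreal (\<phi> z * (\<psi>0 * (T z v * ?p v))) \<partial>lborel \<partial>lborel) + ennreal C"
    if [measurable]: "(\<lambda>(z, v). S z v) \<in> borel_measurable (borel \<Otimes>\<^sub>M borel)" "(\<lambda>(z, v). T z v) \<in> borel_measurable (borel \<Otimes>\<^sub>M borel)"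
      and le: "\<And>z v. S z v \<le> T z v + Db z v" and T: "\<And>z v. 0 \<le> T z v" for S T :: "real \<Rightarrow> real \<Rightarrow> real"
  proof -
    have "(\<integral>\<^sup>+z. \<integral>\<^sup>+v. ennreal (\<phi> z * (\<psi>0 * (S z v * ?p v))) \<partial>lborel \<partial>lborel)
      \<le> (\<integral>\<^sup>+z. \<integral>\<^sup>+v. ennreal (\<phi> z * (\<psi>0 * (T z v * ?p v))) + ennreal (\<psi>0 * (Db z v * ?p v)) \<partial>lborel \<partial>lborel)"
    proof (intro nn_integral_mono)
      fix z v
      have pv: "0 \<le> ?p v" using pos by simp
      have d: "0 \<le> \<psi>0 * (Db z v * ?p v)" using \<psi>0_nonneg Db_nonneg pv by (intro mult_nonneg_nonneg)
      have "S z v * ?p v \<le> (T z v + Db z v) * ?p v" by (intro mult_right_mono le pv)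
      then have "\<psi>0 * (S z v * ?p v) \<le> \<psi>0 * ((T z v + Db z v) * ?p v)" using \<psi>0_nonneg by (rule mult_left_mono)
      then have "\<phi> z * (\<psi>0 * (S z v * ?p v)) \<le> \<phi> z * (\<psi>0 * ((T z v + Db z v) * ?p v))" using \<phi>(1) by (rule mult_left_mono)
      also have "\<dots> = \<phi> z * (\<psi>0 * (T z v * ?p v)) + \<phi> z * (\<psi>0 * (Db z v * ?p v))" by (simp add: algebra_simps)
      also have "\<phi> z * (\<psi>0 * (Db z v * ?p v)) \<le> 1 * (\<psi>0 * (Db z v * ?p v))" by (intro mult_right_mono \<phi> d)
      finally have "\<phi> z * (\<psi>0 * (S z v * ?p v)) \<le> \<phi> z * (\<psi>0 * (T z v * ?p v)) + \<psi>0 * (Db z v * ?p v)" by simp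
      moreover have "0 \<le> \<phi> z * (\<psi>0 * (T z v * ?p v))" using \<psi>0_nonneg T pv \<phi> by (intro mult_nonneg_nonneg)
      ultimately show "ennreal (\<phi> z * (\<psi>0 * (S z v * ?p v))) \<le> ennreal (\<phi> z * (\<psi>0 * (T z v * ?p v))) + ennreal (\<psi>0 * (Db z v * ?p v))"
        using d by (simp add: ennreal_plus[symmetric] ennreal_leI del: ennreal_plus)
    qed
    also have "\<dots> = (\<integral>\<^sup>+z. (\<integral>\<^sup>+v. ennreal (\<phi> z * (\<psi>0 * (T z v * ?p v))) \<partial>lborel) + (\<integral>\<^sup>+v. ennreal (\<psi>0 * (Db z v * ?p v)) \<partial>lborel) \<partial>lborel)"
      by (intro nn_integral_cong nn_integral_add) measurable
    also have "\<dots> = (\<integral>\<^sup>+z. \<integral>\<^sup>+v. ennreal (\<phi> z * (\<psi>0 * (T z v * ?p v))) \<partial>lborel \<partial>lborel)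
        + (\<integral>\<^sup>+z. \<integral>\<^sup>+v. ennreal (\<psi>0 * (Db z v * ?p v)) \<partial>lborel \<partial>lborel)"
      by (rule nn_integral_add) measurable
    also have "\<dots> \<le> (\<integral>\<^sup>+z. \<integral>\<^sup>+v. ennreal (\<phi> z * (\<psi>0 * (T z v * ?p v))) \<partial>lborel \<partial>lborel) + ennreal C"
      unfolding C_def by (intro add_left_mono one_step_error)
    finally show ?thesis .
  qed
  have R0nn: "0 \<le> R0 z" for z by (simp add: R0_def gauss_half_def)
  have a0: "0 \<le> (\<integral>x. g x \<partial>?\<pi>)" and b0: "0 \<le> (\<integral>x. \<phi> x \<partial>?\<pi>)"
    by (intro Bochner_Integration.integral_nonneg g \<phi>)+
  have "ennreal (\<integral>x. g x \<partial>?\<pi>) \<le> ennreal (\<integral>x. \<phi> x \<partial>?\<pi>) + ennreal C"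
    unfolding A B
  proof (rule cmp)
    show "R z v \<le> R0 z + Db z v" for z v using R_close[of z v] by linarith
  qed (use R0nn in \<open>simp_all add: R_meas\<close>)
  moreover have "ennreal (\<integral>x. \<phi> x \<partial>?\<pi>) \<le> ennreal (\<integral>x. g x \<partial>?\<pi>) + ennreal C"
    unfolding A B
  proof (rule cmp)
    show "R0 z \<le> R z v + Db z v" for z v using R_close[of z v] by linarith
  qed (use R_nonneg in \<open>simp_all add: R_meas\<close>)
  ultimately have "(\<integral>x. g x \<partial>?\<pi>) \<le> (\<integral>x. \<phi> x \<partial>?\<pi>) + C" "(\<integral>x. \<phi> x \<partial>?\<pi>) \<le> (\<integral>x. g x \<partial>?\<pi>) + C"
    using a0 b0 \<open>C \<ge> 0\<close> by (simp_all add: ennreal_plus[symmetric] del: ennreal_plus)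
  then show ?thesis unfolding g_def C_def by (simp only: abs_le_iff) linarith
qed

end

section \<open>Stationarity of the limit law\<close>

text \<open>
  Any recursion fed with the block noises of a Brownian motion, from an initial condition
  independent of it, is a driven chain.
\<close>

lemma (in brownian) driven_chainI:
  assumes \<zeta>: "\<zeta> \<in> borel_measurable M" and ind: "independent_of_process M \<zeta> W"
    and F: "(\<lambda>(x, s). F x s) \<in> borel_measurable (borel \<Otimes>\<^sub>M noise_space)"
    and Q: "Q = distr M noise_space (noise W h 0)"
  shows "driven_chain M Q F (past_filtration M W h \<zeta>) (noise W h) \<zeta>"
proof -
  have sQ: "sets Q = sets noise_space" by (simp add: Q)
  have bw: "brownian M W h" by (rule brownian_axioms)
  show ?thesis
  proof (intro driven_chain.intro driven_chain_axioms.intro prob_space_axioms)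
    show "prob_space Q" unfolding Q by (rule prob_space_distr) measurable
    show "(\<lambda>(x, s). F x s) \<in> borel_measurable (borel \<Otimes>\<^sub>M Q)"
      using F by (simp cong: measurable_cong_sets sets_pair_measure_cong add: sQ)
    show "subalgebra M (past_filtration M W h \<zeta> k)" for k by (rule past_filtration_sub[OF \<zeta>])
    show "subalgebra (past_filtration M W h \<zeta> (Suc k)) (past_filtration M W h \<zeta> k)" for k by (rule past_filtration_mono)
    show "\<zeta> \<in> borel_measurable (past_filtration M W h \<zeta> 0)" by (rule initial_meas_past)
    show "noise W h k \<in> measurable (past_filtration M W h \<zeta> (Suc k)) Q" for k
      using noise_meas_past[of k \<zeta>] by (simp cong: measurable_cong_sets add: sQ)
    show "distr M Q (noise W h k) = Q" for k
    proof -
      have "distr M Q (noise W h k) = distr M noise_space (noise W h k)" by (rule distr_cong) (simp_all add: sQ)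
      also have "\<dots> = Q" unfolding Q by (rule noise_distr_unique[OF bw bw])
      finally show ?thesis .
    qed
    show "prob (A \<inter> (noise W h k -` B \<inter> space M)) = prob A * prob (noise W h k -` B \<inter> space M)"
      if "A \<in> sets (past_filtration M W h \<zeta> k)" "B \<in> sets Q" for k A B
      using noise_indep_past[OF \<zeta> ind that(1)] that(2) by (simp add: sQ)
  qed
qed

text \<open>
  The \<open>2 ^ m\<close> steps of the scheme are themselves a driven chain, for the block length
  \<open>h / 2 ^ m\<close> of which only the increment over the whole block is used. The one-step
  bound is applied to the test function averaged over the remaining noise, which again has values
  in \<open>[0, 1]\<close>, and the errors add up.
\<close>

lemma scheme_near_stationary:
  fixes \<phi> :: "real \<Rightarrow> real"
  assumes pos: "\<sigma> > 0" "\<alpha>1 > 0" "\<alpha>2 > 0" and bw: "brownian M W h"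
    and Y0: "distributed M lborel Y0 (stat_density \<alpha>1 \<alpha>2 \<sigma>)" and ind: "independent_of_process M Y0 W"
    and small: "2 * \<alpha>1 * (h / 2 ^ m) \<le> 3/4" "2 * \<alpha>2 * (h / 2 ^ m) \<le> 3/4"
    and \<phi>: "\<phi> \<in> borel_measurable borel" "\<And>x. 0 \<le> \<phi> x" "\<And>x. \<phi> x \<le> 1"
  shows "\<bar>(\<integral>\<omega>. \<phi> (block_step \<alpha>1 \<alpha>2 \<sigma> h m (Y0 \<omega>) (noise W h 0 \<omega>)) \<partial>M) - (\<integral>x. \<phi> x \<partial>stat_law \<alpha>1 \<alpha>2 \<sigma>)\<bar>
    \<le> 2 ^ m * (stat_const \<alpha>1 \<alpha>2 \<sigma> * sqrt (2 / pi) * (32 * (\<bar>\<alpha>1 - \<alpha>2\<bar> / \<sigma>\<^sup>2) * \<sigma> ^ 3 + 24 * max \<alpha>1 \<alpha>2 * \<sigma>)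
         * ((h / 2 ^ m) * sqrt (h / 2 ^ m)))"
proof -
  interpret B: brownian M W h by fact
  define \<delta> where "\<delta> = h / 2 ^ m"
  have \<delta>: "\<delta> > 0" using B.h_pos by (simp add: \<delta>_def)
  interpret B': brownian M W \<delta> using B.bm \<delta> by unfold_locales
  let ?c1 = "decay \<alpha>1 \<delta>" and ?c2 = "decay \<alpha>2 \<delta>" and ?s = "\<sigma> * sqrt \<delta>" and ?\<pi> = "stat_law \<alpha>1 \<alpha>2 \<sigma>"
  let ?N = "density lborel (\<lambda>x. ennreal (normal_density 0 ?s x))"
  define \<epsilon> where "\<epsilon> = stat_const \<alpha>1 \<alpha>2 \<sigma> * sqrt (2 / pi) * (32 * (\<bar>\<alpha>1 - \<alpha>2\<bar> / \<sigma>\<^sup>2) * \<sigma> ^ 3 + 24 * max \<alpha>1 \<alpha>2 * \<sigma>) * (\<delta> * sqrt \<delta>)"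
  define F where "F x s = kink ?c1 ?c2 x + \<sigma> * s (0::nat, 0::nat)" for x and s :: "nat \<times> nat \<Rightarrow> real"
  have [measurable]: "Y0 \<in> borel_measurable M" using Y0 by (simp add: distributed_def)
  have F: "(\<lambda>(x, s). F x s) \<in> borel_measurable (borel \<Otimes>\<^sub>M noise_space)" unfolding F_def split_beta by measurable
  interpret D: driven_chain M "distr M noise_space (noise W \<delta> 0)" F "past_filtration M W \<delta> Y0" "noise W \<delta>" Y0
    by (rule B'.driven_chainI[OF _ ind F refl]) measurable
  have d: "distr M lborel Y0 = ?\<pi>" using Y0 by (simp add: distributed_def stat_law_def)
  have prob: "prob_space ?\<pi>" unfolding d[symmetric] by (rule B.prob_space_distr) simp
  have [measurable_cong]: "sets ?\<pi> = sets borel" by (simp add: stat_law_def)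
  interpret \<pi>: prob_space ?\<pi> by (rule prob)
  have chain: "D.chain j \<omega> = scheme \<alpha>1 \<alpha>2 \<sigma> \<delta> (\<lambda>i. noise W h 0 \<omega> (m, i)) (Y0 \<omega>) j" if "j \<le> 2 ^ m" for j \<omega>
    using that
  proof (induction j)
    case (Suc j)
    have nz: "noise W \<delta> j \<omega> (0, 0) = noise W h 0 \<omega> (m, j)"
      using Suc.prems by (simp add: noise_def dyadic_inc_def \<delta>_def)
    have ih: "D.chain j \<omega> = scheme \<alpha>1 \<alpha>2 \<sigma> \<delta> (\<lambda>i. noise W h 0 \<omega> (m, i)) (Y0 \<omega>) j" using Suc by simp
    show ?case unfolding D.chain.simps scheme.simps ih by (simp only: F_def nz)
  qed simp
  have kernel: "(\<integral>s. \<psi> (F x s) \<partial>distr M noise_space (noise W \<delta> 0)) = (\<integral>v. \<psi> (kink ?c1 ?c2 x + v) \<partial>?N)"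
    if [measurable]: "\<psi> \<in> borel_measurable borel" for \<psi> :: "real \<Rightarrow> real" and x
  proof -
    note [measurable] = F
    have "distributed M lborel (\<lambda>\<omega>. 0 + \<sigma> * dyadic_inc W \<delta> 0 0 \<omega>) (normal_density (0 + \<sigma> * 0) (\<bar>\<sigma>\<bar> * sqrt (\<delta> / 2 ^ 0)))"
      using B'.dyadic_inc_distributed[of 0 0] pos \<delta> by (intro B.normal_density_affine) auto
    then have "distributed M lborel (\<lambda>\<omega>. \<sigma> * dyadic_inc W \<delta> 0 0 \<omega>) (normal_density 0 ?s)" using pos by simp
    then have dN: "distr M lborel (\<lambda>\<omega>. \<sigma> * dyadic_inc W \<delta> 0 0 \<omega>) = ?N" by (simp add: distributed_def)
    have Fx: "(\<lambda>s. F x s) \<in> borel_measurable noise_space" unfolding F_def by measurable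
    have "(\<integral>s. \<psi> (F x s) \<partial>distr M noise_space (noise W \<delta> 0)) = (\<integral>\<omega>. \<psi> (F x (noise W \<delta> 0 \<omega>)) \<partial>M)"
      by (rule integral_distr[OF B'.noise_measurable]) (use Fx in measurable)
    also have "\<dots> = (\<integral>\<omega>. \<psi> (kink ?c1 ?c2 x + \<sigma> * dyadic_inc W \<delta> 0 0 \<omega>) \<partial>M)" by (simp add: F_def noise_def)
    also have "\<dots> = (\<integral>v. \<psi> (kink ?c1 ?c2 x + v) \<partial>distr M lborel (\<lambda>\<omega>. \<sigma> * dyadic_inc W \<delta> 0 0 \<omega>))"
      by (rule integral_distr[symmetric]) measurable
    finally show ?thesis unfolding dN .
  qed
  have main: "\<bar>(\<integral>\<omega>. \<psi> (D.chain j \<omega>) \<partial>M) - (\<integral>x. \<psi> x \<partial>?\<pi>)\<bar> \<le> real j * \<epsilon>"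
    if "\<psi> \<in> borel_measurable borel" "\<And>x. 0 \<le> \<psi> x" "\<And>x. \<psi> x \<le> 1" for j and \<psi> :: "real \<Rightarrow> real"
    using that
  proof (induction j arbitrary: \<psi>)
    case 0
    note [measurable] = 0(1)
    have "(\<integral>x. \<psi> x \<partial>?\<pi>) = (\<integral>\<omega>. \<psi> (Y0 \<omega>) \<partial>M)" unfolding d[symmetric] by (rule integral_distr) measurable
    then show ?case by simp
  next
    case (Suc j)
    note [measurable] = Suc.prems(1) F
    interpret N: prob_space ?N using pos \<delta> by (intro prob_space_normal_density) simp
    define g where "g x = (\<integral>v. \<psi> (kink ?c1 ?c2 x + v) \<partial>?N)" for x
    have gm: "g \<in> borel_measurable borel" unfolding g_def by measurable
    have iN: "integrable ?N (\<lambda>v. \<psi> (kink ?c1 ?c2 x + v))" for x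
      by (rule N.integrable_const_bound[where B=1]) (auto simp: Suc.prems)
    have g0: "0 \<le> g x" for x unfolding g_def by (intro Bochner_Integration.integral_nonneg Suc.prems)
    have g1: "g x \<le> 1" for x
    proof -
      have "g x \<le> (\<integral>v. 1 \<partial>?N)" unfolding g_def by (intro integral_mono iN) (auto simp: Suc.prems)
      then show ?thesis using N.prob_space by simp
    qed
    have "(\<integral>\<omega>. \<psi> (D.chain (Suc j) \<omega>) \<partial>M) = (\<integral>\<omega>. (\<integral>s. \<psi> (F (D.chain j \<omega>) s) \<partial>distr M noise_space (noise W \<delta> 0)) \<partial>M)"
    proof -
      let ?h = "\<lambda>p. \<psi> (F (fst p) (snd p))"
      have hm: "?h \<in> borel_measurable (borel \<Otimes>\<^sub>M distr M noise_space (noise W \<delta> 0))"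
        using measurable_compose[OF F Suc.prems(1)] by (simp add: split_beta cong: measurable_cong_sets)
      have "integrable M (\<lambda>\<omega>. ?h (D.chain j \<omega>, noise W \<delta> j \<omega>))"
      proof (rule B.integrable_const_bound[where B=1])
        have "(\<lambda>\<omega>. \<psi> (D.chain (Suc j) \<omega>)) \<in> borel_measurable M" by measurable
        then show "(\<lambda>\<omega>. ?h (D.chain j \<omega>, noise W \<delta> j \<omega>)) \<in> borel_measurable M" by simp
      qed (auto simp: Suc.prems)
      from D.expect_step[OF D.chain_measurable_Fil hm this] show ?thesis by simp
    qed
    also have "\<dots> = (\<integral>\<omega>. g (D.chain j \<omega>) \<partial>M)" unfolding g_def by (simp add: kernel[OF Suc.prems(1)])
    finally have eq: "(\<integral>\<omega>. \<psi> (D.chain (Suc j) \<omega>) \<partial>M) = (\<integral>\<omega>. g (D.chain j \<omega>) \<partial>M)" .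
    have "\<bar>(\<integral>\<omega>. g (D.chain j \<omega>) \<partial>M) - (\<integral>x. g x \<partial>?\<pi>)\<bar> \<le> real j * \<epsilon>" by (rule Suc.IH[OF gm g0 g1])
    moreover have "\<bar>(\<integral>x. g x \<partial>?\<pi>) - (\<integral>x. \<psi> x \<partial>?\<pi>)\<bar> \<le> \<epsilon>"
      unfolding g_def \<epsilon>_def
      by (rule one_step_bound[OF pos \<delta> _ _ prob Suc.prems]) (use small in \<open>simp_all add: \<delta>_def\<close>)
    ultimately have "\<bar>(\<integral>\<omega>. g (D.chain j \<omega>) \<partial>M) - (\<integral>x. \<psi> x \<partial>?\<pi>)\<bar> \<le> real j * \<epsilon> + \<epsilon>" by linarith
    then show ?case unfolding eq by (simp add: distrib_right)
  qed
  have "(\<integral>\<omega>. \<phi> (block_step \<alpha>1 \<alpha>2 \<sigma> h m (Y0 \<omega>) (noise W h 0 \<omega>)) \<partial>M) = (\<integral>\<omega>. \<phi> (D.chain (2 ^ m) \<omega>) \<partial>M)"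
    using chain[of "2 ^ m"] by (simp add: block_step_def \<delta>_def)
  then show ?thesis using main[OF \<phi>, of "2 ^ m"] unfolding \<epsilon>_def \<delta>_def by simp
qed

text \<open>
  Started from the stationary density, the scheme of level \<open>m\<close> has at time
  \<open>h\<close> a law within order \<open>sqrt (h / 2 ^ m)\<close> of it, and it converges
  almost surely to the solution.
\<close>

theorem stationary_law:
  assumes pos: "\<sigma> > 0" "\<alpha>1 > 0" "\<alpha>2 > 0" and h: "h > 0" and bm: "brownian_motion M W"
    and Y0: "distributed M lborel (Y 0) (stat_density \<alpha>1 \<alpha>2 \<sigma>)" and ind: "independent_of_process M (Y 0) W"
    and sol: "sde_solution M W (drift \<alpha>1 \<alpha>2) \<sigma> (Y 0) Y"
  shows "distr M borel (Y h) = stat_law \<alpha>1 \<alpha>2 \<sigma>"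
proof -
  interpret B: brownian M W h using bm h by unfold_locales
  let ?\<pi> = "stat_law \<alpha>1 \<alpha>2 \<sigma>"
  have [measurable]: "Y 0 \<in> borel_measurable M" "Y h \<in> borel_measurable M"
    using sol h by (auto simp: sde_solution_def)
  have d: "distr M borel (Y 0) = ?\<pi>" using Y0 by (simp add: distributed_def stat_law_def cong: distr_cong)
  have prob: "prob_space ?\<pi>" unfolding d[symmetric] by (rule B.prob_space_distr) simp
  have sets_pi[measurable_cong]: "sets ?\<pi> = sets borel" by (simp add: stat_law_def)
  interpret \<pi>: prob_space ?\<pi> by (rule prob)
  define C where "C = stat_const \<alpha>1 \<alpha>2 \<sigma> * sqrt (2 / pi) * (32 * (\<bar>\<alpha>1 - \<alpha>2\<bar> / \<sigma>\<^sup>2) * \<sigma> ^ 3 + 24 * max \<alpha>1 \<alpha>2 * \<sigma>)"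
  have "(\<lambda>m. h * (1 / 2) ^ m) \<longlonglongrightarrow> h * 0" by (intro tendsto_intros LIMSEQ_realpow_zero) auto
  then have lim: "(\<lambda>m. h / 2 ^ m) \<longlonglongrightarrow> 0" by (simp add: power_divide)
  have small: "\<forall>\<^sub>F m in sequentially. 2 * \<alpha> * (h / 2 ^ m) \<le> 3/4" if "\<alpha> > 0" for \<alpha>
  proof -
    have "(\<lambda>m. 2 * \<alpha> * (h / 2 ^ m)) \<longlonglongrightarrow> 2 * \<alpha> * 0" by (intro tendsto_intros lim)
    then have "\<forall>\<^sub>F m in sequentially. 2 * \<alpha> * (h / 2 ^ m) < 3/4" by (rule order_tendstoD(2)) simp
    then show ?thesis by eventually_elim simp
  qed
  have key: "(\<integral>\<omega>. \<phi> (Y h \<omega>) \<partial>M) = (\<integral>x. \<phi> x \<partial>?\<pi>)"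
    if cont: "\<And>x. isCont \<phi> x" and \<phi>: "\<And>x. 0 \<le> \<phi> x" "\<And>x. \<phi> x \<le> 1" for \<phi> :: "real \<Rightarrow> real"
  proof -
    have [measurable]: "\<phi> \<in> borel_measurable borel"
      using cont by (intro borel_measurable_continuous_onI) (simp add: continuous_at_imp_continuous_on)
    let ?b = "\<lambda>m \<omega>. block_step \<alpha>1 \<alpha>2 \<sigma> h m (Y 0 \<omega>) (noise W h 0 \<omega>)"
    have bl: "AE \<omega> in M. (\<lambda>m. ?b m \<omega>) \<longlonglongrightarrow> Y h \<omega>"
      using sde_block[OF pos(2,3) h bm sol]
    proof eventually_elim
      case (elim \<omega>)
      then have "(\<lambda>m. block_step \<alpha>1 \<alpha>2 \<sigma> h m (Y (real 0 * h) \<omega>) (noise W h 0 \<omega>)) \<longlonglongrightarrow> Y (real (Suc 0) * h) \<omega>" by blast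
      then show ?case by simp
    qed
    have l1: "(\<lambda>m. \<integral>\<omega>. \<phi> (?b m \<omega>) \<partial>M) \<longlonglongrightarrow> (\<integral>\<omega>. \<phi> (Y h \<omega>) \<partial>M)"
    proof (rule integral_dominated_convergence[where w="\<lambda>_. 1"])
      show "AE \<omega> in M. (\<lambda>m. \<phi> (?b m \<omega>)) \<longlonglongrightarrow> \<phi> (Y h \<omega>)"
        using bl by eventually_elim (rule isCont_tendsto_compose[OF cont])
    qed (auto simp: \<phi>)
    have "(\<lambda>m. (\<integral>\<omega>. \<phi> (?b m \<omega>) \<partial>M) - (\<integral>x. \<phi> x \<partial>?\<pi>)) \<longlonglongrightarrow> 0"
    proof (rule Lim_null_comparison)
      show "\<forall>\<^sub>F m in sequentially. norm ((\<integral>\<omega>. \<phi> (?b m \<omega>) \<partial>M) - (\<integral>x. \<phi> x \<partial>?\<pi>)) \<le> C * h * sqrt (h / 2 ^ m)"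
        using small[OF pos(2)] small[OF pos(3)]
      proof eventually_elim
        case (elim m)
        have "norm ((\<integral>\<omega>. \<phi> (?b m \<omega>) \<partial>M) - (\<integral>x. \<phi> x \<partial>?\<pi>)) \<le> 2 ^ m * (C * ((h / 2 ^ m) * sqrt (h / 2 ^ m)))"
          using scheme_near_stationary[OF pos B.brownian_axioms Y0 ind elim \<open>\<phi> \<in> borel_measurable borel\<close> \<phi>] unfolding C_def by simp
        also have "\<dots> = C * h * sqrt (h / 2 ^ m)" by simp
        finally show ?case .
      qed
      have "(\<lambda>m. C * h * sqrt (h / 2 ^ m)) \<longlonglongrightarrow> C * h * sqrt 0" by (intro tendsto_intros lim)
      then show "(\<lambda>m. C * h * sqrt (h / 2 ^ m)) \<longlonglongrightarrow> 0" by simp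
    qed
    then have "(\<lambda>m. \<integral>\<omega>. \<phi> (?b m \<omega>) \<partial>M) \<longlonglongrightarrow> (\<integral>x. \<phi> x \<partial>?\<pi>)" by (simp add: LIM_zero_iff)
    with l1 show ?thesis by (rule LIMSEQ_unique)
  qed
  have rd1: "real_distribution (distr M borel (Y h))" by (rule B.real_distribution_distr) measurable
  have rd2: "real_distribution ?\<pi>" by (intro real_distribution.intro prob real_distribution_axioms.intro sets_pi)
  show ?thesis
  proof (rule Levy_uniqueness[OF rd1 rd2], rule ext)
    fix t
    \<comment> \<open>moves a function with values in \<open>[-1, 1]\<close>, such as a cosine, into the range \<open>[0, 1]\<close>\<close>
    have half: "(\<integral>x. f x \<partial>L) = 2 * (\<integral>x. (1 + f x) / 2 \<partial>L) - 1"
      if "prob_space L" "f \<in> borel_measurable L" "\<And>x. \<bar>f x\<bar> \<le> 1" for L :: "real measure" and f :: "real \<Rightarrow> real"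
    proof -
      interpret L: prob_space L by fact
      have "integrable L f" by (rule L.integrable_const_bound[where B=1]) (use that in auto)
      then show ?thesis by (simp add: L.prob_space add_divide_distrib)
    qed
    have eq: "(\<integral>x. f x \<partial>distr M borel (Y h)) = (\<integral>x. f x \<partial>?\<pi>)"
      if f: "\<And>x. isCont f x" "\<And>x. \<bar>f x\<bar> \<le> 1" for f :: "real \<Rightarrow> real"
    proof -
      have [measurable]: "f \<in> borel_measurable borel"
        using f(1) by (intro borel_measurable_continuous_onI) (simp add: continuous_at_imp_continuous_on)
      have b: "-1 \<le> f x" "f x \<le> 1" for x using f(2)[of x] by (auto simp: abs_le_iff)
      have "(\<integral>x. (1 + f x) / 2 \<partial>distr M borel (Y h)) = (\<integral>\<omega>. (1 + f (Y h \<omega>)) / 2 \<partial>M)"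
        by (rule integral_distr) measurable
      also have "\<dots> = (\<integral>x. (1 + f x) / 2 \<partial>?\<pi>)"
      proof (rule key)
        show "isCont (\<lambda>x. (1 + f x) / 2) x" for x using f(1) by (intro continuous_intros) auto
        show "0 \<le> (1 + f x) / 2" "(1 + f x) / 2 \<le> 1" for x using b[of x] by simp_all
      qed
      finally show ?thesis
        using half[OF real_distribution.axioms(1)[OF rd1] _ f(2)] half[OF prob _ f(2)] by simp
    qed
    have re: "char L t = Complex (\<integral>x. cos (t * x) \<partial>L) (\<integral>x. sin (t * x) \<partial>L)" if "real_distribution L" for L
    proof -
      interpret L: real_distribution L by fact
      have i: "integrable L (\<lambda>x. iexp (t * x))" by (intro L.integrable_iexp) auto
      show ?thesis unfolding char_def
      proof (rule complex_eqI)
        show "Re (\<integral>x. iexp (t * x) \<partial>L) = Re (Complex (\<integral>x. cos (t * x) \<partial>L) (\<integral>x. sin (t * x) \<partial>L))"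
          by (subst integral_Re[OF i, symmetric]) (simp add: Re_exp)
        show "Im (\<integral>x. iexp (t * x) \<partial>L) = Im (Complex (\<integral>x. cos (t * x) \<partial>L) (\<integral>x. sin (t * x) \<partial>L))"
          by (subst integral_Im[OF i, symmetric]) (simp add: Im_exp)
      qed
    qed
    have "(\<integral>x. cos (t * x) \<partial>distr M borel (Y h)) = (\<integral>x. cos (t * x) \<partial>?\<pi>)"
      "(\<integral>x. sin (t * x) \<partial>distr M borel (Y h)) = (\<integral>x. sin (t * x) \<partial>?\<pi>)"
      by (rule eq; auto intro!: continuous_intros)+
    then show "char (distr M borel (Y h)) t = char ?\<pi> t" unfolding re[OF rd1] re[OF rd2] by simp
  qed
qed

text \<open>
  The stationary density is dominated by a multiple of the normal density with the larger of the
  two variances.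
\<close>

lemma stat_law_moments:
  assumes pos: "\<sigma> > 0" "\<alpha>1 > 0" "\<alpha>2 > 0"
  shows "integrable (stat_law \<alpha>1 \<alpha>2 \<sigma>) (\<lambda>x. \<bar>x\<bar> ^ q)"
proof -
  define a where "a = min \<alpha>1 \<alpha>2"
  have a: "a > 0" "a \<le> \<alpha>1" "a \<le> \<alpha>2" using pos by (auto simp: a_def)
  define \<tau> where "\<tau> = \<sigma> / sqrt (2 * a)"
  have \<tau>: "\<tau> > 0" "\<tau>\<^sup>2 = \<sigma>\<^sup>2 / (2 * a)" using pos a by (auto simp: \<tau>_def power_divide)
  define K where "K = stat_const \<alpha>1 \<alpha>2 \<sigma> * sqrt (2 * pi * \<tau>\<^sup>2)"
  have c0: "0 \<le> stat_const \<alpha>1 \<alpha>2 \<sigma>" using pos by (simp add: stat_const_def)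
  have sd: "0 \<le> stat_density \<alpha>1 \<alpha>2 \<sigma> x" for x unfolding stat_density_eq using c0 by (simp add: gauss_half_def)
  have le: "stat_density \<alpha>1 \<alpha>2 \<sigma> x \<le> K * normal_density 0 \<tau> x" for x
  proof -
    have g: "gauss_half \<alpha> \<sigma> x \<le> exp (- (a * x\<^sup>2 / \<sigma>\<^sup>2))" if "a \<le> \<alpha>" for \<alpha>
      unfolding gauss_half_def using that by (auto intro!: divide_right_mono mult_right_mono)
    have "stat_density \<alpha>1 \<alpha>2 \<sigma> x \<le> stat_const \<alpha>1 \<alpha>2 \<sigma> * exp (- (a * x\<^sup>2 / \<sigma>\<^sup>2))"
      unfolding stat_density_eq using g[OF a(2)] g[OF a(3)] c0 by (intro mult_left_mono) auto
    also have "\<dots> = K * normal_density 0 \<tau> x"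
    proof -
      have "(x - 0)\<^sup>2 / (2 * \<tau>\<^sup>2) = a * x\<^sup>2 / \<sigma>\<^sup>2" unfolding \<tau>(2) using a by simp
      then show ?thesis unfolding K_def normal_density_def using \<tau>(1) by simp
    qed
    finally show ?thesis .
  qed
  have "integrable lborel (\<lambda>x. stat_density \<alpha>1 \<alpha>2 \<sigma> x * \<bar>x\<bar> ^ q)"
  proof (rule Bochner_Integration.integrable_bound[OF integrable_mult_right[OF integrable_normal_moment_abs[OF \<tau>(1), of 0 q], of K]])
    show "AE x in lborel. norm (stat_density \<alpha>1 \<alpha>2 \<sigma> x * \<bar>x\<bar> ^ q) \<le> norm (K * (normal_density 0 \<tau> x * \<bar>x - 0\<bar> ^ q))"
    proof (intro AE_I2)
      fix x
      have "stat_density \<alpha>1 \<alpha>2 \<sigma> x * \<bar>x\<bar> ^ q \<le> K * normal_density 0 \<tau> x * \<bar>x\<bar> ^ q" by (intro mult_right_mono le) simp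
      moreover have "0 \<le> K * normal_density 0 \<tau> x * \<bar>x\<bar> ^ q" by (rule mult_nonneg_nonneg[OF order_trans[OF sd le]]) simp
      moreover have "0 \<le> stat_density \<alpha>1 \<alpha>2 \<sigma> x * \<bar>x\<bar> ^ q" using sd[of x] by simp
      ultimately show "norm (stat_density \<alpha>1 \<alpha>2 \<sigma> x * \<bar>x\<bar> ^ q) \<le> norm (K * (normal_density 0 \<tau> x * \<bar>x - 0\<bar> ^ q))"
        by (simp only: real_norm_def abs_of_nonneg diff_zero mult.assoc)
    qed
  qed measurable
  then show ?thesis unfolding stat_law_def using sd by (subst integrable_density) auto
qed

section \<open>Stationary moments and their inversion\<close>

text \<open>
  The substitution \<open>t = a x\<^sup>2\<close> turns the Gamma integral into the moment.
\<close>

lemma half_gaussian_moment: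
  fixes a n :: real
  assumes a: "a > 0" and n: "n > 0"
  shows "has_bochner_integral lborel (\<lambda>x. x powr n * exp (- (a * x\<^sup>2)) * indicator {0<..} x)
     (Gamma ((n + 1) / 2) / (2 * a powr ((n + 1) / 2)))"
proof -
  define p where "p = (n + 1) / 2"
  have p: "p > 0" using n by (simp add: p_def)
  let ?S = "{0::real<..}"
  define f where "f t = t powr (p - 1) / exp t" for t :: real
  have "(f has_integral Gamma p) {0..}" unfolding f_def by (rule Gamma_integral_real[OF p])
  then have hi: "(f has_integral Gamma p) ?S"
    by (rule has_integral_spike_set_eq[THEN iffD1, rotated 2]) (auto intro: negligible_subset[of "{0}"])
  have fa: "f absolutely_integrable_on ?S"
    using hi by (intro nonnegative_absolutely_integrable_1) (auto simp: f_def integrable_on_def)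
  have img: "(\<lambda>x. a * x\<^sup>2) ` ?S = ?S"
  proof
    show "?S \<subseteq> (\<lambda>x. a * x\<^sup>2) ` ?S"
    proof
      fix y assume "y \<in> ?S"
      then have "y = a * (sqrt (y / a))\<^sup>2" "sqrt (y / a) \<in> ?S" using a by auto
      then show "y \<in> (\<lambda>x. a * x\<^sup>2) ` ?S" by blast
    qed
  qed (use a in auto)
  have inj: "inj_on (\<lambda>x. a * x\<^sup>2) ?S" using a by (auto simp: inj_on_def power2_eq_iff_nonneg)
  have subst: "(\<lambda>x. \<bar>2 * a * x\<bar> * f (a * x\<^sup>2)) absolutely_integrable_on ?S \<and>
      integral ?S (\<lambda>x. \<bar>2 * a * x\<bar> * f (a * x\<^sup>2)) = Gamma p"
  proof (rule iffD2[OF has_absolute_integral_change_of_variables_1'[where g="\<lambda>x. a * x\<^sup>2" and g'="\<lambda>x. 2 * a * x" and f=f and S="?S" and b="Gamma p"]])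
    show "((\<lambda>x. a * x\<^sup>2) has_field_derivative 2 * a * x) (at x within ?S)" for x
      by (auto intro!: derivative_eq_intros)
    show "f absolutely_integrable_on (\<lambda>x. a * x\<^sup>2) ` ?S \<and> integral ((\<lambda>x. a * x\<^sup>2) ` ?S) f = Gamma p"
      unfolding img using fa hi by (auto intro: integral_unique)
  qed (use inj in auto)
  have form: "\<bar>2 * a * x\<bar> * f (a * x\<^sup>2) = 2 * a powr p * (x powr n * exp (- (a * x\<^sup>2)))" if "x \<in> ?S" for x
  proof -
    have x: "x > 0" using that by simp
    have "(a * x\<^sup>2) powr (p - 1) = a powr (p - 1) * x powr (n - 1)"
    proof -
      have "x\<^sup>2 = x powr 2" using x by simp
      moreover have "2 * (p - 1) = n - 1" by (simp add: p_def field_simps)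
      ultimately have "(x\<^sup>2) powr (p - 1) = x powr (n - 1)" by (simp only: powr_powr)
      then show ?thesis using a x by (simp add: powr_mult)
    qed
    moreover have "a * a powr (p - 1) = a powr p" using a by (simp add: powr_mult_base)
    moreover have "x * x powr (n - 1) = x powr n" using x by (simp add: powr_mult_base)
    ultimately show ?thesis using a x by (simp add: f_def exp_minus divide_inverse abs_mult) (metis mult.assoc mult.commute)
  qed
  from subst have "(\<lambda>x. \<bar>2 * a * x\<bar> * f (a * x\<^sup>2)) absolutely_integrable_on ?S"
    and "integral ?S (\<lambda>x. \<bar>2 * a * x\<bar> * f (a * x\<^sup>2)) = Gamma p" by blast+
  moreover have "set_integrable lebesgue ?S (\<lambda>x. \<bar>2 * a * x\<bar> * f (a * x\<^sup>2))
      = set_integrable lebesgue ?S (\<lambda>x. 2 * a powr p * (x powr n * exp (- (a * x\<^sup>2))))"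
    by (rule set_integrable_cong[OF refl refl form])
  moreover have "integral ?S (\<lambda>x. \<bar>2 * a * x\<bar> * f (a * x\<^sup>2))
      = integral ?S (\<lambda>x. 2 * a powr p * (x powr n * exp (- (a * x\<^sup>2))))"
    by (rule Henstock_Kurzweil_Integration.integral_cong[OF form])
  ultimately have ai: "(\<lambda>x. 2 * a powr p * (x powr n * exp (- (a * x\<^sup>2)))) absolutely_integrable_on ?S"
    and iv: "integral ?S (\<lambda>x. 2 * a powr p * (x powr n * exp (- (a * x\<^sup>2)))) = Gamma p"
    by metis+
  have ap: "2 * a powr p > 0" using a by simp
  have "(\<lambda>x. x powr n * exp (- (a * x\<^sup>2))) absolutely_integrable_on ?S"
    using set_integrable_mult_right[of "1 / (2 * a powr p)", OF ai] ap by simp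
  then have si: "set_integrable lborel ?S (\<lambda>x. x powr n * exp (- (a * x\<^sup>2)))"
    unfolding set_integrable_def by (subst (asm) integrable_completion) auto
  have "(LINT x:?S|lborel. x powr n * exp (- (a * x\<^sup>2))) = integral ?S (\<lambda>x. x powr n * exp (- (a * x\<^sup>2)))"
    by (rule set_borel_integral_eq_integral(2)[OF si])
  also have "\<dots> = Gamma p / (2 * a powr p)"
  proof -
    define I where "I = integral ?S (\<lambda>x. x powr n * exp (- (a * x\<^sup>2)))"
    have "2 * a powr p * I = Gamma p"
      using iv unfolding I_def Henstock_Kurzweil_Integration.integral_mult_right .
    then show ?thesis using ap unfolding I_def[symmetric] by (simp add: field_simps)
  qed
  finally have v: "(LINT x:?S|lborel. x powr n * exp (- (a * x\<^sup>2))) = Gamma p / (2 * a powr p)" .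
  show ?thesis
    using si v unfolding set_integrable_def set_lebesgue_integral_def has_bochner_integral_iff p_def
    by (simp add: mult.commute)
qed

text \<open>
  Both moments share the constant \<open>c\<close> and differ only in the power of their own
  parameter; this is what makes the pair invertible.
\<close>

lemma stat_moments:
  fixes \<alpha>1 \<alpha>2 \<sigma> n :: real
  assumes pos: "\<sigma> > 0" "\<alpha>1 > 0" "\<alpha>2 > 0" "n > 0"
  defines "c \<equiv> sqrt (\<alpha>1 * \<alpha>2) * \<sigma> powr n * Gamma ((n + 1) / 2) / (sqrt pi * (sqrt \<alpha>1 + sqrt \<alpha>2))"
  shows "stat_L \<alpha>1 \<alpha>2 \<sigma> n = c / \<alpha>1 powr ((n + 1) / 2)"
    and "stat_R \<alpha>1 \<alpha>2 \<sigma> n = c / \<alpha>2 powr ((n + 1) / 2)"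
proof -
  define k where "k = 2 * sqrt (\<alpha>1 * \<alpha>2) / (sqrt pi * (sqrt \<alpha>1 + sqrt \<alpha>2) * \<sigma>)"
  have k: "k \<ge> 0" using pos by (simp add: k_def)
  have sdm[measurable]: "stat_density \<alpha>1 \<alpha>2 \<sigma> \<in> borel_measurable borel" unfolding stat_density_def[abs_def] by measurable
  have sd: "0 \<le> stat_density \<alpha>1 \<alpha>2 \<sigma> x" for x
    unfolding stat_density_def k_def[symmetric] by (intro mult_nonneg_nonneg k add_nonneg_nonneg) auto
  have [measurable]: "g1 n \<in> borel_measurable borel" "g2 n \<in> borel_measurable borel"
    unfolding g1_def[abs_def] g2_def[abs_def] by measurable
  have I: "has_bochner_integral lborel (\<lambda>x. x powr n * exp (- (\<alpha> * x\<^sup>2 / \<sigma>\<^sup>2)) * indicator {0<..} x)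
     (Gamma ((n + 1) / 2) * \<sigma> powr (n + 1) / (2 * \<alpha> powr ((n + 1) / 2)))" if "\<alpha> > 0" for \<alpha>
  proof -
    have "(\<sigma>\<^sup>2) powr ((n + 1) / 2) = \<sigma> powr (n + 1)"
    proof -
      have "\<sigma>\<^sup>2 = \<sigma> powr 2" using pos by simp
      moreover have "2 * ((n + 1) / 2) = n + 1" by simp
      ultimately show ?thesis by (simp only: powr_powr)
    qed
    then show ?thesis
      using half_gaussian_moment[of "\<alpha> / \<sigma>\<^sup>2" n] that pos by (simp add: powr_divide)
  qed
  have ck: "k * (Gamma ((n + 1) / 2) * \<sigma> powr (n + 1) / (2 * d)) = c / d" for d
  proof -
    have "2 * q / (p * S * \<sigma>) * (g * (E * \<sigma>) / (2 * d)) = q * E * g / (p * S) / d" for q p S g E :: real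
      using pos by (simp add: mult_ac)
    moreover have "\<sigma> powr (n + 1) = \<sigma> powr n * \<sigma>" using pos by (simp add: powr_add)
    ultimately show ?thesis unfolding k_def c_def by (simp only:)
  qed
  have "stat_R \<alpha>1 \<alpha>2 \<sigma> n = (\<integral>x. stat_density \<alpha>1 \<alpha>2 \<sigma> x * g2 n x \<partial>lborel)"
    unfolding stat_R_def stat_law_def using sd by (subst integral_density) auto
  also have "\<dots> = (\<integral>x. k * (x powr n * exp (- (\<alpha>2 * x\<^sup>2 / \<sigma>\<^sup>2)) * indicator {0<..} x) \<partial>lborel)"
    by (intro Bochner_Integration.integral_cong refl) (auto simp: stat_density_def g2_def k_def indicator_def)
  also have "\<dots> = k * (Gamma ((n + 1) / 2) * \<sigma> powr (n + 1) / (2 * \<alpha>2 powr ((n + 1) / 2)))"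
    using has_bochner_integral_integral_eq[OF I[OF pos(3)]] by simp
  finally show "stat_R \<alpha>1 \<alpha>2 \<sigma> n = c / \<alpha>2 powr ((n + 1) / 2)" unfolding ck .
  have "stat_L \<alpha>1 \<alpha>2 \<sigma> n = (\<integral>x. stat_density \<alpha>1 \<alpha>2 \<sigma> x * g1 n x \<partial>lborel)"
    unfolding stat_L_def stat_law_def using sd by (subst integral_density) auto
  also have "\<dots> = \<bar>-1\<bar> *\<^sub>R (\<integral>x. stat_density \<alpha>1 \<alpha>2 \<sigma> (0 + -1 * x) * g1 n (0 + -1 * x) \<partial>lborel)"
    by (rule lborel_integral_real_affine) simp
  also have "\<dots> = (\<integral>x. k * (x powr n * exp (- (\<alpha>1 * x\<^sup>2 / \<sigma>\<^sup>2)) * indicator {0<..} x) \<partial>lborel)"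
    unfolding abs_minus_cancel abs_one scaleR_one
    by (intro Bochner_Integration.integral_cong refl) (auto simp: stat_density_def g1_def k_def indicator_def)
  also have "\<dots> = k * (Gamma ((n + 1) / 2) * \<sigma> powr (n + 1) / (2 * \<alpha>1 powr ((n + 1) / 2)))"
    using has_bochner_integral_integral_eq[OF I[OF pos(2)]] by simp
  finally show "stat_L \<alpha>1 \<alpha>2 \<sigma> n = c / \<alpha>1 powr ((n + 1) / 2)" unfolding ck .
qed

lemma stat_moments_pos:
  assumes "\<sigma> > 0" "\<alpha>1 > 0" "\<alpha>2 > 0" "n > 0"
  shows "stat_L \<alpha>1 \<alpha>2 \<sigma> n > 0" "stat_R \<alpha>1 \<alpha>2 \<sigma> n > 0"
  unfolding stat_moments[OF assms] using assms
  by (auto intro!: divide_pos_pos mult_pos_pos Gamma_real_pos add_pos_pos)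

text \<open>
  The quotient of the two moments is \<open>(\<alpha> / \<beta>) powr ((n + 1) / 2)\<close>, so
  its \<open>(n + 1)\<close>-st root is \<open>sqrt (\<alpha> / \<beta>)\<close>; inserting this
  into either moment isolates one parameter.
\<close>

lemma moment_inversion:
  assumes pos: "\<sigma> > 0" "\<alpha> > 0" "\<beta> > 0" "n > 0"
  defines "c \<equiv> sqrt (\<alpha> * \<beta>) * \<sigma> powr n * Gamma ((n + 1) / 2) / (sqrt pi * (sqrt \<alpha> + sqrt \<beta>))"
  shows "(\<sigma> powr n * Gamma ((n + 1) / 2) / (sqrt pi * (c / \<alpha> powr ((n + 1) / 2)) *
     (((c / \<beta> powr ((n + 1) / 2)) / (c / \<alpha> powr ((n + 1) / 2))) powr (1 / (n + 1)) + 1))) powr (2 / n) = \<alpha>"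
proof -
  have G: "Gamma ((n + 1) / 2) > 0" using pos by (intro Gamma_real_pos) auto
  have c: "c > 0" unfolding c_def using pos G by (intro divide_pos_pos mult_pos_pos add_pos_pos) auto
  have h: "x powr ((n + 1) / 2) = sqrt x * x powr (n / 2)" if "x > 0" for x :: real
    using that by (simp add: powr_half_sqrt[symmetric] powr_add[symmetric] add_divide_distrib add.commute)
  have "((c / \<beta> powr ((n + 1) / 2)) / (c / \<alpha> powr ((n + 1) / 2))) = (\<alpha> / \<beta>) powr ((n + 1) / 2)"
    using c pos by (simp add: powr_divide)
  then have "((c / \<beta> powr ((n + 1) / 2)) / (c / \<alpha> powr ((n + 1) / 2))) powr (1 / (n + 1)) = (\<alpha> / \<beta>) powr ((n + 1) / 2 * (1 / (n + 1)))"
    by (simp only: powr_powr)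
  also have "(n + 1) / 2 * (1 / (n + 1)) = 1 / 2" using pos by (simp add: field_simps)
  also have "(\<alpha> / \<beta>) powr (1 / 2) = sqrt \<alpha> / sqrt \<beta>" using pos by (simp add: powr_half_sqrt real_sqrt_divide)
  finally have r: "((c / \<beta> powr ((n + 1) / 2)) / (c / \<alpha> powr ((n + 1) / 2))) powr (1 / (n + 1)) + 1 = (sqrt \<alpha> + sqrt \<beta>) / sqrt \<beta>"
    using pos by (simp add: field_simps)
  have s: "sqrt \<alpha> + sqrt \<beta> > 0" "sqrt \<alpha> > 0" "sqrt \<beta> > 0" using pos by (auto intro: add_pos_pos)
  have "\<sigma> powr n * Gamma ((n + 1) / 2) / (sqrt pi * (c / \<alpha> powr ((n + 1) / 2)) * ((sqrt \<alpha> + sqrt \<beta>) / sqrt \<beta>)) = \<alpha> powr (n / 2)"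
  proof -
    have "D * g / (p * ((A * B * D * g / (p * S)) / (A * R)) * (S / B)) = R"
      if "A \<noteq> 0" "B \<noteq> 0" "D \<noteq> 0" "g \<noteq> 0" "p \<noteq> 0" "S \<noteq> 0" "R \<noteq> 0" for A B D g p S R :: real
      using that by (simp add: field_simps)
    then show ?thesis unfolding c_def h[OF pos(2)] real_sqrt_mult using s[THEN less_imp_neq, symmetric] G[THEN less_imp_neq, symmetric] pos by simp
  qed
  then show ?thesis unfolding r using pos by (simp add: powr_powr)
qed

lemma G_stat:
  assumes "\<sigma> > 0" "\<alpha>1 > 0" "\<alpha>2 > 0" "n > 0"
  shows "G \<sigma> n (vector [stat_L \<alpha>1 \<alpha>2 \<sigma> n, stat_R \<alpha>1 \<alpha>2 \<sigma> n]) = vector [\<alpha>1, \<alpha>2]"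
proof -
  have 1: "G1 \<sigma> n (stat_L \<alpha>1 \<alpha>2 \<sigma> n) (stat_R \<alpha>1 \<alpha>2 \<sigma> n) = \<alpha>1"
    unfolding G1_def stat_moments[OF assms] by (rule moment_inversion[OF assms])
  have 2: "G2 \<sigma> n (stat_L \<alpha>1 \<alpha>2 \<sigma> n) (stat_R \<alpha>1 \<alpha>2 \<sigma> n) = \<alpha>2"
    unfolding G2_def stat_moments[OF assms]
    using moment_inversion[OF assms(1,3,2,4)] by (simp only: mult.commute[of \<alpha>2 \<alpha>1] add.commute[of "sqrt \<alpha>2" "sqrt \<alpha>1"])
  show ?thesis unfolding G_def by (simp add: 1 2)
qed

lemma differentiable_powr_const:
  fixes f :: "'a::real_normed_vector \<Rightarrow> real"
  assumes "f differentiable (at x)" "f x > 0"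
  shows "(\<lambda>x. f x powr c) differentiable (at x)"
proof -
  obtain f' where "(f has_derivative f') (at x)" using assms(1) by (auto simp: differentiable_def)
  from has_derivative_powr[OF this has_derivative_const[of c] assms(2)] show ?thesis
    unfolding differentiable_def by blast
qed

lemma G_differentiable:
  assumes "z $ 1 > 0" "z $ 2 > 0" "\<sigma> > 0" "n > 0"
  shows "G \<sigma> n differentiable (at z)"
proof -
  have d: "(\<lambda>z::real^2. z $ i) differentiable (at z)" for i
    by (rule bounded_linear_imp_differentiable[OF bounded_linear_vec_nth])
  have Gp: "Gamma ((n + 1) / 2) > 0" using assms by (intro Gamma_real_pos) auto
  have gen: "(\<lambda>z::real^2. (\<sigma> powr n * Gamma ((n + 1) / 2) / (sqrt pi * z $ i * ((z $ j / z $ i) powr (1 / (n + 1)) + 1))) powr (2 / n)) differentiable (at z)"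
    if "z $ i > 0" "z $ j > 0" for i j
  proof (rule differentiable_powr_const)
    have p: "(z $ j / z $ i) powr (1 / (n + 1)) + 1 > 0" by (simp add: add_nonneg_pos)
    have q: "(\<lambda>z::real^2. (z $ j / z $ i) powr (1 / (n + 1))) differentiable (at z)"
      using that by (intro differentiable_powr_const differentiable_divide d) auto
    show "(\<lambda>z::real^2. \<sigma> powr n * Gamma ((n + 1) / 2) / (sqrt pi * z $ i * ((z $ j / z $ i) powr (1 / (n + 1)) + 1))) differentiable (at z)"
      using that p by (intro differentiable_divide differentiable_mult differentiable_add differentiable_const d q) auto
    show "\<sigma> powr n * Gamma ((n + 1) / 2) / (sqrt pi * z $ i * ((z $ j / z $ i) powr (1 / (n + 1)) + 1)) > 0"
      using that p Gp assms by (intro divide_pos_pos mult_pos_pos) auto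
  qed
  have eq: "G \<sigma> n = (\<lambda>z. G1 \<sigma> n (z $ 1) (z $ 2) *\<^sub>R axis 1 1 + G2 \<sigma> n (z $ 1) (z $ 2) *\<^sub>R axis 2 1)"
    by (rule ext) (simp add: G_def vec_eq_iff forall_2 axis_def)
  show ?thesis unfolding eq G1_def G2_def
    using assms by (intro differentiable_add differentiable_scaleR differentiable_const gen) auto
qed

lemma G_measurable: "G \<sigma> n \<in> borel_measurable borel"
proof -
  have eq: "G \<sigma> n = (\<lambda>z. G1 \<sigma> n (z $ 1) (z $ 2) *\<^sub>R axis 1 1 + G2 \<sigma> n (z $ 1) (z $ 2) *\<^sub>R axis 2 1)"
    by (rule ext) (simp add: G_def vec_eq_iff forall_2 axis_def)
  have [measurable]: "(\<lambda>z::real^2. z $ i) \<in> borel_measurable borel" for i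
    by (intro borel_measurable_continuous_onI continuous_intros)
  show ?thesis unfolding eq G1_def G2_def by measurable
qed

section \<open>The moment functions and their covariances\<close>

lemma powr_diff_le_hoelder:
  fixes a b n :: real
  assumes n: "0 < n" "n \<le> 1" and ab: "0 \<le> b" "b \<le> a"
  shows "a powr n - b powr n \<le> (a - b) powr n"
proof (cases "a = 0")
  case False
  then have a: "a > 0" using ab by simp
  have le: "t \<le> t powr n" if "0 \<le> t" "t \<le> 1" for t :: real
  proof (cases "t = 0")
    case False
    then have "t powr 1 \<le> t powr n" using that n by (intro powr_mono') auto
    then show ?thesis using that by simp
  qed simp
  have "1 = (a - b) / a + b / a" using a by (simp add: field_simps)
  also have "\<dots> \<le> ((a - b) / a) powr n + (b / a) powr n"
    using a ab by (intro add_mono le) (auto simp: field_simps)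
  also have "\<dots> = ((a - b) powr n + b powr n) / a powr n"
    using a ab by (simp add: powr_divide add_divide_distrib)
  finally show ?thesis using a by (simp add: field_simps)
qed (use ab in auto)

lemma powr_diff_le_lipschitz:
  fixes a b n :: real
  assumes n: "1 \<le> n" and ab: "0 \<le> b" "b \<le> a"
  shows "a powr n - b powr n \<le> n * (a - b) * a powr (n - 1)"
proof (cases "b = a")
  case False
  then have "b < a" using ab by simp
  have cont: "continuous_on {b..a} (\<lambda>x. x powr n)"
    using ab n by (intro continuous_on_powr' continuous_intros) auto
  have der: "((\<lambda>x. x powr n) has_real_derivative n * z powr (n - 1)) (at z)" if "b < z" for z
    using that ab by (intro has_real_derivative_powr) auto
  obtain l z where z: "b < z" "z < a" "((\<lambda>x. x powr n) has_real_derivative l) (at z)" "a powr n - b powr n = (a - b) * l"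
    using MVT[OF \<open>b < a\<close> cont] der real_differentiable_def by metis
  have "l = n * z powr (n - 1)" using DERIV_unique[OF z(3) der[OF z(1)]] .
  moreover have "z powr (n - 1) \<le> a powr (n - 1)" using z ab n by (intro powr_mono2) auto
  ultimately have "l \<le> n * a powr (n - 1)" using n by simp
  then have "(a - b) * l \<le> (a - b) * (n * a powr (n - 1))" using ab by (intro mult_left_mono) auto
  then show ?thesis using z(4) by (simp add: mult_ac)
qed simp

lemma g1_max: "g1 n x = max (- x) 0 powr n"
  by (cases "x \<le> 0") (auto simp: g1_def max_def)

lemma g2_max: "g2 n x = max x 0 powr n"
  by (cases "x \<le> 0") (auto simp: g2_def max_def)

context contractive_kernel
begin

text \<open>
  For \<open>n \<le> 1\<close> a power is Hoelder continuous with exponent \<open>n\<close> and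
  without weight; for \<open>n > 1\<close> it is locally Lipschitz with a constant of order
  \<open>x powr (n - 1)\<close>, which the weight absorbs. Hence the exponent \<open>min 1
  n\<close>. The function \<open>p\<close> stands for the positive or the negative part.
\<close>

lemma poly_hoelder_powr:
  assumes n: "0 < n" and th: "\<theta> = min 1 n"
    and p: "\<And>x. 0 \<le> p x" "\<And>x. p x \<le> \<bar>x\<bar>" "\<And>x y. \<bar>p x - p y\<bar> \<le> \<bar>x - y\<bar>"
  shows "poly_hoelder (\<lambda>x. p x powr n)"
proof (cases "n \<le> 1")
  case True
  have le: "p x powr n - p y powr n \<le> \<bar>x - y\<bar> powr n" for x y
  proof (cases "p y \<le> p x")
    case le: True
    have "p x powr n - p y powr n \<le> (p x - p y) powr n" by (rule powr_diff_le_hoelder[OF n True p(1) le])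
    also have "\<dots> \<le> \<bar>x - y\<bar> powr n" using p(3)[of x y] le n by (intro powr_mono2) auto
    finally show ?thesis .
  next
    case False
    then have "p x powr n \<le> p y powr n" using p(1) n by (intro powr_mono2) auto
    then show ?thesis using powr_ge_zero[of "\<bar>x - y\<bar>" n] by linarith
  qed
  show ?thesis
  proof (rule poly_hoelderI[of 1 _ 0])
    fix x y
    show "\<bar>p x powr n - p y powr n\<bar> \<le> 1 * \<bar>x - y\<bar> powr \<theta> * ((1 + \<bar>x\<bar>) * (1 + \<bar>y\<bar>)) ^ 0"
      using le[of x y] le[of y x] True by (simp add: th min_def abs_le_iff abs_minus_commute)
  qed simp
next
  case False
  then have th1: "\<theta> = 1" by (simp add: th)
  define q where "q = nat \<lceil>n\<rceil>"
  have q: "n - 1 \<le> real q" using n unfolding q_def by linarith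
  have le: "p x powr n - p y powr n \<le> n * \<bar>x - y\<bar> * ((1 + \<bar>x\<bar>) * (1 + \<bar>y\<bar>)) ^ q" for x y
  proof (cases "p y \<le> p x")
    case le: True
    have "p x powr n - p y powr n \<le> n * (p x - p y) * p x powr (n - 1)"
      using False by (intro powr_diff_le_lipschitz p(1) le) auto
    also have "\<dots> \<le> n * \<bar>x - y\<bar> * ((1 + \<bar>x\<bar>) * (1 + \<bar>y\<bar>)) ^ q"
    proof (intro mult_mono)
      show "p x - p y \<le> \<bar>x - y\<bar>" using p(3)[of x y] by linarith
      have "p x \<le> (1 + \<bar>x\<bar>) * (1 + \<bar>y\<bar>)"
      proof -
        have "0 \<le> \<bar>x\<bar> * \<bar>y\<bar>" by simp
        moreover have "(1 + \<bar>x\<bar>) * (1 + \<bar>y\<bar>) = 1 + \<bar>x\<bar> + \<bar>y\<bar> + \<bar>x\<bar> * \<bar>y\<bar>" by (simp add: algebra_simps)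
        ultimately show ?thesis using p(2)[of x] abs_ge_zero[of y] by linarith
      qed
      then have "p x powr (n - 1) \<le> ((1 + \<bar>x\<bar>) * (1 + \<bar>y\<bar>)) powr (n - 1)"
        using p(1) False by (intro powr_mono2) auto
      also have "\<dots> \<le> ((1 + \<bar>x\<bar>) * (1 + \<bar>y\<bar>)) powr (real q)"
        using q weight_ge_1[of x y] by (intro powr_mono) auto
      also have "\<dots> = ((1 + \<bar>x\<bar>) * (1 + \<bar>y\<bar>)) ^ q" using weight_ge_1[of x y] by (intro powr_realpow) auto
      finally show "p x powr (n - 1) \<le> ((1 + \<bar>x\<bar>) * (1 + \<bar>y\<bar>)) ^ q" .
    qed (use n le in auto)
    finally show ?thesis .
  next
    case ngt: False
    then have "p x powr n \<le> p y powr n" using p(1) n by (intro powr_mono2) auto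
    moreover have "0 \<le> n * \<bar>x - y\<bar> * ((1 + \<bar>x\<bar>) * (1 + \<bar>y\<bar>)) ^ q" using n by simp
    ultimately show ?thesis by linarith
  qed
  show ?thesis
  proof (rule poly_hoelderI[of n _ q])
    fix x y
    have "p y powr n - p x powr n \<le> n * \<bar>x - y\<bar> * ((1 + \<bar>x\<bar>) * (1 + \<bar>y\<bar>)) ^ q"
      using le[of y x] by (simp only: abs_minus_commute[of y x] mult.commute[of "1 + \<bar>y\<bar>"])
    then show "\<bar>p x powr n - p y powr n\<bar> \<le> n * \<bar>x - y\<bar> powr \<theta> * ((1 + \<bar>x\<bar>) * (1 + \<bar>y\<bar>)) ^ q"
      using le[of x y] unfolding th1 powr_one[OF abs_ge_zero] by (intro abs_leI) linarith+
  qed (use n in simp)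
qed

lemma poly_hoelder_g:
  assumes "0 < n" "\<theta> = min 1 n"
  shows "poly_hoelder (g1 n)" "poly_hoelder (g2 n)"
proof -
  have eq: "g1 n = (\<lambda>x. max (- x) 0 powr n)" "g2 n = (\<lambda>x. max x 0 powr n)"
    by (rule ext, rule g1_max, rule ext, rule g2_max)
  have "poly_hoelder (\<lambda>x. max (- x) 0 powr n)" by (rule poly_hoelder_powr[OF assms]; auto simp: max_def abs_if)
  then show "poly_hoelder (g1 n)" by (simp only: eq)
  have "poly_hoelder (\<lambda>x. max x 0 powr n)" by (rule poly_hoelder_powr[OF assms]; auto simp: max_def abs_if)
  then show "poly_hoelder (g2 n)" by (simp only: eq)
qed

lemma P_iter_linear:
  assumes f: "poly_hoelder f" and g: "poly_hoelder g"
  shows "(P ^^ k) (\<lambda>x. c * f x + d * g x) = (\<lambda>x. c * (P ^^ k) f x + d * (P ^^ k) g x)"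
proof (induction k)
  case (Suc k)
  show ?case
  proof (rule ext)
    fix x
    have i: "integrable Q (\<lambda>s. (P ^^ k) f (F x s))" "integrable Q (\<lambda>s. (P ^^ k) g (F x s))"
      using f g by (auto intro: F_integrable P_iter_poly_hoelder)
    have "(P ^^ Suc k) (\<lambda>x. c * f x + d * g x) x = P (\<lambda>x. c * (P ^^ k) f x + d * (P ^^ k) g x) x"
      by (simp add: Suc.IH)
    also have "\<dots> = c * P ((P ^^ k) f) x + d * P ((P ^^ k) g) x" using i by (simp add: P_def)
    finally show "(P ^^ Suc k) (\<lambda>x. c * f x + d * g x) x = c * (P ^^ Suc k) f x + d * (P ^^ Suc k) g x" by simp
  qed
qed simp

lemma lag_cov_bilinear:
  assumes f: "poly_hoelder f" and g: "poly_hoelder g"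
  shows "lag_cov k (\<lambda>x. c * f x + d * g x) (\<lambda>x. c * f x + d * g x)
    = c\<^sup>2 * lag_cov k f f + c * d * (lag_cov k f g + lag_cov k g f) + d\<^sup>2 * lag_cov k g g"
proof -
  have i: "integrable \<pi> f" "integrable \<pi> g" using f g by (auto intro: pi_integrable)
  have ip: "integrable \<pi> (\<lambda>x. u x * (P ^^ k) v x)" if "poly_hoelder u" "poly_hoelder v" for u v
    using that by (intro pi_integrable poly_hoelder_mult P_iter_poly_hoelder)
  have "(\<integral>x. (c * f x + d * g x) * (P ^^ k) (\<lambda>x. c * f x + d * g x) x \<partial>\<pi>)
    = (\<integral>x. c\<^sup>2 * (f x * (P ^^ k) f x) + c * d * (f x * (P ^^ k) g x) + c * d * (g x * (P ^^ k) f x) + d\<^sup>2 * (g x * (P ^^ k) g x) \<partial>\<pi>)"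
    unfolding P_iter_linear[OF f g]
    by (intro Bochner_Integration.integral_cong refl) (simp add: power2_eq_square algebra_simps)
  also have "\<dots> = c\<^sup>2 * (\<integral>x. f x * (P ^^ k) f x \<partial>\<pi>) + c * d * (\<integral>x. f x * (P ^^ k) g x \<partial>\<pi>)
      + c * d * (\<integral>x. g x * (P ^^ k) f x \<partial>\<pi>) + d\<^sup>2 * (\<integral>x. g x * (P ^^ k) g x \<partial>\<pi>)"
    using ip[OF f f] ip[OF f g] ip[OF g f] ip[OF g g] by simp
  finally show ?thesis
    unfolding lag_cov_def using i by (simp add: power2_eq_square algebra_simps)
qed

lemma asym_cov_summable:
  assumes "poly_hoelder f" "poly_hoelder g"
  shows "summable (\<lambda>k. lag_cov (Suc k) f g + lag_cov (Suc k) g f)"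
  using summable_ignore_initial_segment[OF lag_cov_summable(1)[OF assms], of 1]
    summable_ignore_initial_segment[OF lag_cov_summable(1)[OF assms(2,1)], of 1]
  by (intro summable_add) auto

lemma asym_cov_sym: "asym_cov f g = asym_cov g f"
  unfolding asym_cov_def lag_cov_def by (simp add: mult.commute add.commute)

lemma asym_cov_bilinear:
  assumes f: "poly_hoelder f" and g: "poly_hoelder g"
  shows "asym_cov (\<lambda>x. c * f x + d * g x) (\<lambda>x. c * f x + d * g x)
    = c\<^sup>2 * asym_cov f f + 2 * c * d * asym_cov f g + d\<^sup>2 * asym_cov g g"
proof -
  let ?S = "\<lambda>f g. \<Sum>k. lag_cov (Suc k) f g + lag_cov (Suc k) g f"
  have "?S (\<lambda>x. c * f x + d * g x) (\<lambda>x. c * f x + d * g x)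
    = (\<Sum>k. c\<^sup>2 * (lag_cov (Suc k) f f + lag_cov (Suc k) f f) + 2 * c * d * (lag_cov (Suc k) f g + lag_cov (Suc k) g f)
        + d\<^sup>2 * (lag_cov (Suc k) g g + lag_cov (Suc k) g g))"
    unfolding lag_cov_bilinear[OF f g] by (intro suminf_cong) (simp add: algebra_simps)
  also have "\<dots> = c\<^sup>2 * ?S f f + 2 * c * d * ?S f g + d\<^sup>2 * ?S g g"
  proof -
    have s: "summable (\<lambda>k. c\<^sup>2 * (lag_cov (Suc k) f f + lag_cov (Suc k) f f))"
      "summable (\<lambda>k. 2 * c * d * (lag_cov (Suc k) f g + lag_cov (Suc k) g f))"
      "summable (\<lambda>k. d\<^sup>2 * (lag_cov (Suc k) g g + lag_cov (Suc k) g g))"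
      by (rule summable_mult[OF asym_cov_summable[OF f f]], rule summable_mult[OF asym_cov_summable[OF f g]],
          rule summable_mult[OF asym_cov_summable[OF g g]])
    show ?thesis
      unfolding suminf_add[OF summable_add[OF s(1,2)] s(3), symmetric] suminf_add[OF s(1,2), symmetric]
      using asym_cov_summable[OF f f] asym_cov_summable[OF f g] asym_cov_summable[OF g g] by (simp only: suminf_mult)
  qed
  finally show ?thesis
    unfolding asym_cov_def lag_cov_bilinear[OF f g] by (simp add: lag_cov_def algebra_simps)
qed

lemma asym_cov_nonneg: "poly_hoelder f \<Longrightarrow> 0 \<le> asym_cov f f"
  unfolding asym_cov_eq_cond_var[symmetric] by (intro Bochner_Integration.integral_nonneg cond_var_nonneg)

end

context clt_chain
begin

lemma X0_measurable_Fil: "X0 \<in> borel_measurable (Fil k)"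
  by (induction k) (auto intro: X0_meas measurable_Fil_Suc)

lemma X0_measurable[measurable]: "X0 \<in> borel_measurable M"
  by (rule measurable_Fil[OF X0_meas])

lemma chain_product_integrable:
  assumes f: "poly_hoelder f" and g: "poly_hoelder g"
  shows "integrable M (\<lambda>\<omega>. f (X0 \<omega>) * g (chain k \<omega>))"
proof -
  note [measurable] = poly_hoelder_measurable[OF f] poly_hoelder_measurable[OF g]
  have i1: "integrable M (\<lambda>\<omega>. (f (X0 \<omega>))\<^sup>2)" using chain_integrable[OF poly_hoelder_power[OF f, of 2], of 0] by simp
  have i2: "integrable M (\<lambda>\<omega>. (g (chain k \<omega>))\<^sup>2)" using chain_integrable[OF poly_hoelder_power[OF g, of 2], of k] by simp
  show ?thesis
  proof (rule Bochner_Integration.integrable_bound[OF Bochner_Integration.integrable_add[OF i1 i2]])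
    show "AE \<omega> in M. norm (f (X0 \<omega>) * g (chain k \<omega>)) \<le> norm ((f (X0 \<omega>))\<^sup>2 + (g (chain k \<omega>))\<^sup>2)"
      using prod_le_sum_squares[OF abs_ge_zero abs_ge_zero] by (intro AE_I2) (simp add: abs_mult)
  qed measurable
qed

lemma expect_chain_product:
  assumes f: "poly_hoelder f" and g: "poly_hoelder g"
  shows "(\<integral>\<omega>. f (X0 \<omega>) * g (chain k \<omega>) \<partial>M) = (\<integral>\<omega>. f (X0 \<omega>) * (P ^^ k) g (X0 \<omega>) \<partial>M)"
  using g
proof (induction k arbitrary: g)
  case (Suc k)
  have Z: "(\<lambda>\<omega>. f (X0 \<omega>)) \<in> borel_measurable (Fil k)"
    using measurable_compose[OF X0_measurable_Fil poly_hoelder_measurable[OF f]] .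
  have "(\<integral>\<omega>. f (X0 \<omega>) * g (chain (Suc k) \<omega>) \<partial>M) = (\<integral>\<omega>. f (X0 \<omega>) * P g (chain k \<omega>) \<partial>M)"
    using expect_P_step[OF Suc.prems Z] chain_product_integrable[OF f Suc.prems, of "Suc k"] by simp
  also have "\<dots> = (\<integral>\<omega>. f (X0 \<omega>) * (P ^^ k) (P g) (X0 \<omega>) \<partial>M)" by (rule Suc.IH[OF P_poly_hoelder[OF Suc.prems]])
  finally show ?case by (simp add: funpow_swap1)
qed simp

text \<open>
  In the stationary chain the covariances that define the limiting matrix are those of the kernel,
  and therefore do not depend on the probability space on which the stationary solution is
  realised.
\<close>

lemma covariance_eq_lag_cov:
  assumes f: "poly_hoelder f" and g: "poly_hoelder g" and stat: "distr M borel X0 = \<pi>"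
  shows "covariance M (\<lambda>\<omega>. f (X0 \<omega>)) (\<lambda>\<omega>. g (chain k \<omega>)) = lag_cov k f g"
proof -
  note [measurable] = poly_hoelder_measurable[OF f] poly_hoelder_measurable[OF g] poly_hoelder_measurable[OF P_iter_poly_hoelder[OF g]]
  have E: "(\<integral>\<omega>. u (X0 \<omega>) \<partial>M) = (\<integral>x. u x \<partial>\<pi>)" if [measurable]: "u \<in> borel_measurable borel" for u :: "real \<Rightarrow> real"
    unfolding stat[symmetric] by (rule integral_distr[symmetric]) measurable
  have i: "integrable M (\<lambda>\<omega>. f (X0 \<omega>))" "integrable M (\<lambda>\<omega>. g (chain k \<omega>))"
    "integrable M (\<lambda>\<omega>. f (X0 \<omega>) * g (chain k \<omega>))"
    using chain_integrable[OF f, of 0] chain_integrable[OF g, of k] chain_product_integrable[OF f g] by simp_all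
  have mf: "(\<integral>\<omega>. f (X0 \<omega>) \<partial>M) = (\<integral>x. f x \<partial>\<pi>)" by (rule E) measurable
  have mg: "(\<integral>\<omega>. g (chain k \<omega>) \<partial>M) = (\<integral>x. g x \<partial>\<pi>)"
    unfolding expect_chain[OF g] by (subst E) (simp_all add: pi_P_iter[OF g])
  have "covariance M (\<lambda>\<omega>. f (X0 \<omega>)) (\<lambda>\<omega>. g (chain k \<omega>))
    = (\<integral>\<omega>. f (X0 \<omega>) * g (chain k \<omega>) - (\<integral>x. g x \<partial>\<pi>) * f (X0 \<omega>) - (\<integral>x. f x \<partial>\<pi>) * g (chain k \<omega>) + (\<integral>x. f x \<partial>\<pi>) * (\<integral>x. g x \<partial>\<pi>) \<partial>M)"
    unfolding covariance_def mf mg by (intro Bochner_Integration.integral_cong refl) (simp add: algebra_simps)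
  also have "\<dots> = (\<integral>\<omega>. f (X0 \<omega>) * g (chain k \<omega>) \<partial>M) - (\<integral>x. f x \<partial>\<pi>) * (\<integral>x. g x \<partial>\<pi>)"
    using i by (simp add: mf mg prob_space)
  also have "(\<integral>\<omega>. f (X0 \<omega>) * g (chain k \<omega>) \<partial>M) = (\<integral>x. f x * (P ^^ k) g x \<partial>\<pi>)"
    unfolding expect_chain_product[OF f g] by (rule E) measurable
  finally show ?thesis by (simp add: lag_cov_def)
qed

end

section \<open>Asymptotic normality of the estimator\<close>

text \<open>
  The null set can be chosen independently of \<open>k\<close>, and on its complement the
  block-wise convergence of the scheme identifies each step of the solution with the recursion.
\<close>

lemma sampled_solution_eq_chain:
  assumes pos: "\<alpha>1 > 0" "\<alpha>2 > 0" and h: "h > 0" and bm: "brownian_motion M W"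
    and sol: "sde_solution M W (drift \<alpha>1 \<alpha>2) \<sigma> \<zeta> X"
    and chain: "driven_chain M Q (flow \<alpha>1 \<alpha>2 \<sigma> h) Fil (noise W h) \<zeta>"
  shows "AE \<omega> in M. \<forall>k. X (real k * h) \<omega> = driven_chain.chain (flow \<alpha>1 \<alpha>2 \<sigma> h) (noise W h) \<zeta> k \<omega>"
  using sde_block[OF pos h bm sol]
proof eventually_elim
  interpret driven_chain M Q "flow \<alpha>1 \<alpha>2 \<sigma> h" Fil "noise W h" \<zeta> by (rule chain)
  case (elim \<omega>)
  show ?case
  proof
    fix k show "X (real k * h) \<omega> = chain k \<omega>"
    proof (induction k)
      case (Suc k)
      have "flow \<alpha>1 \<alpha>2 \<sigma> h (X (real k * h) \<omega>) (noise W h k \<omega>) = X (real (Suc k) * h) \<omega>"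
        using elim h by (intro flow_eq_lim) auto
      then show ?case by (simp add: Suc.IH)
    qed (use elim in simp)
  qed
qed

text \<open>
  The stationary solution supplies the invariant law of the kernel: its first step has the law of
  \<open>F\<close> under \<open>\<pi> \<Otimes>\<^sub>M Q\<close> by independence, and the law
  \<open>\<pi>\<close> again by stationarity.
\<close>

lemma stationary_sample:
  assumes pos: "\<sigma> > 0" "\<alpha>1 > 0" "\<alpha>2 > 0" and h: "h > 0" and bm: "brownian_motion M W"
    and Y0: "distributed M lborel (Y 0) (stat_density \<alpha>1 \<alpha>2 \<sigma>)" and ind: "independent_of_process M (Y 0) W"
    and sol: "sde_solution M W (drift \<alpha>1 \<alpha>2) \<sigma> (Y 0) Y"
    and \<theta>: "0 < \<theta>" "\<theta> \<le> 1"
  defines "Q \<equiv> distr M noise_space (noise W h 0)"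
  shows "clt_chain Q (flow \<alpha>1 \<alpha>2 \<sigma> h) (exp (- min \<alpha>1 \<alpha>2 * h)) \<theta> (stat_law \<alpha>1 \<alpha>2 \<sigma>) M
      (past_filtration M W h (Y 0)) (noise W h) (Y 0)"
    and "distr M borel (Y 0) = stat_law \<alpha>1 \<alpha>2 \<sigma>"
proof -
  let ?F = "flow \<alpha>1 \<alpha>2 \<sigma> h" and ?\<pi> = "stat_law \<alpha>1 \<alpha>2 \<sigma>"
  interpret B: brownian M W h using bm h by unfold_locales
  have [measurable]: "Y 0 \<in> borel_measurable M" "Y h \<in> borel_measurable M"
    using sol h by (auto simp: sde_solution_def)
  show d: "distr M borel (Y 0) = ?\<pi>" using Y0 by (simp add: distributed_def stat_law_def cong: distr_cong)
  have dc: "driven_chain M Q ?F (past_filtration M W h (Y 0)) (noise W h) (Y 0)"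
    by (rule B.driven_chainI[OF _ ind flow_measurable]) (simp_all add: Q_def)
  interpret D: driven_chain M Q ?F "past_filtration M W h (Y 0)" "noise W h" "Y 0" by (rule dc)
  note [measurable] = D.F_meas
  have "distr (?\<pi> \<Otimes>\<^sub>M Q) borel (\<lambda>(x, s). ?F x s)
    = distr (distr M (borel \<Otimes>\<^sub>M Q) (\<lambda>\<omega>. (Y 0 \<omega>, noise W h 0 \<omega>))) borel (\<lambda>(x, s). ?F x s)"
    by (subst D.joint_distr[OF D.X0_meas]) (simp add: d)
  also have "\<dots> = distr M borel (D.chain 1)"
    by (subst distr_distr) (auto intro!: distr_cong simp: comp_def)
  also have "\<dots> = distr M borel (Y h)"
  proof (rule distr_cong_AE)
    show "AE \<omega> in M. D.chain 1 \<omega> = Y h \<omega>"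
      using sampled_solution_eq_chain[OF pos(2,3) h bm sol dc]
    proof eventually_elim
      case (elim \<omega>)
      show ?case using elim[rule_format, of 1] by simp
    qed
  qed simp_all
  also have "\<dots> = ?\<pi>" by (rule stationary_law[OF pos h bm Y0 ind sol])
  finally have inv: "distr (?\<pi> \<Otimes>\<^sub>M Q) borel (\<lambda>(x, s). ?F x s) = ?\<pi>" .
  have pp: "prob_space ?\<pi>" unfolding d[symmetric] by (rule B.prob_space_distr) measurable
  show "clt_chain Q ?F (exp (- min \<alpha>1 \<alpha>2 * h)) \<theta> ?\<pi> M (past_filtration M W h (Y 0)) (noise W h) (Y 0)"
  proof (intro clt_chain.intro clt_chain_axioms.intro contractive_kernel.intro)
    show "prob_space Q" by (rule D.prob_noise)
    show "(\<lambda>(x, s). ?F x s) \<in> borel_measurable (borel \<Otimes>\<^sub>M Q)" by (rule D.F_meas)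
    show "exp (- min \<alpha>1 \<alpha>2 * h) < 1" using pos h by (simp add: min_def)
    show "\<bar>?F x s - ?F y s\<bar> \<le> exp (- min \<alpha>1 \<alpha>2 * h) * \<bar>x - y\<bar>" for x y s
      using h by (intro flow_contraction) simp
    show "integrable ?\<pi> (\<lambda>x. \<bar>x\<bar> ^ q)" for q by (rule stat_law_moments[OF pos])
    then show "integrable M (\<lambda>\<omega>. \<bar>Y 0 \<omega>\<bar> ^ q)" for q
      unfolding d[symmetric] by (subst (asm) integrable_distr_eq) auto
    show "sets ?\<pi> = sets borel" by (simp add: stat_law_def)
    show "driven_chain M Q ?F (past_filtration M W h (Y 0)) (noise W h) (Y 0)" by (rule dc)
  qed (use pp inv \<theta> in auto)
qed

lemma covariance_cong_AE:
  assumes "AE \<omega> in M. U \<omega> = U' \<omega>" "AE \<omega> in M. V \<omega> = V' \<omega>"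
    and [measurable]: "U \<in> borel_measurable M" "U' \<in> borel_measurable M" "V \<in> borel_measurable M" "V' \<in> borel_measurable M"
  shows "covariance M U V = covariance M U' V'"
proof -
  have i: "integral\<^sup>L M U = integral\<^sup>L M U'" "integral\<^sup>L M V = integral\<^sup>L M V'"
    by (rule integral_cong_AE; (fact | measurable))+
  then show ?thesis unfolding covariance_def
  proof (intro integral_cong_AE)
    show "AE \<omega> in M. (U \<omega> - integral\<^sup>L M U) * (V \<omega> - integral\<^sup>L M V) = (U' \<omega> - integral\<^sup>L M U') * (V' \<omega> - integral\<^sup>L M V')"
      using assms(1,2) unfolding i by eventually_elim (simp only:)
  qed measurable
qed

lemma (in clt_chain) long_run_cov_eq_asym_cov:
  assumes f: "poly_hoelder f" and g: "poly_hoelder g" and stat: "distr M borel X0 = \<pi>"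
    and eq: "AE \<omega> in M. \<forall>k. Y (real k * h) \<omega> = chain k \<omega>"
    and Y: "\<And>k::nat. Y (real k * h) \<in> borel_measurable M"
  shows "long_run_cov M Y h f g = asym_cov f g"
proof -
  have Y0[measurable]: "Y 0 \<in> borel_measurable M" using Y[of 0] by simp
  note [measurable] = Y
  have cov: "covariance M (\<lambda>\<omega>. u (Y 0 \<omega>)) (\<lambda>\<omega>. v (Y (real k * h) \<omega>)) = lag_cov k u v"
    if u: "poly_hoelder u" and v: "poly_hoelder v" for u v k
  proof -
    note [measurable] = poly_hoelder_measurable[OF u] poly_hoelder_measurable[OF v]
    have "covariance M (\<lambda>\<omega>. u (Y 0 \<omega>)) (\<lambda>\<omega>. v (Y (real k * h) \<omega>))
      = covariance M (\<lambda>\<omega>. u (X0 \<omega>)) (\<lambda>\<omega>. v (chain k \<omega>))"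
    proof (rule covariance_cong_AE)
      show "AE \<omega> in M. u (Y 0 \<omega>) = u (X0 \<omega>)"
        using eq
      proof eventually_elim
        case (elim \<omega>)
        show ?case using elim[rule_format, of 0] by simp
      qed
      show "AE \<omega> in M. v (Y (real k * h) \<omega>) = v (chain k \<omega>)" using eq by eventually_elim simp
    qed measurable
    also have "\<dots> = lag_cov k u v" by (rule covariance_eq_lag_cov[OF u v stat])
    finally show ?thesis .
  qed
  show ?thesis
    unfolding long_run_cov_def asym_cov_def Let_def cov[OF f g] cov[OF g f]
    using cov[OF f g, of 0] by simp
qed

lemma quadratic_form_2:
  fixes S :: "real^2^2"
  shows "a \<bullet> (S *v a) = (a $ 1)\<^sup>2 * S $ 1 $ 1 + a $ 1 * a $ 2 * (S $ 1 $ 2 + S $ 2 $ 1) + (a $ 2)\<^sup>2 * S $ 2 $ 2"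
  by (simp add: inner_vec_def matrix_vector_mult_def sum_2 power2_eq_square algebra_simps)

lemma quadratic_form_conjugate:
  fixes S :: "real^'n^'n" and J :: "real^'n^'m"
  shows "a \<bullet> ((J ** S ** transpose J) *v a) = (transpose J *v a) \<bullet> (S *v (transpose J *v a))"
  by (simp only: transpose_matrix_vector dot_lmul_matrix matrix_vector_mul_assoc[symmetric])

text \<open>
  The Cramer--Wold reduction: a linear form in the two empirical moments is the empirical mean of
  the single observable \<open>a\<^sub>1 f + a\<^sub>2 g\<close>, whose asymptotic variance is the
  quadratic form of \<open>S\<close>. That \<open>S\<close> is positive semidefinite comes out
  along the way, an asymptotic variance being nonnegative.
\<close>

lemma (in clt_chain) empirical_moments_char:
  fixes a :: "real^2"
  assumes f: "poly_hoelder f" and g: "poly_hoelder g"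
    and eq: "AE \<omega> in M. \<forall>k. X (real k * h) \<omega> = chain k \<omega>"
    and X: "\<And>k::nat. X (real k * h) \<in> borel_measurable M"
    and \<Theta>: "\<And>N \<omega>. \<Theta> N \<omega> = vector [1 / real N * (\<Sum>k = 1..N. f (X (real k * h) \<omega>)), 1 / real N * (\<Sum>k = 1..N. g (X (real k * h) \<omega>))]"
    and S: "S = vector [vector [asym_cov f f, asym_cov f g], vector [asym_cov g f, asym_cov g g]]"
  shows "(\<lambda>N. \<integral>\<omega>. iexp (a \<bullet> (sqrt (real N) *\<^sub>R (\<Theta> N \<omega> - vector [\<integral>x. f x \<partial>\<pi>, \<integral>x. g x \<partial>\<pi>]))) \<partial>M)
    \<longlonglongrightarrow> exp (- (a \<bullet> (S *v a)) / 2)"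
    and "0 \<le> a \<bullet> (S *v a)"
proof -
  note [measurable] = X poly_hoelder_measurable[OF f] poly_hoelder_measurable[OF g]
  let ?u = "\<lambda>x. a $ 1 * f x + a $ 2 * g x"
  have u: "poly_hoelder ?u" by (intro poly_hoelder_add poly_hoelder_cmult f g)
  note [measurable] = poly_hoelder_measurable[OF u]
  have form: "a \<bullet> (S *v a) = asym_cov ?u ?u"
    unfolding quadratic_form_2 asym_cov_bilinear[OF f g] S by (simp add: asym_cov_sym[of g f])
  then show "0 \<le> a \<bullet> (S *v a)" using asym_cov_nonneg[OF u] by simp
  have iu: "(\<integral>x. ?u x \<partial>\<pi>) = a $ 1 * (\<integral>x. f x \<partial>\<pi>) + a $ 2 * (\<integral>x. g x \<partial>\<pi>)"
    using pi_integrable[OF f] pi_integrable[OF g] by simp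
  have inner: "a \<bullet> (sqrt (real N) *\<^sub>R (\<Theta> N \<omega> - vector [\<integral>x. f x \<partial>\<pi>, \<integral>x. g x \<partial>\<pi>]))
    = 1 / sqrt (real N) * (\<Sum>k = 1..N. ?u (X (real k * h) \<omega>) - (\<integral>x. ?u x \<partial>\<pi>))" for N \<omega>
  proof (cases "N = 0")
    case False
    have s: "sqrt (real N) * (1 / real N) = 1 / sqrt (real N)"
      using False real_sqrt_mult_self[of "real N"] by (simp add: field_simps)
    have s': "sqrt (real N) = 1 / sqrt (real N) * real N" using False by (simp add: real_div_sqrt)
    let ?A = "\<Sum>k = 1..N. f (X (real k * h) \<omega>)" and ?B = "\<Sum>k = 1..N. g (X (real k * h) \<omega>)"
    have "a \<bullet> (sqrt (real N) *\<^sub>R (\<Theta> N \<omega> - vector [\<integral>x. f x \<partial>\<pi>, \<integral>x. g x \<partial>\<pi>]))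
      = a $ 1 * (sqrt (real N) * (1 / real N * ?A - (\<integral>x. f x \<partial>\<pi>))) + a $ 2 * (sqrt (real N) * (1 / real N * ?B - (\<integral>x. g x \<partial>\<pi>)))"
      by (simp add: \<Theta> inner_vec_def sum_2)
    also have "\<dots> = (sqrt (real N) * (1 / real N)) * (a $ 1 * ?A + a $ 2 * ?B) - sqrt (real N) * (\<integral>x. ?u x \<partial>\<pi>)"
      unfolding iu by (simp add: algebra_simps)
    also have "\<dots> = 1 / sqrt (real N) * (a $ 1 * ?A + a $ 2 * ?B - real N * (\<integral>x. ?u x \<partial>\<pi>))"
      unfolding s by (subst (2) s') (simp only: right_diff_distrib mult.assoc)
    also have "a $ 1 * ?A + a $ 2 * ?B - real N * (\<integral>x. ?u x \<partial>\<pi>) = (\<Sum>k = 1..N. ?u (X (real k * h) \<omega>) - (\<integral>x. ?u x \<partial>\<pi>))"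
      by (simp add: sum_subtractf sum.distrib sum_distrib_left)
    finally show ?thesis .
  qed simp
  have "(\<integral>\<omega>. iexp (a \<bullet> (sqrt (real N) *\<^sub>R (\<Theta> N \<omega> - vector [\<integral>x. f x \<partial>\<pi>, \<integral>x. g x \<partial>\<pi>]))) \<partial>M)
    = (\<integral>\<omega>. iexp (1 / sqrt (real N) * (\<Sum>k=1..N. ?u (chain k \<omega>) - (\<integral>x. ?u x \<partial>\<pi>))) \<partial>M)" for N
    unfolding inner
  proof (rule integral_cong_AE)
    show "AE \<omega> in M. iexp (1 / sqrt (real N) * (\<Sum>k = 1..N. ?u (X (real k * h) \<omega>) - (\<integral>x. ?u x \<partial>\<pi>)))
      = iexp (1 / sqrt (real N) * (\<Sum>k=1..N. ?u (chain k \<omega>) - (\<integral>x. ?u x \<partial>\<pi>)))"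
      using eq by eventually_elim (simp only:)
  qed measurable
  then show "(\<lambda>N. \<integral>\<omega>. iexp (a \<bullet> (sqrt (real N) *\<^sub>R (\<Theta> N \<omega> - vector [\<integral>x. f x \<partial>\<pi>, \<integral>x. g x \<partial>\<pi>]))) \<partial>M)
    \<longlonglongrightarrow> exp (- (a \<bullet> (S *v a)) / 2)"
    using chain_clt[OF u] by (simp only: form)
qed

lemma measurable_vector_2:
  assumes [measurable]: "f \<in> borel_measurable M" "g \<in> borel_measurable M"
  shows "(\<lambda>x. vector [f x, g x] :: real^2) \<in> borel_measurable M"
proof -
  have eq: "(vector [f x, g x] :: real^2) = f x *\<^sub>R axis 1 1 + g x *\<^sub>R axis 2 1" for x
    by (simp add: vec_eq_iff forall_2 axis_def)
  show ?thesis unfolding eq by measurable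
qed

lemma g_measurable: "g1 n \<in> borel_measurable borel" "g2 n \<in> borel_measurable borel"
  unfolding g1_def g2_def by measurable

theorem theorem3p5:
  fixes \<sigma> \<alpha>1 \<alpha>2 x0 n h :: real
    and M :: "'a measure" and W X :: "real \<Rightarrow> 'a \<Rightarrow> real"
    and M' :: "'b measure" and W' Y :: "real \<Rightarrow> 'b \<Rightarrow> real"
  assumes "\<sigma> > 0" and "\<alpha>1 > 0" and "\<alpha>2 > 0" and "n > 0" and "h > 0"
    and "brownian_motion M W"
    and "sde_solution M W (drift \<alpha>1 \<alpha>2) \<sigma> (\<lambda>_. x0) X"
    and "brownian_motion M' W'"
    and "distributed M' lborel (Y 0) (stat_density \<alpha>1 \<alpha>2 \<sigma>)"
    and "independent_of_process M' (Y 0) W'"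
    and "sde_solution M' W' (drift \<alpha>1 \<alpha>2) \<sigma> (Y 0) Y"
  defines "J \<equiv> jacobian (G \<sigma> n)
                 (at (vector [stat_L \<alpha>1 \<alpha>2 \<sigma> n, stat_R \<alpha>1 \<alpha>2 \<sigma> n]))"
  shows "\<exists>\<nu>. multivariate_normal \<nu> 0 (J ** Sigma_mat M' Y n h ** transpose J) \<and>
             conv_in_distribution M
               (\<lambda>N \<omega>. sqrt (real N) *\<^sub>R (estimator X \<sigma> n h N \<omega> - vector [\<alpha>1, \<alpha>2])) \<nu>"
proof -
  note pos = assms(1-3) and n = assms(4) and h = assms(5) and bm = assms(6) and solX = assms(7)
    and bm' = assms(8) and Y0 = assms(9) and ind = assms(10) and solY = assms(11)
  define \<theta> where "\<theta> = min 1 n"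
  have \<theta>: "0 < \<theta>" "\<theta> \<le> 1" using n by (auto simp: \<theta>_def)
  define Q where "Q = distr M' noise_space (noise W' h 0)"
  let ?F = "flow \<alpha>1 \<alpha>2 \<sigma> h" and ?\<rho> = "exp (- min \<alpha>1 \<alpha>2 * h)" and ?\<pi> = "stat_law \<alpha>1 \<alpha>2 \<sigma>"
  interpret B: brownian M W h using bm h by unfold_locales
  interpret B': brownian M' W' h using bm' h by unfold_locales
  interpret C': clt_chain Q ?F ?\<rho> \<theta> ?\<pi> M' "past_filtration M' W' h (Y 0)" "noise W' h" "Y 0"
    unfolding Q_def by (rule stationary_sample(1)[OF pos h bm' Y0 ind solY \<theta>])
  \<comment> \<open>the two Brownian motions drive the same kernel, so the invariant law and the asymptotic covariances found on \<open>M'\<close> serve for the chain on \<open>M\<close>\<close>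
  have QM: "Q = distr M noise_space (noise W h 0)"
    unfolding Q_def by (rule noise_distr_unique) unfold_locales
  have dc: "driven_chain M Q ?F (past_filtration M W h (\<lambda>_. x0)) (noise W h) (\<lambda>_. x0)"
    by (rule B.driven_chainI[OF _ independent_of_process_const[OF bm] flow_measurable QM]) simp
  interpret C: clt_chain Q ?F ?\<rho> \<theta> ?\<pi> M "past_filtration M W h (\<lambda>_. x0)" "noise W h" "\<lambda>_. x0"
    by (intro clt_chain.intro clt_chain_axioms.intro C'.contractive_kernel_axioms dc) simp

  have Xm[measurable]: "X (real k * h) \<in> borel_measurable M" and Ym: "Y (real k * h) \<in> borel_measurable M'" for k :: nat
    using solX solY h by (auto simp: sde_solution_def)
  have eqX: "AE \<omega> in M. \<forall>k. X (real k * h) \<omega> = C.chain k \<omega>"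
    by (rule sampled_solution_eq_chain[OF pos(2,3) h bm solX dc])
  have eqY: "AE \<omega> in M'. \<forall>k. Y (real k * h) \<omega> = C'.chain k \<omega>"
    by (rule sampled_solution_eq_chain[OF pos(2,3) h bm' solY C'.driven_chain_axioms])
  note hg = C'.poly_hoelder_g[OF n \<theta>_def]

  define S where "S = Sigma_mat M' Y n h"
  have lrc: "long_run_cov M' Y h f g = C'.asym_cov f g" if "C'.poly_hoelder f" "C'.poly_hoelder g" for f g
    by (rule C'.long_run_cov_eq_asym_cov[OF that stationary_sample(2)[OF pos h bm' Y0 ind solY \<theta>] eqY Ym])
  have S: "S = vector [vector [C'.asym_cov (g1 n) (g1 n), C'.asym_cov (g1 n) (g2 n)],
      vector [C'.asym_cov (g2 n) (g1 n), C'.asym_cov (g2 n) (g2 n)]]"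
    unfolding S_def Sigma_mat_def by (simp only: lrc hg)
  define \<Theta> where "\<Theta> N \<omega> = (vector [emp_L X n h N \<omega>, emp_R X n h N \<omega>] :: real^2)" for N \<omega>
  define m where "m = (vector [stat_L \<alpha>1 \<alpha>2 \<sigma> n, stat_R \<alpha>1 \<alpha>2 \<sigma> n] :: real^2)"
  have \<Theta>m[measurable]: "\<Theta> N \<in> borel_measurable M" for N
  proof -
    have [measurable]: "(\<lambda>\<omega>. g1 n (X (real k * h) \<omega>)) \<in> borel_measurable M"
      "(\<lambda>\<omega>. g2 n (X (real k * h) \<omega>)) \<in> borel_measurable M" for k :: nat
      by (rule measurable_compose[OF Xm g_measurable(1)], rule measurable_compose[OF Xm g_measurable(2)])
    show ?thesis unfolding \<Theta>_def emp_L_def emp_R_def by (rule measurable_vector_2) measurable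
  qed
  have \<Theta>_eq: "\<Theta> N \<omega> = vector [1 / real N * (\<Sum>k = 1..N. g1 n (X (real k * h) \<omega>)), 1 / real N * (\<Sum>k = 1..N. g2 n (X (real k * h) \<omega>))]"
    for N \<omega> by (simp only: \<Theta>_def emp_L_def emp_R_def)
  have conv: "(\<lambda>N. \<integral>\<omega>. iexp (a \<bullet> (sqrt (real N) *\<^sub>R (\<Theta> N \<omega> - m))) \<partial>M) \<longlonglongrightarrow> exp (- (a \<bullet> (S *v a)) / 2)" for a
    unfolding m_def stat_L_def stat_R_def
    by (rule C.empirical_moments_char(1)[OF hg eqX Xm \<Theta>_eq S])
  have psd: "0 \<le> a \<bullet> (S *v a)" for a
    by (rule C.empirical_moments_char(2)[OF hg eqX Xm \<Theta>_eq S])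
  have sym: "S $ 1 $ 2 = S $ 2 $ 1" unfolding S by (simp add: C'.asym_cov_sym)
  obtain \<nu>0 where \<nu>0: "multivariate_normal \<nu>0 0 S" "\<And>a. (\<integral>x. iexp (a \<bullet> x) \<partial>\<nu>0) = exp (- (a \<bullet> (S *v a)) / 2)"
    using exists_centered_normal[OF sym psd] by blast

  \<comment> \<open>the delta method at the stationary moments, where both coordinates are positive\<close>
  have D: "(G \<sigma> n has_derivative (*v) J) (at m)"
  proof -
    have "m $ 1 > 0" "m $ 2 > 0" using stat_moments_pos[OF pos n] by (simp_all add: m_def)
    then have "G \<sigma> n differentiable (at m)" using pos(1) n by (rule G_differentiable)
    then show ?thesis unfolding J_def m_def[symmetric] by (simp only: jacobian_works)
  qed
  define T where "T = J ** S ** transpose J"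
  have T: "a \<bullet> (T *v a) = (transpose J *v a) \<bullet> (S *v (transpose J *v a))" for a
    unfolding T_def by (rule quadratic_form_conjugate)
  have symT: "T $ 1 $ 2 = T $ 2 $ 1"
    unfolding T_def by (simp add: matrix_matrix_mult_def transpose_def sum_2 sym algebra_simps)
  have psdT: "0 \<le> a \<bullet> (T *v a)" for a unfolding T by (rule psd)
  obtain \<nu> where \<nu>: "multivariate_normal \<nu> 0 T" "\<And>a. (\<integral>x. iexp (a \<bullet> x) \<partial>\<nu>) = exp (- (a \<bullet> (T *v a)) / 2)"
    using exists_centered_normal[OF symT psdT] by blast

  have "conv_in_distribution M (\<lambda>N \<omega>. sqrt (real N) *\<^sub>R (G \<sigma> n (\<Theta> N \<omega>) - G \<sigma> n m)) \<nu>"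
  proof (rule levy_continuity_euclidean)
    note [measurable] = G_measurable
    show "(\<lambda>\<omega>. sqrt (real N) *\<^sub>R (G \<sigma> n (\<Theta> N \<omega>) - G \<sigma> n m)) \<in> borel_measurable M" for N
      by measurable
    fix a :: "real^2"
    have "(\<lambda>N. \<integral>\<omega>. iexp (a \<bullet> (sqrt (real N) *\<^sub>R (G \<sigma> n (\<Theta> N \<omega>) - G \<sigma> n m))) \<partial>M)
      \<longlonglongrightarrow> (\<integral>x. iexp (a \<bullet> (J *v x)) \<partial>\<nu>0)"
    proof (rule delta_method_char[OF B.prob_space_axioms _ _ \<Theta>m G_measurable _ D])
      show "prob_space \<nu>0" "sets \<nu>0 = sets borel" using \<nu>0(1) by (simp_all only: multivariate_normal_def)
      show "(\<lambda>N. \<integral>\<omega>. iexp (a \<bullet> (sqrt (real N) *\<^sub>R (\<Theta> N \<omega> - m))) \<partial>M) \<longlonglongrightarrow> (\<integral>x. iexp (a \<bullet> x) \<partial>\<nu>0)" for a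
        unfolding \<nu>0(2) by (rule conv)
    qed
    also have "(\<integral>x. iexp (a \<bullet> (J *v x)) \<partial>\<nu>0) = (\<integral>x. iexp ((transpose J *v a) \<bullet> x) \<partial>\<nu>0)"
      by (simp only: transpose_matrix_vector dot_lmul_matrix)
    also have "\<dots> = (\<integral>x. iexp (a \<bullet> x) \<partial>\<nu>)" unfolding \<nu>0(2) \<nu>(2) T ..
    finally show "(\<lambda>N. \<integral>\<omega>. iexp (a \<bullet> (sqrt (real N) *\<^sub>R (G \<sigma> n (\<Theta> N \<omega>) - G \<sigma> n m))) \<partial>M)
      \<longlonglongrightarrow> (\<integral>x. iexp (a \<bullet> x) \<partial>\<nu>)" .
    show "prob_space \<nu>" "sets \<nu> = sets borel" using \<nu>(1) by (simp_all only: multivariate_normal_def)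
  qed (rule B.prob_space_axioms)
  moreover have "G \<sigma> n m = vector [\<alpha>1, \<alpha>2]" unfolding m_def by (rule G_stat[OF pos n])
  ultimately show ?thesis
    using \<nu>(1) unfolding T_def S_def \<Theta>_def estimator_def by (simp only:) blast
qed

end
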